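(* Let $\alpha,\mu,\zeta,\eta\in\mathbb{R}$ with $\alpha<0$ and $\zeta-\mu>0$. Let $T>0$ and $s\ge 0$ be given. Then for any $(u_0,v_0),(u_1,v_1)\in H^s_0(\mathbb{T})\times H^s_0(\mathbb{T})$ there exists a pair of control functions $(f,h)\in L^2(0,T;H^s_0(\mathbb{T}))\times L^2(0,T;H^s_0(\mathbb{T}))$ such that the system $$\begin{cases}\partial_t u+\partial_x^3u+\mu\,\partial_xu+\eta\,\partial_xv=Gf,\\ \partial_t v+\alpha\,\partial_x^3v+\zeta\,\partial_xv+\eta\,\partial_xu=Gh,\end{cases}\qquad x\in\mathbb{T},\ t\in(0,T),$$ has a solution $(u,v)\in C([0,T];H^s_0(\mathbb{T}))\times C([0,T];H^s_0(\mathbb{T}))$ satisfying $$(u(x,0),v(x,0))=(u_0(x),v_0(x))\quad\text{and}\quad (u(x,T),v(x,T))=(u_1(x),v_1(x)).$$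
   Context: $\mathbb{T}=\mathbb{R}/2\pi\mathbb{Z}$. $H^s(\mathbb{T})$ is the usual Sobolev space of periodic distributions with norm $\|f\|_s=\|\langle k\rangle^s\widehat f(k)\|_{\ell^2}$, $\langle k\rangle=1+|k|$; $H^s_0(\mathbb{T})$ is its subspace of functions with zero mean $[u]=\frac1{2\pi}\int_{\mathbb{T}}u\,dx=0$. Fix a nonnegative smooth function $g:\mathbb{T}\to\mathbb{R}$ with $\{g>0\}=\omega$, a nonempty open subset of $\mathbb{T}$, and $\int_{\mathbb{T}}g(x)\,dx=1$. The operator $G$ is $$(G\ell)(x,t)=g(x)\Big(\ell(x,t)-\int_{\mathbb{T}}g(y)\ell(y,t)\,dy\Big).$$ Solutions are understood in the mild (Duhamel) sense with respect to the strongly continuous group generated by the linear operator $L(u,v)=(-\partial_x^3u-\mu\partial_xu-\eta\partial_xv,\ -\eta\partial_xu-\alpha\partial_x^3v-\zeta\partial_xv)$. *)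

theory Defs
  imports "HOL-Analysis.Analysis" "HOL-Library.Function_Algebras"
begin

text \<open>
  Functions on the circle are \<open>2\<pi>\<close>-periodic functions on the line.  Only Sobolev
  spaces of order \<open>s \<ge> 0\<close> occur, so their elements are represented by
  square-integrable functions; two representatives denote the same element iff they agree
  almost everywhere, iff the seminorm of their difference is 0.
\<close>

instantiation "fun" :: (type, real_vector) real_vector
begin

definition scaleR_fun :: "real \<Rightarrow> ('a \<Rightarrow> 'b) \<Rightarrow> 'a \<Rightarrow> 'b" where
  "scaleR_fun r f = (\<lambda>x. r *\<^sub>R f x)"

instance
  by standard (auto simp: scaleR_fun_def fun_eq_iff algebra_simps)

end

section \<open>Sobolev spaces on the circle\<close>

definition circle_int :: "(real \<Rightarrow> 'a) \<Rightarrow> 'a::{banach, second_countable_topology}" where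
  "circle_int f = (LINT x:{0..2*pi}|lborel. f x)"

definition periodic :: "(real \<Rightarrow> 'a) \<Rightarrow> bool" where
  "periodic f \<longleftrightarrow> (\<forall>x. f (x + 2*pi) = f x)"

definition smooth_periodic :: "(real \<Rightarrow> real) \<Rightarrow> bool" where
  "smooth_periodic \<phi> \<longleftrightarrow> periodic \<phi> \<and> (\<forall>n x. (deriv ^^ n) \<phi> differentiable (at x))"

definition L2_circle :: "(real \<Rightarrow> complex) set" where
  "L2_circle = {f. f \<in> borel_measurable borel \<and> periodic f
     \<and> set_integrable lborel {0..2*pi} (\<lambda>x. (cmod (f x))\<^sup>2)}"

definition fourier :: "(real \<Rightarrow> complex) \<Rightarrow> int \<Rightarrow> complex" where
  "fourier f k = circle_int (\<lambda>x. f x * cis (- (of_int k * x))) / (2*pi)"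

definition bracket :: "int \<Rightarrow> real" where
  "bracket k = 1 + \<bar>of_int k\<bar>"

definition sob_norm :: "real \<Rightarrow> (real \<Rightarrow> complex) \<Rightarrow> real" where
  "sob_norm s f = sqrt (\<Sum>\<^sub>\<infinity>k\<in>UNIV. (bracket k powr s * cmod (fourier f k))\<^sup>2)"

definition sob :: "real \<Rightarrow> (real \<Rightarrow> complex) set" where
  "sob s = {f \<in> L2_circle. (\<lambda>k. (bracket k powr s * cmod (fourier f k))\<^sup>2) summable_on UNIV}"

definition mean :: "(real \<Rightarrow> complex) \<Rightarrow> complex" where
  "mean f = circle_int f / (2*pi)"

text \<open>The zero-mean space; \<open>K\<close> is the field of scalars, \<open>\<real>\<close> (real-valued
  functions) or \<open>UNIV\<close> (complex-valued functions).\<close>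

definition sob0 :: "complex set \<Rightarrow> real \<Rightarrow> (real \<Rightarrow> complex) set" where
  "sob0 K s = {f \<in> sob s. range f \<subseteq> K \<and> mean f = 0}"

definition ae_eq :: "(real \<Rightarrow> 'a) \<Rightarrow> (real \<Rightarrow> 'a) \<Rightarrow> bool" where
  "ae_eq f g \<longleftrightarrow> (AE x in lborel. f x = g x)"

definition distr_deriv :: "nat \<Rightarrow> (real \<Rightarrow> complex) \<Rightarrow> (real \<Rightarrow> complex) \<Rightarrow> bool" where
  "distr_deriv n u w \<longleftrightarrow> u \<in> L2_circle \<and> w \<in> L2_circle \<and>
     (\<forall>\<phi>. smooth_periodic \<phi> \<longrightarrow>
        circle_int (\<lambda>x. w x * of_real (\<phi> x))
          = (-1) ^ n * circle_int (\<lambda>x. u x * of_real ((deriv ^^ n) \<phi> x)))"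

section \<open>Seminormed spaces of representatives\<close>

text \<open>Here \<open>X\<close> is the carrier and \<open>N\<close> the seminorm; equality in the
  associated normed space is \<open>N (x - y) = 0\<close>.\<close>

definition cont_into :: "'v::real_vector set \<Rightarrow> ('v \<Rightarrow> real) \<Rightarrow> real set \<Rightarrow> (real \<Rightarrow> 'v) \<Rightarrow> bool" where
  "cont_into X N S F \<longleftrightarrow> (\<forall>t\<in>S. F t \<in> X \<and> ((\<lambda>r. N (F r - F t)) \<longlongrightarrow> 0) (at t within S))"

definition simple_into :: "'v set \<Rightarrow> 'a measure \<Rightarrow> ('a \<Rightarrow> 'v) \<Rightarrow> bool" where
  "simple_into X M \<Phi> \<longleftrightarrow> simple_function M \<Phi> \<and> \<Phi> ` space M \<subseteq> X"

definition strongly_measurable ::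
  "'v::real_vector set \<Rightarrow> ('v \<Rightarrow> real) \<Rightarrow> 'a measure \<Rightarrow> ('a \<Rightarrow> 'v) \<Rightarrow> bool" where
  "strongly_measurable X N M F \<longleftrightarrow> (AE t in M. F t \<in> X) \<and>
     (\<exists>\<Phi>. (\<forall>n. simple_into X M (\<Phi> n)) \<and> (AE t in M. (\<lambda>n. N (F t - \<Phi> n t)) \<longlonglongrightarrow> 0))"

definition L2_into ::
  "'v::real_vector set \<Rightarrow> ('v \<Rightarrow> real) \<Rightarrow> 'a measure \<Rightarrow> ('a \<Rightarrow> 'v) \<Rightarrow> bool" where
  "L2_into X N M F \<longleftrightarrow> strongly_measurable X N M F \<and> (\<integral>\<^sup>+t. ennreal ((N (F t))\<^sup>2) \<partial>M) < \<infinity>"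

text \<open>The Bochner integral over a finite measure, as in
  \<open>Bochner_Integration.has_bochner_integral\<close>, with the seminorm in place of
  the norm of a type class.\<close>

definition has_bochner_integral_in ::
  "'v::real_vector set \<Rightarrow> ('v \<Rightarrow> real) \<Rightarrow> 'a measure \<Rightarrow> ('a \<Rightarrow> 'v) \<Rightarrow> 'v \<Rightarrow> bool" where
  "has_bochner_integral_in X N M F I \<longleftrightarrow> I \<in> X \<and> strongly_measurable X N M F \<and>
     (\<exists>\<Phi>. (\<forall>n. simple_into X M (\<Phi> n)) \<and>
        (\<lambda>n. \<integral>\<^sup>+t. ennreal (N (F t - \<Phi> n t)) \<partial>M) \<longlonglongrightarrow> 0 \<and>
        (\<lambda>n. N (Bochner_Integration.simple_bochner_integral M (\<Phi> n) - I)) \<longlonglongrightarrow> 0)"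

definition C0_group ::
  "'v::real_vector set \<Rightarrow> ('v \<Rightarrow> real) \<Rightarrow> (real \<Rightarrow> 'v \<Rightarrow> 'v) \<Rightarrow> bool" where
  "C0_group X N W \<longleftrightarrow>
     (\<forall>t. \<forall>x\<in>X. W t x \<in> X) \<and>
     (\<forall>t a b. \<forall>x\<in>X. \<forall>y\<in>X. N (W t (a *\<^sub>R x + b *\<^sub>R y) - (a *\<^sub>R W t x + b *\<^sub>R W t y)) = 0) \<and>
     (\<forall>t. \<exists>C. \<forall>x\<in>X. N (W t x) \<le> C * N x) \<and>
     (\<forall>x\<in>X. N (W 0 x - x) = 0) \<and>
     (\<forall>t r. \<forall>x\<in>X. N (W (t + r) x - W t (W r x)) = 0) \<and>
     (\<forall>x\<in>X. ((\<lambda>t. N (W t x - x)) \<longlongrightarrow> 0) (at 0))"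

text \<open>The graph of the infinitesimal generator.\<close>

definition generator ::
  "'v::real_vector set \<Rightarrow> ('v \<Rightarrow> real) \<Rightarrow> (real \<Rightarrow> 'v \<Rightarrow> 'v) \<Rightarrow> ('v \<times> 'v) set" where
  "generator X N W = {(x, y). x \<in> X \<and> y \<in> X \<and>
     ((\<lambda>t. N ((W t x - x) /\<^sub>R t - y)) \<longlongrightarrow> 0) (at 0)}"

section \<open>The coupled system\<close>

type_synonym state = "(real \<Rightarrow> complex) \<times> (real \<Rightarrow> complex)"

definition states :: "complex set \<Rightarrow> real \<Rightarrow> state set" where
  "states K s = sob0 K s \<times> sob0 K s"

definition state_norm :: "real \<Rightarrow> state \<Rightarrow> real" where
  "state_norm s = (\<lambda>(u, v). sqrt ((sob_norm s u)\<^sup>2 + (sob_norm s v)\<^sup>2))"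

text \<open>The graph of \<open>L\<close> in \<open>H\<^sup>s\<^sub>0 \<times> H\<^sup>s\<^sub>0\<close>, with domain
  \<open>H\<^sub>0\<close> of order \<open>s + 3\<close> in both components.\<close>

definition L_graph ::
  "complex set \<Rightarrow> real \<Rightarrow> real \<Rightarrow> real \<Rightarrow> real \<Rightarrow> real \<Rightarrow> (state \<times> state) set" where
  "L_graph K \<alpha> \<mu> \<zeta> \<eta> s = {((u, v), (p, q)).
     (u, v) \<in> states K (s + 3) \<and> (p, q) \<in> states K s \<and>
     (\<exists>u1 u3 v1 v3. distr_deriv 1 u u1 \<and> distr_deriv 3 u u3 \<and> distr_deriv 1 v v1 \<and> distr_deriv 3 v v3 \<and>
        ae_eq p (\<lambda>x. - u3 x - \<mu> * u1 x - \<eta> * v1 x) \<and>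
        ae_eq q (\<lambda>x. - \<eta> * u1 x - \<alpha> * v3 x - \<zeta> * v1 x))}"

definition G_op :: "(real \<Rightarrow> real) \<Rightarrow> (real \<Rightarrow> complex) \<Rightarrow> real \<Rightarrow> complex" where
  "G_op g l = (\<lambda>x. g x * (l x - circle_int (\<lambda>y. g y * l y)))"

text \<open>\<open>(u, v)\<close> is a mild solution on \<open>[0, T]\<close>, with initial value
  \<open>(u 0, v 0)\<close>.  The group is determined by its generator up to equality almost
  everywhere, so the existential quantifier only names it.\<close>

definition mild_solution ::
  "complex set \<Rightarrow> (real \<Rightarrow> real) \<Rightarrow> real \<Rightarrow> real \<Rightarrow> real \<Rightarrow> real \<Rightarrow> real \<Rightarrow> real
    \<Rightarrow> (real \<Rightarrow> real \<Rightarrow> complex) \<Rightarrow> (real \<Rightarrow> real \<Rightarrow> complex)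
    \<Rightarrow> (real \<Rightarrow> real \<Rightarrow> complex) \<Rightarrow> (real \<Rightarrow> real \<Rightarrow> complex) \<Rightarrow> bool" where
  "mild_solution K g \<alpha> \<mu> \<zeta> \<eta> s T f h u v \<longleftrightarrow>
     (\<exists>W. C0_group (states K s) (state_norm s) W \<and>
          generator (states K s) (state_norm s) W = L_graph K \<alpha> \<mu> \<zeta> \<eta> s \<and>
          (\<forall>t\<in>{0..T}. \<exists>I.
             has_bochner_integral_in (states K s) (state_norm s) (lebesgue_on {0..t})
               (\<lambda>r. W (t - r) (G_op g (f r), G_op g (h r))) I \<and>
             state_norm s ((u t, v t) - (W t (u 0, v 0) + I)) = 0))"

end

theory Submission
  imports Defs
begin

text \<open>
  In Fourier modes the linear part acts by a symmetric \<open>2 \<times> 2\<close> matrix.  Its eigenbasis turns the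
  group into multiplication by \<open>cis (lam a * t)\<close>, where \<open>a = (k, \<sigma>)\<close> consists of a frequency and a
  branch.  As \<open>G\<close> is symmetric, the controls \<open>G p\<close> and \<open>G q\<close>, with \<open>(p, q)\<close> a free
  solution, steer the system by the controllability Gramian, so it has to be inverted on
  sequences weighted by \<open>bracket k powr s\<close>.  Cubic dispersion makes the Gramian a nonzero multiple of
  the identity plus an operator that gains one derivative.  The Fredholm alternative reduces its
  invertibility to injectivity, and kernel elements are smooth.

  Injectivity: if \<open>x\<close> lies in the kernel, then \<open>G\<close> annihilates the free solution with
  coefficients \<open>x\<close> at every time.  The kernel is finite-dimensional and invariant under
  multiplication by \<open>lam\<close>, which has finite level sets, so \<open>x\<close> has finite support.  A trigonometric
  polynomial which is constant on the infinite set where \<open>g\<close> does not vanish is constant,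
  and the zero modes are excluded.
\<close>

section \<open>Square-summable families\<close>

text \<open>The obstacle is the presence of two branches. Eigenvalues of different branches may
  coincide or nearly coincide at different frequencies, so the time integral gives no decay there
  and no uniform spectral gap is available. The signs of \<alpha> and \<zeta> - \<mu> compensate:
  they keep the difference \<open>dl k\<close> of the diagonal symbols positive and quadratically
  growing, so the fixed coupling \<eta> rotates the eigenvectors by an angle that tends to zero at
  high frequency. The weights are conjugated into the matrices, which lets the same Schur estimates
  serve every order s. Fredholm theory is done by splitting coordinates: the high-frequency
  equations are solved by a Neumann series and a finite linear system remains. T may be arbitrarily
  small because the kernel condition is only differentiated on [0, T], never continued beyond it.
  Multiplication by \<open>lam\<close> costs three orders of weight, so smoothness of kernel
  elements must come before invariance. Real data need no separate construction: uniqueness makes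
  the solution inherit the symmetry under k to -k.\<close>

definition l2 :: "('a \<Rightarrow> complex) set" where
  "l2 = {z. (\<lambda>a. (cmod (z a))\<^sup>2) summable_on UNIV}"

definition l2n :: "('a \<Rightarrow> complex) \<Rightarrow> real" where
  "l2n z = sqrt (\<Sum>\<^sub>\<infinity>a. (cmod (z a))\<^sup>2)"

lemma has_sum_finite_sum:
  fixes f :: "'i \<Rightarrow> 'a \<Rightarrow> 'b::{topological_comm_monoid_add}"
  assumes "finite I" "\<And>i. i \<in> I \<Longrightarrow> (f i has_sum S i) A"
  shows "((\<lambda>x. \<Sum>i\<in>I. f i x) has_sum (\<Sum>i\<in>I. S i)) A"
  using assms by (induction I rule: finite_induct) (auto intro!: has_sum_add)

lemma l2n_nonneg [simp]: "0 \<le> l2n z"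
  by (simp add: l2n_def infsum_nonneg)

lemma l2n_sq: "(l2n z)\<^sup>2 = (\<Sum>\<^sub>\<infinity>a. (cmod (z a))\<^sup>2)"
  by (simp add: l2n_def infsum_nonneg)

lemma sum_sq_le_l2n: "z \<in> l2 \<Longrightarrow> finite F \<Longrightarrow> (\<Sum>a\<in>F. (cmod (z a))\<^sup>2) \<le> (l2n z)\<^sup>2"
  unfolding l2n_sq l2_def by (auto intro!: finite_sum_le_infsum)

lemma L2_set_le_l2n: "z \<in> l2 \<Longrightarrow> finite F \<Longrightarrow> L2_set (\<lambda>a. cmod (z a)) F \<le> l2n z"
  using sum_sq_le_l2n[of z F] by (simp add: L2_set_def real_le_lsqrt)

lemma norm_le_l2n: "z \<in> l2 \<Longrightarrow> cmod (z a) \<le> l2n z"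
  using L2_set_le_l2n[of z "{a}"] by simp

lemma l2I_sq:
  assumes "\<And>F. finite F \<Longrightarrow> (\<Sum>a\<in>F. (cmod (z a))\<^sup>2) \<le> C\<^sup>2" and "0 \<le> C"
  shows "z \<in> l2" "l2n z \<le> C"
proof -
  have s: "(\<lambda>a. (cmod (z a))\<^sup>2) summable_on UNIV"
    by (rule nonneg_bounded_partial_sums_imp_summable_on[where C = "C\<^sup>2"])
      (auto intro!: eventually_finite_subsets_at_top_weakI assms)
  then show "z \<in> l2" by (simp add: l2_def)
  have "(l2n z)\<^sup>2 \<le> C\<^sup>2" unfolding l2n_sq
    by (rule infsum_le_finite_sums[OF s]) (auto intro: assms)
  then show "l2n z \<le> C" using \<open>0 \<le> C\<close> power2_le_imp_le by blast
qed

text \<open>Membership and norm bounds are tested on finite index sets, where \<open>L2_set\<close>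
  supplies the triangle and Cauchy-Schwarz inequalities; this criterion passes to the full index
  set.\<close>

lemma l2I:
  assumes "\<And>F. finite F \<Longrightarrow> L2_set (\<lambda>a. cmod (z a)) F \<le> C"
  shows "z \<in> l2" "l2n z \<le> C"
proof -
  have C: "0 \<le> C" using assms[of "{}"] by simp
  have "(\<Sum>a\<in>F. (cmod (z a))\<^sup>2) \<le> C\<^sup>2" if "finite F" for F
    using assms[OF that] by (simp add: L2_set_def sqrt_le_D)
  from l2I_sq[OF this C] show "z \<in> l2" "l2n z \<le> C" by auto
qed

lemma l2_add:
  assumes "x \<in> l2" "y \<in> l2"
  shows "(\<lambda>a. x a + y a) \<in> l2" "l2n (\<lambda>a. x a + y a) \<le> l2n x + l2n y"
proof -
  have "L2_set (\<lambda>a. cmod (x a + y a)) F \<le> l2n x + l2n y" if F: "finite F" for F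
  proof -
    have "L2_set (\<lambda>a. cmod (x a + y a)) F \<le> L2_set (\<lambda>a. cmod (x a) + cmod (y a)) F"
      by (rule L2_set_mono) (auto simp: norm_triangle_ineq)
    also have "\<dots> \<le> L2_set (\<lambda>a. cmod (x a)) F + L2_set (\<lambda>a. cmod (y a)) F"
      by (rule L2_set_triangle_ineq)
    also have "\<dots> \<le> l2n x + l2n y"
      using assms F by (intro add_mono L2_set_le_l2n)
    finally show ?thesis .
  qed
  from l2I[OF this] show "(\<lambda>a. x a + y a) \<in> l2" "l2n (\<lambda>a. x a + y a) \<le> l2n x + l2n y" by auto
qed

lemma l2_cmult:
  assumes "x \<in> l2"
  shows "(\<lambda>a. c * x a) \<in> l2" "l2n (\<lambda>a. c * x a) = cmod c * l2n x"
  using assms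
  by (auto simp: l2_def l2n_def norm_mult power_mult_distrib infsum_cmult_right real_sqrt_mult
      intro!: summable_on_cmult_right)

lemma l2_mono:
  assumes "y \<in> l2" "\<And>a. cmod (x a) \<le> cmod (y a)"
  shows "x \<in> l2" "l2n x \<le> l2n y"
proof -
  have "L2_set (\<lambda>a. cmod (x a)) F \<le> l2n y" if F: "finite F" for F
    using L2_set_le_l2n[OF assms(1) F] L2_set_mono[of F "\<lambda>a. cmod (x a)" "\<lambda>a. cmod (y a)"] assms(2)
    by fastforce
  from l2I[OF this] show "x \<in> l2" "l2n x \<le> l2n y" by auto
qed

lemma l2n_cong: "(\<And>a. cmod (x a) = cmod (y a)) \<Longrightarrow> l2n x = l2n y"
  by (simp add: l2n_def)

lemma l2_cong: "(\<And>a. cmod (x a) = cmod (y a)) \<Longrightarrow> x \<in> l2 \<longleftrightarrow> y \<in> l2"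
  by (simp add: l2_def)

lemma l2_minus:
  assumes "x \<in> l2"
  shows "(\<lambda>a. - x a) \<in> l2" "l2n (\<lambda>a. - x a) = l2n x"
  using assms by (auto simp: l2_def l2n_def)

lemma l2_diff:
  assumes "x \<in> l2" "y \<in> l2"
  shows "(\<lambda>a. x a - y a) \<in> l2" "l2n (\<lambda>a. x a - y a) \<le> l2n x + l2n y"
  using l2_add[OF assms(1) l2_minus(1)[OF assms(2)]] l2_minus[OF assms(2)] by auto

lemma l2_finite_support:
  assumes "finite F" "\<And>a. a \<notin> F \<Longrightarrow> z a = 0"
  shows "z \<in> l2"
proof -
  have "(\<lambda>a. (cmod (z a))\<^sup>2) summable_on UNIV \<longleftrightarrow> (\<lambda>a. (cmod (z a))\<^sup>2) summable_on F"
    by (rule summable_on_cong_neutral) (auto simp: assms(2))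
  then show ?thesis using assms(1) by (simp add: l2_def)
qed

lemma l2n_eq_0: "x \<in> l2 \<Longrightarrow> l2n x = 0 \<Longrightarrow> x a = 0"
  using norm_le_l2n[of x a] by simp

lemma l2n_zero [simp]: "l2n (\<lambda>a. 0) = 0"
  by (simp add: l2n_def)

lemma zero_l2 [simp]: "(\<lambda>a. 0) \<in> l2"
  by (simp add: l2_def)

lemma l2_mult_summable:
  assumes "x \<in> l2" "y \<in> l2"
  shows "(\<lambda>a. norm (x a * y a)) summable_on UNIV" "cmod (\<Sum>\<^sub>\<infinity>a. x a * y a) \<le> l2n x * l2n y"
proof -
  have *: "(\<Sum>a\<in>F. norm (x a * y a)) \<le> l2n x * l2n y" if "finite F" for F
  proof -
    have "(\<Sum>a\<in>F. norm (x a * y a)) = (\<Sum>a\<in>F. \<bar>cmod (x a)\<bar> * \<bar>cmod (y a)\<bar>)"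
      by (simp add: norm_mult)
    also have "\<dots> \<le> L2_set (\<lambda>a. cmod (x a)) F * L2_set (\<lambda>a. cmod (y a)) F"
      by (rule L2_set_mult_ineq)
    also have "\<dots> \<le> l2n x * l2n y"
      using assms that by (intro mult_mono L2_set_le_l2n) auto
    finally show ?thesis .
  qed
  show s: "(\<lambda>a. norm (x a * y a)) summable_on UNIV"
    by (rule nonneg_bounded_partial_sums_imp_summable_on[where C = "l2n x * l2n y"])
      (auto intro!: eventually_finite_subsets_at_top_weakI *)
  show "cmod (\<Sum>\<^sub>\<infinity>a. x a * y a) \<le> l2n x * l2n y"
    using norm_infsum_bound[OF s] infsum_le_finite_sums[OF s *] by fastforce
qed

text \<open>The tail is tested on finite sets disjoint from \<open>A\<close>, the form in which it
  combines with the criterion \<open>l2I_sq\<close>.\<close>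

lemma l2_tail:
  assumes "z \<in> l2" and "0 < \<epsilon>"
  shows "\<exists>A. finite A \<and> (\<forall>B. finite B \<longrightarrow> A \<inter> B = {} \<longrightarrow> (\<Sum>a\<in>B. (cmod (z a))\<^sup>2) \<le> \<epsilon>)"
proof -
  from assms have sz: "(\<lambda>a. (cmod (z a))\<^sup>2) summable_on UNIV" by (simp add: l2_def)
  obtain A where A: "finite A" "dist (\<Sum>a\<in>A. (cmod (z a))\<^sup>2) (\<Sum>\<^sub>\<infinity>a. (cmod (z a))\<^sup>2) \<le> \<epsilon>"
    using infsum_finite_approximation[OF sz \<open>0 < \<epsilon>\<close>] by auto
  have "(\<Sum>a\<in>B. (cmod (z a))\<^sup>2) \<le> \<epsilon>" if "finite B" "A \<inter> B = {}" for B
  proof -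
    have "(\<Sum>a\<in>A \<union> B. (cmod (z a))\<^sup>2) \<le> (\<Sum>\<^sub>\<infinity>a. (cmod (z a))\<^sup>2)"
      using A that by (intro finite_sum_le_infsum[OF sz]) auto
    then show ?thesis using A that
      by (auto simp: sum.union_disjoint dist_real_def abs_real_def split: if_splits)
  qed
  then show ?thesis using A(1) by blast
qed

text \<open>Dominated convergence for sequences: outside a finite set the fixed majorant
  \<open>y\<close> controls the tail for all \<open>r\<close> at once, and on the finite set
  coordinatewise convergence suffices. Strong continuity of the group and convergence of its
  difference quotients both come from here.\<close>

lemma l2n_dominated:
  assumes y: "y \<in> l2"
    and le: "\<And>r a. cmod (z r a) \<le> cmod (y a)"
    and lim: "\<And>a. ((\<lambda>r. z r a) \<longlongrightarrow> 0) F"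
  shows "((\<lambda>r. l2n (z r)) \<longlongrightarrow> 0) F"
proof (rule tendstoI)
  fix e :: real assume e: "0 < e"
  obtain A where A: "finite A"
    and tail: "\<And>B. finite B \<Longrightarrow> A \<inter> B = {} \<Longrightarrow> (\<Sum>a\<in>B. (cmod (y a))\<^sup>2) \<le> e\<^sup>2 / 4"
    using l2_tail[OF y, of "e\<^sup>2 / 4"] e by auto
  have "((\<lambda>r. \<Sum>a\<in>A. (cmod (z r a))\<^sup>2) \<longlongrightarrow> (\<Sum>a\<in>A. (cmod 0)\<^sup>2)) F"
    by (intro tendsto_intros lim)
  then have "\<forall>\<^sub>F r in F. (\<Sum>a\<in>A. (cmod (z r a))\<^sup>2) < e\<^sup>2 / 4"
    by (rule order_tendstoD) (use e in auto)
  then show "\<forall>\<^sub>F r in F. dist (l2n (z r)) 0 < e"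
  proof eventually_elim
    case (elim r)
    have "(\<Sum>a\<in>B. (cmod (z r a))\<^sup>2) \<le> (sqrt (e\<^sup>2/2))\<^sup>2" if B: "finite B" for B
    proof -
      have "(\<Sum>a\<in>B. (cmod (z r a))\<^sup>2) = (\<Sum>a\<in>B \<inter> A. (cmod (z r a))\<^sup>2) + (\<Sum>a\<in>B - A. (cmod (z r a))\<^sup>2)"
        using B by (rule sum.Int_Diff)
      also have "(\<Sum>a\<in>B \<inter> A. (cmod (z r a))\<^sup>2) \<le> (\<Sum>a\<in>A. (cmod (z r a))\<^sup>2)"
        using A by (intro sum_mono2) auto
      also have "(\<Sum>a\<in>B - A. (cmod (z r a))\<^sup>2) \<le> (\<Sum>a\<in>B - A. (cmod (y a))\<^sup>2)"
        by (intro sum_mono power_mono le) auto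
      also have "\<dots> \<le> e\<^sup>2/4" using B by (intro tail) auto
      finally show ?thesis using elim by simp
    qed
    then have "l2n (z r) \<le> sqrt (e\<^sup>2/2)" by (rule l2I_sq) auto
    also have "\<dots> < e"
      using e by (simp add: real_less_lsqrt)
    finally show ?case by simp
  qed
qed

text \<open>Splitting \<open>cmod (T a b)\<close> into two square roots, Cauchy-Schwarz bounds each
  output coordinate through the row sums; summing over \<open>a\<close> then uses the column
  sums.\<close>

lemma Schur_test:
  fixes T :: "'a \<Rightarrow> 'b \<Rightarrow> complex"
  assumes row: "\<And>a F. finite F \<Longrightarrow> (\<Sum>b\<in>F. cmod (T a b)) \<le> R"
    and col: "\<And>b F. finite F \<Longrightarrow> (\<Sum>a\<in>F. cmod (T a b)) \<le> R"
    and z: "z \<in> l2"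
  shows "(\<lambda>b. norm (T a b * z b)) summable_on UNIV"
    and "(\<lambda>a. \<Sum>\<^sub>\<infinity>b. T a b * z b) \<in> l2"
    and "l2n (\<lambda>a. \<Sum>\<^sub>\<infinity>b. T a b * z b) \<le> R * l2n z"
proof -
  have R: "0 \<le> R" using row[of "{}"] by simp
  have sT: "(\<lambda>b. cmod (T a b)) summable_on UNIV" for a
    by (rule nonneg_bounded_partial_sums_imp_summable_on[where C = R])
      (auto intro!: eventually_finite_subsets_at_top_weakI row)
  show s: "(\<lambda>b. norm (T a b * z b)) summable_on UNIV" for a
  proof (rule Infinite_Sum.abs_summable_on_comparison_test')
    show "(\<lambda>b. cmod (T a b) * l2n z) summable_on UNIV"
      using sT by (intro summable_on_cmult_left) auto
    show "norm (T a b * z b) \<le> cmod (T a b) * l2n z" for b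
      by (simp add: norm_mult mult_left_mono norm_le_l2n[OF z])
  qed
  have "(\<lambda>b. norm (cmod (T a b) * (cmod (z b))\<^sup>2)) summable_on UNIV" for a
  proof (rule Infinite_Sum.abs_summable_on_comparison_test')
    show "(\<lambda>b. cmod (T a b) * (l2n z)\<^sup>2) summable_on UNIV"
      using sT by (intro summable_on_cmult_left) auto
    show "norm (cmod (T a b) * (cmod (z b))\<^sup>2) \<le> cmod (T a b) * (l2n z)\<^sup>2" for b
      by (auto intro!: mult_left_mono power_mono norm_le_l2n[OF z])
  qed
  then have s2: "(\<lambda>b. cmod (T a b) * (cmod (z b))\<^sup>2) summable_on UNIV" for a
    using Infinite_Sum.abs_summable_summable by fastforce
  have pt: "(cmod (\<Sum>\<^sub>\<infinity>b. T a b * z b))\<^sup>2 \<le> R * (\<Sum>\<^sub>\<infinity>b. cmod (T a b) * (cmod (z b))\<^sup>2)" for a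
  proof -
    \<comment> \<open>\<open>t\<close> and \<open>q\<close> are the two Cauchy-Schwarz factors.
      Their entries are real and nonnegative, so the sum of norms equals the norm of their
      pairing.\<close>
    define t where "t = (\<lambda>b. of_real (sqrt (cmod (T a b))) :: complex)"
    define q where "q = (\<lambda>b. of_real (sqrt (cmod (T a b)) * cmod (z b)) :: complex)"
    have t2: "(cmod (t b))\<^sup>2 = cmod (T a b)" "(cmod (q b))\<^sup>2 = cmod (T a b) * (cmod (z b))\<^sup>2" for b
      by (auto simp: t_def q_def power_mult_distrib norm_mult)
    have tl: "t \<in> l2" "q \<in> l2" using sT s2 by (auto simp: l2_def t2)
    have "cmod (\<Sum>\<^sub>\<infinity>b. T a b * z b) \<le> (\<Sum>\<^sub>\<infinity>b. cmod (T a b * z b))"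
      by (rule norm_infsum_bound[OF s])
    also have "\<dots> = (\<Sum>\<^sub>\<infinity>b. cmod (t b * q b))"
      by (intro infsum_cong) (simp add: norm_mult t_def q_def abs_mult mult.assoc[symmetric])
    also have "\<dots> = cmod (\<Sum>\<^sub>\<infinity>b. t b * q b)"
    proof -
      have e: "t b * q b = of_real (cmod (t b * q b))" for b
        by (simp add: t_def q_def norm_mult abs_mult)
      have "(\<Sum>\<^sub>\<infinity>b. t b * q b) = of_real (\<Sum>\<^sub>\<infinity>b. cmod (t b * q b))"
        using infsumI[OF has_sum_of_real[OF has_sum_infsum[OF l2_mult_summable(1)[OF tl]]]] e
        by (metis (no_types, lifting) infsum_cong)
      then show ?thesis by (simp add: infsum_nonneg)
    qed
    also have "\<dots> \<le> l2n t * l2n q" by (rule l2_mult_summable[OF tl])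
    finally have "(cmod (\<Sum>\<^sub>\<infinity>b. T a b * z b))\<^sup>2 \<le> (l2n t)\<^sup>2 * (l2n q)\<^sup>2"
      by (metis norm_ge_zero power_mono power_mult_distrib)
    also have "\<dots> \<le> R * (\<Sum>\<^sub>\<infinity>b. cmod (T a b) * (cmod (z b))\<^sup>2)"
    proof (rule mult_mono)
      show "(l2n t)\<^sup>2 \<le> R" unfolding l2n_sq t2
        by (rule infsum_le_finite_sums[OF sT]) (auto intro: row)
    qed (auto simp: l2n_sq t2 R infsum_nonneg)
    finally show ?thesis .
  qed
  have "(\<Sum>a\<in>F. (cmod (\<Sum>\<^sub>\<infinity>b. T a b * z b))\<^sup>2) \<le> (R * l2n z)\<^sup>2" if F: "finite F" for F
  proof -
    have sz: "(\<lambda>b. (cmod (z b))\<^sup>2) summable_on UNIV" using z by (simp add: l2_def)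
    have h: "((\<lambda>b. \<Sum>a\<in>F. cmod (T a b) * (cmod (z b))\<^sup>2) has_sum
        (\<Sum>a\<in>F. \<Sum>\<^sub>\<infinity>b. cmod (T a b) * (cmod (z b))\<^sup>2)) UNIV"
      using s2 by (intro has_sum_finite_sum F) auto
    have "(\<Sum>a\<in>F. (cmod (\<Sum>\<^sub>\<infinity>b. T a b * z b))\<^sup>2)
        \<le> R * (\<Sum>a\<in>F. \<Sum>\<^sub>\<infinity>b. cmod (T a b) * (cmod (z b))\<^sup>2)"
      unfolding sum_distrib_left by (intro sum_mono pt)
    also have "(\<Sum>a\<in>F. \<Sum>\<^sub>\<infinity>b. cmod (T a b) * (cmod (z b))\<^sup>2)
        = (\<Sum>\<^sub>\<infinity>b. \<Sum>a\<in>F. cmod (T a b) * (cmod (z b))\<^sup>2)"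
      using infsumI[OF h] by simp
    also have "\<dots> \<le> (\<Sum>\<^sub>\<infinity>b. R * (cmod (z b))\<^sup>2)"
    proof (rule infsum_mono)
      show "(\<lambda>b. \<Sum>a\<in>F. cmod (T a b) * (cmod (z b))\<^sup>2) summable_on UNIV"
        using h by (auto simp: summable_on_def)
      show "(\<lambda>b. R * (cmod (z b))\<^sup>2) summable_on UNIV" using sz by (intro summable_on_cmult_right) 
      show "(\<Sum>a\<in>F. cmod (T a b) * (cmod (z b))\<^sup>2) \<le> R * (cmod (z b))\<^sup>2" for b
        unfolding sum_distrib_right[symmetric] by (intro mult_right_mono col F) auto
    qed
    also have "\<dots> = R * (l2n z)\<^sup>2" using sz by (simp add: l2n_sq infsum_cmult_right)
    finally show ?thesis using R by (simp add: power2_eq_square mult_left_mono mult.assoc mult.left_commute)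
  qed
  from l2I_sq[OF this] show "(\<lambda>a. \<Sum>\<^sub>\<infinity>b. T a b * z b) \<in> l2"
    "l2n (\<lambda>a. \<Sum>\<^sub>\<infinity>b. T a b * z b) \<le> R * l2n z"
    using R by auto
qed

section \<open>Infinite matrices, the Neumann series and linear dependence\<close>

lemma l2_sum:
  assumes "finite A" "\<And>m. m \<in> A \<Longrightarrow> d m \<in> l2"
  shows "(\<lambda>a. \<Sum>m\<in>A. d m a) \<in> l2 \<and> l2n (\<lambda>a. \<Sum>m\<in>A. d m a) \<le> (\<Sum>m\<in>A. l2n (d m))"
  using assms
proof (induction A rule: finite_induct)
  case (insert m A)
  then show ?case
    using l2_add[of "d m" "\<lambda>a. \<Sum>m\<in>A. d m a"] by fastforce
qed auto

text \<open>\<open>infsum\<close> returns 0 for a family that is not summable, so linearity of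
  \<open>mapp T\<close> holds only under summability assumptions.\<close>

definition mapp :: "('a \<Rightarrow> 'b \<Rightarrow> complex) \<Rightarrow> ('b \<Rightarrow> complex) \<Rightarrow> 'a \<Rightarrow> complex" where
  "mapp T z = (\<lambda>a. \<Sum>\<^sub>\<infinity>b. T a b * z b)"

lemma mapp_diff:
  assumes "\<And>a. (\<lambda>b. norm (T a b * x b)) summable_on UNIV" "\<And>a. (\<lambda>b. norm (T a b * y b)) summable_on UNIV"
  shows "mapp T (\<lambda>b. x b - y b) a = mapp T x a - mapp T y a"
proof -
  have s: "(\<lambda>b. T a b * x b) summable_on UNIV" "(\<lambda>b. T a b * y b) summable_on UNIV"
    using assms Infinite_Sum.abs_summable_summable by fastforce+
  have "((\<lambda>b. T a b * x b + - (T a b * y b)) has_sum (mapp T x a + - mapp T y a)) UNIV"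
    unfolding mapp_def using s by (intro has_sum_add has_sum_infsum has_sum_uminusI)
  then show ?thesis
    by (simp add: mapp_def infsumI right_diff_distrib)
qed

text \<open>The terms \<open>d m\<close> are the images of \<open>c\<close> under the powers of
  \<open>- mapp T\<close> and shrink by 1/2 at each step. The series converges coordinatewise, and
  finite sections of the limit inherit the geometric tail bound, which puts the limit in
  \<open>l2\<close>.\<close>

lemma Neumann_series:
  fixes T :: "'a \<Rightarrow> 'a \<Rightarrow> complex"
  assumes row: "\<And>a F. finite F \<Longrightarrow> (\<Sum>b\<in>F. cmod (T a b)) \<le> 1/2"
    and col: "\<And>b F. finite F \<Longrightarrow> (\<Sum>a\<in>F. cmod (T a b)) \<le> 1/2"
    and c: "c \<in> l2"
  shows "\<exists>x\<in>l2. \<forall>a. x a + mapp T x a = c a"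
proof -
  define d where "d m = ((\<lambda>z a. - mapp T z a) ^^ m) c" for m :: nat
  have d0: "d 0 = c" and dS: "d (Suc m) = (\<lambda>a. - mapp T (d m) a)" for m
    by (auto simp: d_def)
  have mT: "(\<lambda>b. norm (T a b * z b)) summable_on UNIV" "mapp T z \<in> l2" "l2n (mapp T z) \<le> 1/2 * l2n z"
    if "z \<in> l2" for z a
    using Schur_test[of T "1/2" z, OF row col that] by (auto simp: mapp_def)
  have d: "d m \<in> l2 \<and> l2n (d m) \<le> (1/2)^m * l2n c" for m
  proof (induction m)
    case (Suc m)
    then show ?case using mT[of "d m"] l2_minus[of "mapp T (d m)"] by (auto simp: dS)
  qed (simp add: d0 c)
  define s where "s n = (\<lambda>a. \<Sum>m<n. d m a)" for n
  have sl: "s n \<in> l2" for n unfolding s_def using l2_sum[of "{..<n}" d] d by auto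
  have ab: "cmod (d m a) \<le> (1/2)^m * l2n c" for m a
    using d[of m] norm_le_l2n[of "d m" a] by linarith
  have gs: "summable (\<lambda>m. (1/2::real)^m * l2n c)"
    by (intro summable_mult2 summable_geometric) auto
  have sm: "summable (\<lambda>m. d m a)" for a
    by (rule summable_comparison_test'[OF gs]) (use ab in auto)
  define x where "x a = (\<Sum>m. d m a)" for a
  have lim: "(\<lambda>n. s n a) \<longlonglongrightarrow> x a" for a
    unfolding s_def x_def using summable_LIMSEQ[OF sm] .
  have tail: "(\<lambda>a. x a - s n a) \<in> l2 \<and> l2n (\<lambda>a. x a - s n a) \<le> 2 * (1/2)^n * l2n c" for n
  proof -
    have "L2_set (\<lambda>a. cmod (x a - s n a)) F \<le> 2 * (1/2)^n * l2n c" if F: "finite F" for F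
    proof (rule tendsto_upperbound)
      show "(\<lambda>N. L2_set (\<lambda>a. cmod (s N a - s n a)) F) \<longlonglongrightarrow> L2_set (\<lambda>a. cmod (x a - s n a)) F"
        unfolding L2_set_def by (intro tendsto_intros lim)
      show "\<forall>\<^sub>F N in sequentially. L2_set (\<lambda>a. cmod (s N a - s n a)) F \<le> 2 * (1/2)^n * l2n c"
        using eventually_ge_at_top[of n]
      proof eventually_elim
        case (elim N)
        have e: "(\<lambda>a. s N a - s n a) = (\<lambda>a. \<Sum>m\<in>{n..<N}. d m a)"
          using elim by (auto simp: s_def fun_eq_iff sum_diff_nat_ivl[of 0 n N, simplified atLeast0LessThan, symmetric] lessThan_atLeast0)
        have "L2_set (\<lambda>a. cmod (s N a - s n a)) F \<le> l2n (\<lambda>a. \<Sum>m\<in>{n..<N}. d m a)"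
          unfolding fun_cong[OF e] using l2_sum[of "{n..<N}" d] d F by (intro L2_set_le_l2n) auto
        also have "\<dots> \<le> (\<Sum>m\<in>{n..<N}. l2n (d m))" using l2_sum[of "{n..<N}" d] d by auto
        also have "\<dots> \<le> (\<Sum>m\<in>{n..<N}. (1/2)^m * l2n c)" using d by (intro sum_mono) auto
        also have "\<dots> = (\<Sum>m\<in>{n..<N}. (1/2::real)^m) * l2n c" by (simp add: sum_distrib_right)
        also have "(\<Sum>m\<in>{n..<N}. (1/2::real)^m) = 2 * ((1/2)^n - (1/2)^N)"
          using elim by (induction N rule: dec_induct) (simp_all add: algebra_simps)
        also have "\<dots> * l2n c \<le> 2 * (1/2)^n * l2n c" by (intro mult_right_mono) auto
        finally show ?case .
      qed
    qed auto
    from l2I[OF this] show ?thesis by auto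
  qed
  have xl: "x \<in> l2" using tail[of 0] by (simp add: s_def)
  \<comment> \<open>The partial sums satisfy the equation with one index shifted; both terms then
    pass to the limit coordinatewise.\<close>
  have ss: "s (Suc n) a + mapp T (s n) a = c a" for n a
  proof (induction n)
    case 0
    then show ?case by (simp add: s_def d0 mapp_def)
  next
    case (Suc n)
    have "mapp T (\<lambda>b. s (Suc n) b - s n b) a = mapp T (s (Suc n)) a - mapp T (s n) a"
      by (rule mapp_diff; rule mT; rule sl)
    moreover have "(\<lambda>b. s (Suc n) b - s n b) = d n" by (auto simp: s_def)
    moreover have "s (Suc (Suc n)) a = s (Suc n) a - mapp T (d n) a" by (simp add: s_def dS)
    ultimately have "s (Suc (Suc n)) a = s (Suc n) a - (mapp T (s (Suc n)) a - mapp T (s n) a)" by simp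
    then show ?case using Suc by simp
  qed
  have "(\<lambda>n. mapp T (s n) a) \<longlonglongrightarrow> mapp T x a" for a
  proof -
    have "(\<lambda>n. mapp T x a - mapp T (s n) a) \<longlonglongrightarrow> 0"
    proof (rule Lim_null_comparison)
      show "\<forall>\<^sub>F n in sequentially. norm (mapp T x a - mapp T (s n) a) \<le> (1/2)^n * l2n c"
      proof (rule always_eventually, intro allI)
        fix n
        have "mapp T x a - mapp T (s n) a = mapp T (\<lambda>b. x b - s n b) a"
          by (rule mapp_diff[symmetric]; rule mT; (rule sl | rule xl))
        also have "cmod \<dots> \<le> l2n (mapp T (\<lambda>b. x b - s n b))"
          using tail mT by (intro norm_le_l2n) auto
        also have "\<dots> \<le> 1/2 * l2n (\<lambda>b. x b - s n b)" using tail mT by auto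
        also have "\<dots> \<le> (1/2)^n * l2n c" using tail[of n] by auto
        finally show "norm (mapp T x a - mapp T (s n) a) \<le> (1/2)^n * l2n c" .
      qed
      show "(\<lambda>n. (1/2)^n * l2n c) \<longlonglongrightarrow> 0" using summable_LIMSEQ_zero[OF gs] .
    qed
    then have "(\<lambda>n. mapp T x a - (mapp T x a - mapp T (s n) a)) \<longlonglongrightarrow> mapp T x a - 0"
      by (intro tendsto_intros)
    then show ?thesis by simp
  qed
  then have "(\<lambda>n. s (Suc n) a + mapp T (s n) a) \<longlonglongrightarrow> x a + mapp T x a" for a
    using lim by (intro tendsto_add LIMSEQ_Suc)
  then have "x a + mapp T x a = c a" for a
    unfolding ss using LIMSEQ_unique tendsto_const by metis
  then show ?thesis using xl by blast
qed

text \<open>Gaussian elimination: an equation with a nonzero coefficient at \<open>i\<close>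
  eliminates the unknown \<open>i\<close>, and both counts drop by one. It serves the Fredholm
  alternative and, later, the construction of a polynomial relation for kernel elements.\<close>

lemma linear_dependence:
  fixes v :: "'j \<Rightarrow> 'l \<Rightarrow> complex"
  assumes "finite L" "finite J" "card L < card J"
  shows "\<exists>\<alpha>. (\<exists>j\<in>J. \<alpha> j \<noteq> 0) \<and> (\<forall>l\<in>L. (\<Sum>j\<in>J. \<alpha> j * v j l) = 0)"
  using assms
proof (induction L arbitrary: J v rule: finite_induct)
  case empty
  then have "J \<noteq> {}" by auto
  then show ?case by (intro exI[of _ "\<lambda>_. 1"]) auto
next
  case (insert l L)
  show ?case
  proof (cases "\<forall>j\<in>J. v j l = 0")
    case True
    obtain \<alpha> where "\<exists>j\<in>J. \<alpha> j \<noteq> 0" "\<forall>l\<in>L. (\<Sum>j\<in>J. \<alpha> j * v j l) = 0"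
      using insert.IH[of J v] insert.prems insert.hyps by auto
    then show ?thesis using True by (intro exI[of _ \<alpha>]) auto
  next
    case False
    then obtain i where i: "i \<in> J" "v i l \<noteq> 0" by auto
    define v' where "v' j m = v j m - v j l / v i l * v i m" for j m
    have "card L < card (J - {i})" using insert i by (simp add: card_Diff_singleton)
    then obtain \<alpha> where \<alpha>: "\<exists>j\<in>J-{i}. \<alpha> j \<noteq> 0" "\<forall>m\<in>L. (\<Sum>j\<in>J-{i}. \<alpha> j * v' j m) = 0"
      using insert.IH[of "J-{i}" v'] insert.prems by auto
    define S where "S = (\<Sum>j\<in>J-{i}. \<alpha> j * v j l)"
    \<comment> \<open>The coefficient at \<open>i\<close> is the one that solves the eliminated
      equation \<open>l\<close>.\<close>
    define \<beta> where "\<beta> = \<alpha>(i := - S / v i l)"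
    have split: "(\<Sum>j\<in>J. \<beta> j * v j m) = - S / v i l * v i m + (\<Sum>j\<in>J-{i}. \<alpha> j * v j m)" for m
      using i insert.prems by (subst sum.remove[of J i]) (auto simp: \<beta>_def intro!: sum.cong)
    have "(\<Sum>j\<in>J. \<beta> j * v j m) = 0" if "m \<in> L" for m
    proof -
      have "0 = (\<Sum>j\<in>J-{i}. \<alpha> j * v' j m)" using \<alpha> that by simp
      also have "\<dots> = (\<Sum>j\<in>J-{i}. \<alpha> j * v j m) - S / v i l * v i m"
        by (simp add: v'_def S_def right_diff_distrib sum_subtractf sum_divide_distrib sum_distrib_right mult.assoc[symmetric])
      finally show ?thesis by (simp add: split)
    qed
    moreover have "(\<Sum>j\<in>J. \<beta> j * v j l) = 0" using i by (simp add: split S_def)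
    moreover have "\<exists>j\<in>J. \<beta> j \<noteq> 0" using \<alpha>(1) by (auto simp: \<beta>_def)
    ultimately show ?thesis by auto
  qed
qed

section \<open>Matrices that are scalar up to smoothing\<close>

text \<open>By the Schur test the bounds in \<open>smoothing\<close> say that \<open>E\<close> gains one order of
  decay: it maps \<open>lw p\<close> to \<open>lw (p + 1)\<close>.\<close>

locale smoothing_matrix =
  fixes br :: "'a \<Rightarrow> real" and E :: "'a \<Rightarrow> 'a \<Rightarrow> complex" and \<delta> :: complex
  assumes br_ge1: "1 \<le> br a"
    and finite_br: "finite {a. br a \<le> r}"
    and \<delta>: "\<delta> \<noteq> 0"
    and smoothing: "0 \<le> p \<Longrightarrow> \<exists>R. \<forall>F. finite F \<longrightarrow>
        (\<forall>a. (\<Sum>b\<in>F. cmod (E a b) * br a powr (p + 1) * br b powr (-p)) \<le> R) \<and>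
        (\<forall>b. (\<Sum>a\<in>F. cmod (E a b) * br a powr (p + 1) * br b powr (-p)) \<le> R)"
begin

text \<open>The sequence counterpart of a Sobolev space of order \<open>p\<close>, with
  \<open>br\<close> in the role of the frequency bracket.\<close>

definition lw :: "real \<Rightarrow> ('a \<Rightarrow> complex) set" where
  "lw p = {x. (\<lambda>a. of_real (br a powr p) * x a) \<in> l2}"

lemma br_pos: "0 < br a" using br_ge1[of a] by linarith

lemma lw_0: "lw 0 = l2"
proof -
  have "br a \<noteq> 0" for a using br_pos[of a] by simp
  then show ?thesis by (simp add: lw_def)
qed

lemma lw_mono:
  assumes "p \<le> q" "x \<in> lw q"
  shows "x \<in> lw p"
proof -
  have "(\<lambda>a. of_real (br a powr p) * x a) \<in> l2"
    by (rule l2_mono(1)[where y = "\<lambda>a. of_real (br a powr q) * x a"])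
      (use assms br_ge1 in \<open>simp_all add: lw_def norm_mult mult_right_mono powr_mono\<close>)
  then show ?thesis by (simp add: lw_def)
qed

lemma l2_imp_lw_0: "x \<in> lw p \<Longrightarrow> 0 \<le> p \<Longrightarrow> x \<in> l2"
  using lw_mono[of 0 p x] lw_0 by auto

lemma lw_summable:
  assumes p: "0 \<le> p" and x: "x \<in> lw p"
  shows "(\<lambda>b. norm (E a b * x b)) summable_on UNIV"
proof -
  obtain R where "\<forall>F. finite F \<longrightarrow> (\<forall>a. (\<Sum>b\<in>F. cmod (E a b) * br a powr (0 + 1) * br b powr (-0)) \<le> R) \<and> (\<forall>b. (\<Sum>a\<in>F. cmod (E a b) * br a powr (0 + 1) * br b powr (-0)) \<le> R)"
    using smoothing[OF order_refl] by (rule exE)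
  then have R: "\<And>a F. finite F \<Longrightarrow> (\<Sum>b\<in>F. cmod (E a b) * br a powr (0 + 1) * br b powr (-0)) \<le> R"
     "\<And>b F. finite F \<Longrightarrow> (\<Sum>a\<in>F. cmod (E a b) * br a powr (0 + 1) * br b powr (-0)) \<le> R" by simp_all
  have le: "cmod (E a b) \<le> cmod (E a b) * br a powr (0 + 1) * br b powr (-0)" for a b
  proof -
    have "cmod (E a b) * 1 \<le> cmod (E a b) * br a" using br_ge1[of a] by (intro mult_left_mono) auto
    then show ?thesis using br_pos[of a] br_pos[of b] by simp
  qed
  show ?thesis
  proof (rule Schur_test(1)[of E R x])
    show "(\<Sum>b\<in>F. cmod (E a b)) \<le> R" if "finite F" for a F
      using sum_mono[of F, OF le] R(1)[OF that] by (rule order_trans)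
    show "(\<Sum>a\<in>F. cmod (E a b)) \<le> R" if "finite F" for b F
      using sum_mono[of F, OF le] R(2)[OF that] by (rule order_trans)
    show "x \<in> l2" using l2_imp_lw_0[OF x p] .
  qed
qed

definition op :: "('a \<Rightarrow> complex) \<Rightarrow> 'a \<Rightarrow> complex" where
  "op x = (\<lambda>a. \<delta> * x a + mapp E x a)"

text \<open>A mixed problem: the equation is imposed on the coordinates in \<open>H\<close> and the
  other coordinates are prescribed. Its matrix is the identity outside \<open>H\<close>, so for
  \<open>H\<close> at high frequency it is close to an invertible diagonal one, and low frequencies
  enter only as data.\<close>

definition solvable :: "real \<Rightarrow> 'a set \<Rightarrow> bool" where
  "solvable p H \<longleftrightarrow> (\<forall>c\<in>lw p. \<exists>x\<in>lw p. (\<forall>a\<in>H. op x a = c a) \<and> (\<forall>a. a \<notin> H \<longrightarrow> x a = c a))"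

definition uniquely :: "real \<Rightarrow> 'a set \<Rightarrow> bool" where
  "uniquely p H \<longleftrightarrow> (\<forall>x\<in>lw p. (\<forall>a\<in>H. op x a = 0) \<and> (\<forall>a. a \<notin> H \<longrightarrow> x a = 0) \<longrightarrow> x = (\<lambda>a. 0))"

lemma solvableD:
  assumes "solvable p H" "c \<in> lw p"
  shows "\<exists>x\<in>lw p. (\<forall>a\<in>H. op x a = c a) \<and> (\<forall>a. a \<notin> H \<longrightarrow> x a = c a)"
  using assms(1)[unfolded solvable_def] assms(2) by (rule bspec)

lemma uniquelyD:
  assumes u: "uniquely p H" and x: "x \<in> lw p" "\<And>a. a \<in> H \<Longrightarrow> op x a = 0" "\<And>a. a \<notin> H \<Longrightarrow> x a = 0"
  shows "x = (\<lambda>a. 0)"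
  using bspec[OF u[unfolded uniquely_def] x(1)] x(2,3) by simp

text \<open>At high frequencies the smoothing part is a small perturbation of \<open>\<delta>\<close>.\<close>

lemma high_frequency:
  assumes p: "0 \<le> p"
  shows "\<exists>N. \<forall>H. H \<subseteq> {a. N < br a} \<longrightarrow> solvable p H \<and> uniquely p H"
proof -
  obtain R0 where "\<forall>F. finite F \<longrightarrow> (\<forall>a. (\<Sum>b\<in>F. cmod (E a b) * br a powr (p + 1) * br b powr (-p)) \<le> R0) \<and> (\<forall>b. (\<Sum>a\<in>F. cmod (E a b) * br a powr (p + 1) * br b powr (-p)) \<le> R0)"
    using smoothing[OF p] by (rule exE)
  then have R0: "\<And>a F. finite F \<Longrightarrow> (\<Sum>b\<in>F. cmod (E a b) * br a powr (p + 1) * br b powr (-p)) \<le> R0"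
     "\<And>b F. finite F \<Longrightarrow> (\<Sum>a\<in>F. cmod (E a b) * br a powr (p + 1) * br b powr (-p)) \<le> R0" by simp_all
  define R where "R = R0"
  have R: "0 \<le> R" using R0(1)[of "{}"] by (simp add: R_def)
  \<comment> \<open>One order of \<open>br a\<close> is gained by \<open>E\<close>, so above
    \<open>N\<close> the conjugated and normalised matrix has row and column sums at most
    \<open>R / (cmod \<delta> * N)\<close>, that is 1/2.\<close>
  define N where "N = 2 * R / cmod \<delta>"
  have d: "0 < cmod \<delta>" using \<delta> by simp
  have N: "0 \<le> N" using R d by (simp add: N_def)
  show ?thesis
  proof (intro exI[of _ N] allI impI)
    fix H :: "'a set" assume H: "H \<subseteq> {a. N < br a}"
    \<comment> \<open>Conjugation by the weights turns the problem on \<open>lw p\<close> into one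
      on \<open>l2\<close>, and division by \<delta> normalises the diagonal. Rows outside
      \<open>H\<close> are zero, which leaves the identity there.\<close>
    define T where "T a b = (if a \<in> H then of_real (br a powr p) * E a b * of_real (br b powr (-p)) / \<delta> else 0)" for a b
    have le2: "cmod (T a b) * (2 * R) \<le> cmod (E a b) * br a powr (p + 1) * br b powr (-p)" for a b
    proof (cases "a \<in> H")
      case True
      then have "2 * R \<le> cmod \<delta> * br a" using H d by (auto simp: N_def field_simps)
      then have "cmod (T a b) * (2 * R) \<le> cmod (T a b) * (cmod \<delta> * br a)" by (intro mult_left_mono) auto
      also have "\<dots> = cmod (E a b) * br a powr (p + 1) * br b powr (-p)"
        using True d br_pos[of a] by (simp add: T_def norm_mult norm_divide powr_add)
      finally show ?thesis .
    qed (simp add: T_def)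
    \<comment> \<open>The bounds are available only after multiplication by \<open>2 * R\<close>;
      the degenerate case \<open>R = 0\<close>, in which \<open>E\<close> vanishes, is settled
      separately by \<open>R_0\<close>.\<close>
    have half: "S \<le> 1/2" if "S * (2 * R) \<le> R" "R = 0 \<Longrightarrow> S = 0" for S :: real
      using that R by (cases "R = 0") (auto simp: mult.commute)
    have R_0: "T a b = 0" if "R = 0" for a b
    proof -
      have "cmod (E a b) * br a powr (p + 1) * br b powr (-p) \<le> 0"
        using R0(1)[of "{b}" a] that by (simp add: R_def)
      moreover have "0 < br a powr (p + 1) * br b powr (-p)" using br_pos[of a] br_pos[of b] by simp
      ultimately have "cmod (E a b) \<le> 0"
        by (metis mult.assoc mult_le_cancel_right mult_zero_left not_less)
      then show ?thesis by (simp add: T_def)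
    qed
    have row: "(\<Sum>b\<in>F. cmod (T a b)) \<le> 1/2" if F: "finite F" for a F
    proof (rule half)
      show "(\<Sum>b\<in>F. cmod (T a b)) * (2 * R) \<le> R"
        unfolding sum_distrib_right using order_trans[OF sum_mono[of F, OF le2] R0(1)[OF F]] by (simp add: R_def)
    qed (simp add: R_0)
    have col: "(\<Sum>a\<in>F. cmod (T a b)) \<le> 1/2" if F: "finite F" for b F
    proof (rule half)
      show "(\<Sum>a\<in>F. cmod (T a b)) * (2 * R) \<le> R"
        unfolding sum_distrib_right using order_trans[OF sum_mono[of F, OF le2] R0(2)[OF F]] by (simp add: R_def)
    qed (simp add: R_0)
    have conj: "mapp T (\<lambda>b. of_real (br b powr p) * x b) a = of_real (br a powr p) * mapp E x a / \<delta>" if "a \<in> H" for x a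
    proof -
      have e: "T a b * (of_real (br b powr p) * x b) = of_real (br a powr p) / \<delta> * (E a b * x b)" for b
        using that br_pos[of b] by (simp add: T_def powr_minus field_simps)
      show ?thesis unfolding mapp_def e infsum_cmult_right' by simp
    qed
    have conj0: "mapp T z a = 0" if "a \<notin> H" for z a using that by (simp add: mapp_def T_def)
    have ex: "\<exists>x\<in>lw p. (\<forall>a\<in>H. \<delta> * x a + mapp E x a = c a) \<and> (\<forall>a. a \<notin> H \<longrightarrow> x a = c a)"
      if c: "c \<in> lw p" for c
    proof -
      define c' where "c' a = of_real (br a powr p) * (if a \<in> H then c a / \<delta> else c a)" for a
      have "c' \<in> l2"
      proof (rule l2_mono(1))
        show "(\<lambda>a. of_real (1 + 1 / cmod \<delta>) * (of_real (br a powr p) * c a)) \<in> l2"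
          using c unfolding lw_def by (intro l2_cmult) auto
        show "cmod (c' a) \<le> cmod (of_real (1 + 1 / cmod \<delta>) * (of_real (br a powr p) * c a))" for a
        proof -
          have "1 \<le> 1 + 1 / cmod \<delta>" "1 / cmod \<delta> \<le> 1 + 1 / cmod \<delta>" using d by auto
          then have "1 * (br a powr p * cmod (c a)) \<le> (1 + 1 / cmod \<delta>) * (br a powr p * cmod (c a))"
            "(1 / cmod \<delta>) * (br a powr p * cmod (c a)) \<le> (1 + 1 / cmod \<delta>) * (br a powr p * cmod (c a))"
            by (intro mult_right_mono; simp)+
          moreover have "cmod (of_real (1 + 1 / cmod \<delta>) :: complex) = 1 + 1 / cmod \<delta>"
            unfolding norm_of_real using d by simp
          ultimately show ?thesis by (simp add: c'_def norm_mult norm_divide del: of_real_add)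
        qed
      qed
      from Neumann_series[OF row col this] obtain y where
        y: "y \<in> l2" "\<And>a. y a + mapp T y a = c' a" by blast
      define x where "x a = of_real (br a powr (-p)) * y a" for a
      have nz: "complex_of_real (br a powr p) \<noteq> 0" "br a \<noteq> 0" for a using br_pos[of a] by simp_all
      have yx: "y = (\<lambda>b. of_real (br b powr p) * x b)"
        using nz by (simp add: x_def fun_eq_iff powr_minus field_simps)
      have "\<delta> * x a + mapp E x a = c a" if "a \<in> H" for a
      proof -
        have "of_real (br a powr p) * x a + of_real (br a powr p) * mapp E x a / \<delta> = of_real (br a powr p) * c a / \<delta>"
          using y(2)[of a] conj[OF that, of x] that by (simp add: yx c'_def)
        then have "of_real (br a powr p) * (\<delta> * x a + mapp E x a) = of_real (br a powr p) * c a"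
          using \<delta> by (simp add: field_simps)
        then show ?thesis using nz by simp
      qed
      moreover have "x a = c a" if "a \<notin> H" for a
        using y(2)[of a] conj0[OF that, of y] that nz(1)[of a] by (simp add: yx c'_def)
      moreover have "x \<in> lw p" using y(1) by (simp add: lw_def yx)
      ultimately show ?thesis by blast
    qed
    have un: "x = (\<lambda>a. 0)"
      if x: "x \<in> lw p" "\<forall>a\<in>H. \<delta> * x a + mapp E x a = 0" "\<forall>a. a \<notin> H \<longrightarrow> x a = 0" for x
    proof -
      define y where "y = (\<lambda>b. of_real (br b powr p) * x b)"
      have y: "y \<in> l2" using x(1) by (simp add: lw_def y_def)
      have "y a = - mapp T y a" for a
      proof (cases "a \<in> H")
        case True
        have "mapp E x a = - \<delta> * x a" using x(2) True by (simp add: eq_neg_iff_add_eq_0 add.commute)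
        then show ?thesis using conj[OF True, of x] \<delta> by (simp add: y_def)
      qed (use conj0 x(3) in \<open>auto simp: y_def\<close>)
      then have "y = (\<lambda>a. - mapp T y a)" by auto
      then have "l2n y = l2n (mapp T y)" by (metis l2n_cong norm_minus_cancel)
      also have "\<dots> \<le> 1/2 * l2n y" using Schur_test(3)[OF row col y] by (simp add: mapp_def)
      finally have "l2n y = 0" using l2n_nonneg[of y] by linarith
      then have "y a = 0" for a by (rule l2n_eq_0[OF y])
      moreover have "br a \<noteq> 0" for a using br_pos[of a] by simp
      ultimately show ?thesis by (simp add: y_def fun_eq_iff)
    qed
    show "solvable p H \<and> uniquely p H"
      unfolding solvable_def uniquely_def op_def using ex un by blast
  qed
qed

section \<open>Regularity of kernel elements and the Fredholm alternative\<close>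

lemma op_add:
  assumes "x \<in> l2" "y \<in> l2"
  shows "op (\<lambda>a. \<beta> * x a + \<gamma> * y a) a = \<beta> * op x a + \<gamma> * op y a"
proof -
  have s: "(\<lambda>b. E a b * x b) summable_on UNIV" "(\<lambda>b. E a b * y b) summable_on UNIV"
    using assms lw_summable[OF order_refl] lw_0 Infinite_Sum.abs_summable_summable by fastforce+
  have "((\<lambda>b. \<beta> * (E a b * x b) + \<gamma> * (E a b * y b)) has_sum (\<beta> * mapp E x a + \<gamma> * mapp E y a)) UNIV"
    unfolding mapp_def using s by (intro has_sum_add has_sum_cmult_right has_sum_infsum)
  then have "mapp E (\<lambda>b. \<beta> * x b + \<gamma> * y b) a = \<beta> * mapp E x a + \<gamma> * mapp E y a"
    by (simp add: mapp_def infsumI algebra_simps)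
  then show ?thesis by (simp add: op_def algebra_simps)
qed

lemma op_sum:
  assumes "finite J" "\<And>j. j \<in> J \<Longrightarrow> x j \<in> l2"
  shows "op (\<lambda>a. \<Sum>j\<in>J. \<alpha> j * x j a) a = (\<Sum>j\<in>J. \<alpha> j * op (x j) a) \<and> (\<lambda>a. \<Sum>j\<in>J. \<alpha> j * x j a) \<in> l2"
  using assms
proof (induction J rule: finite_induct)
  case empty
  then show ?case by (simp add: op_def mapp_def)
next
  case (insert i J)
  have "op (\<lambda>a. \<alpha> i * x i a + 1 * (\<Sum>j\<in>J. \<alpha> j * x j a)) a = \<alpha> i * op (x i) a + 1 * op (\<lambda>a. \<Sum>j\<in>J. \<alpha> j * x j a) a"
    using insert by (intro op_add) auto
  moreover have "(\<lambda>a. \<alpha> i * x i a + 1 * (\<Sum>j\<in>J. \<alpha> j * x j a)) \<in> l2"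
    using insert l2_cmult(1)[of "x i" "\<alpha> i"] by (intro l2_add) auto
  ultimately show ?case using insert by simp
qed

lemma op_diff:
  assumes "x \<in> l2" "y \<in> l2"
  shows "op (\<lambda>a. x a - y a) a = op x a - op y a"
  using op_add[OF assms, of 1 "-1"] by simp

lemma lw_finite_support:
  assumes "finite F" "\<And>a. a \<notin> F \<Longrightarrow> z a = 0"
  shows "z \<in> lw p"
  unfolding lw_def using assms by (auto intro!: l2_finite_support[OF assms(1)])

lemma lw_sum:
  assumes "finite J" "\<And>j. j \<in> J \<Longrightarrow> x j \<in> lw p"
  shows "(\<lambda>a. \<Sum>j\<in>J. \<alpha> j * x j a) \<in> lw p"
  using assms
proof (induction J rule: finite_induct)
  case empty
  then show ?case by (simp add: lw_def)
next
  case (insert i J)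
  have "(\<lambda>a. \<alpha> i * (of_real (br a powr p) * x i a) + of_real (br a powr p) * (\<Sum>j\<in>J. \<alpha> j * x j a)) \<in> l2"
    using insert l2_cmult(1)[of "\<lambda>a. of_real (br a powr p) * x i a" "\<alpha> i"] by (intro l2_add) (auto simp: lw_def)
  then show ?case using insert by (simp add: lw_def algebra_simps)
qed

text \<open>Instead of gaining one order at a time, the mixed problem is solved in
  \<open>lw p\<close> with the low-frequency values of \<open>x\<close> as data. The result and
  \<open>x\<close> both solve it in \<open>l2\<close>, where the solution is unique.\<close>

lemma regularity:
  assumes x: "x \<in> l2" "\<And>a. a \<in> Z \<Longrightarrow> x a = 0" "\<And>a. a \<notin> Z \<Longrightarrow> op x a = 0" and p: "0 \<le> p"
  shows "x \<in> lw p"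
proof -
  obtain N where N: "\<And>H. H \<subseteq> {a. N < br a} \<Longrightarrow> solvable p H"
    using high_frequency[OF p] by blast
  obtain N' where N': "\<And>H. H \<subseteq> {a. N' < br a} \<Longrightarrow> uniquely 0 H"
    using high_frequency[of 0] by blast
  define H where "H = {a. max N N' < br a} - Z"
  \<comment> \<open>Zero right-hand side for the high-frequency equations, the values of
    \<open>x\<close> below the cutoff. On \<open>Z\<close> above the cutoff it agrees with
    \<open>x\<close>, which vanishes there.\<close>
  define c where "c a = (if max N N' < br a then 0 else x a)" for a
  have "c \<in> lw p"
    by (rule lw_finite_support[OF finite_br[of "max N N'"]]) (auto simp: c_def)
  have sH: "solvable p H" by (rule N) (auto simp: H_def)
  obtain y where y: "y \<in> lw p" "\<And>a. a \<in> H \<Longrightarrow> op y a = c a" "\<And>a. a \<notin> H \<Longrightarrow> y a = c a"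
    using solvableD[OF sH \<open>c \<in> lw p\<close>] by blast
  have y0: "y \<in> l2" using l2_imp_lw_0[OF y(1) p] .
  have "(\<lambda>a. y a - x a) = (\<lambda>a. 0)"
  proof (rule uniquelyD[of 0 H])
    show "uniquely 0 H" by (rule N') (auto simp: H_def)
    show "(\<lambda>a. y a - x a) \<in> lw 0" using y0 x(1) by (simp add: lw_0 l2_diff)
    show "op (\<lambda>a. y a - x a) a = 0" if "a \<in> H" for a
      using op_diff[OF y0 x(1), of a] y(2)[OF that] x(3)[of a] that by (auto simp: H_def c_def)
    show "y a - x a = 0" if "a \<notin> H" for a
      using y(3)[OF that] x(2)[of a] that by (auto simp: H_def c_def)
  qed
  then have "y = x" by (simp add: fun_eq_iff)
  then show ?thesis using y(1) by simp
qed

text \<open>Finite dimension is expressed by a finite set \<open>L\<close> of coordinates that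
  determine a kernel element: if the low frequencies vanish, what remains solves a homogeneous
  high-frequency problem.\<close>

lemma finite_dimensional_kernel:
  "\<exists>L. finite L \<and> (\<forall>x\<in>l2. (\<forall>a\<in>Z \<union> L. x a = 0) \<and> (\<forall>a. a \<notin> Z \<longrightarrow> op x a = 0) \<longrightarrow> x = (\<lambda>a. 0))"
proof -
  obtain N where N: "\<And>H. H \<subseteq> {a. N < br a} \<Longrightarrow> uniquely 0 H"
    using high_frequency[of 0] by blast
  have "x = (\<lambda>a. 0)" if "x \<in> l2" "\<forall>a\<in>Z \<union> {a. br a \<le> N}. x a = 0" "\<forall>a. a \<notin> Z \<longrightarrow> op x a = 0" for x
  proof (rule uniquelyD[of 0 "{a. N < br a} - Z"])
    show "uniquely 0 ({a. N < br a} - Z)" by (rule N) auto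
  qed (use that in \<open>auto simp: lw_0 not_less\<close>)
  then show ?thesis using finite_br[of N] by blast
qed

text \<open>The high-frequency equations are solved once for \<open>c\<close> and once for each unit
  vector at a low frequency. The residuals on \<open>L\<close> are \<open>card L + 1\<close> vectors
  with \<open>card L\<close> coordinates, hence dependent, and a dependence gives a combination that
  solves all equations up to a scalar. Injectivity shows that this scalar is not zero.\<close>

theorem Fredholm_alternative:
  assumes inj: "\<And>x. x \<in> l2 \<Longrightarrow> (\<And>a. a \<in> Z \<Longrightarrow> x a = 0) \<Longrightarrow> (\<And>a. a \<notin> Z \<Longrightarrow> op x a = 0) \<Longrightarrow> x = (\<lambda>a. 0)"
    and p: "0 \<le> p" and c: "c \<in> lw p"
  shows "\<exists>x\<in>lw p. (\<forall>a\<in>Z. x a = 0) \<and> (\<forall>a. a \<notin> Z \<longrightarrow> op x a = c a)"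
proof -
  obtain N where N: "\<And>H. H \<subseteq> {a. N < br a} \<Longrightarrow> solvable p H"
    using high_frequency[OF p] by blast
  define H where "H = {a. N < br a} - Z"
  define L where "L = {a. br a \<le> N} - Z"
  have L: "finite L" using finite_br[of N] by (simp add: L_def)
  have HL: "a \<in> H \<or> a \<in> L" if "a \<notin> Z" for a using that by (auto simp: H_def L_def)
  have sH: "solvable p H" by (rule N) (auto simp: H_def)
  \<comment> \<open>Each unit vector at \<open>l\<close> is completed so that the homogeneous
    equation holds on \<open>H\<close>; adding such vectors corrects low frequencies without
    disturbing the high ones.\<close>
  have "\<exists>x\<in>lw p. (\<forall>a\<in>H. op x a = 0) \<and> (\<forall>a. a \<notin> H \<longrightarrow> x a = (if a = l then 1 else 0))" if "l \<in> L" for l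
  proof -
    have "(\<lambda>a. if a = l then 1 else 0) \<in> lw p" by (rule lw_finite_support[of "{l}"]) auto
    from solvableD[OF sH this] obtain x where "x \<in> lw p" "\<And>a. a \<in> H \<Longrightarrow> op x a = (if a = l then 1 else 0)"
      "\<And>a. a \<notin> H \<Longrightarrow> x a = (if a = l then 1 else 0)" by blast
    moreover have "l \<notin> H" using that by (auto simp: H_def L_def)
    ultimately show ?thesis by (intro bexI[of _ x]) auto
  qed
  then obtain \<xi> where \<xi>: "\<And>l. l \<in> L \<Longrightarrow> \<xi> l \<in> lw p" "\<And>l a. l \<in> L \<Longrightarrow> a \<in> H \<Longrightarrow> op (\<xi> l) a = 0"
    "\<And>l a. l \<in> L \<Longrightarrow> a \<notin> H \<Longrightarrow> \<xi> l a = (if a = l then 1 else 0)" by metis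
  have "(\<lambda>a. if a \<in> H then c a else 0) \<in> lw p"
    unfolding lw_def mem_Collect_eq
    by (rule l2_mono(1)[where y = "\<lambda>a. of_real (br a powr p) * c a"]) (use c in \<open>auto simp: lw_def\<close>)
  from solvableD[OF sH this] obtain y where "y \<in> lw p" "\<And>a. a \<in> H \<Longrightarrow> op y a = (if a \<in> H then c a else 0)"
    "\<And>a. a \<notin> H \<Longrightarrow> y a = (if a \<in> H then c a else 0)" by blast
  then have y: "y \<in> lw p" "\<And>a. a \<in> H \<Longrightarrow> op y a = c a" "\<And>a. a \<notin> H \<Longrightarrow> y a = 0" by simp_all
  define X where "X j = (case j of None \<Rightarrow> y | Some l \<Rightarrow> \<xi> l)" for j
  \<comment> \<open>Residuals of the equations: they vanish on \<open>H\<close>, so only their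
    values on \<open>L\<close> matter.\<close>
  define v where "v j a = (case j of None \<Rightarrow> op y a - c a | Some l \<Rightarrow> op (\<xi> l) a)" for j a
  define J where "J = insert None (Some ` L)"
  have J: "finite J" "card L < card J" using L by (auto simp: J_def card_image)
  obtain \<alpha> where \<alpha>: "\<exists>j\<in>J. \<alpha> j \<noteq> 0" "\<And>l. l \<in> L \<Longrightarrow> (\<Sum>j\<in>J. \<alpha> j * v j l) = 0"
    using linear_dependence[OF L J(1) J(2), of v] by auto
  have vH: "v j a = 0" if "j \<in> J" "a \<in> H" for j a
    using that \<xi>(2) y(2) by (auto simp: J_def v_def)
  define x where "x = (\<lambda>a. \<Sum>j\<in>J. \<alpha> j * X j a)"
  have Xl: "X j \<in> lw p" if "j \<in> J" for j using that \<xi>(1) y(1) by (auto simp: J_def X_def)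
  have Xl0: "X j \<in> l2" if "j \<in> J" for j using l2_imp_lw_0[OF Xl[OF that] p] .
  have xl: "x \<in> lw p" unfolding x_def by (rule lw_sum[OF J(1) Xl])
  have sumJ: "(\<Sum>j\<in>J. f j) = f None + (\<Sum>l\<in>L. f (Some l))" for f :: "'a option \<Rightarrow> complex"
    using L by (simp add: J_def sum.reindex)
  have opx: "op x a = \<alpha> None * c a" if a: "a \<notin> Z" for a
  proof -
    have "op x a = (\<Sum>j\<in>J. \<alpha> j * op (X j) a)" unfolding x_def using op_sum[OF J(1) Xl0] by auto
    also have "\<dots> = (\<Sum>j\<in>J. \<alpha> j * v j a) + \<alpha> None * c a"
      by (simp add: sumJ X_def v_def algebra_simps)
    also have "(\<Sum>j\<in>J. \<alpha> j * v j a) = 0" using HL[OF a] \<alpha>(2) vH by auto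
    finally show ?thesis by simp
  qed
  have xZ: "x a = 0" if "a \<in> Z" for a
    using that y(3)[of a] \<xi>(3)[of _ a] unfolding x_def sumJ by (auto simp: X_def H_def L_def intro!: sum.neutral)
  \<comment> \<open>If \<open>y\<close> had weight zero, \<open>x\<close> would be a kernel element
    whose coordinates on \<open>L\<close> are the other weights; injectivity would make all of them
    vanish.\<close>
  have "\<alpha> None \<noteq> 0"
  proof
    assume 0: "\<alpha> None = 0"
    have "x = (\<lambda>a. 0)"
      by (rule inj) (use l2_imp_lw_0[OF xl p] xZ opx 0 in auto)
    moreover have "x l = \<alpha> (Some l)" if "l \<in> L" for l
    proof -
      have "x l = (\<Sum>m\<in>L. \<alpha> (Some m) * \<xi> m l)" by (simp add: x_def sumJ X_def 0)
      also have "\<dots> = (\<Sum>m\<in>L. if m = l then \<alpha> (Some m) else 0)"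
        using that \<xi>(3)[of _ l] by (intro sum.cong) (auto simp: H_def L_def)
      finally show ?thesis using that L by simp
    qed
    ultimately show False using \<alpha>(1) 0 by (auto simp: J_def)
  qed
  have l: "(\<lambda>a. x a / \<alpha> None) \<in> lw p"
    using lw_sum[OF J(1), of X p "\<lambda>j. \<alpha> j / \<alpha> None"] Xl by (simp add: x_def sum_divide_distrib)
  have "op (\<lambda>a. x a / \<alpha> None) a = c a" if "a \<notin> Z" for a
  proof -
    have "op (\<lambda>a. x a / \<alpha> None) a = op x a / \<alpha> None"
      using op_add[of x x "1 / \<alpha> None" 0 a] l2_imp_lw_0[OF xl p] by simp
    also have "\<dots> = c a" unfolding opx[OF that] using \<open>\<alpha> None \<noteq> 0\<close> by simp
    finally show ?thesis .
  qed
  moreover have "x a / \<alpha> None = 0" if "a \<in> Z" for a unfolding xZ[OF that] by simp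
  ultimately show ?thesis using l by (intro bexI[of _ "\<lambda>a. x a / \<alpha> None"] conjI ballI allI impI)
qed

end

section \<open>Fourier series of square-integrable functions\<close>

definition cm :: "real measure" where
  "cm = restrict_space lborel {0..2*pi}"

lemma space_cm [simp]: "space cm = {0..2*pi}"
  by (simp add: cm_def space_restrict_space)

lemma finite_measure_cm: "finite_measure cm"
  by standard (simp add: cm_def emeasure_restrict_space space_restrict_space)

interpretation cm: finite_measure cm by (rule finite_measure_cm)

lemma measure_cm [simp]: "measure cm {0..2*pi} = 2*pi"
  by (simp add: cm_def measure_restrict_space)

lemma circle_int_cm: "circle_int f = integral\<^sup>L cm f"
  unfolding circle_int_def cm_def set_lebesgue_integral_def
  by (subst integral_restrict_space) auto

lemma set_integrable_cm:
  fixes f :: "real \<Rightarrow> 'a::{banach, second_countable_topology}"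
  shows "set_integrable lborel {0..2*pi} f \<longleftrightarrow> integrable cm f"
  unfolding cm_def set_integrable_def using integrable_restrict_space[of "{0..2*pi}" lborel f] by simp

lemma borel_measurable_cm [measurable (raw)]: "f \<in> borel_measurable borel \<Longrightarrow> f \<in> borel_measurable cm"
  by (simp add: cm_def measurable_restrict_space1)

definition e :: "int \<Rightarrow> real \<Rightarrow> complex" where
  "e k x = cis (of_int k * x)"

lemma norm_e [simp]: "cmod (e k x) = 1" by (simp add: e_def)

lemma e_measurable [measurable]: "e k \<in> borel_measurable borel"
  unfolding e_def[abs_def] by (intro borel_measurable_continuous_onI continuous_intros)

lemma cnj_e: "cnj (e k x) = e (-k) x" by (simp add: e_def cis_cnj)

lemma e_mult: "e k x * e j x = e (k + j) x" by (simp add: e_def cis_mult algebra_simps)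

lemma e_0 [simp]: "e 0 x = 1" by (simp add: e_def)

lemma periodic_e: "periodic (e k)"
proof -
  have "cis (of_int k * (2 * pi)) = 1"
    by (metis cis_multiple_2pi Ints_of_int mult.commute mult.assoc)
  then show ?thesis by (simp add: periodic_def e_def distrib_left cis_mult[symmetric])
qed

lemma fourier_e: "fourier f k = circle_int (\<lambda>x. f x * e (-k) x) / (2*pi)"
  by (simp add: fourier_def e_def)

lemma L2_circleD:
  assumes "f \<in> L2_circle"
  shows "f \<in> borel_measurable borel" "periodic f" "integrable cm (\<lambda>x. (cmod (f x))\<^sup>2)"
    "integrable cm f"
proof -
  show 1: "f \<in> borel_measurable borel" "periodic f" "integrable cm (\<lambda>x. (cmod (f x))\<^sup>2)"
    using assms by (auto simp: L2_circle_def set_integrable_cm)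
  show "integrable cm f"
  proof (rule Bochner_Integration.integrable_bound)
    show "integrable cm (\<lambda>x. 1 + (cmod (f x))\<^sup>2)" using 1 by (intro Bochner_Integration.integrable_add) auto
    have "t \<le> 1 + t\<^sup>2" for t :: real
      using sum_squares_bound[of 1 t] zero_le_power2[of t] by (smt (verit) mult_cancel_left2 power2_eq_square mult_less_cancel_left2)
    then show "AE x in cm. norm (f x) \<le> norm (1 + (cmod (f x))\<^sup>2)"
      by (intro AE_I2) (smt (verit) norm_ge_zero real_norm_def zero_le_power2)
  qed (use 1 in simp)
qed

lemma L2_circleI:
  assumes "f \<in> borel_measurable borel" "periodic f" "integrable cm (\<lambda>x. (cmod (f x))\<^sup>2)"
  shows "f \<in> L2_circle"
  using assms by (auto simp: L2_circle_def set_integrable_cm)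

lemma L2_integrable_mult:
  assumes "f \<in> L2_circle" "g \<in> L2_circle"
  shows "integrable cm (\<lambda>x. f x * g x)"
proof (rule Bochner_Integration.integrable_bound)
  show "integrable cm (\<lambda>x. (cmod (f x))\<^sup>2 + (cmod (g x))\<^sup>2)"
    using assms by (intro Bochner_Integration.integrable_add L2_circleD)
  have "t * u \<le> t\<^sup>2 + u\<^sup>2" if "0 \<le> t" "0 \<le> u" for t u :: real
    using sum_squares_bound[of t u] mult_nonneg_nonneg[OF that] by linarith
  then show "AE x in cm. norm (f x * g x) \<le> norm ((cmod (f x))\<^sup>2 + (cmod (g x))\<^sup>2)"
    by (intro AE_I2) (simp add: norm_mult)
  show "(\<lambda>x. f x * g x) \<in> borel_measurable cm"
    using L2_circleD(1)[OF assms(1)] L2_circleD(1)[OF assms(2)] by measurable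
qed

lemma L2_circle_bounded_mult:
  assumes f: "f \<in> L2_circle" and g: "g \<in> borel_measurable borel" "periodic g" "\<And>x. cmod (g x) \<le> C"
  shows "(\<lambda>x. g x * f x) \<in> L2_circle"
proof (rule L2_circleI)
  note [measurable] = L2_circleD(1)[OF f] g(1)
  show "(\<lambda>x. g x * f x) \<in> borel_measurable borel" by measurable
  show "periodic (\<lambda>x. g x * f x)" using g(2) L2_circleD(2)[OF f] by (simp add: periodic_def)
  show "integrable cm (\<lambda>x. (cmod (g x * f x))\<^sup>2)"
  proof (rule Bochner_Integration.integrable_bound)
    show "integrable cm (\<lambda>x. C\<^sup>2 * (cmod (f x))\<^sup>2)" using L2_circleD(3)[OF f] by simp
    show "AE x in cm. norm ((cmod (g x * f x))\<^sup>2) \<le> norm (C\<^sup>2 * (cmod (f x))\<^sup>2)"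
      using g(3) by (intro AE_I2) (auto simp: norm_mult power_mult_distrib intro!: mult_right_mono power_mono)
  qed measurable
qed

lemma L2_circle_add:
  assumes "f \<in> L2_circle" "g \<in> L2_circle"
  shows "(\<lambda>x. f x + g x) \<in> L2_circle"
proof (rule L2_circleI)
  note [measurable] = L2_circleD(1)[OF assms(1)] L2_circleD(1)[OF assms(2)]
  show "(\<lambda>x. f x + g x) \<in> borel_measurable borel" by measurable
  show "periodic (\<lambda>x. f x + g x)" using L2_circleD(2)[OF assms(1)] L2_circleD(2)[OF assms(2)]
    by (simp add: periodic_def)
  show "integrable cm (\<lambda>x. (cmod (f x + g x))\<^sup>2)"
  proof (rule Bochner_Integration.integrable_bound)
    show "integrable cm (\<lambda>x. 2 * ((cmod (f x))\<^sup>2 + (cmod (g x))\<^sup>2))"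
      using L2_circleD(3)[OF assms(1)] L2_circleD(3)[OF assms(2)] by simp
    have "(cmod (f x + g x))\<^sup>2 \<le> 2 * ((cmod (f x))\<^sup>2 + (cmod (g x))\<^sup>2)" for x
    proof -
      have "(cmod (f x + g x))\<^sup>2 \<le> (cmod (f x) + cmod (g x))\<^sup>2"
        by (intro power_mono norm_triangle_ineq) auto
      also have "\<dots> \<le> 2 * ((cmod (f x))\<^sup>2 + (cmod (g x))\<^sup>2)"
        using sum_squares_bound[of "cmod (f x)" "cmod (g x)"] by (simp add: power2_sum)
      finally show ?thesis .
    qed
    then show "AE x in cm. norm ((cmod (f x + g x))\<^sup>2) \<le> norm (2 * ((cmod (f x))\<^sup>2 + (cmod (g x))\<^sup>2))"
      by (intro AE_I2) simp
  qed measurable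
qed

lemma L2_circle_const: "(\<lambda>x. c) \<in> L2_circle"
  by (rule L2_circleI) (auto simp: periodic_def)

lemma L2_circle_cmult: "f \<in> L2_circle \<Longrightarrow> (\<lambda>x. c * f x) \<in> L2_circle"
  by (rule L2_circle_bounded_mult[where C = "cmod c"]) (auto simp: periodic_def)

lemma L2_circle_e: "e k \<in> L2_circle"
  by (rule L2_circleI) (auto simp: periodic_e)

lemma L2_circle_diff: "f \<in> L2_circle \<Longrightarrow> g \<in> L2_circle \<Longrightarrow> (\<lambda>x. f x - g x) \<in> L2_circle"
  using L2_circle_add[of f "\<lambda>x. -1 * g x"] L2_circle_cmult[of g "-1"] by simp

lemma L2_circle_sum:
  "finite F \<Longrightarrow> (\<And>i. i \<in> F \<Longrightarrow> f i \<in> L2_circle) \<Longrightarrow> (\<lambda>x. \<Sum>i\<in>F. f i x) \<in> L2_circle"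
  by (induction F rule: finite_induct) (auto simp: L2_circle_const intro: L2_circle_add)

lemma L2_circle_cnj: "f \<in> L2_circle \<Longrightarrow> (\<lambda>x. cnj (f x)) \<in> L2_circle"
  by (auto simp: L2_circle_def periodic_def intro: borel_measurable_continuous_on[OF continuous_on_cnj[OF continuous_on_id]])

lemma fourier_add:
  assumes "f \<in> L2_circle" "g \<in> L2_circle"
  shows "fourier (\<lambda>x. f x + g x) k = fourier f k + fourier g k"
  using L2_integrable_mult[OF assms(1) L2_circle_e] L2_integrable_mult[OF assms(2) L2_circle_e]
  by (simp add: fourier_e circle_int_cm distrib_right add_divide_distrib)

lemma fourier_cmult: "fourier (\<lambda>x. c * f x) k = c * fourier f k"
  by (simp add: fourier_e circle_int_cm mult.assoc)

lemma fourier_diff: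
  assumes "f \<in> L2_circle" "g \<in> L2_circle"
  shows "fourier (\<lambda>x. f x - g x) k = fourier f k - fourier g k"
  using fourier_add[OF assms(1) L2_circle_cmult[OF assms(2), of "-1"]] fourier_cmult[of "-1" g k] by simp

lemma fourier_sum:
  "finite F \<Longrightarrow> (\<And>i. i \<in> F \<Longrightarrow> f i \<in> L2_circle) \<Longrightarrow> fourier (\<lambda>x. \<Sum>i\<in>F. f i x) k = (\<Sum>i\<in>F. fourier (f i) k)"
proof (induction F rule: finite_induct)
  case empty
  then show ?case by (simp add: fourier_e circle_int_cm)
qed (simp add: fourier_add L2_circle_sum)

lemma fourier_cnj: "fourier (\<lambda>x. cnj (f x)) k = cnj (fourier f (- k))"
proof -
  have "cnj (circle_int (\<lambda>x. f x * e k x)) = circle_int (\<lambda>x. cnj (f x) * e (-k) x)"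
    unfolding circle_int_cm by (subst Bochner_Integration.integral_cnj[symmetric]) (simp add: cnj_e)
  then show ?thesis by (simp add: fourier_e)
qed

lemma circle_int_e: "circle_int (e k) = (if k = 0 then 2*pi else 0)"
proof (cases "k = 0")
  case True
  then show ?thesis by (simp add: circle_int_cm e_def[abs_def] scaleR_conv_of_real)
next
  case False
  let ?F = "\<lambda>x. e k x / (\<i> * of_int k)"
  have ev: "e k x = exp (\<i> * of_int k * of_real x)" for x by (simp add: e_def cis_conv_exp mult.assoc)
  have "(?F has_vector_derivative e k x) (at x within A)" for x A
    unfolding ev by (rule has_vector_derivative_real_field) (use False in \<open>auto intro!: derivative_eq_intros\<close>)
  then have "integral\<^sup>L lborel (\<lambda>x. indicator {0..2*pi} x *\<^sub>R e k x) = ?F (2*pi) - ?F 0"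
    by (intro integral_FTC_Icc) (auto simp: e_def intro!: continuous_intros)
  moreover have "e k (2*pi) = e k 0" using periodic_e[of k] by (metis add_0 periodic_def)
  ultimately show ?thesis using False by (simp add: circle_int_def set_lebesgue_integral_def)
qed

lemma fourier_of_e: "fourier (e k) j = (if j = k then 1 else 0)"
  by (simp add: fourier_e e_mult circle_int_e[of "k - j", simplified] circle_int_e)

section \<open>Cauchy-Schwarz and Bessel inequalities\<close>

definition n2 :: "(real \<Rightarrow> complex) \<Rightarrow> real" where
  "n2 f = sqrt (integral\<^sup>L cm (\<lambda>x. (cmod (f x))\<^sup>2))"

lemma n2_sq: "(n2 f)\<^sup>2 = integral\<^sup>L cm (\<lambda>x. (cmod (f x))\<^sup>2)" by (simp add: n2_def)

lemma n2_nonneg [simp]: "0 \<le> n2 f" by (simp add: n2_def)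

text \<open>Integrating \<open>2 * cmod (f x * g x) \<le> t * (cmod (f x))\<^sup>2 + (cmod (g
  x))\<^sup>2 / t\<close> and optimising over \<open>t > 0\<close> gives the bound, with
  \<open>t = n2 g / n2 f\<close>.\<close>

lemma Cauchy_Schwarz_cm:
  assumes f: "f \<in> L2_circle" and g: "g \<in> L2_circle"
  shows "integral\<^sup>L cm (\<lambda>x. cmod (f x * g x)) \<le> n2 f * n2 g"
    "cmod (circle_int (\<lambda>x. f x * g x)) \<le> n2 f * n2 g"
proof -
  let ?X = "integral\<^sup>L cm (\<lambda>x. cmod (f x * g x))"
  have le: "2 * ?X \<le> t * (n2 f)\<^sup>2 + (n2 g)\<^sup>2 / t" if t: "t > 0" for t
  proof -
    have "2 * ?X = integral\<^sup>L cm (\<lambda>x. 2 * cmod (f x * g x))" by simp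
    also have "\<dots> \<le> integral\<^sup>L cm (\<lambda>x. t * (cmod (f x))\<^sup>2 + (cmod (g x))\<^sup>2 / t)"
    proof (rule integral_mono)
      show "integrable cm (\<lambda>x. 2 * cmod (f x * g x))"
        using L2_integrable_mult[OF f g] by (intro integrable_mult_right integrable_norm)
      show "integrable cm (\<lambda>x. t * (cmod (f x))\<^sup>2 + (cmod (g x))\<^sup>2 / t)"
        using L2_circleD(3)[OF f] L2_circleD(3)[OF g] by simp
      fix x
      have "0 \<le> (t * cmod (f x) - cmod (g x))\<^sup>2 / t" using t by simp
      also have "\<dots> = t * (cmod (f x))\<^sup>2 + (cmod (g x))\<^sup>2 / t - 2 * cmod (f x * g x)"
        using t by (simp add: power2_eq_square field_simps norm_mult)
      finally show "2 * cmod (f x * g x) \<le> t * (cmod (f x))\<^sup>2 + (cmod (g x))\<^sup>2 / t" by simp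
    qed
    also have "\<dots> = t * (n2 f)\<^sup>2 + (n2 g)\<^sup>2 / t"
      using L2_circleD(3)[OF f] L2_circleD(3)[OF g] by (simp add: n2_sq)
    finally show ?thesis .
  qed
  show 1: "?X \<le> n2 f * n2 g"
  proof (cases "n2 f = 0 \<or> n2 g = 0")
    case False
    then have p: "n2 f > 0" "n2 g > 0" by (simp_all add: less_le)
    have "2 * ?X \<le> (n2 g / n2 f) * (n2 f)\<^sup>2 + (n2 g)\<^sup>2 / (n2 g / n2 f)" using p by (intro le) simp
    also have "\<dots> = 2 * (n2 f * n2 g)" using p by (simp add: power2_eq_square field_simps)
    finally show ?thesis by simp
  next
    case True
    have "?X \<le> 0"
    proof (rule field_le_epsilon)
      fix \<epsilon> :: real assume e: "\<epsilon> > 0"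
      \<comment> \<open>With a vanishing norm there is no optimal \<open>t\<close>; a large or a
        small \<open>t\<close> makes the bound at most \<epsilon>. The added 1 keeps the quotients
        positive and well defined.\<close>
      define t where "t = (if n2 f = 0 then ((n2 g)\<^sup>2 + 1) / \<epsilon> else \<epsilon> / ((n2 f)\<^sup>2 + 1))"
      have "(n2 f)\<^sup>2 + 1 > 0" "(n2 g)\<^sup>2 + 1 > 0" by (smt (verit) zero_le_power2)+
      then have t: "t > 0" using e by (simp add: t_def)
      have "t * (n2 f)\<^sup>2 + (n2 g)\<^sup>2 / t \<le> \<epsilon>"
      proof (cases "n2 f = 0")
        case True
        then show ?thesis using e \<open>(n2 g)\<^sup>2 + 1 > 0\<close> by (simp add: t_def field_simps)
      next
        case False
        then have "n2 g = 0" using True by simp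
        then show ?thesis using False e \<open>(n2 f)\<^sup>2 + 1 > 0\<close> by (simp add: t_def field_simps)
      qed
      then show "?X \<le> 0 + \<epsilon>" using le[OF t] e by simp
    qed
    then show ?thesis using True by auto
  qed
  show "cmod (circle_int (\<lambda>x. f x * g x)) \<le> n2 f * n2 g"
    unfolding circle_int_cm using integral_norm_bound[of cm "\<lambda>x. f x * g x"] 1 by linarith
qed

definition trig :: "int set \<Rightarrow> (int \<Rightarrow> complex) \<Rightarrow> real \<Rightarrow> complex" where
  "trig F c = (\<lambda>x. \<Sum>k\<in>F. c k * e k x)"

lemma L2_circle_trig: "finite F \<Longrightarrow> trig F c \<in> L2_circle"
  unfolding trig_def by (intro L2_circle_sum L2_circle_cmult L2_circle_e)

lemma fourier_trig: "finite F \<Longrightarrow> fourier (trig F c) j = (if j \<in> F then c j else 0)"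
  unfolding trig_def
  by (subst fourier_sum) (auto simp: L2_circle_cmult L2_circle_e fourier_cmult fourier_of_e if_distrib if_distribR sum.delta cong: if_cong)

lemma circle_int_trig:
  assumes f: "f \<in> L2_circle" and F: "finite F"
  shows "circle_int (\<lambda>x. trig F c x * f x) = (\<Sum>k\<in>F. c k * circle_int (\<lambda>x. e k x * f x))"
proof -
  have "(\<lambda>x. trig F c x * f x) = (\<lambda>x. \<Sum>k\<in>F. c k * (e k x * f x))"
    by (simp add: trig_def sum_distrib_right mult.assoc)
  then show ?thesis
    unfolding circle_int_cm using L2_integrable_mult[OF L2_circle_e f]
    by (simp add: Bochner_Integration.integral_sum)
qed

lemma n2_trig:
  assumes "finite F"
  shows "(n2 (trig F c))\<^sup>2 = 2*pi * (\<Sum>k\<in>F. (cmod (c k))\<^sup>2)"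
proof -
  have "of_real ((n2 (trig F c))\<^sup>2) = circle_int (\<lambda>x. trig F c x * cnj (trig F c x))"
    unfolding n2_sq circle_int_cm by (simp add: complex_norm_square[symmetric] flip: of_real_power integral_complex_of_real)
  also have "\<dots> = (\<Sum>k\<in>F. c k * circle_int (\<lambda>x. e k x * cnj (trig F c x)))"
    by (intro circle_int_trig L2_circle_cnj L2_circle_trig assms)
  also have "\<dots> = (\<Sum>k\<in>F. c k * (2*pi * cnj (c k)))"
  proof (rule sum.cong)
    fix k assume k: "k \<in> F"
    have "fourier (\<lambda>x. cnj (trig F c x)) (-k) = cnj (c k)"
      using k assms by (simp add: fourier_cnj fourier_trig)
    then have "circle_int (\<lambda>x. e k x * cnj (trig F c x)) = 2*pi * cnj (c k)"
      by (simp add: fourier_e mult.commute field_simps)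
    then show "c k * circle_int (\<lambda>x. e k x * cnj (trig F c x)) = c k * (2*pi * cnj (c k))" by simp
  qed simp
  also have "\<dots> = of_real (2*pi * (\<Sum>k\<in>F. (cmod (c k))\<^sup>2))"
    unfolding of_real_mult of_real_sum complex_norm_square sum_distrib_left
    by (intro sum.cong) (simp_all add: mult_ac)
  finally show ?thesis using of_real_eq_iff by blast
qed

text \<open>Pairing \<open>f\<close> with the conjugate of its partial sum \<open>t\<close> returns
  the squared norm of \<open>t\<close>, so Cauchy-Schwarz gives \<open>n2 t \<le> n2 f\<close>. The
  norm \<open>n2\<close> is not normalised, hence the factor \<open>2*pi\<close>.\<close>

lemma Bessel:
  assumes f: "f \<in> L2_circle"
  shows "fourier f \<in> l2"
proof (rule l2I_sq(1))
  fix F :: "int set" assume F: "finite F"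
  define t where "t = trig F (fourier f)"
  have t: "t \<in> L2_circle" unfolding t_def using F by (rule L2_circle_trig)
  have "circle_int (\<lambda>x. cnj (t x) * f x) = cnj (circle_int (\<lambda>x. t x * cnj (f x)))"
    unfolding circle_int_cm by (subst Bochner_Integration.integral_cnj[symmetric]) simp
  also have "\<dots> = cnj (\<Sum>k\<in>F. fourier f k * circle_int (\<lambda>x. e k x * cnj (f x)))"
    unfolding t_def by (subst circle_int_trig) (auto intro: F L2_circle_cnj f)
  also have "\<dots> = (\<Sum>k\<in>F. 2 * pi * (cmod (fourier f k))\<^sup>2)"
  proof -
    have "circle_int (\<lambda>x. e k x * cnj (f x)) = 2*pi * cnj (fourier f k)" for k
      using fourier_cnj[of f "-k"] by (simp add: fourier_e mult.commute field_simps)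
    then show ?thesis
      unfolding of_real_mult of_real_sum complex_norm_square by (simp add: mult_ac)
  qed
  also have "\<dots> = of_real ((n2 t)\<^sup>2)" by (simp add: t_def n2_trig[OF F] sum_distrib_left)
  finally have "(n2 t)\<^sup>2 = cmod (circle_int (\<lambda>x. cnj (t x) * f x))" by (simp add: norm_of_real del: of_real_power)
  also have "\<dots> \<le> n2 (\<lambda>x. cnj (t x)) * n2 f" by (intro Cauchy_Schwarz_cm L2_circle_cnj t f)
  finally have "n2 t * n2 t \<le> n2 t * n2 f" by (simp add: n2_def power2_eq_square)
  then have "n2 t \<le> n2 f" using n2_nonneg[of t] n2_nonneg[of f] by (metis mult_le_cancel_left less_le)
  then have "(n2 t)\<^sup>2 \<le> (n2 f)\<^sup>2" by (intro power_mono) auto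
  then show "(\<Sum>k\<in>F. (cmod (fourier f k))\<^sup>2) \<le> (n2 f / sqrt (2*pi))\<^sup>2"
    by (simp add: t_def n2_trig[OF F] power_divide field_simps)
qed simp

section \<open>Completeness of the exponentials\<close>

definition annih :: "(real \<Rightarrow> complex) \<Rightarrow> (real \<Rightarrow> complex) set" where
  "annih f = {r \<in> borel_measurable borel. (\<exists>C. \<forall>x. cmod (r x) \<le> C) \<and> (\<forall>k. circle_int (\<lambda>x. f x * (r x * e k x)) = 0)}"

lemma integrable_mult_bounded:
  assumes f: "f \<in> L2_circle" and r: "r \<in> borel_measurable borel" "\<And>x. cmod (r x) \<le> C"
  shows "integrable cm (\<lambda>x. f x * r x)"
proof (rule Bochner_Integration.integrable_bound)
  note [measurable] = L2_circleD(1)[OF f] r(1)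
  show "integrable cm (\<lambda>x. C * cmod (f x))" using L2_circleD(4)[OF f] by simp
  show "AE x in cm. norm (f x * r x) \<le> norm (C * cmod (f x))"
  proof (intro AE_I2)
    fix x
    have "0 \<le> C" using r(2)[of x] norm_ge_zero[of "r x"] by linarith
    then show "norm (f x * r x) \<le> norm (C * cmod (f x))"
      using mult_right_mono[OF r(2)[of x], of "cmod (f x)"] by (simp add: norm_mult mult.commute)
  qed
  show "(\<lambda>x. f x * r x) \<in> borel_measurable cm" by measurable
qed

text \<open>The condition defining \<open>annih\<close> asks for every frequency \<open>k\<close>,
  not only for a vanishing mean, so that multiplication by an exponential merely shifts
  \<open>k\<close>. The induction over products of polynomials relies on this stability.\<close>

lemma annih_e:
  assumes "r \<in> annih f"
  shows "(\<lambda>x. e j x * r x) \<in> annih f"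
proof -
  obtain C where C: "\<forall>x. cmod (r x) \<le> C" and [measurable]: "r \<in> borel_measurable borel"
    and 0: "\<And>k. circle_int (\<lambda>x. f x * (r x * e k x)) = 0"
    using assms by (auto simp: annih_def)
  have eq: "(\<lambda>x. f x * (e j x * r x * e k x)) = (\<lambda>x. f x * (r x * e (j + k) x))" for k
    by (simp add: e_mult[symmetric] mult_ac)
  have "circle_int (\<lambda>x. f x * (e j x * r x * e k x)) = 0" for k unfolding eq by (rule 0)
  moreover have "(\<lambda>x. e j x * r x) \<in> borel_measurable borel" by measurable
  moreover have "\<forall>x. cmod (e j x * r x) \<le> C" using C by (simp add: norm_mult)
  ultimately show ?thesis by (auto simp: annih_def)
qed

lemma annih_lincomb:
  assumes f: "f \<in> L2_circle" and "r \<in> annih f" "q \<in> annih f"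
  shows "(\<lambda>x. a * r x + b * q x) \<in> annih f"
proof -
  obtain C where C: "\<And>x. cmod (r x) \<le> C" and [measurable]: "r \<in> borel_measurable borel"
    and r0: "\<And>k. circle_int (\<lambda>x. f x * (r x * e k x)) = 0"
    using assms by (auto simp: annih_def)
  obtain D where D: "\<And>x. cmod (q x) \<le> D" and [measurable]: "q \<in> borel_measurable borel"
    and q0: "\<And>k. circle_int (\<lambda>x. f x * (q x * e k x)) = 0"
    using assms by (auto simp: annih_def)
  have i: "integrable cm (\<lambda>x. f x * (r x * e k x))" "integrable cm (\<lambda>x. f x * (q x * e k x))" for k
    by (rule integrable_mult_bounded[OF f, where C = C]; use C in \<open>simp add: norm_mult\<close>)
      (rule integrable_mult_bounded[OF f, where C = D]; use D in \<open>simp add: norm_mult\<close>)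
  have eq: "(\<lambda>x. f x * ((a * r x + b * q x) * e k x)) = (\<lambda>x. a * (f x * (r x * e k x)) + b * (f x * (q x * e k x)))" for k
    by (simp add: algebra_simps)
  have "circle_int (\<lambda>x. f x * ((a * r x + b * q x) * e k x)) = 0" for k
    unfolding eq using i r0[of k] q0[of k] by (simp add: circle_int_cm)
  moreover have "(\<lambda>x. a * r x + b * q x) \<in> borel_measurable borel" by measurable
  moreover have "cmod (a * r x + b * q x) \<le> cmod a * C + cmod b * D" for x
    using C[of x] D[of x] by (intro order_trans[OF norm_triangle_ineq] add_mono) (auto simp: norm_mult intro: mult_left_mono)
  ultimately show ?thesis unfolding annih_def by blast
qed

text \<open>Polynomials in the plane are restricted to the unit circle. A product is applied one
  factor at a time, which is why \<open>r\<close> is arbitrary.\<close>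

lemma annih_polynomial:
  assumes f: "f \<in> L2_circle" and "real_polynomial_function P" and "r \<in> annih f"
  shows "(\<lambda>x. of_real (P (cis x)) * r x) \<in> annih f"
  using assms(2,3)
proof (induction P arbitrary: r rule: real_polynomial_function.induct)
  case (linear l)
  \<comment> \<open>A real-linear functional at \<open>cis x\<close> is a combination of cosine and
    sine; \<open>a\<close> and \<open>b\<close> are its coefficients in \<open>e 1\<close> and
    \<open>e (-1)\<close>.\<close>
  define a where "a = (of_real (l 1) - \<i> * of_real (l \<i>)) / 2"
  define b where "b = (of_real (l 1) + \<i> * of_real (l \<i>)) / 2"
  have "l (cis x) = cos x * l 1 + sin x * l \<i>" for x
  proof -
    have "cis x = cos x *\<^sub>R 1 + sin x *\<^sub>R \<i>" by (simp add: complex_eq_iff)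
    then show ?thesis using linear(1)
      by (simp add: linear_simps)
  qed
  then have "of_real (l (cis x)) = a * e 1 x + b * e (-1) x" for x
    by (simp add: a_def b_def e_def complex_eq_iff field_simps)
  then have "(\<lambda>x. of_real (l (cis x)) * r x) = (\<lambda>x. a * (e 1 x * r x) + b * (e (-1) x * r x))"
    by (simp add: algebra_simps)
  then show ?case using annih_lincomb[OF f annih_e annih_e] linear by simp
next
  case (const c)
  then show ?case using annih_lincomb[OF f const const, of "of_real c" 0] by simp
next
  case (add p q)
  show ?case using annih_lincomb[OF f add.IH(1)[OF add.prems] add.IH(2)[OF add.prems], of 1 1]
    by (simp add: distrib_right)
next
  case (mult p q)
  show ?case using mult.IH(1)[OF mult.IH(2)[OF mult.prems]] by (simp add: mult.assoc)
qed

text \<open>Stone-Weierstrass on the compact circle replaces \<open>h\<close> by a polynomial up to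
  \<epsilon>. The polynomial part integrates to zero and the error is at most \<epsilon> times the
  integral of \<open>cmod (f x)\<close>.\<close>

lemma annih_continuous:
  assumes f: "f \<in> L2_circle" and 0: "\<And>k. fourier f k = 0"
    and h: "continuous_on (sphere 0 1) (h :: complex \<Rightarrow> real)" and m: "(\<lambda>x. h (cis x)) \<in> borel_measurable borel"
  shows "circle_int (\<lambda>x. f x * of_real (h (cis x))) = 0"
proof -
  have c0: "circle_int (\<lambda>x. f x * e k x) = 0" for k using 0[of "-k"] by (simp add: fourier_e)
  have one: "(\<lambda>x. 1) \<in> annih f" using c0 by (auto simp: annih_def intro!: exI[of _ 1])
  let ?I = "circle_int (\<lambda>x. f x * of_real (h (cis x)))"
  define K where "K = integral\<^sup>L cm (\<lambda>x. cmod (f x))"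
  have K: "0 \<le> K" by (simp add: K_def)
  have le: "cmod ?I \<le> \<epsilon> * K" if \<epsilon>: "\<epsilon> > 0" for \<epsilon>
  proof -
    obtain P where P: "real_polynomial_function P" "\<And>z. z \<in> sphere 0 1 \<Longrightarrow> \<bar>h z - P z\<bar> < \<epsilon>"
      using Stone_Weierstrass_real_polynomial_function[OF compact_sphere h \<epsilon>] by blast
    have A: "(\<lambda>x. of_real (P (cis x))) \<in> annih f" using annih_polynomial[OF f P(1) one] by simp
    then obtain C where [measurable]: "(\<lambda>x. complex_of_real (P (cis x))) \<in> borel_measurable borel"
      and C: "\<And>x. cmod (of_real (P (cis x))) \<le> C" by (auto simp: annih_def)
    have P0: "circle_int (\<lambda>x. f x * of_real (P (cis x))) = 0" using A e_0 by (auto simp: annih_def dest: spec[of _ 0])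
    have i1: "integrable cm (\<lambda>x. f x * of_real (P (cis x)))"
      by (rule integrable_mult_bounded[OF f _ C]) measurable
    have d: "cmod (of_real (h (cis x)) - of_real (P (cis x))) \<le> \<epsilon>" for x
      using P(2)[of "cis x"] by (simp flip: of_real_diff)
    have i2: "integrable cm (\<lambda>x. f x * (of_real (h (cis x)) - of_real (P (cis x))))"
      by (rule integrable_mult_bounded[OF f _ d]) (use m in measurable)
    have "?I = circle_int (\<lambda>x. f x * of_real (P (cis x)) + f x * (of_real (h (cis x)) - of_real (P (cis x))))"
      by (simp add: algebra_simps)
    also have "\<dots> = circle_int (\<lambda>x. f x * (of_real (h (cis x)) - of_real (P (cis x))))"
      using P0 i1 i2 by (simp add: circle_int_cm)
    also have "cmod \<dots> \<le> integral\<^sup>L cm (\<lambda>x. cmod (f x * (of_real (h (cis x)) - of_real (P (cis x)))))"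
      unfolding circle_int_cm by (rule integral_norm_bound)
    also have "\<dots> \<le> integral\<^sup>L cm (\<lambda>x. \<epsilon> * cmod (f x))"
    proof (rule integral_mono)
      show "integrable cm (\<lambda>x. \<epsilon> * cmod (f x))" using L2_circleD(4)[OF f] by simp
      show "cmod (f x * (of_real (h (cis x)) - of_real (P (cis x)))) \<le> \<epsilon> * cmod (f x)" for x
        using mult_right_mono[OF d[of x], of "cmod (f x)"] by (simp add: norm_mult mult.commute)
    qed (use i2 in simp)
    also have "\<dots> = \<epsilon> * K" by (simp add: K_def)
    finally show ?thesis .
  qed
  have "cmod ?I \<le> 0"
  proof (rule field_le_epsilon)
    fix \<delta> :: real assume "\<delta> > 0"
    have "cmod ?I \<le> \<delta> / (K + 1) * K" using K \<open>\<delta> > 0\<close> by (intro le) simp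
    also have "\<dots> \<le> \<delta>" using K \<open>\<delta> > 0\<close> by (simp add: field_simps)
    finally show "cmod ?I \<le> 0 + \<delta>" by simp
  qed
  then show ?thesis by simp
qed

text \<open>The indicator is the limit of truncated multiples of a distance function. Only functions
  of \<open>cis x\<close> are admissible, so the distance is measured in the plane from the image of
  the complement.\<close>

lemma annih_open:
  assumes f: "f \<in> L2_circle" and 0: "\<And>k. fourier f k = 0" and U: "open U"
  shows "circle_int (\<lambda>x. f x * indicator U x) = 0"
proof -
  \<comment> \<open>The endpoints are removed because \<open>cis\<close> identifies them; inside the
    open period \<open>cis\<close> separates \<open>V\<close> from its complement. The removed
    points form a null set.\<close>
  define V where "V = U \<inter> {0<..<2*pi}"
  define C where "C = cis ` ({0..2*pi} - V)"
  have "compact ({0..2*pi} - V)" by (intro compact_diff) (auto simp: V_def intro: U)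
  then have cC: "closed C" unfolding C_def by (intro compact_imp_closed compact_continuous_image continuous_intros)
  have "0 \<in> {0..2*pi} - V" by (simp add: V_def)
  then have neC: "C \<noteq> {}" unfolding C_def by blast
  have inC: "cis x \<in> C \<longleftrightarrow> x \<notin> V" if x: "x \<in> {0..2*pi}" for x
  proof
    assume "cis x \<in> C"
    then obtain y where y: "y \<in> {0..2*pi}" "y \<notin> V" "cis x = cis y" by (auto simp: C_def)
    show "x \<notin> V"
    proof
      assume "x \<in> V"
      then have xx: "0 < x" "x < 2*pi" by (auto simp: V_def)
      obtain n :: int where n: "x = y + 2 * pi * n"
        using y(3) sin_cos_eq_iff[of x y] by (auto simp: complex_eq_iff mult_ac)
      have "n = 0"
      proof (rule ccontr)
        assume "n \<noteq> 0"
        then consider "real_of_int n \<ge> 1" | "real_of_int n \<le> -1" by linarith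
        then show False
        proof cases
          case 1
          then have "2 * pi * 1 \<le> 2 * pi * n" by (intro mult_left_mono) auto
          then show False using n xx y(1) unfolding atLeastAtMost_iff by linarith
        next
          case 2
          then have "2 * pi * n \<le> 2 * pi * (-1)" by (intro mult_left_mono) auto
          then show False using n xx y(1) unfolding atLeastAtMost_iff by linarith
        qed
      qed
      then show False using n y(2) \<open>x \<in> V\<close> by simp
    qed
  next
    assume "x \<notin> V" then show "cis x \<in> C" using x by (auto simp: C_def)
  qed
  define h where "h n z = min 1 (real n * infdist z C)" for n z
  have hc: "continuous_on S (h n)" for S n unfolding h_def[abs_def] by (intro continuous_intros)
  have hm: "(\<lambda>x. h n (cis x)) \<in> borel_measurable borel" for n
    unfolding h_def by (intro borel_measurable_continuous_onI continuous_intros)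
  have I0: "circle_int (\<lambda>x. f x * of_real (h n (cis x))) = 0" for n
    by (rule annih_continuous[OF f 0 hc hm])
  note [measurable] = L2_circleD(1)[OF f] hm
  have "(\<lambda>n. integral\<^sup>L cm (\<lambda>x. f x * of_real (h n (cis x)))) \<longlonglongrightarrow> integral\<^sup>L cm (\<lambda>x. f x * indicator V x)"
  proof (rule integral_dominated_convergence[where w = "\<lambda>x. cmod (f x)"])
    have "V \<in> sets borel" using U by (auto simp: V_def)
    then show "(\<lambda>x. f x * indicator V x) \<in> borel_measurable cm" by measurable
    show "(\<lambda>x. f x * of_real (h n (cis x))) \<in> borel_measurable cm" for n by measurable
    show "integrable cm (\<lambda>x. cmod (f x))" using L2_circleD(4)[OF f] by simp
    show "AE x in cm. (\<lambda>n. f x * of_real (h n (cis x))) \<longlonglongrightarrow> f x * indicator V x"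
    proof (rule AE_I2)
      fix x assume "x \<in> space cm"
      then have x: "x \<in> {0..2*pi}" by simp
      have "(\<lambda>n. h n (cis x)) \<longlonglongrightarrow> indicator V x"
      proof (cases "x \<in> V")
        case True
        then have pos: "infdist (cis x) C > 0" using infdist_pos_not_in_closed[OF cC neC] inC[OF x] by auto
        obtain N :: nat where N: "1 / infdist (cis x) C < N" using reals_Archimedean2 by blast
        have "h n (cis x) = 1" if "n \<ge> N" for n
        proof -
          have "1 / infdist (cis x) C < n" using N that by linarith
          then have "1 \<le> n * infdist (cis x) C" using pos by (simp add: field_simps)
          then show ?thesis by (simp add: h_def)
        qed
        then have "\<forall>\<^sub>F n in sequentially. h n (cis x) = 1" by (auto simp: eventually_sequentially)
        then show ?thesis using True by (simp add: tendsto_eventually)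
      next
        case False
        then have "infdist (cis x) C = 0" using inC[OF x] in_closed_iff_infdist_zero[OF cC neC] by auto
        then show ?thesis using False by (simp add: h_def)
      qed
      then have "(\<lambda>n. f x * of_real (h n (cis x))) \<longlonglongrightarrow> f x * of_real (indicator V x)"
        by (intro tendsto_intros)
      then show "(\<lambda>n. f x * of_real (h n (cis x))) \<longlonglongrightarrow> f x * indicator V x"
        by (cases "x \<in> V") simp_all
    qed
    show "AE x in cm. norm (f x * of_real (h n (cis x))) \<le> cmod (f x)" for n
    proof (rule AE_I2)
      fix x
      have "\<bar>h n (cis x)\<bar> \<le> 1" by (auto simp: h_def infdist_nonneg min_def)
      then show "norm (f x * of_real (h n (cis x))) \<le> cmod (f x)"
        by (simp add: norm_mult mult_left_le)
    qed
  qed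
  then have "(\<lambda>n. 0) \<longlonglongrightarrow> integral\<^sup>L cm (\<lambda>x. f x * indicator V x)" using I0 by (simp add: circle_int_cm)
  then have "integral\<^sup>L cm (\<lambda>x. f x * indicator V x) = 0" using LIMSEQ_unique tendsto_const by metis
  moreover have "integral\<^sup>L cm (\<lambda>x. f x * indicator V x) = integral\<^sup>L cm (\<lambda>x. f x * indicator U x)"
  proof (rule integral_cong_AE)
    have "U \<in> sets borel" "V \<in> sets borel" using U by (auto simp: V_def)
    then show "(\<lambda>x. f x * indicator V x) \<in> borel_measurable cm" "(\<lambda>x. f x * indicator U x) \<in> borel_measurable cm"
      by measurable
    have "AE x in lborel. x \<noteq> 0 \<and> x \<noteq> 2*pi" by (intro AE_conjI AE_lborel_singleton)
    then have "AE x in cm. x \<noteq> 0 \<and> x \<noteq> 2*pi" unfolding cm_def by (subst AE_restrict_space_iff) auto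
    then show "AE x in cm. f x * indicator V x = f x * indicator U x"
      using AE_space by eventually_elim (auto simp: V_def indicator_def)
  qed
  ultimately show ?thesis by (simp add: circle_int_cm)
qed

text \<open>A Dynkin argument: open sets are stable under intersection and generate the Borel sets,
  while a vanishing integral passes to complements and countable disjoint unions.\<close>

lemma annih_borel:
  assumes f: "f \<in> L2_circle" and 0: "\<And>k. fourier f k = 0" and A: "A \<in> sets borel"
  shows "circle_int (\<lambda>x. f x * indicator A x) = 0"
proof -
  note [measurable] = L2_circleD(1)[OF f]
  have i: "integrable cm (\<lambda>x. f x * indicator B x)" if "B \<in> sets borel" for B
    by (rule integrable_mult_bounded[OF f, of _ 1]) (use that in \<open>auto simp: indicator_def\<close>)
  have if': "integrable cm f" using L2_circleD(4)[OF f] .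
  have If: "integral\<^sup>L cm f = 0" using 0[of 0] by (simp add: fourier_e circle_int_cm)
  have sb: "sets (borel :: real measure) = sigma_sets UNIV {S. open S}" by (simp add: borel_def)
  have os: "Int_stable {S :: real set. open S}" "{S :: real set. open S} \<subseteq> Pow UNIV"
    by (auto simp: Int_stable_def)
  from A have "A \<in> sigma_sets UNIV {S :: real set. open S}" unfolding sb .
  with os have "integral\<^sup>L cm (\<lambda>x. f x * indicator A x) = 0"
  proof (induction rule: sigma_sets_induct_disjoint)
    case (basic U)
    then show ?case using annih_open[OF f 0, of U] by (simp add: circle_int_cm)
  next
    case empty
    then show ?case by simp
  next
    case (compl B)
    have B: "B \<in> sets borel" using compl unfolding sb by simp
    have eq: "(\<lambda>x. f x * indicator (UNIV - B) x) = (\<lambda>x. f x - f x * indicator B x)"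
      by (auto simp: indicator_def fun_eq_iff)
    show ?case unfolding eq using i[OF B] if' If compl by simp
  next
    case (union B)
    have B: "range B \<subseteq> sets borel" using union unfolding sb by simp
    then have Bi[measurable]: "B i \<in> sets borel" for i by auto
    have part: "(\<Sum>i<n. f x * indicator (B i) x) = f x * indicator (\<Union>i<n. B i) x" for n x
    proof -
      have "disjoint_family_on B {..<n}" using union(1) by (auto simp: disjoint_family_on_def)
      then show ?thesis by (simp add: sum_distrib_left[symmetric] indicator_UN_disjoint)
    qed
    have "(\<lambda>n. integral\<^sup>L cm (\<lambda>x. \<Sum>i<n. f x * indicator (B i) x)) \<longlonglongrightarrow> integral\<^sup>L cm (\<lambda>x. f x * indicator (\<Union>i. B i) x)"
    proof (rule integral_dominated_convergence[where w = "\<lambda>x. cmod (f x)"])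
      show "integrable cm (\<lambda>x. cmod (f x))" using if' by simp
      show "AE x in cm. (\<lambda>n. \<Sum>i<n. f x * indicator (B i) x) \<longlonglongrightarrow> f x * indicator (\<Union>i. B i) x"
      proof (rule AE_I2)
        fix x
        show "(\<lambda>n. \<Sum>i<n. f x * indicator (B i) x) \<longlonglongrightarrow> f x * indicator (\<Union>i. B i) x"
          unfolding part by (intro tendsto_mult tendsto_const LIMSEQ_indicator_UN)
      qed
      show "AE x in cm. norm (\<Sum>i<n. f x * indicator (B i) x) \<le> cmod (f x)" for n
      proof (rule AE_I2)
        fix x
        show "norm (\<Sum>i<n. f x * indicator (B i) x) \<le> cmod (f x)"
          unfolding part by (auto simp: indicator_def)
      qed
    qed measurable
    moreover have "integral\<^sup>L cm (\<lambda>x. \<Sum>i<n. f x * indicator (B i) x) = 0" for n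
      using i[OF Bi] union(3) by (subst Bochner_Integration.integral_sum) auto
    ultimately have "(\<lambda>n. 0) \<longlonglongrightarrow> integral\<^sup>L cm (\<lambda>x. f x * indicator (\<Union>i. B i) x)" by simp
    then show ?case using LIMSEQ_unique[OF _ tendsto_const] by blast
  qed
  then show ?thesis by (simp add: circle_int_cm)
qed

text \<open>The vanishing integrals are applied to the sets where the real part, the imaginary part
  and their negatives are positive.\<close>

theorem fourier_eq_0_imp_AE:
  assumes f: "f \<in> L2_circle" and 0: "\<And>k. fourier f k = 0"
  shows "AE x in cm. f x = 0"
proof -
  note [measurable] = L2_circleD(1)[OF f]
  have pos: "AE x in cm. \<phi> x \<le> 0"
    if \<phi>: "\<phi> \<in> borel_measurable borel" "integrable cm \<phi>" "\<And>A. A \<in> sets borel \<Longrightarrow> integral\<^sup>L cm (\<lambda>x. \<phi> x * indicator A x) = 0"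
    for \<phi> :: "real \<Rightarrow> real"
  proof -
    have [measurable]: "{x. 0 < \<phi> x} \<in> sets borel" using \<phi>(1) by measurable
    have "AE x in cm. \<phi> x * indicator {x. 0 < \<phi> x} x = 0"
    proof (subst integral_nonneg_eq_0_iff_AE[symmetric])
      show "integrable cm (\<lambda>x. \<phi> x * indicator {x. 0 < \<phi> x} x)"
        by (rule Bochner_Integration.integrable_bound[OF \<phi>(2)]) (use \<phi>(1) in \<open>auto simp: indicator_def\<close>)
      show "integral\<^sup>L cm (\<lambda>x. \<phi> x * indicator {x. 0 < \<phi> x} x) = 0" by (rule \<phi>(3)) measurable
    qed (auto simp: indicator_def)
    then show ?thesis by eventually_elim (auto simp: indicator_def split: if_splits)
  qed
  have I: "integral\<^sup>L cm (\<lambda>x. f x * indicator A x) = 0" "integrable cm (\<lambda>x. f x * indicator A x)" if "A \<in> sets borel" for A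
    using annih_borel[OF f 0 that] integrable_mult_bounded[OF f, of "indicator A" 1] that
    by (auto simp: circle_int_cm indicator_def)
  have ind: "Re (indicator A x) = indicator A x" "Im (indicator A x) = 0" for A and x :: real
    by (auto simp: indicator_def)
  have R: "integral\<^sup>L cm (\<lambda>x. Re (f x) * indicator A x) = 0" "integral\<^sup>L cm (\<lambda>x. Im (f x) * indicator A x) = 0"
    if "A \<in> sets borel" for A
    using arg_cong[OF I(1)[OF that], of Re] arg_cong[OF I(1)[OF that], of Im] integral_Re[OF I(2)[OF that]] integral_Im[OF I(2)[OF that]]
    by (simp_all add: ind)
  have i: "integrable cm (\<lambda>x. Re (f x))" "integrable cm (\<lambda>x. Im (f x))"
    using L2_circleD(4)[OF f] by auto
  have "AE x in cm. Re (f x) \<le> 0" "AE x in cm. Im (f x) \<le> 0" "AE x in cm. - Re (f x) \<le> 0" "AE x in cm. - Im (f x) \<le> 0"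
    by (rule pos; use R i in simp)+
  then show ?thesis by eventually_elim (auto simp: complex_eq_iff)
qed

section \<open>The Riesz-Fischer theorem and Parseval's identity\<close>

lemma n2_minus_commute: "n2 (\<lambda>x. f x - g x) = n2 (\<lambda>x. g x - f x)"
  by (simp add: n2_def norm_minus_commute)

lemma n2_e [simp]: "n2 (e k) = sqrt (2*pi)" by (simp add: n2_def)

lemma norm_fourier_le:
  assumes "f \<in> L2_circle"
  shows "cmod (fourier f k) \<le> n2 f * sqrt (2*pi) / (2*pi)"
  using Cauchy_Schwarz_cm(2)[OF assms L2_circle_e, of "-k"]
  by (auto simp: fourier_e norm_divide norm_mult intro!: divide_right_mono)

lemma periodic_int:
  assumes "periodic f"
  shows "f (x + 2*pi * of_int n) = f x"
proof (induction n rule: int_induct[where k = 0])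
  case (step1 i)
  have "f (x + 2*pi * of_int (i + 1)) = f (x + 2*pi * of_int i + 2*pi)" by (simp add: algebra_simps)
  then show ?case using assms step1 by (simp only: periodic_def)
next
  case (step2 i)
  have "f (x + 2*pi * of_int (i - 1)) = f (x + 2*pi * of_int (i - 1) + 2*pi)" using assms by (simp only: periodic_def)
  also have "x + 2*pi * of_int (i - 1) + 2*pi = x + 2*pi * of_int i" by (simp add: algebra_simps)
  finally show ?case using step2 by simp
qed simp

abbreviation psum :: "(int \<Rightarrow> complex) \<Rightarrow> nat \<Rightarrow> real \<Rightarrow> complex" where
  "psum c n \<equiv> trig {- int n..int n} c"

text \<open>The partial sums are Cauchy in mean square, hence in mean, hence along a subsequence
  almost everywhere. Fatou's lemma turns the pointwise limit back into a limit in mean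
  square.\<close>

theorem Riesz_Fischer:
  assumes c: "c \<in> l2"
  shows "\<exists>f\<in>L2_circle. fourier f = c \<and> (\<lambda>n. n2 (\<lambda>x. f x - psum c n x)) \<longlonglongrightarrow> 0"
proof -
  let ?s = "psum c"
  have sL: "?s n \<in> L2_circle" for n by (rule L2_circle_trig) simp
  note [measurable] = L2_circleD(1)[OF sL]
  have cau: "\<exists>N. \<forall>i\<ge>N. \<forall>j\<ge>N. n2 (\<lambda>x. ?s i x - ?s j x) < \<epsilon>" if \<epsilon>: "\<epsilon> > 0" for \<epsilon>
  proof -
    \<comment> \<open>The factor \<open>2*pi\<close> of \<open>n2_trig\<close> turns this tail into
      \<open>\<epsilon>\<^sup>2 / 2\<close>, which leaves room for a strict inequality.\<close>
    obtain A where A: "finite A" "\<And>B. finite B \<Longrightarrow> A \<inter> B = {} \<Longrightarrow> (\<Sum>k\<in>B. (cmod (c k))\<^sup>2) \<le> \<epsilon>\<^sup>2 / (4*pi)"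
      using l2_tail[OF c, of "\<epsilon>\<^sup>2 / (4*pi)"] \<epsilon> by auto
    obtain N :: nat where N: "\<forall>k\<in>A. \<bar>k\<bar> \<le> int N"
    proof -
      have "\<forall>k\<in>A. \<bar>k\<bar> \<le> int (nat (Max (insert 0 (abs ` A))))" using A(1) by auto
      then show ?thesis using that by blast
    qed
    have le: "n2 (\<lambda>x. ?s i x - ?s j x) < \<epsilon>" if "N \<le> j" "j \<le> i" for i j
    proof -
      let ?B = "{- int i..int i} - {- int j..int j}"
      have "?s i x - ?s j x = trig ?B c x" for x
        unfolding trig_def using that by (subst sum_diff) auto
      then have "(n2 (\<lambda>x. ?s i x - ?s j x))\<^sup>2 = 2*pi * (\<Sum>k\<in>?B. (cmod (c k))\<^sup>2)"
        using n2_trig[of ?B c] by simp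
      also have "\<dots> \<le> 2*pi*(\<epsilon>\<^sup>2 / (4*pi))"
        using N that by (intro mult_left_mono A(2)) fastforce+
      also have "\<dots> = \<epsilon>\<^sup>2 / 2" by simp
      also have "\<dots> < \<epsilon>\<^sup>2" using \<epsilon> by simp
      finally show ?thesis using \<epsilon> by (meson less_imp_le power_less_imp_less_base)
    qed
    have "n2 (\<lambda>x. ?s i x - ?s j x) < \<epsilon>" if "i \<ge> N" "j \<ge> N" for i j
      using le[of j i] le[of i j] n2_minus_commute[of "?s i" "?s j"] that by (cases "i \<le> j") auto
    then show ?thesis by blast
  qed
  have "\<exists>N. \<forall>i\<ge>N. \<forall>j\<ge>N. (LINT x|cm. cmod (?s i x - ?s j x)) < \<epsilon>" if \<epsilon>: "\<epsilon> > 0" for \<epsilon>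
  proof -
    obtain N where N: "\<And>i j. i \<ge> N \<Longrightarrow> j \<ge> N \<Longrightarrow> n2 (\<lambda>x. ?s i x - ?s j x) < \<epsilon> / sqrt (2*pi)"
      using cau[of "\<epsilon> / sqrt (2*pi)"] \<epsilon> by auto
    have "(LINT x|cm. cmod (?s i x - ?s j x)) < \<epsilon>" if "i \<ge> N" "j \<ge> N" for i j
    proof -
      have "(LINT x|cm. cmod (?s i x - ?s j x)) \<le> n2 (\<lambda>x. ?s i x - ?s j x) * n2 (e 0)"
        using Cauchy_Schwarz_cm(1)[OF L2_circle_diff[OF sL sL] L2_circle_e[of 0], of i j] by (simp del: n2_e)
      also have "\<dots> < \<epsilon>" using N[OF that] by (simp add: field_simps)
      finally show ?thesis .
    qed
    then show ?thesis by blast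
  qed
  from cauchy_L1_AE_cauchy_subseq[OF L2_circleD(4)[OF sL] this]
  obtain r where r: "strict_mono r" "AE x in cm. Cauchy (\<lambda>i. ?s (r i) x)" by blast
  define f0 where "f0 x = lim (\<lambda>i. ?s (r i) x)" for x
  \<comment> \<open>Convergence is known only within one period. Shifting the argument into
    \<open>[0, 2*pi)\<close> makes the function periodic at every point, as \<open>L2_circle\<close>
    demands.\<close>
  define f where "f x = f0 (x - 2*pi * of_int \<lfloor>x / (2*pi)\<rfloor>)" for x
  have f0[measurable]: "f0 \<in> borel_measurable borel" unfolding f0_def by measurable
  have fm[measurable]: "f \<in> borel_measurable borel" unfolding f_def by measurable
  have fp: "periodic f"
  proof -
    have "\<lfloor>(x + 2*pi) / (2*pi)\<rfloor> = \<lfloor>x / (2*pi)\<rfloor> + 1" for x by (simp add: add_divide_distrib)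
    then show ?thesis by (simp add: periodic_def f_def algebra_simps)
  qed
  have "AE x in lborel. x \<noteq> 2*pi" by (rule AE_lborel_singleton)
  then have "AE x in cm. x \<noteq> 2*pi" unfolding cm_def by (subst AE_restrict_space_iff) auto
  then have lim: "AE x in cm. (\<lambda>i. ?s (r i) x) \<longlonglongrightarrow> f x"
    using r(2) AE_space
  proof eventually_elim
    case (elim x)
    then have "0 \<le> x / (2*pi)" "x / (2*pi) < 1" by auto
    then have "\<lfloor>x / (2*pi)\<rfloor> = 0" by (simp add: floor_eq_iff)
    then have "f x = f0 x" by (simp add: f_def)
    then show ?case using elim(2) unfolding f0_def
      by (simp add: Cauchy_convergent_iff convergent_LIMSEQ_iff)
  qed
  have fatou: "(\<integral>\<^sup>+x. ennreal ((cmod (f x - ?s n x))\<^sup>2) \<partial>cm) \<le> ennreal C"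
    if "\<forall>\<^sub>F i in sequentially. (n2 (\<lambda>x. ?s (r i) x - ?s n x))\<^sup>2 \<le> C" for n C
  proof -
    have "(\<integral>\<^sup>+x. ennreal ((cmod (f x - ?s n x))\<^sup>2) \<partial>cm)
        = (\<integral>\<^sup>+x. liminf (\<lambda>i. ennreal ((cmod (?s (r i) x - ?s n x))\<^sup>2)) \<partial>cm)"
    proof (rule nn_integral_cong_AE)
      show "AE x in cm. ennreal ((cmod (f x - ?s n x))\<^sup>2) = liminf (\<lambda>i. ennreal ((cmod (?s (r i) x - ?s n x))\<^sup>2))"
        using lim
      proof eventually_elim
        case (elim x)
        then have "(\<lambda>i. ennreal ((cmod (?s (r i) x - ?s n x))\<^sup>2)) \<longlonglongrightarrow> ennreal ((cmod (f x - ?s n x))\<^sup>2)"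
          by (intro tendsto_intros)
        from lim_imp_Liminf[OF _ this] show ?case by simp
      qed
    qed
    also have "\<dots> \<le> liminf (\<lambda>i. \<integral>\<^sup>+x. ennreal ((cmod (?s (r i) x - ?s n x))\<^sup>2) \<partial>cm)"
      by (rule nn_integral_liminf) measurable
    also have "(\<lambda>i. \<integral>\<^sup>+x. ennreal ((cmod (?s (r i) x - ?s n x))\<^sup>2) \<partial>cm) = (\<lambda>i. ennreal ((n2 (\<lambda>x. ?s (r i) x - ?s n x))\<^sup>2))"
      unfolding n2_sq using L2_circleD(3)[OF L2_circle_diff[OF sL sL]]
      by (intro ext nn_integral_eq_integral) auto
    also have "liminf \<dots> \<le> limsup \<dots>" by (rule Liminf_le_Limsup) simp
    also have "\<dots> \<le> ennreal C"
      by (rule Limsup_bounded) (use that in \<open>auto elim!: eventually_mono intro: ennreal_leI\<close>)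
    finally show ?thesis .
  qed
  have bnd: "\<exists>N. \<forall>n\<ge>N. (\<lambda>x. f x - ?s n x) \<in> L2_circle \<and> n2 (\<lambda>x. f x - ?s n x) \<le> \<epsilon>" if \<epsilon>: "\<epsilon> > 0" for \<epsilon>
  proof -
    obtain N where N: "\<And>i j. i \<ge> N \<Longrightarrow> j \<ge> N \<Longrightarrow> n2 (\<lambda>x. ?s i x - ?s j x) < \<epsilon>" using cau[OF \<epsilon>] by blast
    have "(\<lambda>x. f x - ?s n x) \<in> L2_circle \<and> n2 (\<lambda>x. f x - ?s n x) \<le> \<epsilon>" if n: "n \<ge> N" for n
    proof -
      have "\<forall>\<^sub>F i in sequentially. (n2 (\<lambda>x. ?s (r i) x - ?s n x))\<^sup>2 \<le> \<epsilon>\<^sup>2"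
        using eventually_ge_at_top[of N]
      proof eventually_elim
        case (elim i)
        then have "r i \<ge> N" using seq_suble[OF r(1), of i] by simp
        then show ?case using N[OF _ n, of "r i"] by (intro power_mono) auto
      qed
      note le = fatou[OF this]
      have i: "integrable cm (\<lambda>x. (cmod (f x - ?s n x))\<^sup>2)"
        by (rule integrableI_bounded) (use le in \<open>auto simp: le_less_trans\<close>)
      have "ennreal ((n2 (\<lambda>x. f x - ?s n x))\<^sup>2) \<le> ennreal (\<epsilon>\<^sup>2)"
        using le unfolding n2_sq by (subst nn_integral_eq_integral[OF i, symmetric]) auto
      then have "(n2 (\<lambda>x. f x - ?s n x))\<^sup>2 \<le> \<epsilon>\<^sup>2" using ennreal_le_iff by simp
      then have "n2 (\<lambda>x. f x - ?s n x) \<le> \<epsilon>" using \<epsilon> by (meson less_imp_le power2_le_imp_le)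
      moreover have "(\<lambda>x. f x - ?s n x) \<in> L2_circle"
        by (rule L2_circleI) (use i fp L2_circleD(2)[OF sL] in \<open>auto simp: periodic_def\<close>)
      ultimately show ?thesis by simp
    qed
    then show ?thesis by blast
  qed
  obtain N where "(\<lambda>x. f x - ?s N x) \<in> L2_circle" using bnd[of 1] by auto
  from L2_circle_add[OF this sL[of N]] have f: "f \<in> L2_circle" by simp
  have conv: "(\<lambda>n. n2 (\<lambda>x. f x - ?s n x)) \<longlonglongrightarrow> 0"
  proof (rule LIMSEQ_I)
    fix \<epsilon> :: real assume "\<epsilon> > 0"
    then have "\<epsilon>/2 > 0" "\<epsilon>/2 < \<epsilon>" by auto
    then show "\<exists>N. \<forall>n\<ge>N. norm (n2 (\<lambda>x. f x - ?s n x) - 0) < \<epsilon>"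
      using bnd[of "\<epsilon>/2"] by (metis diff_zero le_less_trans n2_nonneg abs_of_nonneg real_norm_def)
  qed
  have "fourier f k = c k" for k
  proof -
    have "(\<lambda>n. fourier f k - fourier (?s n) k) \<longlonglongrightarrow> 0"
    proof (rule Lim_null_comparison)
      show "\<forall>\<^sub>F n in sequentially. norm (fourier f k - fourier (?s n) k) \<le> n2 (\<lambda>x. f x - ?s n x) * sqrt (2*pi) / (2*pi)"
        by (intro always_eventually allI)
          (metis fourier_diff[OF f sL] norm_fourier_le[OF L2_circle_diff[OF f sL]])
      show "(\<lambda>n. n2 (\<lambda>x. f x - ?s n x) * sqrt (2*pi) / (2*pi)) \<longlonglongrightarrow> 0"
        using conv by (intro tendsto_eq_intros) auto
    qed
    moreover have "\<forall>\<^sub>F n in sequentially. fourier f k - fourier (?s n) k = fourier f k - c k"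
      using eventually_ge_at_top[of "nat \<bar>k\<bar>"] by eventually_elim (auto simp: fourier_trig)
    ultimately have "(\<lambda>n. fourier f k - c k) \<longlonglongrightarrow> 0" using tendsto_cong by fast
    then show ?thesis by (simp add: LIMSEQ_const_iff)
  qed
  then show ?thesis using f conv by blast
qed

text \<open>Riesz-Fischer builds a function from the coefficients with the desired convergence;
  uniqueness of coefficients identifies it with \<open>f\<close> almost everywhere.\<close>

theorem fourier_series_L2:
  assumes f: "f \<in> L2_circle"
  shows "(\<lambda>n. n2 (\<lambda>x. f x - psum (fourier f) n x)) \<longlonglongrightarrow> 0"
proof -
  obtain h where h: "h \<in> L2_circle" "fourier h = fourier f"
    "(\<lambda>n. n2 (\<lambda>x. h x - psum (fourier f) n x)) \<longlonglongrightarrow> 0"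
    using Riesz_Fischer[OF Bessel[OF f]] by blast
  have ae: "AE x in cm. f x - h x = 0"
    by (rule fourier_eq_0_imp_AE[OF L2_circle_diff[OF f h(1)]]) (simp add: fourier_diff[OF f h(1)] h(2))
  have "n2 (\<lambda>x. f x - psum (fourier f) n x) = n2 (\<lambda>x. h x - psum (fourier f) n x)" for n
  proof -
    have sL: "psum (fourier f) n \<in> L2_circle" by (rule L2_circle_trig) simp
    note [measurable] = L2_circleD(1)[OF sL] L2_circleD(1)[OF f] L2_circleD(1)[OF h(1)]
    have "integral\<^sup>L cm (\<lambda>x. (cmod (f x - psum (fourier f) n x))\<^sup>2) = integral\<^sup>L cm (\<lambda>x. (cmod (h x - psum (fourier f) n x))\<^sup>2)"
      by (rule integral_cong_AE) (use ae in auto)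
    then show ?thesis by (simp add: n2_def)
  qed
  then show ?thesis using h(3) by simp
qed

lemma psum_circle_int_tendsto:
  assumes f: "f \<in> L2_circle" and g: "g \<in> L2_circle"
  shows "(\<lambda>n. circle_int (\<lambda>x. psum (fourier f) n x * g x)) \<longlonglongrightarrow> circle_int (\<lambda>x. f x * g x)"
proof -
  have sL: "psum (fourier f) n \<in> L2_circle" for n by (rule L2_circle_trig) simp
  have "(\<lambda>n. circle_int (\<lambda>x. f x * g x) - circle_int (\<lambda>x. psum (fourier f) n x * g x)) \<longlonglongrightarrow> 0"
  proof (rule Lim_null_comparison)
    have "circle_int (\<lambda>x. f x * g x) - circle_int (\<lambda>x. psum (fourier f) n x * g x) = circle_int (\<lambda>x. (f x - psum (fourier f) n x) * g x)" for n
      using L2_integrable_mult[OF f g] L2_integrable_mult[OF sL g]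
      by (simp add: circle_int_cm left_diff_distrib)
    then show "\<forall>\<^sub>F n in sequentially. norm (circle_int (\<lambda>x. f x * g x) - circle_int (\<lambda>x. psum (fourier f) n x * g x))
        \<le> n2 (\<lambda>x. f x - psum (fourier f) n x) * n2 g"
      using Cauchy_Schwarz_cm(2)[OF L2_circle_diff[OF f sL] g] by simp
    show "(\<lambda>n. n2 (\<lambda>x. f x - psum (fourier f) n x) * n2 g) \<longlonglongrightarrow> 0"
      using fourier_series_L2[OF f] by (intro tendsto_eq_intros) auto
  qed
  then have "(\<lambda>n. circle_int (\<lambda>x. f x * g x) - (circle_int (\<lambda>x. f x * g x) - circle_int (\<lambda>x. psum (fourier f) n x * g x)))
      \<longlonglongrightarrow> circle_int (\<lambda>x. f x * g x) - 0"
    by (intro tendsto_intros)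
  then show ?thesis by simp
qed

lemma l2_reindex:
  assumes "bij h" "z \<in> l2"
  shows "(\<lambda>a. z (h a)) \<in> l2"
  using assms summable_on_reindex_bij_betw[of h UNIV UNIV "\<lambda>a. (cmod (z a))\<^sup>2"] by (simp add: l2_def)

lemma filterlim_symmetric_intervals:
  "filterlim (\<lambda>n. {- int n..int n}) (finite_subsets_at_top UNIV) sequentially"
  unfolding filterlim_finite_subsets_at_top
proof (intro allI impI)
  fix A :: "int set" assume A: "finite A \<and> A \<subseteq> UNIV"
  show "\<forall>\<^sub>F n in sequentially. finite {- int n..int n} \<and> A \<subseteq> {- int n..int n} \<and> {- int n..int n} \<subseteq> UNIV"
    using eventually_ge_at_top[of "nat (Max (insert 0 (abs ` A)))"]
  proof eventually_elim
    case (elim n)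
    have "\<bar>k\<bar> \<le> int n" if "k \<in> A" for k
    proof -
      have "\<bar>k\<bar> \<le> Max (insert 0 (abs ` A))" using A that by (intro Max_ge) auto
      then show ?thesis using elim by linarith
    qed
    then show ?case by fastforce
  qed
qed

text \<open>The bilinear form, with \<open>fourier g (- k)\<close> instead of a conjugate, fits the
  symmetric operators to which it is applied. Bessel's inequality gives absolute summability, so the
  value may be read along symmetric intervals, where the sums are pairings with partial sums of
  \<open>f\<close>.\<close>

theorem Parseval:
  assumes f: "f \<in> L2_circle" and g: "g \<in> L2_circle"
  shows "((\<lambda>k. fourier f k * fourier g (- k)) has_sum circle_int (\<lambda>x. f x * g x) / (2*pi)) UNIV"
    "(\<lambda>k. norm (fourier f k * fourier g (- k))) summable_on UNIV"
proof -
  have "bij (uminus :: int \<Rightarrow> int)"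
    unfolding bij_def surj_def by (auto simp: inj_def) (metis minus_minus)
  from l2_reindex[OF this Bessel[OF g]] have "(\<lambda>k. fourier g (- k)) \<in> l2" .
  from l2_mult_summable(1)[OF Bessel[OF f] this]
  show s: "(\<lambda>k. norm (fourier f k * fourier g (- k))) summable_on UNIV" .
  then have "(\<lambda>k. fourier f k * fourier g (- k)) summable_on UNIV"
    by (rule Infinite_Sum.abs_summable_summable)
  then obtain S where S: "((\<lambda>k. fourier f k * fourier g (- k)) has_sum S) UNIV" by (auto simp: summable_on_def)
  have "(\<lambda>n. \<Sum>k\<in>{- int n..int n}. fourier f k * fourier g (- k)) \<longlonglongrightarrow> S"
    using filterlim_compose[OF S[unfolded has_sum_def] filterlim_symmetric_intervals] .
  moreover have "(\<Sum>k\<in>{- int n..int n}. fourier f k * fourier g (- k)) = circle_int (\<lambda>x. psum (fourier f) n x * g x) / (2*pi)" for n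
    by (subst circle_int_trig[OF g]) (auto simp: sum_divide_distrib fourier_e mult.commute)
  ultimately have "(\<lambda>n. circle_int (\<lambda>x. psum (fourier f) n x * g x) / (2*pi)) \<longlonglongrightarrow> S" by simp
  moreover have "(\<lambda>n. circle_int (\<lambda>x. psum (fourier f) n x * g x) / (2*pi)) \<longlonglongrightarrow> circle_int (\<lambda>x. f x * g x) / (2*pi)"
    by (intro tendsto_intros psum_circle_int_tendsto f g) simp
  ultimately have "S = circle_int (\<lambda>x. f x * g x) / (2*pi)" by (rule LIMSEQ_unique)
  then show "((\<lambda>k. fourier f k * fourier g (- k)) has_sum circle_int (\<lambda>x. f x * g x) / (2*pi)) UNIV" using S by simp
qed

section \<open>Equality almost everywhere and synthesis from coefficients\<close>

lemma AE_cm: "(AE x in cm. P x) \<longleftrightarrow> (AE x in lborel. x \<in> {0..2*pi} \<longrightarrow> P x)"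
  unfolding cm_def by (subst AE_restrict_space_iff) auto

text \<open>The coefficients see a single period. Translation by the countably many multiples of
  \<open>2*pi\<close>, together with periodicity, carries the equality to the whole line, on which
  \<open>ae_eq\<close> is defined.\<close>

lemma ae_eqI:
  assumes f: "f \<in> L2_circle" and g: "g \<in> L2_circle" and eq: "\<And>k. fourier f k = fourier g k"
  shows "ae_eq f g"
proof -
  note [measurable] = L2_circleD(1)[OF f] L2_circleD(1)[OF g]
  let ?P = "\<lambda>x. x \<in> {0..2*pi} \<longrightarrow> f x = g x"
  have "AE x in cm. f x - g x = 0"
    by (rule fourier_eq_0_imp_AE[OF L2_circle_diff[OF f g]]) (simp add: fourier_diff[OF f g] eq)
  then have P: "AE x in lborel. ?P x" by (simp add: AE_cm)
  have "AE x in lborel. ?P (c + x)" for c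
  proof -
    have "AE x in distr lborel borel ((+) c). ?P x" by (subst lborel_distr_plus) (rule P)
    then show ?thesis by (subst (asm) AE_distr_iff) auto
  qed
  then have "AE x in lborel. \<forall>n::int. ?P (2*pi * of_int n + x)"
    unfolding AE_all_countable by blast
  then show ?thesis unfolding ae_eq_def
  proof eventually_elim
    case (elim x)
    let ?n = "- \<lfloor>x / (2*pi)\<rfloor>"
    have "of_int \<lfloor>x / (2*pi)\<rfloor> \<le> x / (2*pi)" "x / (2*pi) < of_int \<lfloor>x / (2*pi)\<rfloor> + 1" by linarith+
    then have "of_int \<lfloor>x / (2*pi)\<rfloor> * (2*pi) \<le> x" "x < (of_int \<lfloor>x / (2*pi)\<rfloor> + 1) * (2*pi)"
      by (simp_all only: pos_le_divide_eq pos_divide_less_eq zero_less_mult_iff pi_gt_zero zero_less_numeral simp_thms)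
    then have "2*pi * of_int ?n + x \<in> {0..2*pi}" by (simp add: algebra_simps)
    then have "f (2*pi * of_int ?n + x) = g (2*pi * of_int ?n + x)" using elim by blast
    then show ?case
      using periodic_int[OF L2_circleD(2)[OF f], of x ?n] periodic_int[OF L2_circleD(2)[OF g], of x ?n]
      by (simp add: add.commute)
  qed
qed

lemma fourier_cong_ae:
  assumes "ae_eq f g" and [measurable]: "f \<in> borel_measurable borel" "g \<in> borel_measurable borel"
  shows "fourier f k = fourier g k"
proof -
  have "AE x in cm. f x = g x" using assms(1) unfolding ae_eq_def AE_cm by eventually_elim simp
  then have "integral\<^sup>L cm (\<lambda>x. f x * e (-k) x) = integral\<^sup>L cm (\<lambda>x. g x * e (-k) x)"
    by (intro integral_cong_AE) auto
  then show ?thesis by (simp add: fourier_e circle_int_cm)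
qed

definition hermitian :: "(int \<Rightarrow> complex) \<Rightarrow> bool" where
  "hermitian c \<longleftrightarrow> (\<forall>k. c (- k) = cnj (c k))"

text \<open>A fixed choice of representative. Hermitian coefficients receive one that is real at
  every point, because \<open>sob0\<close> restricts the whole range and not only almost every
  value.\<close>

definition synth :: "(int \<Rightarrow> complex) \<Rightarrow> real \<Rightarrow> complex" where
  "synth c = (SOME f. f \<in> L2_circle \<and> fourier f = c \<and> (hermitian c \<longrightarrow> range f \<subseteq> \<real>))"

lemma synth:
  assumes c: "c \<in> l2"
  shows "synth c \<in> L2_circle" "fourier (synth c) = c" "hermitian c \<Longrightarrow> range (synth c) \<subseteq> \<real>"
proof -
  obtain f where f: "f \<in> L2_circle" "fourier f = c" using Riesz_Fischer[OF c] by blast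
  have "\<exists>f. f \<in> L2_circle \<and> fourier f = c \<and> (hermitian c \<longrightarrow> range f \<subseteq> \<real>)"
  proof (cases "hermitian c")
    case True
    \<comment> \<open>Averaging with the conjugate makes all values real and leaves hermitian
      coefficients unchanged.\<close>
    let ?h = "\<lambda>x. (1/2) * (f x + cnj (f x))"
    have "?h \<in> L2_circle" by (intro L2_circle_cmult L2_circle_add L2_circle_cnj f)
    moreover have "fourier ?h k = c k" for k
    proof -
      have "fourier ?h k = (1/2) * (fourier f k + cnj (fourier f (- k)))"
        by (simp only: fourier_cmult fourier_add[OF f(1) L2_circle_cnj[OF f(1)]] fourier_cnj)
      then show ?thesis using True by (simp add: f(2) hermitian_def)
    qed
    moreover have "range ?h \<subseteq> \<real>" by (auto simp: complex_is_Real_iff)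
    ultimately show ?thesis by blast
  qed (use f in blast)
  from someI_ex[OF this] show "synth c \<in> L2_circle" "fourier (synth c) = c" "hermitian c \<Longrightarrow> range (synth c) \<subseteq> \<real>"
    unfolding synth_def by auto
qed

lemma hermitian_fourier:
  assumes "range f \<subseteq> \<real>"
  shows "hermitian (fourier f)"
proof -
  have "f x \<in> \<real>" for x using assms by auto
  then have eq: "(\<lambda>x. cnj (f x)) = f" by (simp add: fun_eq_iff Reals_cnj_iff)
  have "fourier f (- k) = cnj (fourier f k)" for k
    using fourier_cnj[of f "-k"] unfolding eq by (simp only: minus_minus)
  then show ?thesis unfolding hermitian_def by blast
qed

section \<open>Matrices with off-diagonal decay\<close>

lemma bracket_ge1: "1 \<le> bracket k" by (simp add: bracket_def)
lemma bracket_pos [simp]: "0 < bracket k" by (simp add: bracket_def)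
lemma bracket_nonzero [simp]: "bracket k \<noteq> 0" using bracket_pos[of k] by linarith
lemma bracket_nonneg [simp]: "0 \<le> bracket k" using bracket_pos[of k] by linarith
lemma bracket_minus [simp]: "bracket (- k) = bracket k" by (simp add: bracket_def)

lemma bracket_le_mult: "bracket (k + j) \<le> bracket k * bracket j"
proof -
  have "bracket (k + j) \<le> 1 + (\<bar>of_int k\<bar> + \<bar>of_int j\<bar>)"
    unfolding bracket_def using abs_triangle_ineq[of "real_of_int k" "real_of_int j"] by simp
  also have "\<dots> \<le> (1 + \<bar>of_int k\<bar>) * (1 + \<bar>of_int j\<bar>)" by (simp add: algebra_simps)
  finally show ?thesis by (simp add: bracket_def)
qed

lemma bracket_le_diff: "bracket k \<le> bracket (k - j) * bracket j"
  using bracket_le_mult[of "k - j" j] by simp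

lemma bracket_diff_le: "bracket (k - j) \<le> bracket k * bracket j"
  using bracket_le_mult[of k "- j"] by simp

lemma bracket_swap: "bracket (k - j) = bracket (j - k)"
  by (simp add: bracket_def abs_minus_commute)

definition rapid :: "(int \<Rightarrow> complex) \<Rightarrow> bool" where
  "rapid c \<longleftrightarrow> (\<forall>n::nat. \<exists>C. \<forall>k. cmod (c k) * bracket k ^ n \<le> C)"

text \<open>\<open>pos\<close> assigns a frequency to an index, so that one estimate serves indices
  that are frequencies and indices that also carry a branch. Decay of every order is required
  because conjugation by a weight of order s uses up about s orders.\<close>

definition off_diagonal :: "('a \<Rightarrow> int) \<Rightarrow> ('a \<Rightarrow> 'a \<Rightarrow> complex) \<Rightarrow> bool" where
  "off_diagonal pos M \<longleftrightarrow> (\<forall>n::nat. \<exists>C. \<forall>a b. cmod (M a b) * bracket (pos a - pos b) ^ n \<le> C)"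

lemma off_diagonal_rapid: "rapid c \<Longrightarrow> off_diagonal (\<lambda>k. k) (\<lambda>k j. c (k - j))"
  unfolding rapid_def off_diagonal_def by blast

text \<open>For a matrix of rank one, \<open>bracket (k - j) \<le> bracket k * bracket j\<close>
  converts decay in each variable into decay in the difference.\<close>

lemma off_diagonal_mult:
  assumes "rapid c" "rapid d"
  shows "off_diagonal (\<lambda>k. k) (\<lambda>k j. c k * d j)"
  unfolding off_diagonal_def
proof
  fix n :: nat
  obtain C D where C: "\<And>k. cmod (c k) * bracket k ^ n \<le> C" and D: "\<And>k. cmod (d k) * bracket k ^ n \<le> D"
    using assms unfolding rapid_def by meson
  have "cmod (c k * d j) * bracket (k - j) ^ n \<le> C * D" for k j
  proof -
    have "cmod (c k * d j) * bracket (k - j) ^ n \<le> cmod (c k * d j) * (bracket k * bracket j) ^ n"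
      by (intro mult_left_mono power_mono bracket_diff_le) (auto intro: less_imp_le)
    also have "\<dots> = (cmod (c k) * bracket k ^ n) * (cmod (d j) * bracket j ^ n)"
      by (simp add: norm_mult power_mult_distrib mult_ac)
    also have "\<dots> \<le> C * D"
    proof (rule mult_mono)
      show "0 \<le> C" using order_trans[OF norm_ge_zero[of "c 0"], of C] C[of 0] by (simp add: bracket_def)
    qed (use C D in \<open>auto intro: less_imp_le\<close>)
    finally show ?thesis .
  qed
  then show "\<exists>C. \<forall>a b. cmod (c a * d b) * bracket (a - b) ^ n \<le> C" by blast
qed

lemma off_diagonal_add:
  assumes "off_diagonal pos M" "off_diagonal pos N"
  shows "off_diagonal pos (\<lambda>a b. M a b + N a b)"
  unfolding off_diagonal_def
proof
  fix n :: nat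
  obtain C D where C: "\<And>a b. cmod (M a b) * bracket (pos a - pos b) ^ n \<le> C"
    and D: "\<And>a b. cmod (N a b) * bracket (pos a - pos b) ^ n \<le> D"
    using assms unfolding off_diagonal_def by meson
  have "cmod (M a b + N a b) * bracket (pos a - pos b) ^ n \<le> C + D" for a b
  proof -
    have "cmod (M a b + N a b) * bracket (pos a - pos b) ^ n \<le> (cmod (M a b) + cmod (N a b)) * bracket (pos a - pos b) ^ n"
      by (intro mult_right_mono norm_triangle_ineq) (auto intro: less_imp_le)
    then show ?thesis using C[of a b] D[of a b] by (simp add: distrib_right)
  qed
  then show "\<exists>C. \<forall>a b. cmod (M a b + N a b) * bracket (pos a - pos b) ^ n \<le> C" by blast
qed

lemma off_diagonal_cmult:
  assumes "off_diagonal pos M"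
  shows "off_diagonal pos (\<lambda>a b. c * M a b)"
  unfolding off_diagonal_def
proof
  fix n :: nat
  obtain C where C: "\<And>a b. cmod (M a b) * bracket (pos a - pos b) ^ n \<le> C"
    using assms unfolding off_diagonal_def by meson
  have "cmod (c * M a b) * bracket (pos a - pos b) ^ n \<le> cmod c * C" for a b
    using mult_left_mono[OF C[of a b], of "cmod c"] by (simp add: norm_mult mult.assoc)
  then show "\<exists>C. \<forall>a b. cmod (c * M a b) * bracket (pos a - pos b) ^ n \<le> C" by blast
qed

section \<open>Schur estimates on weighted sequence spaces\<close>

lemma sum_bracket_bound: "\<exists>S. \<forall>F k. finite F \<longrightarrow> (\<Sum>j\<in>F. 1 / bracket (k - j) ^ 2) \<le> S"
proof -
  define h where "h m = 1 / (1 + real m)\<^sup>2" for m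
  have "summable (\<lambda>n. inverse (of_nat n ^ 2) :: real)" by (rule inverse_power_summable) simp
  then have "summable (\<lambda>n. inverse (of_nat (Suc n) ^ 2) :: real)" by (subst summable_Suc_iff)
  then have s: "summable h" by (simp add: h_def[abs_def] inverse_eq_divide add.commute)
  have part: "(\<Sum>i\<in>A. h (nat \<bar>i\<bar>)) \<le> suminf h" if "finite A" "inj_on (\<lambda>i. nat \<bar>i\<bar>) A" for A :: "int set"
  proof -
    have "(\<Sum>i\<in>A. h (nat \<bar>i\<bar>)) = (\<Sum>m\<in>(\<lambda>i. nat \<bar>i\<bar>) ` A. h m)"
      using that by (simp add: sum.reindex)
    also have "\<dots> \<le> suminf h" using that by (intro sum_le_suminf s) (auto simp: h_def)
    finally show ?thesis .
  qed
  have bh: "1 / bracket i ^ 2 = h (nat \<bar>i\<bar>)" for i by (simp add: bracket_def h_def)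
  have F0: "(\<Sum>i\<in>F. h (nat \<bar>i\<bar>)) \<le> 2 * suminf h" if F: "finite F" for F :: "int set"
  proof -
    have "(\<Sum>i\<in>F. h (nat \<bar>i\<bar>)) = (\<Sum>i\<in>F \<inter> {0..}. h (nat \<bar>i\<bar>)) + (\<Sum>i\<in>F - {0..}. h (nat \<bar>i\<bar>))"
      using F by (rule sum.Int_Diff)
    also have "\<dots> \<le> suminf h + suminf h"
      using F by (intro add_mono part) (auto simp: inj_on_def)
    finally show ?thesis by simp
  qed
  have "(\<Sum>j\<in>F. 1 / bracket (k - j) ^ 2) \<le> 2 * suminf h" if F: "finite F" for F :: "int set" and k
  proof -
    have "(\<Sum>j\<in>F. 1 / bracket (k - j) ^ 2) = (\<Sum>i\<in>(\<lambda>j. k - j) ` F. h (nat \<bar>i\<bar>))"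
      unfolding bh by (subst sum.reindex) (auto simp: inj_on_def)
    also have "\<dots> \<le> 2 * suminf h" using F by (intro F0) auto
    finally show ?thesis .
  qed
  then show ?thesis by blast
qed

text \<open>The bound is uniform in the centre \<open>k\<close>; this turns off-diagonal decay into
  one bound for all rows and all columns.\<close>

definition bracket_summable :: "('a \<Rightarrow> int) \<Rightarrow> bool" where
  "bracket_summable pos \<longleftrightarrow> (\<exists>S. \<forall>F k. finite F \<longrightarrow> (\<Sum>j\<in>F. 1 / bracket (k - pos j) ^ 2) \<le> S)"

lemma bracket_summable_id: "bracket_summable (\<lambda>k. k)"
  using sum_bracket_bound by (simp add: bracket_summable_def)

lemma bracket_summable_fst: "bracket_summable (fst :: int \<times> bool \<Rightarrow> int)"
proof -
  obtain S where S: "\<And>F k. finite F \<Longrightarrow> (\<Sum>j\<in>F. 1 / bracket (k - j) ^ 2) \<le> S"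
    using sum_bracket_bound by auto
  have "(\<Sum>j\<in>F. 1 / bracket (k - fst j) ^ 2) \<le> 2 * S" if F: "finite F" for F :: "(int \<times> bool) set" and k
  proof -
    have "(\<Sum>j\<in>F. 1 / bracket (k - fst j) ^ 2) \<le> (\<Sum>j\<in>fst ` F \<times> (UNIV :: bool set). 1 / bracket (k - fst j) ^ 2)"
      using F by (intro sum_mono2) (auto intro: rev_image_eqI)
    also have "\<dots> = (\<Sum>j\<in>fst ` F. \<Sum>\<sigma>\<in>(UNIV::bool set). 1 / bracket (k - j) ^ 2)"
      by (subst sum.cartesian_product) (auto intro: sum.cong)
    also have "\<dots> = 2 * (\<Sum>j\<in>fst ` F. 1 / bracket (k - j) ^ 2)" by (simp add: sum_distrib_left)
    also have "\<dots> \<le> 2 * S" using S[of "fst ` F" k] F by simp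
    finally show ?thesis .
  qed
  then show ?thesis unfolding bracket_summable_def by blast
qed

lemma Peetre: "0 \<le> s \<Longrightarrow> bracket k powr s \<le> bracket (k - j) powr s * bracket j powr s"
  using powr_mono2[OF _ _ bracket_le_diff[of k j], of s] by (simp add: powr_mult less_imp_le)

text \<open>By Peetre's inequality, conjugation by the weights costs at most
  \<open>bracket (pos a - pos b) powr s\<close>, which the off-diagonal decay absorbs.\<close>

lemma weighted_Schur:
  assumes M: "off_diagonal pos M" and sum: "bracket_summable pos" and s: "0 \<le> s"
  shows "\<exists>R. \<forall>F. finite F \<longrightarrow>
     (\<forall>a. (\<Sum>b\<in>F. cmod (M a b) * bracket (pos a) powr s * bracket (pos b) powr (-s)) \<le> R) \<and>
     (\<forall>b. (\<Sum>a\<in>F. cmod (M a b) * bracket (pos a) powr s * bracket (pos b) powr (-s)) \<le> R)"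
proof -
  \<comment> \<open>The exponent s, rounded up, pays for the weights; the remaining two orders make
    rows and columns summable.\<close>
  define n where "n = nat \<lceil>s\<rceil> + 2"
  obtain C where C: "\<And>a b. cmod (M a b) * bracket (pos a - pos b) ^ n \<le> C"
    using M unfolding off_diagonal_def by meson
  obtain S where S: "\<And>F k. finite F \<Longrightarrow> (\<Sum>j\<in>F. 1 / bracket (k - pos j) ^ 2) \<le> S"
    using sum by (auto simp: bracket_summable_def)
  have C0: "0 \<le> C"
    using C[of undefined undefined] by (meson bracket_pos less_imp_le mult_nonneg_nonneg norm_ge_zero order_trans zero_le_power)
  have le: "cmod (M a b) * bracket (pos a) powr s * bracket (pos b) powr (-s) \<le> C * (1 / bracket (pos a - pos b) ^ 2)" for a b
  proof -
    let ?d = "bracket (pos a - pos b)"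
    have "bracket (pos a) powr s * bracket (pos b) powr (-s) \<le> ?d powr s * bracket (pos b) powr s * bracket (pos b) powr (-s)"
      using Peetre[OF s, of "pos a" "pos b"] by (intro mult_right_mono) auto
    also have "\<dots> = ?d powr s" using bracket_pos[of "pos b"] by (simp add: powr_minus del: bracket_pos)
    also have "\<dots> \<le> ?d powr real (nat \<lceil>s\<rceil>)"
      using s bracket_ge1 by (intro powr_mono) linarith+
    also have "\<dots> = ?d ^ n / ?d ^ 2" by (simp add: powr_realpow n_def power_add power2_eq_square)
    finally have "cmod (M a b) * (bracket (pos a) powr s * bracket (pos b) powr (-s)) \<le> cmod (M a b) * (?d ^ n / ?d ^ 2)"
      by (rule mult_left_mono) simp
    also have "\<dots> \<le> C * (1 / ?d ^ 2)"
      using mult_right_mono[OF C[of a b], of "1 / ?d ^ 2"] by simp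
    finally show ?thesis by (simp add: mult.assoc)
  qed
  have "(\<Sum>b\<in>F. cmod (M a b) * bracket (pos a) powr s * bracket (pos b) powr (-s)) \<le> C * S" if "finite F" for F a
  proof -
    have "(\<Sum>b\<in>F. cmod (M a b) * bracket (pos a) powr s * bracket (pos b) powr (-s)) \<le> (\<Sum>b\<in>F. C * (1 / bracket (pos a - pos b) ^ 2))"
      by (intro sum_mono le)
    also have "\<dots> = C * (\<Sum>b\<in>F. 1 / bracket (pos a - pos b) ^ 2)" by (simp add: sum_distrib_left)
    also have "\<dots> \<le> C * S" by (intro mult_left_mono S C0 that)
    finally show ?thesis .
  qed
  moreover have "(\<Sum>a\<in>F. cmod (M a b) * bracket (pos a) powr s * bracket (pos b) powr (-s)) \<le> C * S" if "finite F" for F b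
  proof -
    have "(\<Sum>a\<in>F. cmod (M a b) * bracket (pos a) powr s * bracket (pos b) powr (-s)) \<le> (\<Sum>a\<in>F. C * (1 / bracket (pos a - pos b) ^ 2))"
      by (intro sum_mono le)
    also have "\<dots> = C * (\<Sum>a\<in>F. 1 / bracket (pos b - pos a) ^ 2)"
      by (simp add: sum_distrib_left bracket_swap[of _ "pos b"])
    also have "\<dots> \<le> C * S" by (intro mult_left_mono S C0 that)
    finally show ?thesis .
  qed
  ultimately show ?thesis by (intro exI[of _ "C * S"]) simp
qed

text \<open>The Schur test is applied to the conjugated matrix and translated back, which also
  yields absolute summability of each row against \<open>z\<close>.\<close>

lemma weighted_Schur_bound:
  assumes M: "off_diagonal pos M" and sum: "bracket_summable pos" and s: "0 \<le> s"
  shows "\<exists>R\<ge>0. \<forall>z. (\<lambda>a. of_real (bracket (pos a) powr s) * z a) \<in> l2 \<longrightarrow>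
     (\<forall>a. (\<lambda>b. norm (M a b * z b)) summable_on UNIV) \<and>
     (\<lambda>a. of_real (bracket (pos a) powr s) * mapp M z a) \<in> l2 \<and>
     l2n (\<lambda>a. of_real (bracket (pos a) powr s) * mapp M z a) \<le> R * l2n (\<lambda>a. of_real (bracket (pos a) powr s) * z a)"
proof -
  from weighted_Schur[OF M sum s] obtain R where R: "\<forall>F. finite F \<longrightarrow>
     (\<forall>a. (\<Sum>b\<in>F. cmod (M a b) * bracket (pos a) powr s * bracket (pos b) powr (-s)) \<le> R) \<and>
     (\<forall>b. (\<Sum>a\<in>F. cmod (M a b) * bracket (pos a) powr s * bracket (pos b) powr (-s)) \<le> R)" by (rule exE)
  define T where "T a b = of_real (bracket (pos a) powr s) * M a b * of_real (bracket (pos b) powr (-s))" for a b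
  have cT: "cmod (T a b) = cmod (M a b) * bracket (pos a) powr s * bracket (pos b) powr (-s)" for a b
    by (simp add: T_def norm_mult)
  have row: "(\<Sum>b\<in>F. cmod (T a b)) \<le> R" if "finite F" for a F using R that unfolding cT by simp
  have col: "(\<Sum>a\<in>F. cmod (T a b)) \<le> R" if "finite F" for b F using R that unfolding cT by simp
  have "0 \<le> R" using row[of "{}"] by simp
  moreover have "(\<forall>a. (\<lambda>b. norm (M a b * z b)) summable_on UNIV) \<and>
     (\<lambda>a. of_real (bracket (pos a) powr s) * mapp M z a) \<in> l2 \<and>
     l2n (\<lambda>a. of_real (bracket (pos a) powr s) * mapp M z a) \<le> R * l2n (\<lambda>a. of_real (bracket (pos a) powr s) * z a)"
    if z: "(\<lambda>a. of_real (bracket (pos a) powr s) * z a) \<in> l2" for z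
  proof -
    let ?w = "\<lambda>a. complex_of_real (bracket (pos a) powr s)"
    have nz: "?w a \<noteq> 0" for a using bracket_pos[of "pos a"] by simp
    have Tz: "T a b * (?w b * z b) = ?w a * (M a b * z b)" for a b
      using nz[of b] by (simp add: T_def powr_minus field_simps)
    note S = Schur_test[OF row col z, unfolded Tz]
    have m: "(\<Sum>\<^sub>\<infinity>b. ?w a * (M a b * z b)) = ?w a * mapp M z a" for a
      unfolding mapp_def by (rule infsum_cmult_right')
    have "(\<lambda>b. norm (M a b * z b)) summable_on UNIV" for a
    proof -
      have "(\<lambda>b. (1 / bracket (pos a) powr s) * norm (?w a * (M a b * z b))) summable_on UNIV"
        by (intro summable_on_cmult_right S(1))
      then show ?thesis using nz[of a] by (simp add: norm_mult)
    qed
    then show ?thesis using S(2,3) unfolding m by simp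
  qed
  ultimately show ?thesis by blast
qed

section \<open>Smooth functions and distributional derivatives\<close>

abbreviation cplx :: "(real \<Rightarrow> real) \<Rightarrow> real \<Rightarrow> complex" where
  "cplx \<phi> \<equiv> \<lambda>x. of_real (\<phi> x)"

lemma funpow_deriv_Suc: "(deriv ^^ n) (deriv \<phi>) = (deriv ^^ Suc n) \<phi>"
  by (simp add: funpow_swap1)

lemma periodic_deriv:
  assumes "periodic \<phi>" "\<And>x. \<phi> differentiable (at x)"
  shows "periodic (deriv \<phi>)"
  unfolding periodic_def
proof
  fix x
  have e: "(\<lambda>y. \<phi> (y + 2*pi)) = \<phi>" using assms(1) by (auto simp: periodic_def)
  have "(\<phi> has_real_derivative deriv \<phi> (x + 2*pi)) (at (x + 2*pi))"
    using assms(2) DERIV_deriv_iff_real_differentiable by blast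
  then have "((\<lambda>y. \<phi> (y + 2*pi)) has_real_derivative deriv \<phi> (x + 2*pi)) (at x)"
    by (simp add: DERIV_shift)
  then show "deriv \<phi> (x + 2*pi) = deriv \<phi> x" unfolding e by (metis DERIV_imp_deriv)
qed

lemma smooth_periodic_deriv:
  assumes "smooth_periodic \<phi>"
  shows "smooth_periodic (deriv \<phi>)"
proof -
  have d: "\<And>n x. (deriv ^^ n) \<phi> differentiable (at x)" using assms by (simp add: smooth_periodic_def)
  from d[of 0] have "periodic (deriv \<phi>)" using assms by (intro periodic_deriv) (auto simp: smooth_periodic_def)
  then show ?thesis using d[of "Suc _"] by (simp add: smooth_periodic_def funpow_deriv_Suc del: funpow.simps)
qed

lemma smooth_periodic_funpow: "smooth_periodic \<phi> \<Longrightarrow> smooth_periodic ((deriv ^^ n) \<phi>)"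
  by (induction n) (auto intro: smooth_periodic_deriv)

lemma smooth_periodic_DERIV:
  "smooth_periodic \<phi> \<Longrightarrow> (\<phi> has_real_derivative deriv \<phi> x) (at x)"
  using DERIV_deriv_iff_real_differentiable[of \<phi> x] spec[of _ 0, of "\<lambda>n. \<forall>x. (deriv ^^ n) \<phi> differentiable (at x)"]
  by (simp add: smooth_periodic_def)

lemma smooth_periodic_continuous: "smooth_periodic \<phi> \<Longrightarrow> continuous_on A \<phi>"
  by (intro continuous_at_imp_continuous_on ballI DERIV_isCont[OF smooth_periodic_DERIV])

lemma smooth_periodic_L2: "smooth_periodic \<phi> \<Longrightarrow> cplx \<phi> \<in> L2_circle"
  and smooth_periodic_bounded: "smooth_periodic \<phi> \<Longrightarrow> \<exists>C. \<forall>x. \<bar>\<phi> x\<bar> \<le> C"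
proof -
  assume s: "smooth_periodic \<phi>"
  have p: "periodic \<phi>" using s by (simp add: smooth_periodic_def)
  have [measurable]: "\<phi> \<in> borel_measurable borel"
    by (intro borel_measurable_continuous_onI smooth_periodic_continuous s)
  have "compact (\<phi> ` {0..2*pi})"
    by (intro compact_continuous_image smooth_periodic_continuous s) simp
  then obtain C where C: "\<And>x. x \<in> {0..2*pi} \<Longrightarrow> \<bar>\<phi> x\<bar> \<le> C"
    using compact_imp_bounded bounded_iff by (metis imageI real_norm_def)
  have C': "\<bar>\<phi> x\<bar> \<le> C" for x
  proof -
    let ?n = "- \<lfloor>x / (2*pi)\<rfloor>"
    have "of_int \<lfloor>x / (2*pi)\<rfloor> \<le> x / (2*pi)" "x / (2*pi) < of_int \<lfloor>x / (2*pi)\<rfloor> + 1" by linarith+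
    then have "of_int \<lfloor>x / (2*pi)\<rfloor> * (2*pi) \<le> x" "x < (of_int \<lfloor>x / (2*pi)\<rfloor> + 1) * (2*pi)"
      by (simp_all only: pos_le_divide_eq pos_divide_less_eq zero_less_mult_iff pi_gt_zero zero_less_numeral simp_thms)
    then have "x + 2 * pi * of_int ?n \<in> {0..2*pi}" by (simp add: algebra_simps)
    from C[OF this] show ?thesis using periodic_int[OF p, of x ?n] by simp
  qed
  then show "\<exists>C. \<forall>x. \<bar>\<phi> x\<bar> \<le> C" by blast
  show "cplx \<phi> \<in> L2_circle"
    using L2_circle_bounded_mult[OF L2_circle_const, of "cplx \<phi>" C 1] C' p
    by (simp add: periodic_def)
qed

text \<open>Integration by parts: the product of \<phi> with \<open>e (-k)\<close> is periodic, so
  its derivative integrates to zero over one period.\<close>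

lemma fourier_deriv:
  assumes s: "smooth_periodic \<phi>"
  shows "fourier (cplx (deriv \<phi>)) k = \<i> * of_int k * fourier (cplx \<phi>) k"
proof -
  let ?F = "\<lambda>x. of_real (\<phi> x) * e (-k) x"
  let ?f = "\<lambda>x. of_real (deriv \<phi> x) * e (-k) x + of_real (\<phi> x) * (- (\<i> * of_int k) * e (-k) x)"
  have ev: "e (-k) x = exp (- (\<i> * of_int k) * of_real x)" for x by (simp add: e_def cis_conv_exp mult.assoc)
  have de: "(e (-k) has_vector_derivative - (\<i> * of_int k) * e (-k) x) (at x within A)" for x A
    unfolding ev[abs_def] by (rule has_vector_derivative_real_field) (auto intro!: derivative_eq_intros)
  have "((\<lambda>x. complex_of_real (\<phi> x)) has_vector_derivative of_real (deriv \<phi> x)) (at x within A)" for x A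
    using smooth_periodic_DERIV[OF s, of x]
    by (intro has_vector_derivative_of_real) (simp add: has_real_derivative_iff_has_vector_derivative[symmetric] has_field_derivative_at_within)
  then have "(?F has_vector_derivative ?f x) (at x within A)" for x A
    using has_vector_derivative_mult[OF _ de, of "\<lambda>x. of_real (\<phi> x)"] by (simp add: add.commute)
  moreover have "continuous_on {0..2*pi} ?f"
    unfolding e_def by (intro continuous_intros smooth_periodic_continuous s smooth_periodic_deriv)
  ultimately have "integral\<^sup>L lborel (\<lambda>x. indicator {0..2*pi} x *\<^sub>R ?f x) = ?F (2*pi) - ?F 0"
    by (intro integral_FTC_Icc) auto
  also have "\<dots> = 0"
  proof -
    have "e (-k) (2*pi) = e (-k) 0" using periodic_e[of "-k"] by (metis add_0 periodic_def)
    moreover have "\<phi> (2*pi) = \<phi> 0" using s by (metis add_0 periodic_def smooth_periodic_def)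
    ultimately show ?thesis by simp
  qed
  finally have "circle_int ?f = 0" by (simp add: circle_int_def set_lebesgue_integral_def)
  moreover have "circle_int ?f = circle_int (\<lambda>x. of_real (deriv \<phi> x) * e (-k) x) + - (\<i> * of_int k) * circle_int (\<lambda>x. of_real (\<phi> x) * e (-k) x)"
  proof -
    have "?f = (\<lambda>x. of_real (deriv \<phi> x) * e (-k) x + (- (\<i> * of_int k)) * (of_real (\<phi> x) * e (-k) x))"
      by (simp add: mult_ac)
    then show ?thesis
      using L2_integrable_mult[OF smooth_periodic_L2[OF s] L2_circle_e] 
        L2_integrable_mult[OF smooth_periodic_L2[OF smooth_periodic_deriv[OF s]] L2_circle_e]
      by (simp add: circle_int_cm)
  qed
  ultimately show ?thesis by (simp add: fourier_e)
qed

lemma fourier_funpow_deriv: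
  "smooth_periodic \<phi> \<Longrightarrow> fourier (cplx ((deriv ^^ n) \<phi>)) k = (\<i> * of_int k) ^ n * fourier (cplx \<phi>) k"
proof (induction n)
  case (Suc n)
  then show ?case using fourier_deriv[OF smooth_periodic_funpow[OF Suc.prems], of n k] by simp
qed simp

text \<open>The coefficients of the \<open>n\<close>-th derivative are bounded by its norm. Orders 0
  and \<open>n\<close> together control \<open>bracket k ^ n\<close>; the factor
  \<open>2 ^ n\<close> comes from
  \<open>bracket k \<le> 2 * max 1 \<bar>of_int k\<bar>\<close>.\<close>

lemma rapid_fourier:
  assumes s: "smooth_periodic \<phi>"
  shows "rapid (fourier (cplx \<phi>))"
  unfolding rapid_def
proof
  fix n :: nat
  define C where "C m = n2 (cplx ((deriv ^^ m) \<phi>)) * sqrt (2*pi) / (2*pi)" for m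
  have C: "cmod (fourier (cplx \<phi>) k) * \<bar>of_int k\<bar> ^ m \<le> C m" for k m
    using norm_fourier_le[OF smooth_periodic_L2[OF smooth_periodic_funpow[OF s]], of m k]
    by (simp add: fourier_funpow_deriv[OF s] norm_mult norm_power C_def mult.commute)
  have "cmod (fourier (cplx \<phi>) k) * bracket k ^ n \<le> 2 ^ n * (C 0 + C n)" for k
  proof -
    have "bracket k \<le> 2 * max 1 \<bar>of_int k\<bar>" by (simp add: bracket_def)
    then have "bracket k ^ n \<le> 2 ^ n * max 1 \<bar>of_int k\<bar> ^ n"
      by (subst power_mult_distrib[symmetric]) (intro power_mono, auto intro: less_imp_le)
    also have "max 1 \<bar>real_of_int k\<bar> ^ n \<le> \<bar>of_int k\<bar> ^ 0 + \<bar>of_int k\<bar> ^ n"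
      by (cases "\<bar>real_of_int k\<bar> \<le> 1") (auto simp: max_def)
    finally have "cmod (fourier (cplx \<phi>) k) * bracket k ^ n
        \<le> cmod (fourier (cplx \<phi>) k) * (2 ^ n * (\<bar>of_int k\<bar> ^ 0 + \<bar>of_int k\<bar> ^ n))"
      by (intro mult_left_mono) auto
    also have "\<dots> = 2 ^ n * (cmod (fourier (cplx \<phi>) k) * \<bar>of_int k\<bar> ^ 0 + cmod (fourier (cplx \<phi>) k) * \<bar>of_int k\<bar> ^ n)"
      by (simp add: algebra_simps)
    also have "\<dots> \<le> 2 ^ n * (C 0 + C n)" using C[of k 0] C[of k n] by (intro mult_left_mono add_mono) auto
    finally show ?thesis .
  qed
  then show "\<exists>C. \<forall>k. cmod (fourier (cplx \<phi>) k) * bracket k ^ n \<le> C" by blast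
qed

text \<open>Smoothness truncated at a finite order. The product rule mixes a function with the
  derivative of the other, so closure under products needs an induction on the order in which both
  factors vary.\<close>

definition diff_upto :: "nat \<Rightarrow> (real \<Rightarrow> real) \<Rightarrow> bool" where
  "diff_upto n \<phi> \<longleftrightarrow> (\<forall>m\<le>n. \<forall>x. (deriv ^^ m) \<phi> differentiable (at x))"

lemma diff_upto_0: "diff_upto 0 \<phi> \<longleftrightarrow> (\<forall>x. \<phi> differentiable (at x))"
  by (simp add: diff_upto_def)

lemma diff_upto_Suc: "diff_upto (Suc n) \<phi> \<longleftrightarrow> (\<forall>x. \<phi> differentiable (at x)) \<and> diff_upto n (deriv \<phi>)"
proof -
  have "(\<forall>m\<le>Suc n. P m) \<longleftrightarrow> P 0 \<and> (\<forall>m\<le>n. P (Suc m))" for P :: "nat \<Rightarrow> bool"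
    using Suc_le_mono by (auto split: nat.split) (metis not0_implies_Suc Suc_le_mono)
  then show ?thesis unfolding diff_upto_def by (simp add: funpow_deriv_Suc del: funpow.simps(2))
qed

lemma diff_upto_add: "diff_upto n \<phi> \<Longrightarrow> diff_upto n \<psi> \<Longrightarrow> diff_upto n (\<lambda>x. \<phi> x + \<psi> x)"
proof (induction n arbitrary: \<phi> \<psi>)
  case (Suc n)
  have d: "\<phi> differentiable (at x)" "\<psi> differentiable (at x)" for x using Suc.prems by (auto simp: diff_upto_Suc)
  then have "deriv (\<lambda>x. \<phi> x + \<psi> x) = (\<lambda>x. deriv \<phi> x + deriv \<psi> x)"
    by (intro ext deriv_add) (auto simp: field_differentiable_def real_differentiable_def)
  then show ?case using Suc d by (simp add: diff_upto_Suc)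
qed (simp add: diff_upto_0)

lemma diff_upto_mono: "diff_upto (Suc n) \<phi> \<Longrightarrow> diff_upto n \<phi>"
  by (simp add: diff_upto_def)

lemma diff_upto_mult: "diff_upto n \<phi> \<Longrightarrow> diff_upto n \<psi> \<Longrightarrow> diff_upto n (\<lambda>x. \<phi> x * \<psi> x)"
proof (induction n arbitrary: \<phi> \<psi>)
  case (Suc n)
  have d: "\<phi> differentiable (at x)" "\<psi> differentiable (at x)" for x using Suc.prems by (auto simp: diff_upto_Suc)
  then have "deriv (\<lambda>x. \<phi> x * \<psi> x) = (\<lambda>x. \<phi> x * deriv \<psi> x + deriv \<phi> x * \<psi> x)"
    by (intro ext deriv_mult) (auto simp: field_differentiable_def real_differentiable_def)
  moreover have "diff_upto n (\<lambda>x. \<phi> x * deriv \<psi> x + deriv \<phi> x * \<psi> x)"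
    using Suc.prems by (intro diff_upto_add Suc.IH) (auto simp: diff_upto_Suc intro: diff_upto_mono[unfolded diff_upto_Suc])
  ultimately show ?case using d by (simp add: diff_upto_Suc)
qed (simp add: diff_upto_0)

lemma smooth_periodic_mult:
  assumes "smooth_periodic \<phi>" "smooth_periodic \<psi>"
  shows "smooth_periodic (\<lambda>x. \<phi> x * \<psi> x)"
proof -
  have "diff_upto n (\<lambda>x. \<phi> x * \<psi> x)" for n
    using assms by (intro diff_upto_mult) (auto simp: smooth_periodic_def diff_upto_def)
  then show ?thesis using assms by (auto simp: smooth_periodic_def diff_upto_def periodic_def)
qed

section \<open>Distributional derivatives in terms of Fourier coefficients\<close>

lemma funpow_deriv_cos:
  "(deriv ^^ n) (\<lambda>x::real. cos (c * x + \<theta>)) = (\<lambda>x. c ^ n * cos (c * x + (\<theta> + n * (pi/2))))"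
proof (induction n)
  case (Suc n)
  have "deriv (\<lambda>x. c ^ n * cos (c * x + (\<theta> + n * (pi/2)))) x = c ^ Suc n * cos (c * x + (\<theta> + Suc n * (pi/2)))" for x
  proof -
    have "((\<lambda>x. c ^ n * cos (c * x + (\<theta> + n * (pi/2)))) has_real_derivative c ^ n * (- sin (c * x + (\<theta> + n * (pi/2))) * c)) (at x)"
      by (auto intro!: derivative_eq_intros)
    then have "deriv (\<lambda>x. c ^ n * cos (c * x + (\<theta> + n * (pi/2)))) x = c ^ n * (- sin (c * x + (\<theta> + n * (pi/2))) * c)"
      by (rule DERIV_imp_deriv)
    also have "- sin (c * x + (\<theta> + n * (pi/2))) = cos ((c * x + (\<theta> + n * (pi/2))) + pi/2)"
      by (simp add: cos_add)
    also have "(c * x + (\<theta> + n * (pi/2))) + pi/2 = c * x + (\<theta> + Suc n * (pi/2))" by (simp add: algebra_simps)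
    finally show ?thesis by simp
  qed
  then show ?case using Suc by auto
qed simp

lemma smooth_periodic_cos: "smooth_periodic (\<lambda>x. cos (of_int k * x + \<theta>))"
  unfolding smooth_periodic_def
proof (intro conjI allI)
  have "cos (of_int k * (x + 2*pi) + \<theta>) = cos (of_int k * x + \<theta>)" for x
  proof -
    have eq: "of_int k * (x + 2*pi) + \<theta> = (of_int k * x + \<theta>) + 2 * pi * of_int k" by (simp add: algebra_simps)
    show ?thesis unfolding eq by (rule periodic_int) (simp add: periodic_def)
  qed
  then show "periodic (\<lambda>x. cos (of_int k * x + \<theta>))" by (simp add: periodic_def)
  show "(deriv ^^ n) (\<lambda>x. cos (of_int k * x + \<theta>)) differentiable (at x)" for n x
    unfolding funpow_deriv_cos real_differentiable_def by (rule exI) (rule derivative_eq_intros refl)+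
qed

text \<open>Testing against cosines suffices: their phases recover both exponentials.\<close>

lemma distr_deriv_fourier:
  assumes "distr_deriv n u w"
  shows "fourier w k = (\<i> * of_int k) ^ n * fourier u k"
proof -
  have u: "u \<in> L2_circle" and w: "w \<in> L2_circle"
    and t: "\<And>\<phi>. smooth_periodic \<phi> \<Longrightarrow> circle_int (\<lambda>x. w x * of_real (\<phi> x)) = (-1) ^ n * circle_int (\<lambda>x. u x * of_real ((deriv ^^ n) \<phi> x))"
    using assms by (auto simp: distr_deriv_def)
  let ?c = "\<lambda>\<theta> x. cos (of_int k * x + \<theta>)"
  \<comment> \<open>Phases 0 and \<open>-pi/2\<close> give cosine and sine, so the exponential is a
    complex combination of two admissible real test functions.\<close>
  have cs: "e (-k) x = of_real (?c 0 x) - \<i> * of_real (?c (-pi/2) x)" for x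
    by (simp add: e_def complex_eq_iff cos_diff)
  \<comment> \<open>Each derivative advances both phases by \<open>pi/2\<close>; on the combined
    exponential this is multiplication by \<open>- (\<i> * of_int k)\<close>.\<close>
  have dcs: "of_real ((deriv ^^ n) (?c 0) x) - \<i> * of_real ((deriv ^^ n) (?c (-pi/2)) x) = (- (\<i> * of_int k)) ^ n * e (-k) x" for x
  proof -
    have "of_int k * x + (-pi/2 + n * (pi/2)) = (of_int k * x + n * (pi/2)) - pi/2" by simp
    then have sn: "cos (of_int k * x + (-pi/2 + n * (pi/2))) = sin (of_int k * x + n * (pi/2))"
      by (simp only: cos_diff cos_pi_half sin_pi_half mult_zero_right mult_1_right add_0)
    have c: "cis (- y) = of_real (cos y) - \<i> * of_real (sin y)" for y by (simp add: complex_eq_iff)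
    have dm: "cis (- (real n * (pi/2))) = (- \<i>) ^ n"
      using Complex.DeMoivre[of "- (pi/2)" n] unfolding cis_minus_pi_half by simp
    have p: "(- (\<i> * of_int k)) ^ n = (of_int k :: complex) ^ n * (-\<i>) ^ n"
      by (simp only: power_mult_distrib[symmetric]) (simp add: mult.commute)
    have "- (of_int k * x + n * (pi/2)) = of_int (-k) * x + - (n * (pi/2))" by simp
    then have cm: "cis (- (of_int k * x + n * (pi/2))) = e (-k) x * (- \<i>) ^ n"
      unfolding e_def dm[symmetric] cis_mult by (rule arg_cong)
    have "of_real ((deriv ^^ n) (?c 0) x) - \<i> * of_real ((deriv ^^ n) (?c (-pi/2)) x)
        = of_int k ^ n * cis (- (of_int k * x + n * (pi/2)))"
      unfolding funpow_deriv_cos sn c by (simp add: right_diff_distrib)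
    also have "\<dots> = (- (\<i> * of_int k)) ^ n * e (-k) x" unfolding p cm by (simp only: mult_ac)
    finally show ?thesis .
  qed
  have sm: "cplx ((deriv ^^ m) (?c \<theta>)) \<in> L2_circle" for m \<theta>
    by (intro smooth_periodic_L2 smooth_periodic_funpow smooth_periodic_cos)
  have lin: "circle_int (\<lambda>x. h x * (of_real ((deriv ^^ m) (?c 0) x) - \<i> * of_real ((deriv ^^ m) (?c (-pi/2)) x)))
      = circle_int (\<lambda>x. h x * of_real ((deriv ^^ m) (?c 0) x)) - \<i> * circle_int (\<lambda>x. h x * of_real ((deriv ^^ m) (?c (-pi/2)) x))"
    if "h \<in> L2_circle" for h m
  proof -
    have "(\<lambda>x. h x * (of_real ((deriv ^^ m) (?c 0) x) - \<i> * of_real ((deriv ^^ m) (?c (-pi/2)) x)))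
      = (\<lambda>x. h x * of_real ((deriv ^^ m) (?c 0) x) - \<i> * (h x * of_real ((deriv ^^ m) (?c (-pi/2)) x)))"
      by (simp add: algebra_simps)
    then show ?thesis
      using L2_integrable_mult[OF that sm[of m 0]] L2_integrable_mult[OF that sm[of m "-pi/2"]]
      by (simp add: circle_int_cm)
  qed
  have "circle_int (\<lambda>x. w x * e (-k) x)
      = circle_int (\<lambda>x. w x * of_real (?c 0 x)) - \<i> * circle_int (\<lambda>x. w x * of_real (?c (-pi/2) x))"
    unfolding cs by (rule lin[OF w, of 0, unfolded funpow_0])
  also have "\<dots> = (-1) ^ n * (circle_int (\<lambda>x. u x * of_real ((deriv ^^ n) (?c 0) x)) - \<i> * circle_int (\<lambda>x. u x * of_real ((deriv ^^ n) (?c (-pi/2)) x)))"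
    unfolding t[OF smooth_periodic_cos] by (simp only: right_diff_distrib mult.left_commute)
  also have "\<dots> = (-1) ^ n * circle_int (\<lambda>x. u x * ((- (\<i> * of_int k)) ^ n * e (-k) x))"
    unfolding lin[OF u, of n, symmetric] dcs ..
  also have "circle_int (\<lambda>x. u x * ((- (\<i> * of_int k)) ^ n * e (-k) x)) = (- (\<i> * of_int k)) ^ n * circle_int (\<lambda>x. u x * e (-k) x)"
    unfolding circle_int_cm mult.left_commute[of "u _"] by (rule Bochner_Integration.integral_mult_right_zero)
  also have "(-1) ^ n * ((- (\<i> * of_int k)) ^ n * circle_int (\<lambda>x. u x * e (-k) x)) = (\<i> * of_int k) ^ n * circle_int (\<lambda>x. u x * e (-k) x)"
  proof -
    have "(-1) ^ n * (- (\<i> * of_int k)) ^ n = (\<i> * of_int k :: complex) ^ n"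
      by (simp only: power_mult_distrib[symmetric]) simp
    then show ?thesis by (simp only: mult.assoc[symmetric])
  qed
  finally show ?thesis by (simp add: fourier_e)
qed

text \<open>Parseval moves the factor \<open>(\<i> * of_int k) ^ n\<close> from \<open>u\<close> to
  the test function. The sign appears because the test function enters at frequency
  \<open>- k\<close>.\<close>

lemma distr_derivI:
  assumes u: "u \<in> L2_circle" and w: "w \<in> L2_circle" and eq: "\<And>k. fourier w k = (\<i> * of_int k) ^ n * fourier u k"
  shows "distr_deriv n u w"
  unfolding distr_deriv_def
proof (intro conjI u w allI impI)
  fix \<phi> assume s: "smooth_periodic \<phi>"
  note p1 = infsumI[OF Parseval(1)[OF w smooth_periodic_L2[OF s]]]
  note p2 = infsumI[OF Parseval(1)[OF u smooth_periodic_L2[OF smooth_periodic_funpow[OF s, of n]]]]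
  have "(\<Sum>\<^sub>\<infinity>k. fourier w k * fourier (cplx \<phi>) (- k)) = (\<Sum>\<^sub>\<infinity>k. (-1) ^ n * (fourier u k * fourier (cplx ((deriv ^^ n) \<phi>)) (- k)))"
  proof (rule infsum_cong)
    fix k
    have "(\<i> * of_int k) ^ n = (-1) ^ n * (\<i> * of_int (- k)) ^ n"
      unfolding power_mult_distrib[symmetric] by simp
    then show "fourier w k * fourier (cplx \<phi>) (- k) = (-1) ^ n * (fourier u k * fourier (cplx ((deriv ^^ n) \<phi>)) (- k))"
      by (simp add: eq fourier_funpow_deriv[OF s])
  qed
  also have "\<dots> = (-1) ^ n * (\<Sum>\<^sub>\<infinity>k. fourier u k * fourier (cplx ((deriv ^^ n) \<phi>)) (- k))"
    by (rule infsum_cmult_right')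
  finally show "circle_int (\<lambda>x. w x * of_real (\<phi> x)) = (-1) ^ n * circle_int (\<lambda>x. u x * of_real ((deriv ^^ n) \<phi> x))"
    unfolding p1 p2 by simp
qed

section \<open>The control operator\<close>

lemma mem_sob_iff: "f \<in> sob s \<longleftrightarrow> f \<in> L2_circle \<and> (\<lambda>k. of_real (bracket k powr s) * fourier f k) \<in> l2"
  by (simp add: sob_def l2_def norm_mult)

lemma sob_norm_eq: "sob_norm s f = l2n (\<lambda>k. of_real (bracket k powr s) * fourier f k)"
  by (simp add: sob_norm_def l2n_def norm_mult)

lemma mean_eq: "mean f = fourier f 0"
  by (simp add: mean_def fourier_e)

text \<open>By symmetry the coefficient of \<open>A p\<close> is a pairing of \<open>p\<close> with
  \<open>A (e (-k))\<close>, which Parseval expands; symmetry once more identifies the entries. In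
  this way \<open>A\<close> is never interchanged with an infinite series.\<close>

lemma symmetric_operator_fourier:
  assumes L2: "\<And>p. p \<in> L2_circle \<Longrightarrow> A p \<in> L2_circle"
    and sym: "\<And>p q. p \<in> L2_circle \<Longrightarrow> q \<in> L2_circle \<Longrightarrow> circle_int (\<lambda>x. A p x * q x) = circle_int (\<lambda>x. p x * A q x)"
    and p: "p \<in> L2_circle"
  shows "fourier (A p) k = mapp (\<lambda>k j. fourier (A (e j)) k) (fourier p) k"
proof -
  have "fourier (A p) k = circle_int (\<lambda>x. p x * A (e (-k)) x) / (2*pi)"
    unfolding fourier_e by (subst sym[OF p L2_circle_e]) simp
  moreover have "fourier (A (e (-k))) (-j) = fourier (A (e j)) k" for j
    unfolding fourier_e using sym[OF L2_circle_e[of "-k"] L2_circle_e[of j]] by (simp add: mult.commute)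
  ultimately show ?thesis
    using infsumI[OF Parseval(1)[OF p L2[OF L2_circle_e], of "-k"]] by (simp add: mapp_def mult.commute)
qed

locale control_profile =
  fixes g :: "real \<Rightarrow> real"
  assumes smooth: "smooth_periodic g" and total: "circle_int g = 1"
begin

abbreviation "G \<equiv> G_op g"

definition avg :: "(real \<Rightarrow> complex) \<Rightarrow> complex" where
  "avg p = circle_int (\<lambda>x. of_real (g x) * p x)"

lemma G_eq: "G p = (\<lambda>x. of_real (g x) * (p x - avg p))"
  by (simp add: G_op_def avg_def)

lemma g_L2: "cplx g \<in> L2_circle" by (rule smooth_periodic_L2[OF smooth])

lemma g_mult_L2:
  assumes "p \<in> L2_circle"
  shows "(\<lambda>x. of_real (g x) * p x) \<in> L2_circle"
proof -
  obtain C where C: "\<And>x. \<bar>g x\<bar> \<le> C" using smooth_periodic_bounded[OF smooth] by auto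
  show ?thesis
    by (rule L2_circle_bounded_mult[OF assms, where C = C]) (use L2_circleD[OF g_L2] C in auto)
qed

lemma G_L2: "p \<in> L2_circle \<Longrightarrow> G p \<in> L2_circle"
  unfolding G_eq by (intro g_mult_L2 L2_circle_diff L2_circle_const)

lemma circle_int_g: "circle_int (cplx g) = 1"
  using total by (simp add: circle_int_cm)

text \<open>The bilinear form of \<open>G\<close> is the covariance with respect to the density
  \<open>g\<close>. Symmetry and the zero mean of \<open>G p\<close> are read off from it.\<close>

lemma circle_int_G_mult:
  assumes p: "p \<in> L2_circle" and q: "q \<in> L2_circle"
  shows "circle_int (\<lambda>x. G p x * q x) = circle_int (\<lambda>x. of_real (g x) * p x * q x) - avg p * avg q"
proof -
  have "(\<lambda>x. G p x * q x) = (\<lambda>x. of_real (g x) * p x * q x - avg p * (of_real (g x) * q x))"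
    by (simp add: G_eq algebra_simps)
  then show ?thesis
    using L2_integrable_mult[OF g_mult_L2[OF p] q] L2_integrable_mult[OF g_L2 q]
    by (simp add: circle_int_cm avg_def)
qed

lemma G_sym:
  assumes p: "p \<in> L2_circle" and q: "q \<in> L2_circle"
  shows "circle_int (\<lambda>x. G p x * q x) = circle_int (\<lambda>x. p x * G q x)"
  using circle_int_G_mult[OF p q] circle_int_G_mult[OF q p] by (simp add: mult_ac)

lemma G_mean: "p \<in> L2_circle \<Longrightarrow> fourier (G p) 0 = 0"
  using circle_int_G_mult[OF _ L2_circle_const[of 1]] circle_int_g
  by (simp add: fourier_e avg_def[of "\<lambda>x. 1"]) (simp add: avg_def)

section \<open>The matrices of the control operator and of its square\<close>

definition Gm :: "int \<Rightarrow> int \<Rightarrow> complex" where "Gm k j = fourier (G (e j)) k"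
definition GGm :: "int \<Rightarrow> int \<Rightarrow> complex" where "GGm k j = fourier (G (G (e j))) k"

lemma fourier_G: "p \<in> L2_circle \<Longrightarrow> fourier (G p) k = mapp Gm (fourier p) k"
  unfolding Gm_def[abs_def] by (rule symmetric_operator_fourier) (auto simp: G_L2 G_sym)

lemma fourier_GG: "p \<in> L2_circle \<Longrightarrow> fourier (G (G p)) k = mapp GGm (fourier p) k"
  unfolding GGm_def[abs_def]
  by (rule symmetric_operator_fourier[where A = "\<lambda>p. G (G p)"]) (auto simp: G_L2 G_sym)

lemma avg_e: "avg (e j) = 2*pi * fourier (cplx g) (- j)"
  by (simp add: avg_def fourier_e)

lemma Gm_eq: "Gm k j = fourier (cplx g) (k - j) - 2*pi * fourier (cplx g) k * fourier (cplx g) (- j)"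
proof -
  have "(\<lambda>x. of_real (g x) * e j x * e (-k) x) = (\<lambda>x. of_real (g x) * e (- (k - j)) x)"
    by (simp add: e_mult mult.assoc)
  then show ?thesis
    using circle_int_G_mult[OF L2_circle_e[of j] L2_circle_e[of "-k"]] avg_e[of j] avg_e[of "-k"]
    by (simp add: Gm_def fourier_e[of "G (e j)"] fourier_e[of "cplx g" "k - j"] diff_divide_distrib mult_ac)
qed

lemma GGm_eq_inner: "GGm k j = circle_int (\<lambda>x. G (e j) x * G (e (- k)) x) / (2*pi)"
  unfolding GGm_def fourier_e by (subst G_sym) (auto simp: G_L2 L2_circle_e)

definition gg :: "int \<Rightarrow> complex" where "gg = fourier (cplx (\<lambda>x. g x * g x))"

lemma gg_L2: "cplx (\<lambda>x. g x * g x) \<in> L2_circle"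
  by (rule smooth_periodic_L2[OF smooth_periodic_mult[OF smooth smooth]])

text \<open>Multiplication by the square of \<open>g\<close> contributes the first term; the
  averages subtracted by \<open>G\<close> contribute matrices of rank one with rapidly decreasing
  factors.\<close>

lemma GGm_eq: "GGm k j = gg (k - j) - avg (e j) * gg k - avg (e (- k)) * gg (- j) + avg (e j) * avg (e (- k)) * gg 0"
proof -
  let ?h = "\<lambda>x. of_real (g x * g x) :: complex"
  have eq: "(\<lambda>x. G (e j) x * G (e (-k)) x) = (\<lambda>x. ?h x * e (- (k - j)) x - avg (e j) * (?h x * e (-k) x)
      - avg (e (-k)) * (?h x * e (- (-j)) x) + avg (e j) * avg (e (-k)) * (?h x * e (- 0) x))"
    by (simp add: G_eq fun_eq_iff e_mult[symmetric] algebra_simps)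
       (metis e_mult add.commute diff_conv_add_uminus mult.commute uminus_add_conv_diff)
  have i: "integrable cm (\<lambda>x. ?h x * e m x)" for m by (rule L2_integrable_mult[OF gg_L2 L2_circle_e])
  show ?thesis unfolding GGm_eq_inner eq gg_def fourier_e
    using i[of "- (k - j)"] i[of "-k"] i[of "- (- j)"] i[of "-0"]
    by (simp only: circle_int_cm Bochner_Integration.integral_add Bochner_Integration.integral_diff
        Bochner_Integration.integral_mult_right_zero integrable_mult_right Bochner_Integration.integrable_diff
        diff_divide_distrib add_divide_distrib times_divide_eq_right)
qed

lemma rapid_g: "rapid (fourier (cplx g))" by (rule rapid_fourier[OF smooth])
lemma rapid_gg: "rapid gg"
  unfolding gg_def by (rule rapid_fourier[OF smooth_periodic_mult[OF smooth smooth]])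

lemma rapid_minus: "rapid c \<Longrightarrow> rapid (\<lambda>k. c (- k))"
  unfolding rapid_def by (metis bracket_minus)

lemma rapid_cmult:
  assumes "rapid c" shows "rapid (\<lambda>k. a * c k)"
  unfolding rapid_def
proof
  fix n
  obtain C where C: "\<And>k. cmod (c k) * bracket k ^ n \<le> C" using assms unfolding rapid_def by meson
  have "cmod (a * c k) * bracket k ^ n \<le> cmod a * C" for k
    using mult_left_mono[OF C[of k], of "cmod a"] by (simp add: norm_mult mult.assoc)
  then show "\<exists>C. \<forall>k. cmod (a * c k) * bracket k ^ n \<le> C" by blast
qed

lemma rapid_avg: "rapid (\<lambda>j. avg (e j))" "rapid (\<lambda>j. avg (e (- j)))"
  using rapid_cmult[OF rapid_minus[OF rapid_g], of "2*pi"] rapid_cmult[OF rapid_g, of "2*pi"] by (simp_all add: avg_e)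

lemma off_diagonal_Gm: "off_diagonal (\<lambda>k. k) Gm"
proof -
  have "off_diagonal (\<lambda>k. k) (\<lambda>k j. fourier (cplx g) (k - j) + (- (2*pi)) * (fourier (cplx g) k * fourier (cplx g) (- j)))"
    by (intro off_diagonal_add off_diagonal_cmult off_diagonal_rapid off_diagonal_mult rapid_g rapid_minus)
  then show ?thesis by (simp add: Gm_eq[abs_def] mult.assoc)
qed

lemma off_diagonal_GGm: "off_diagonal (\<lambda>k. k) GGm"
proof -
  have "off_diagonal (\<lambda>k. k) (\<lambda>k j. ((gg (k - j) + (-1) * (gg k * avg (e j))) + (-1) * (avg (e (- k)) * gg (- j))) + gg 0 * (avg (e (- k)) * avg (e j)))"
    by (intro off_diagonal_add off_diagonal_cmult off_diagonal_rapid off_diagonal_mult rapid_gg rapid_avg rapid_minus)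
  then show ?thesis by (simp add: GGm_eq[abs_def] algebra_simps)
qed

text \<open>On the diagonal the deviation from the mean of \<open>g * g\<close> consists of the
  rank-one corrections alone. One order of their decay is what the smoothing estimate for the
  Gramian consumes.\<close>

lemma GGm_diagonal: "\<exists>C. \<forall>k. cmod (GGm k k - gg 0) * bracket k \<le> C"
proof -
  obtain A0 A1 B0 B1 D0 where A: "\<And>k. cmod (avg (e k)) * bracket k ^ 0 \<le> A0" "\<And>k. cmod (avg (e k)) * bracket k ^ 1 \<le> A1"
    "\<And>k. cmod (avg (e (-k))) * bracket k ^ 0 \<le> B0" "\<And>k. cmod (avg (e (-k))) * bracket k ^ 1 \<le> B1"
    "\<And>k. cmod (gg k) * bracket k ^ 0 \<le> D0"
    using rapid_avg rapid_gg unfolding rapid_def by meson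
  have "cmod (GGm k k - gg 0) * bracket k \<le> A1 * D0 + B1 * D0 + A1 * B0 * D0" for k
  proof -
    let ?a = "cmod (avg (e k))" and ?b = "cmod (avg (e (- k)))" and ?g = "\<lambda>k. cmod (gg k)"
    have eq: "GGm k k - gg 0 = - (avg (e k) * gg k) - avg (e (- k)) * gg (- k) + avg (e k) * avg (e (- k)) * gg 0"
      by (simp add: GGm_eq)
    have le: "cmod (GGm k k - gg 0) \<le> ?a * ?g k + ?b * ?g (- k) + ?a * ?b * ?g 0"
      using norm_triangle_ineq[of "- (avg (e k) * gg k) - avg (e (- k)) * gg (- k)" "avg (e k) * avg (e (- k)) * gg 0"]
        norm_triangle_ineq4[of "- (avg (e k) * gg k)" "avg (e (- k)) * gg (- k)"]
      unfolding eq norm_mult norm_minus_cancel by linarith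
    have "cmod (GGm k k - gg 0) * bracket k \<le> (?a * ?g k + ?b * ?g (- k) + ?a * ?b * ?g 0) * bracket k"
      using le by (rule mult_right_mono) simp
    also have "\<dots> = (?a * bracket k) * ?g k + (?b * bracket k) * ?g (- k) + (?a * bracket k) * ?b * ?g 0"
      by (simp only: distrib_right distrib_left mult_ac)
    also have "\<dots> \<le> A1 * D0 + B1 * D0 + A1 * B0 * D0"
    proof -
      have a: "?a * bracket k \<le> A1" "?b * bracket k \<le> B1" "?b \<le> B0" "?g m \<le> D0" for m
        using A(2)[of k] A(4)[of k] A(3)[of k] A(5)[of m] by simp_all
      have "0 \<le> ?a * bracket k" "0 \<le> ?b * bracket k" by simp_all
      then have p: "0 \<le> A1" "0 \<le> B1" "0 \<le> B0" using a norm_ge_zero[of "avg (e (- k))"] by linarith+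
      have "(?a * bracket k) * ?b \<le> A1 * B0" by (rule mult_mono[OF a(1,3) p(1)]) simp
      then have "(?a * bracket k) * ?b * ?g 0 \<le> A1 * B0 * D0"
        by (rule mult_mono[OF _ a(4)]) (use p in simp_all)
      moreover have "(?a * bracket k) * ?g k \<le> A1 * D0" by (rule mult_mono[OF a(1,4) p(1)]) simp
      moreover have "(?b * bracket k) * ?g (- k) \<le> B1 * D0" by (rule mult_mono[OF a(2,4) p(2)]) simp
      ultimately show ?thesis by linarith
    qed
    finally show ?thesis .
  qed
  then show ?thesis by blast
qed

lemma G_e0: "G (e 0) = (\<lambda>x. 0)"
  using circle_int_g by (simp add: G_eq avg_def fun_eq_iff)

text \<open>\<open>G\<close> annihilates constants, and symmetry carries this over to the row of
  frequency zero. The zero modes are therefore invisible to the Gramian.\<close>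

lemma GGm_0: "GGm k 0 = 0" "GGm 0 j = 0"
  by (simp_all add: GGm_eq_inner G_e0 circle_int_cm)

lemma cnj_avg_e: "cnj (avg (e j)) = avg (e (- j))"
  unfolding avg_def circle_int_cm by (subst Bochner_Integration.integral_cnj[symmetric]) (simp add: cnj_e)

lemma cnj_G_e: "cnj (G (e j) x) = G (e (- j)) x"
  by (simp add: G_eq cnj_avg_e cnj_e)

lemma cnj_GGm: "cnj (GGm k j) = GGm (- k) (- j)"
proof -
  have "cnj (circle_int (\<lambda>x. G (e j) x * G (e (- k)) x)) = circle_int (\<lambda>x. G (e (- j)) x * G (e (- (- k))) x)"
    unfolding circle_int_cm by (subst Bochner_Integration.integral_cnj[symmetric]) (simp add: cnj_G_e)
  then show ?thesis by (simp add: GGm_eq_inner)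
qed

lemma G_real: "range p \<subseteq> \<real> \<Longrightarrow> range (G p) \<subseteq> \<real>"
proof -
  assume "range p \<subseteq> \<real>"
  then have "p x \<in> \<real>" for x by auto
  then have p: "cnj (p x) = p x" for x by (simp add: Reals_cnj_iff)
  have "cnj (avg p) = avg p"
    unfolding avg_def circle_int_cm by (subst Bochner_Integration.integral_cnj[symmetric]) (simp add: p)
  then show ?thesis by (auto simp: G_eq Reals_cnj_iff p)
qed

lemma G_sob0:
  assumes s: "0 \<le> s"
  shows "\<exists>R\<ge>0. \<forall>p\<in>sob s. G p \<in> sob s \<and> sob_norm s (G p) \<le> R * sob_norm s p"
proof -
  obtain R where "R \<ge> 0" and R: "\<And>z. (\<lambda>a. of_real (bracket a powr s) * z a) \<in> l2 \<Longrightarrow>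
     (\<lambda>a. of_real (bracket a powr s) * mapp Gm z a) \<in> l2 \<and>
     l2n (\<lambda>a. of_real (bracket a powr s) * mapp Gm z a) \<le> R * l2n (\<lambda>a. of_real (bracket a powr s) * z a)"
    using weighted_Schur_bound[OF off_diagonal_Gm bracket_summable_id s] by blast
  have "G p \<in> sob s \<and> sob_norm s (G p) \<le> R * sob_norm s p" if "p \<in> sob s" for p
    using that R[of "fourier p"] by (auto simp: mem_sob_iff sob_norm_eq fourier_G G_L2)
  then show ?thesis using \<open>R \<ge> 0\<close> by blast
qed

lemma G_mem_sob0:
  assumes "0 \<le> s" "p \<in> sob0 K s" "K \<in> {\<real>, UNIV}"
  shows "G p \<in> sob0 K s"
  using G_sob0[OF assms(1)] assms(2,3) G_mean G_real
  by (auto simp: sob0_def mean_eq mem_sob_iff)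

text \<open>If the square of \<open>g\<close> had integral zero, \<open>g\<close> would vanish
  almost everywhere, against total mass one. This constant, times \<open>T\<close>, is the scalar
  part of the Gramian.\<close>

lemma gg_0_pos: "\<exists>d>0. gg 0 = of_real d"
proof -
  have [measurable]: "g \<in> borel_measurable borel"
    by (intro borel_measurable_continuous_onI smooth_periodic_continuous smooth)
  have i: "integrable cm (\<lambda>x. g x * g x)"
    using L2_circleD(4)[OF gg_L2] by (simp only: complex_of_real_integrable_eq)
  have "integral\<^sup>L cm (\<lambda>x. g x * g x) \<noteq> 0"
  proof
    assume "integral\<^sup>L cm (\<lambda>x. g x * g x) = 0"
    then have "AE x in cm. g x * g x = 0"
      by (subst (asm) integral_nonneg_eq_0_iff_AE[OF i]) auto
    then have "AE x in cm. g x = 0" by eventually_elim simp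
    then have "integral\<^sup>L cm g = integral\<^sup>L cm (\<lambda>x. 0)" by (intro integral_cong_AE) auto
    then show False using total by (simp add: circle_int_cm)
  qed
  moreover have "integral\<^sup>L cm (\<lambda>x. g x * g x) \<ge> 0" by (rule Bochner_Integration.integral_nonneg) simp
  ultimately have "integral\<^sup>L cm (\<lambda>x. g x * g x) / (2*pi) > 0" by (simp add: less_le)
  moreover have "gg 0 = of_real (integral\<^sup>L cm (\<lambda>x. g x * g x) / (2*pi))"
    unfolding gg_def fourier_e circle_int_cm by (simp flip: of_real_mult)
  ultimately show ?thesis by blast
qed

end

section \<open>Eigenbasis of the linear part\<close>

text \<open>A cubic with a perturbation that is bounded after division by \<open>k\<close>. For the
  gap, the difference of two cubes has the factor \<open>x\<^sup>2 + x * y + y\<^sup>2\<close>,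
  which is at least half of \<open>x\<^sup>2 + y\<^sup>2\<close> and absorbs the linearly growing
  perturbation.\<close>

lemma cubic_gap:
  fixes A B :: real and \<beta> :: "int \<Rightarrow> real"
  assumes A: "A \<noteq> 0" and \<beta>: "\<And>k. \<bar>\<beta> k\<bar> \<le> B"
    and f_def: "\<And>k::int. f k = of_int k * (A * (of_int k)\<^sup>2 + \<beta> k)"
  shows "\<exists>C\<ge>0. \<forall>k j. k \<noteq> j \<longrightarrow> bracket k \<le> C * (1 + \<bar>f k - f j\<bar>)"
    and "\<exists>C\<ge>0. \<forall>k. bracket k ^ 3 \<le> C * (1 + \<bar>f k\<bar>)"
    and "\<exists>C\<ge>0. \<forall>k. \<bar>f k\<bar> \<le> C * bracket k ^ 3"
proof -
  have B: "0 \<le> B" using \<beta>[of 0] by simp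
  have Ap: "0 < \<bar>A\<bar>" using A by simp
  \<comment> \<open>Young's inequality; the weight 1/4 leaves half of the quadratic term after it
    has been used for both frequencies.\<close>
  have lin: "B * \<bar>x\<bar> \<le> \<bar>A\<bar> * x\<^sup>2 / 4 + B\<^sup>2 / \<bar>A\<bar>" for x :: real
  proof -
    have "0 \<le> (\<bar>A\<bar> * \<bar>x\<bar> / 2 - B)\<^sup>2 / \<bar>A\<bar>" using Ap by simp
    also have "\<dots> = \<bar>A\<bar> * x\<^sup>2 / 4 + B\<^sup>2 / \<bar>A\<bar> - B * \<bar>x\<bar>"
      using Ap by (simp add: power2_diff field_simps power2_eq_square)
    finally show ?thesis by simp
  qed
  have ksq: "\<bar>real_of_int k\<bar> \<le> (of_int k)\<^sup>2" for k :: int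
  proof (cases "k = 0")
    case False
    then have "1 \<le> \<bar>real_of_int k\<bar>" by linarith
    then have "\<bar>real_of_int k\<bar> * 1 \<le> \<bar>real_of_int k\<bar> * \<bar>real_of_int k\<bar>" by (intro mult_left_mono) auto
    then show ?thesis by (simp add: power2_eq_square)
  qed simp
  show "\<exists>C\<ge>0. \<forall>k j. k \<noteq> j \<longrightarrow> bracket k \<le> C * (1 + \<bar>f k - f j\<bar>)"
  \<comment> \<open>The last two terms arise from solving the absorbed inequality for
    \<open>x\<^sup>2\<close>; the 1 stems from \<open>bracket k \<le> 1 + x\<^sup>2\<close>.\<close>
  proof (intro exI[of _ "1 + 4 / \<bar>A\<bar> + 8 * B\<^sup>2 / A\<^sup>2"] conjI allI impI)
    fix k j :: int assume "k \<noteq> j"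
    define x y where "x = real_of_int k" and "y = real_of_int j"
    have "1 \<le> \<bar>x - y\<bar>" using \<open>k \<noteq> j\<close> unfolding x_def y_def by linarith
    have q: "x\<^sup>2 + x * y + y\<^sup>2 \<ge> (x\<^sup>2 + y\<^sup>2) / 2"
      using zero_le_power2[of "x + y"] by (simp add: power2_sum)
    have "f k - f j = A * ((x - y) * (x\<^sup>2 + x * y + y\<^sup>2)) + (x * \<beta> k - y * \<beta> j)"
      by (simp add: f_def x_def y_def power2_eq_square algebra_simps)
    moreover have "\<bar>x * \<beta> k - y * \<beta> j\<bar> \<le> B * \<bar>x\<bar> + B * \<bar>y\<bar>"
      using mult_left_mono[OF \<beta>[of k], of "\<bar>x\<bar>"] mult_left_mono[OF \<beta>[of j], of "\<bar>y\<bar>"]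
        abs_triangle_ineq4[of "x * \<beta> k" "y * \<beta> j"] by (simp add: abs_mult mult.commute)
    ultimately have 1: "\<bar>A * ((x - y) * (x\<^sup>2 + x * y + y\<^sup>2))\<bar> \<le> \<bar>f k - f j\<bar> + (B * \<bar>x\<bar> + B * \<bar>y\<bar>)"
      by linarith
    have "\<bar>A\<bar> * (1 * ((x\<^sup>2 + y\<^sup>2) / 2)) \<le> \<bar>A\<bar> * (\<bar>x - y\<bar> * \<bar>x\<^sup>2 + x * y + y\<^sup>2\<bar>)"
    proof (rule mult_left_mono[OF mult_mono])
      show "(x\<^sup>2 + y\<^sup>2) / 2 \<le> \<bar>x\<^sup>2 + x * y + y\<^sup>2\<bar>" using q by linarith
    qed (use \<open>1 \<le> \<bar>x - y\<bar>\<close> in auto)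
    moreover have "\<bar>A\<bar> * (1 * ((x\<^sup>2 + y\<^sup>2) / 2)) = \<bar>A\<bar> * x\<^sup>2 / 2 + \<bar>A\<bar> * y\<^sup>2 / 2"
      by (simp add: distrib_left add_divide_distrib)
    ultimately have "\<bar>A\<bar> * x\<^sup>2 / 2 + \<bar>A\<bar> * y\<^sup>2 / 2 \<le> \<bar>f k - f j\<bar> + (B * \<bar>x\<bar> + B * \<bar>y\<bar>)"
      using 1 unfolding abs_mult by linarith
    then have "\<bar>A\<bar> * x\<^sup>2 / 4 \<le> \<bar>f k - f j\<bar> + 2 * (B\<^sup>2 / \<bar>A\<bar>)"
      using lin[of x] lin[of y] zero_le_power2[of y] mult_nonneg_nonneg[of "\<bar>A\<bar>" "y\<^sup>2"] by linarith
    then have "(\<bar>A\<bar> * x\<^sup>2 / 4) * (4 / \<bar>A\<bar>) \<le> (\<bar>f k - f j\<bar> + 2 * (B\<^sup>2 / \<bar>A\<bar>)) * (4 / \<bar>A\<bar>)"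
      by (rule mult_right_mono) simp
    also have "(\<bar>A\<bar> * x\<^sup>2 / 4) * (4 / \<bar>A\<bar>) = x\<^sup>2" using Ap by simp
    also have "(\<bar>f k - f j\<bar> + 2 * (B\<^sup>2 / \<bar>A\<bar>)) * (4 / \<bar>A\<bar>) = (4 / \<bar>A\<bar>) * \<bar>f k - f j\<bar> + 8 * B\<^sup>2 / A\<^sup>2"
      using Ap by (simp add: field_simps power2_eq_square)
    finally have "bracket k \<le> 1 + (4 / \<bar>A\<bar>) * \<bar>f k - f j\<bar> + 8 * B\<^sup>2 / A\<^sup>2"
      using ksq[of k] by (simp add: bracket_def x_def)
    also have "\<dots> \<le> (1 + 4 / \<bar>A\<bar> + 8 * B\<^sup>2 / A\<^sup>2) * (1 + \<bar>f k - f j\<bar>)"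
    proof -
      have key: "1 + p * F + q \<le> (1 + p + q) * (1 + F)" if "0 \<le> p" "0 \<le> q" "0 \<le> F" for p q F :: real
        using that mult_nonneg_nonneg[OF that(2,3)] by (simp add: algebra_simps)
      show ?thesis by (rule key) auto
    qed
    finally show "bracket k \<le> (1 + 4 / \<bar>A\<bar> + 8 * B\<^sup>2 / A\<^sup>2) * (1 + \<bar>f k - f j\<bar>)" .
  qed (auto intro!: add_nonneg_nonneg)
  have br3: "bracket k ^ 3 \<le> 8 * (1 + \<bar>of_int k\<bar> ^ 3)" for k
  proof -
    have "bracket k ^ 3 \<le> (2 * max 1 \<bar>of_int k\<bar>) ^ 3"
    proof (rule power_mono)
      show "bracket k \<le> 2 * max 1 \<bar>of_int k\<bar>" unfolding bracket_def by linarith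
    qed simp
    also have "\<dots> = 8 * max 1 \<bar>of_int k\<bar> ^ 3" by (simp add: power_mult_distrib)
    also have "max 1 \<bar>real_of_int k\<bar> ^ 3 \<le> 1 + \<bar>of_int k\<bar> ^ 3"
    proof -
      have "max 1 x ^ 3 \<le> 1 + x ^ 3" if "0 \<le> x" for x :: real
        using zero_le_power[OF that, of 3] by (simp add: max_def)
      from this[of "\<bar>real_of_int k\<bar>"] show ?thesis by (simp only: abs_ge_zero simp_thms)
    qed
    finally show ?thesis by simp
  qed
  show "\<exists>C\<ge>0. \<forall>k. bracket k ^ 3 \<le> C * (1 + \<bar>f k\<bar>)"
  proof -
    \<comment> \<open>\<open>q\<close> bounds the frequency where the perturbation can compete with
      the cubic term: there \<open>x\<^sup>2 \<le> 2 * B / \<bar>A\<bar>\<close>, and integrality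
      gives \<open>\<bar>x\<bar> \<le> x\<^sup>2\<close>.\<close>
    define q where "q = 1 + 2 * B / \<bar>A\<bar>"
    have q: "1 \<le> q" using B by (simp add: q_def)
    have "bracket k ^ 3 \<le> 8 * (1 + q ^ 3 + 2 / \<bar>A\<bar>) * (1 + \<bar>f k\<bar>)" for k
    proof -
      define x where "x = real_of_int k"
      have fk: "f k = A * x ^ 3 + x * \<beta> k" by (simp add: f_def x_def power2_eq_square power3_eq_cube algebra_simps)
      have "\<bar>x * \<beta> k\<bar> \<le> B * \<bar>x\<bar>" using mult_left_mono[OF \<beta>[of k], of "\<bar>x\<bar>"] by (simp add: abs_mult mult.commute)
      then have 1: "\<bar>A\<bar> * \<bar>x\<bar> ^ 3 \<le> \<bar>f k\<bar> + B * \<bar>x\<bar>"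
        unfolding power_abs[symmetric] abs_mult[symmetric] fk by linarith
      have "\<bar>x\<bar> ^ 3 \<le> q ^ 3 + (2 / \<bar>A\<bar>) * \<bar>f k\<bar>"
      proof (cases "B \<le> \<bar>A\<bar> * x\<^sup>2 / 2")
        case True
        then have "B * \<bar>x\<bar> \<le> \<bar>A\<bar> * x\<^sup>2 / 2 * \<bar>x\<bar>" by (intro mult_right_mono) auto
        also have "\<dots> = \<bar>A\<bar> * \<bar>x\<bar> ^ 3 / 2" by (simp add: power3_eq_cube power2_eq_square)
        finally have "\<bar>A\<bar> * \<bar>x\<bar> ^ 3 / 2 \<le> \<bar>f k\<bar>" using 1 by linarith
        then have "\<bar>x\<bar> ^ 3 \<le> (2 / \<bar>A\<bar>) * \<bar>f k\<bar>" using Ap by (simp add: field_simps)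
        moreover have "0 \<le> q ^ 3" using q by simp
        ultimately show ?thesis by linarith
      next
        case False
        then have "x\<^sup>2 \<le> 2 * B / \<bar>A\<bar>" using Ap by (simp add: field_simps)
        then have "\<bar>x\<bar> \<le> q" using ksq[of k] by (simp add: q_def x_def)
        then have "\<bar>x\<bar> ^ 3 \<le> q ^ 3" by (intro power_mono) auto
        then show ?thesis by (simp add: add_increasing2)
      qed
      then have "bracket k ^ 3 \<le> 8 * (1 + (q ^ 3 + (2 / \<bar>A\<bar>) * \<bar>f k\<bar>))"
        by (intro order_trans[OF br3[of k]] mult_left_mono add_left_mono) (simp_all add: x_def)
      also have "\<dots> \<le> 8 * (1 + q ^ 3 + 2 / \<bar>A\<bar>) * (1 + \<bar>f k\<bar>)"
      proof -
        have key: "1 + (b + p * F) \<le> (1 + b + p) * (1 + F)" if "0 \<le> p" "0 \<le> b" "0 \<le> F" for p b F :: real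
          using that mult_nonneg_nonneg[OF that(2,3)] by (simp add: algebra_simps)
        have "1 + (q ^ 3 + (2 / \<bar>A\<bar>) * \<bar>f k\<bar>) \<le> (1 + q ^ 3 + 2 / \<bar>A\<bar>) * (1 + \<bar>f k\<bar>)"
          by (rule key) (use q in auto)
        then show ?thesis unfolding mult.assoc by (rule mult_left_mono) simp
      qed
      finally show ?thesis .
    qed
    moreover have "0 \<le> 8 * (1 + q ^ 3 + 2 / \<bar>A\<bar>)" using q by simp
    ultimately show ?thesis by blast
  qed
  show "\<exists>C\<ge>0. \<forall>k. \<bar>f k\<bar> \<le> C * bracket k ^ 3"
  proof (intro exI[of _ "\<bar>A\<bar> + B"] conjI allI)
    fix k
    have b: "\<bar>real_of_int k\<bar> \<le> bracket k" "1 \<le> bracket k" by (auto simp: bracket_def)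
    have "\<bar>A * (of_int k)\<^sup>2 + \<beta> k\<bar> \<le> \<bar>A\<bar> * (of_int k)\<^sup>2 + B"
      using abs_triangle_ineq[of "A * (of_int k)\<^sup>2" "\<beta> k"] \<beta>[of k] by (simp add: abs_mult)
    also have "\<dots> \<le> \<bar>A\<bar> * bracket k ^ 2 + B * bracket k ^ 2"
    proof (intro add_mono mult_left_mono)
      show "(real_of_int k)\<^sup>2 \<le> (bracket k)\<^sup>2" using b by (intro power2_le_iff_abs_le[THEN iffD2]) auto
      show "B \<le> B * (bracket k)\<^sup>2" using B b by (simp add: mult_le_cancel_left1 one_le_power)
    qed auto
    finally have "\<bar>f k\<bar> \<le> bracket k * ((\<bar>A\<bar> + B) * bracket k ^ 2)"
      unfolding f_def abs_mult using b by (intro mult_mono) (auto simp: algebra_simps)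
    then show "\<bar>f k\<bar> \<le> (\<bar>A\<bar> + B) * bracket k ^ 3" by (simp add: power3_eq_cube power2_eq_square mult_ac)
  qed (use B in simp)
qed

section \<open>Diagonalisation of the symbol of the linear part\<close>

locale coupled_system =
  fixes \<alpha> \<mu> \<zeta> \<eta> :: real
  assumes alpha: "\<alpha> < 0" and gap: "\<zeta> - \<mu> > 0"
begin

text \<open>At frequency \<open>k\<close> the linear part is \<open>\<i> * of_int k\<close> times
  the symmetric matrix with rows \<open>(k^2 - \<mu>, - \<eta>)\<close> and
  \<open>(- \<eta>, \<alpha> * k^2 - \<zeta>)\<close>. \<open>dl k\<close> is the difference of its
  diagonal entries and \<open>disc k\<close> that of its eigenvalues.\<close>

definition dl :: "int \<Rightarrow> real" where "dl k = (1 - \<alpha>) * (of_int k)\<^sup>2 + (\<zeta> - \<mu>)"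
definition disc :: "int \<Rightarrow> real" where "disc k = sqrt ((dl k)\<^sup>2 + (2 * \<eta>)\<^sup>2)"
text \<open>\<open>wc k\<close> and \<open>ws k\<close> are cosine and sine of the rotation that
  diagonalises this matrix. As \<open>dl k\<close> is positive, \<open>dl k + disc k\<close>
  involves no cancellation and the normalising factor \<open>wn k\<close> never vanishes.\<close>

definition wn :: "int \<Rightarrow> real" where "wn k = sqrt ((dl k + disc k)\<^sup>2 + (2 * \<eta>)\<^sup>2)"
definition wc :: "int \<Rightarrow> real" where "wc k = (dl k + disc k) / wn k"
definition ws :: "int \<Rightarrow> real" where "ws k = 2 * \<eta> / wn k"

definition wu :: "int \<times> bool \<Rightarrow> real" where "wu = (\<lambda>(k, \<sigma>). if \<sigma> then wc k else ws k)"
definition wv :: "int \<times> bool \<Rightarrow> real" where "wv = (\<lambda>(k, \<sigma>). if \<sigma> then - ws k else wc k)"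

text \<open>Each eigenvalue is written as a diagonal entry with a shift by
  \<open>(disc k - dl k) / 2\<close>. In this form the deviation from a pure cubic is visibly
  bounded after division by \<open>k\<close>.\<close>

definition lam :: "int \<times> bool \<Rightarrow> real" where
  "lam = (\<lambda>(k, \<sigma>). of_int k * (if \<sigma> then (of_int k)\<^sup>2 - \<mu> + (disc k - dl k) / 2 else \<alpha> * (of_int k)\<^sup>2 - \<zeta> - (disc k - dl k) / 2))"

lemma dl_ge: "min (1 - \<alpha>) (\<zeta> - \<mu>) * (1 + (of_int k)\<^sup>2) \<le> dl k"
proof -
  have "min (1 - \<alpha>) (\<zeta> - \<mu>) * (1 + (of_int k)\<^sup>2) = min (1 - \<alpha>) (\<zeta> - \<mu>) * (of_int k)\<^sup>2 + min (1 - \<alpha>) (\<zeta> - \<mu>)"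
    by (simp add: algebra_simps)
  also have "\<dots> \<le> dl k" unfolding dl_def by (intro add_mono mult_right_mono) auto
  finally show ?thesis .
qed

lemma dl_pos: "0 < dl k"
  unfolding dl_def using alpha gap by (intro add_nonneg_pos mult_nonneg_nonneg) auto

lemma disc_ge: "dl k \<le> disc k"
  unfolding disc_def by (rule real_le_rsqrt) simp

lemma disc_le: "disc k \<le> dl k + 2 * \<bar>\<eta>\<bar>"
  using sqrt_sum_squares_le_sum_abs[of "dl k" "2 * \<eta>"] dl_pos[of k] by (simp add: disc_def abs_mult)

lemma disc_sq: "(disc k)\<^sup>2 = (dl k)\<^sup>2 + 4 * \<eta>\<^sup>2"
  by (simp add: disc_def power_mult_distrib)

lemma wn_ge: "dl k \<le> wn k"
proof -
  have "(dl k)\<^sup>2 \<le> (dl k + disc k)\<^sup>2" using dl_pos[of k] disc_ge[of k] by (intro power_mono) auto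
  then show ?thesis unfolding wn_def by (intro real_le_rsqrt) (simp add: add_increasing2)
qed

lemma wn_pos: "0 < wn k" using wn_ge[of k] dl_pos[of k] by linarith

lemma wn_sq: "(wn k)\<^sup>2 = (dl k + disc k)\<^sup>2 + 4 * \<eta>\<^sup>2"
  by (simp add: wn_def power_mult_distrib)

lemma wc_ws: "(wc k)\<^sup>2 + (ws k)\<^sup>2 = 1"
proof -
  have "(wc k)\<^sup>2 + (ws k)\<^sup>2 = ((dl k + disc k)\<^sup>2 + 4 * \<eta>\<^sup>2) / (wn k)\<^sup>2"
    unfolding wc_def ws_def power_divide power_mult_distrib add_divide_distrib[symmetric] by simp
  then show ?thesis using wn_pos[of k] by (simp add: wn_sq[symmetric])
qed

lemma abs_wc_le: "\<bar>wc k\<bar> \<le> 1" and abs_ws_le: "\<bar>ws k\<bar> \<le> 1"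
proof -
  have "(wc k)\<^sup>2 \<le> 1\<^sup>2" "(ws k)\<^sup>2 \<le> 1\<^sup>2"
    using wc_ws[of k] zero_le_power2[of "wc k"] zero_le_power2[of "ws k"] unfolding power_one by linarith+
  then show "\<bar>wc k\<bar> \<le> 1" "\<bar>ws k\<bar> \<le> 1" unfolding abs_le_square_iff[symmetric] by simp_all
qed

text \<open>The coupling is fixed while the diagonal difference \<open>dl k\<close> grows, so the
  eigenvectors align with the coordinate axes. The constant \<open>m\<close> bounds
  \<open>dl k / (1 + k^2)\<close> from below.\<close>

lemma ws_decay: "\<exists>C\<ge>0. \<forall>k. \<bar>ws k\<bar> * bracket k \<le> C"
proof -
  define m where "m = min (1 - \<alpha>) (\<zeta> - \<mu>)"
  have m: "0 < m" using alpha gap by (simp add: m_def)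
  have "\<bar>ws k\<bar> * bracket k \<le> 4 * \<bar>\<eta>\<bar> / m" for k
  proof -
    have "bracket k \<le> 2 * (1 + (of_int k)\<^sup>2)"
    proof -
      have "0 \<le> (\<bar>of_int k\<bar> - 1 :: real)\<^sup>2" by simp
      then have "2 * \<bar>of_int k\<bar> \<le> 1 + (real_of_int k)\<^sup>2" by (simp add: power2_diff)
      have "1 + y \<le> 2 * (1 + z)" if "2 * y \<le> 1 + z" "0 \<le> z" for y z :: real using that by argo
      note this[OF \<open>2 * \<bar>of_int k\<bar> \<le> 1 + (real_of_int k)\<^sup>2\<close>]
      then show ?thesis unfolding bracket_def by simp
    qed
    then have "m * bracket k \<le> m * (2 * (1 + (of_int k)\<^sup>2))" using m by (intro mult_left_mono) auto
    also have "\<dots> = 2 * (m * (1 + (of_int k)\<^sup>2))" by simp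
    also have "\<dots> \<le> 2 * wn k" using dl_ge[of k] wn_ge[of k] unfolding m_def by linarith
    finally have "bracket k \<le> 2 * wn k / m" using m by (simp add: field_simps)
    then have "\<bar>ws k\<bar> * bracket k \<le> \<bar>ws k\<bar> * (2 * wn k / m)" by (intro mult_left_mono) auto
    also have "\<dots> = 4 * \<bar>\<eta>\<bar> / m" using wn_pos[of k] by (simp add: ws_def abs_mult abs_divide)
    finally show ?thesis .
  qed
  then show ?thesis using m by (intro exI[of _ "4 * \<bar>\<eta>\<bar> / m"]) simp
qed

lemma even_symbols: "dl (- k) = dl k" "disc (- k) = disc k" "wn (- k) = wn k" "wc (- k) = wc k" "ws (- k) = ws k"
  by (simp_all add: dl_def disc_def wn_def wc_def ws_def)

lemma w_minus: "wu (- k, \<sigma>) = wu (k, \<sigma>)" "wv (- k, \<sigma>) = wv (k, \<sigma>)"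
  by (simp_all add: wu_def wv_def even_symbols)

lemma lam_minus: "lam (- k, \<sigma>) = - lam (k, \<sigma>)"
  by (simp add: lam_def even_symbols)

lemma eigen:
  "of_int k * (((of_int k)\<^sup>2 - \<mu>) * wu (k, \<sigma>) - \<eta> * wv (k, \<sigma>)) = lam (k, \<sigma>) * wu (k, \<sigma>)"
  "of_int k * (- \<eta> * wu (k, \<sigma>) + (\<alpha> * (of_int k)\<^sup>2 - \<zeta>) * wv (k, \<sigma>)) = lam (k, \<sigma>) * wv (k, \<sigma>)"
proof -
  define x where "x = (real_of_int k)\<^sup>2"
  have n: "wn k \<noteq> 0" using wn_pos[of k] by simp
  have p: "(disc k - dl k) * (dl k + disc k) = 4 * \<eta>\<^sup>2"
    using disc_sq[of k] by (simp add: power2_eq_square algebra_simps)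
  have q: "\<alpha> * x - \<zeta> = x - \<mu> - dl k" by (simp add: dl_def x_def algebra_simps)
  have wc: "wc k = (dl k + disc k) / wn k" and ws: "ws k = 2 * \<eta> / wn k" by (simp_all add: wc_def ws_def)
  \<comment> \<open>\<open>r\<close> is the amount by which the coupling pushes the eigenvalues
    apart, up on one branch and down on the other. The facts \<open>1\<close> and \<open>2\<close>
    are what is left of the eigenvector equations once the diagonal is removed.\<close>
  define r where "r = (disc k - dl k) / 2"
  have 1: "r * wc k = \<eta> * ws k"
    using p by (simp add: r_def wc ws power2_eq_square)
  have 2: "(dl k + r) * ws k = \<eta> * wc k"
  proof -
    have "dl k + r = (dl k + disc k) / 2" by (simp add: r_def field_simps)
    then show ?thesis by (simp add: wc ws)
  qed
  have L: "lam (k, \<sigma>) = of_int k * (if \<sigma> then x - \<mu> + r else x - \<mu> - dl k - r)"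
    using q by (simp add: lam_def x_def r_def)
  have t1: "(x - \<mu>) * wc k + \<eta> * ws k = (x - \<mu> + r) * wc k" "(x - \<mu>) * ws k - \<eta> * wc k = (x - \<mu> - dl k - r) * ws k"
    using 1 2 by (simp_all add: algebra_simps)
  have t2: "- \<eta> * wc k + (x - \<mu> - dl k) * - ws k = (x - \<mu> + r) * - ws k"
    "- \<eta> * ws k + (x - \<mu> - dl k) * wc k = (x - \<mu> - dl k - r) * wc k"
    using 1 2 by (simp_all add: algebra_simps)
  show "of_int k * (((of_int k)\<^sup>2 - \<mu>) * wu (k, \<sigma>) - \<eta> * wv (k, \<sigma>)) = lam (k, \<sigma>) * wu (k, \<sigma>)"
    unfolding x_def[symmetric] L using t1 by (cases \<sigma>) (simp_all add: wu_def wv_def)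
  show "of_int k * (- \<eta> * wu (k, \<sigma>) + (\<alpha> * (of_int k)\<^sup>2 - \<zeta>) * wv (k, \<sigma>)) = lam (k, \<sigma>) * wv (k, \<sigma>)"
    unfolding x_def[symmetric] q L using t2 by (cases \<sigma>) (simp_all add: wu_def wv_def)
qed

text \<open>The branches are perturbed cubics with leading coefficients 1 and \<alpha>; adding the
  two constants serves both. The gap is stated only within a branch, since eigenvalues of different
  branches may meet.\<close>

lemma lam_bounds:
  "\<exists>C\<ge>0. \<forall>k j \<sigma>. k \<noteq> j \<longrightarrow> bracket k \<le> C * (1 + \<bar>lam (k, \<sigma>) - lam (j, \<sigma>)\<bar>)"
  "\<exists>C\<ge>0. \<forall>a. bracket (fst a) ^ 3 \<le> C * (1 + \<bar>lam a\<bar>)"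
  "\<exists>C\<ge>0. \<forall>a. \<bar>lam a\<bar> \<le> C * bracket (fst a) ^ 3"
proof -
  have r: "\<bar>(disc k - dl k) / 2\<bar> \<le> \<bar>\<eta>\<bar>" for k using disc_ge[of k] disc_le[of k] by simp
  define \<beta>1 where "\<beta>1 k = - \<mu> + (disc k - dl k) / 2" for k
  define \<beta>2 where "\<beta>2 k = - \<zeta> - (disc k - dl k) / 2" for k
  have b1: "\<bar>\<beta>1 k\<bar> \<le> \<bar>\<mu>\<bar> + \<bar>\<eta>\<bar>" and b2: "\<bar>\<beta>2 k\<bar> \<le> \<bar>\<zeta>\<bar> + \<bar>\<eta>\<bar>" for k
    using r[of k] unfolding \<beta>1_def \<beta>2_def by linarith+
  have l1: "lam (k, True) = of_int k * (1 * (of_int k)\<^sup>2 + \<beta>1 k)" and l2: "lam (k, False) = of_int k * (\<alpha> * (of_int k)\<^sup>2 + \<beta>2 k)" for k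
    by (simp_all add: lam_def \<beta>1_def \<beta>2_def algebra_simps)
  have a: "\<alpha> \<noteq> 0" using alpha by simp
  note c1 = cubic_gap[OF one_neq_zero b1 l1] and c2 = cubic_gap[OF a b2 l2]
  obtain C1 where C1: "C1 \<ge> 0 \<and> (\<forall>k j. k \<noteq> j \<longrightarrow> bracket k \<le> C1 * (1 + \<bar>lam (k, True) - lam (j, True)\<bar>))"
    using c1(1) by (rule exE)
  obtain C2 where C2: "C2 \<ge> 0 \<and> (\<forall>k j. k \<noteq> j \<longrightarrow> bracket k \<le> C2 * (1 + \<bar>lam (k, False) - lam (j, False)\<bar>))"
    using c2(1) by (rule exE)
  note C = conjunct1[OF C1] conjunct1[OF C2] conjunct2[OF C1, rule_format] conjunct2[OF C2, rule_format]
  have "bracket k \<le> (C1 + C2) * (1 + \<bar>lam (k, \<sigma>) - lam (j, \<sigma>)\<bar>)" if "k \<noteq> j" for k j \<sigma>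
  proof -
    let ?d = "1 + \<bar>lam (k, \<sigma>) - lam (j, \<sigma>)\<bar>"
    have "0 \<le> C1 * ?d" "0 \<le> C2 * ?d" using C by simp_all
    moreover have "bracket k \<le> C1 * ?d \<or> bracket k \<le> C2 * ?d" using C(3,4)[OF that] by (cases \<sigma>) auto
    ultimately show ?thesis unfolding distrib_right by linarith
  qed
  then show "\<exists>C\<ge>0. \<forall>k j \<sigma>. k \<noteq> j \<longrightarrow> bracket k \<le> C * (1 + \<bar>lam (k, \<sigma>) - lam (j, \<sigma>)\<bar>)"
    using C by (intro exI[of _ "C1 + C2"]) simp
  obtain D1 where D1: "D1 \<ge> 0 \<and> (\<forall>k. bracket k ^ 3 \<le> D1 * (1 + \<bar>lam (k, True)\<bar>))"
    using c1(2) by (rule exE)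
  obtain D2 where D2: "D2 \<ge> 0 \<and> (\<forall>k. bracket k ^ 3 \<le> D2 * (1 + \<bar>lam (k, False)\<bar>))"
    using c2(2) by (rule exE)
  note D = conjunct1[OF D1] conjunct1[OF D2] conjunct2[OF D1, rule_format] conjunct2[OF D2, rule_format]
  have "bracket (fst a) ^ 3 \<le> (D1 + D2) * (1 + \<bar>lam a\<bar>)" for a
  proof -
    obtain k \<sigma> where ka: "a = (k, \<sigma>)" by (cases a)
    let ?d = "1 + \<bar>lam a\<bar>"
    have "0 \<le> D1 * ?d" "0 \<le> D2 * ?d" using D by simp_all
    moreover have "bracket k ^ 3 \<le> D1 * ?d \<or> bracket k ^ 3 \<le> D2 * ?d" using D(3,4)[of k] unfolding ka by (cases \<sigma>) auto
    ultimately show ?thesis unfolding distrib_right ka fst_conv by linarith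
  qed
  then show "\<exists>C\<ge>0. \<forall>a. bracket (fst a) ^ 3 \<le> C * (1 + \<bar>lam a\<bar>)"
    using D by (intro exI[of _ "D1 + D2"]) simp
  obtain F1 where F1: "F1 \<ge> 0 \<and> (\<forall>k. \<bar>lam (k, True)\<bar> \<le> F1 * bracket k ^ 3)"
    using c1(3) by (rule exE)
  obtain F2 where F2: "F2 \<ge> 0 \<and> (\<forall>k. \<bar>lam (k, False)\<bar> \<le> F2 * bracket k ^ 3)"
    using c2(3) by (rule exE)
  note F = conjunct1[OF F1] conjunct1[OF F2] conjunct2[OF F1, rule_format] conjunct2[OF F2, rule_format]
  have "\<bar>lam a\<bar> \<le> (F1 + F2) * bracket (fst a) ^ 3" for a
  proof -
    obtain k \<sigma> where ka: "a = (k, \<sigma>)" by (cases a)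
    have "0 \<le> F1 * bracket k ^ 3" "0 \<le> F2 * bracket k ^ 3" using F by simp_all
    moreover have "\<bar>lam a\<bar> \<le> F1 * bracket k ^ 3 \<or> \<bar>lam a\<bar> \<le> F2 * bracket k ^ 3" using F(3,4)[of k] unfolding ka by (cases \<sigma>) auto
    ultimately show ?thesis unfolding distrib_right ka fst_conv by linarith
  qed
  then show "\<exists>C\<ge>0. \<forall>a. \<bar>lam a\<bar> \<le> C * bracket (fst a) ^ 3"
    using F by (intro exI[of _ "F1 + F2"]) simp
qed

lemma finite_bracket: "finite {a :: int \<times> bool. bracket (fst a) \<le> r}"
proof (rule finite_subset)
  show "{a :: int \<times> bool. bracket (fst a) \<le> r} \<subseteq> {- \<lceil>r\<rceil>..\<lceil>r\<rceil>} \<times> UNIV"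
  proof
    fix a :: "int \<times> bool" assume "a \<in> {a. bracket (fst a) \<le> r}"
    then have "\<bar>real_of_int (fst a)\<bar> \<le> r" by (simp add: bracket_def)
    then have "- \<lceil>r\<rceil> \<le> fst a" "fst a \<le> \<lceil>r\<rceil>" by linarith+
    then show "a \<in> {- \<lceil>r\<rceil>..\<lceil>r\<rceil>} \<times> UNIV" by (cases a) auto
  qed
qed simp

text \<open>Cubic growth confines a level set to bounded frequencies. This turns a polynomial
  relation in \<open>lam\<close> into finite support.\<close>

lemma finite_lam_fiber: "finite {a. lam a = \<xi>}"
proof -
  obtain C where "C \<ge> 0 \<and> (\<forall>a. bracket (fst a) ^ 3 \<le> C * (1 + \<bar>lam a\<bar>))" using lam_bounds(2) by (rule exE)
  then have C: "C \<ge> 0" "\<And>a. bracket (fst a) ^ 3 \<le> C * (1 + \<bar>lam a\<bar>)" by auto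
  have "bracket (fst a) \<le> C * (1 + \<bar>\<xi>\<bar>)" if "lam a = \<xi>" for a
  proof -
    have "bracket (fst a) ^ 1 \<le> bracket (fst a) ^ 3" by (rule power_increasing) (auto simp: bracket_ge1)
    then show ?thesis using C(2)[of a] that by simp
  qed
  then have "{a. lam a = \<xi>} \<subseteq> {a. bracket (fst a) \<le> C * (1 + \<bar>\<xi>\<bar>)}" by auto
  then show ?thesis by (rule finite_subset[OF _ finite_bracket])
qed

definition flow :: "real \<Rightarrow> (int \<times> bool \<Rightarrow> complex) \<Rightarrow> int \<times> bool \<Rightarrow> complex" where
  "flow t z = (\<lambda>a. cis (lam a * t) * z a)"

lemma norm_flow [simp]: "cmod (flow t z a) = cmod (z a)"
  by (simp add: flow_def norm_mult)

lemma flow_l2 [simp]: "flow t z \<in> l2 \<longleftrightarrow> z \<in> l2"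
  by (rule l2_cong) simp

end

section \<open>The controllability Gramian\<close>

locale control_system = control_profile g + coupled_system \<alpha> \<mu> \<zeta> \<eta>
  for g :: "real \<Rightarrow> real" and \<alpha> \<mu> \<zeta> \<eta> :: real +
  fixes T :: real
  assumes T: "0 < T"
begin

section \<open>Oscillatory integrals in time and the Gramian matrix\<close>

definition osc :: "real \<Rightarrow> complex" where
  "osc \<xi> = integral {0..T} (\<lambda>r. cis (\<xi> * r))"

lemma osc_0: "osc 0 = of_real T"
  using T by (simp add: osc_def scaleR_conv_of_real)

lemma norm_osc_le: "cmod (osc \<xi>) \<le> T"
  using integral_bound[of 0 T "\<lambda>r. cis (\<xi> * r)" 1] T
  by (simp add: osc_def continuous_intros)

lemma osc_mult: "\<i> * of_real \<xi> * osc \<xi> = cis (\<xi> * T) - 1"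
proof -
  have "((\<lambda>r. \<i> * of_real \<xi> * cis (\<xi> * r)) has_integral (cis (\<xi> * T) - cis (\<xi> * 0))) {0..T}"
  proof (rule fundamental_theorem_of_calculus)
    fix x
    have "((\<lambda>r. exp (\<i> * of_real \<xi> * of_real r)) has_vector_derivative \<i> * of_real \<xi> * exp (\<i> * of_real \<xi> * of_real x)) (at x within {0..T})"
      by (rule has_vector_derivative_real_field) (auto intro!: derivative_eq_intros)
    then show "((\<lambda>r. cis (\<xi> * r)) has_vector_derivative \<i> * of_real \<xi> * cis (\<xi> * x)) (at x within {0..T})"
      by (simp add: cis_conv_exp mult.assoc)
  qed (use T in simp)
  from integral_unique[OF this] show ?thesis by (simp add: osc_def)
qed

text \<open>One inequality for both regimes: the trivial bound \<open>T\<close>, and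
  \<open>2 / \<bar>\<xi>\<bar>\<close> from integrating the exponential.\<close>

lemma osc_decay: "cmod (osc \<xi>) * (1 + \<bar>\<xi>\<bar>) \<le> T + 2"
proof -
  have "\<bar>\<xi>\<bar> * cmod (osc \<xi>) = cmod (cis (\<xi> * T) - 1)"
    using arg_cong[OF osc_mult[of \<xi>], of cmod] by (simp add: norm_mult)
  also have "\<dots> \<le> 2" using norm_triangle_ineq4[of "cis (\<xi> * T)" 1] by simp
  finally show ?thesis using norm_osc_le[of \<xi>] by (simp add: algebra_simps)
qed

lemma cnj_osc: "cnj (osc \<xi>) = osc (- \<xi>)"
  by (simp add: osc_def Henstock_Kurzweil_Integration.integral_cnj cis_cnj)

definition ww :: "int \<times> bool \<Rightarrow> int \<times> bool \<Rightarrow> real" where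
  "ww a b = wu a * wu b + wv a * wv b"

text \<open>In the eigenbasis this is the matrix of \<open>G\<close> applied twice to both
  components: once by the system and once by the choice of the control. The factor \<open>ww\<close>
  is the inner product of the two eigenvectors.\<close>

definition gram :: "int \<times> bool \<Rightarrow> int \<times> bool \<Rightarrow> complex" where
  "gram a b = of_real (ww a b) * GGm (fst a) (fst b)"

text \<open>The Gramian itself: \<open>osc\<close> integrates over time the relative phase of the
  modes \<open>a\<close> and \<open>b\<close>.\<close>

definition Mat :: "int \<times> bool \<Rightarrow> int \<times> bool \<Rightarrow> complex" where
  "Mat a b = gram a b * osc (lam a - lam b)"

definition Err :: "int \<times> bool \<Rightarrow> int \<times> bool \<Rightarrow> complex" where
  "Err a b = Mat a b - (if a = b then gg 0 * of_real T else 0)"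

lemma ww_self: "ww a a = 1"
  using wc_ws[of "fst a"] by (cases a) (auto simp: ww_def wu_def wv_def power2_eq_square add.commute)

lemma ww_opposite: "\<sigma> \<noteq> \<tau> \<Longrightarrow> ww (k, \<sigma>) (k, \<tau>) = 0"
  by (cases \<sigma>; cases \<tau>) (auto simp: ww_def wu_def wv_def)

lemma abs_wu_wv_le: "\<bar>wu a\<bar> \<le> 1" "\<bar>wv a\<bar> \<le> 1"
  using abs_wc_le[of "fst a"] abs_ws_le[of "fst a"] by (cases a; auto simp: wu_def wv_def)+

lemma abs_mult_le_1: "\<bar>x\<bar> \<le> 1 \<Longrightarrow> \<bar>y\<bar> \<le> 1 \<Longrightarrow> \<bar>x * y\<bar> \<le> (1::real)"
  using mult_mono[of "\<bar>x\<bar>" 1 "\<bar>y\<bar>" 1] by (simp add: abs_mult)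

lemma abs_ww_le: "\<bar>ww a b\<bar> \<le> 2"
  using abs_mult_le_1[OF abs_wu_wv_le(1)[of a] abs_wu_wv_le(1)[of b]] abs_mult_le_1[OF abs_wu_wv_le(2)[of a] abs_wu_wv_le(2)[of b]]
  unfolding ww_def by linarith

text \<open>Across branches the inner product is, up to sign, the sine of the difference of the two
  rotation angles, hence small when both angles are.\<close>

lemma ww_cross: "\<sigma> \<noteq> \<tau> \<Longrightarrow> \<bar>ww (k, \<sigma>) (j, \<tau>)\<bar> \<le> \<bar>ws k\<bar> + \<bar>ws j\<bar>"
proof -
  have b: "\<bar>x * y\<bar> \<le> \<bar>x\<bar>" if "\<bar>y\<bar> \<le> 1" for x y :: real
    using mult_left_mono[OF that, of "\<bar>x\<bar>"] by (simp add: abs_mult)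
  assume "\<sigma> \<noteq> \<tau>"
  then have "ww (k, \<sigma>) (j, \<tau>) = ws j * wc k - ws k * wc j \<or> ww (k, \<sigma>) (j, \<tau>) = ws k * wc j - ws j * wc k"
    by (cases \<sigma>; cases \<tau>) (auto simp: ww_def wu_def wv_def mult.commute)
  then show ?thesis using b[OF abs_wc_le[of k], of "ws j"] b[OF abs_wc_le[of j], of "ws k"] by (elim disjE) linarith+
qed

text \<open>The Gramian is \<open>T (g\<^sup>2)^(0)\<close> times the identity plus a smoothing matrix: within a branch
  the eigenvalues separate cubically, across branches the eigenvectors are nearly orthogonal.\<close>

lemma off_diagonal_Err: "off_diagonal fst (\<lambda>a b. of_real (bracket (fst a)) * Err a b)"
  unfolding off_diagonal_def
proof
  fix n :: nat
  obtain C1 where "\<forall>k. cmod (GGm k k - gg 0) * bracket k \<le> C1" using GGm_diagonal by (rule exE)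
  then have C1: "\<And>k. cmod (GGm k k - gg 0) * bracket k \<le> C1" by simp
  \<comment> \<open>One order more than requested: it pays for
    \<open>bracket k \<le> bracket (k - j) * bracket j\<close> when the decay has to come from
    \<open>ws j\<close>.\<close>
  obtain C2 where C2: "\<And>k j. cmod (GGm k j) * bracket (k - j) ^ Suc n \<le> C2"
    using off_diagonal_GGm unfolding off_diagonal_def by meson
  obtain C3 where "C3 \<ge> 0 \<and> (\<forall>k j \<sigma>. k \<noteq> j \<longrightarrow> bracket k \<le> C3 * (1 + \<bar>lam (k, \<sigma>) - lam (j, \<sigma>)\<bar>))"
    using lam_bounds(1) by (rule exE)
  then have C3: "0 \<le> C3" "\<And>k j \<sigma>. k \<noteq> j \<Longrightarrow> bracket k \<le> C3 * (1 + \<bar>lam (k, \<sigma>) - lam (j, \<sigma>)\<bar>)" by auto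
  obtain C4 where "C4 \<ge> 0 \<and> (\<forall>k. \<bar>ws k\<bar> * bracket k \<le> C4)" using ws_decay by (rule exE)
  then have C4: "0 \<le> C4" "\<And>k. \<bar>ws k\<bar> * bracket k \<le> C4" by auto
  have p1: "0 \<le> C1" using C1[of 0] mult_nonneg_nonneg[OF norm_ge_zero bracket_nonneg, of "GGm 0 0 - gg 0" 0] by linarith
  have p2: "0 \<le> C2" using C2[of 0 0] mult_nonneg_nonneg[OF norm_ge_zero zero_le_power[OF bracket_nonneg], of "GGm 0 0" "0 - 0" "Suc n"] by linarith
  have G: "cmod (GGm k j) * bracket (k - j) ^ n \<le> C2" for k j
  proof -
    have "bracket (k - j) ^ n \<le> bracket (k - j) ^ Suc n" by (rule power_increasing) (auto simp: bracket_ge1)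
    then show ?thesis using mult_left_mono[of _ _ "cmod (GGm k j)"] C2[of k j] by (meson norm_ge_zero order_trans)
  qed
  have step: "cmod (of_real (bracket k) * (of_real w * m * o')) * d ^ n = (bracket k * (\<bar>w\<bar> * cmod o')) * (cmod m * d ^ n)"
    for k :: int and w d :: real and m o' :: complex
    by (simp add: norm_mult mult_ac)
  \<comment> \<open>The three terms belong to the diagonal, to pairs within a branch and to pairs
    across branches.\<close>
  let ?C = "C1 * T + 2 * C3 * (T + 2) * C2 + 2 * C4 * T * C2"
  have nn: "0 \<le> C1 * T" "0 \<le> 2 * C3 * (T + 2) * C2" "0 \<le> 2 * C4 * T * C2"
    using p1 p2 C3(1) C4(1) T by simp_all
  have "cmod (of_real (bracket (fst a)) * Err a b) * bracket (fst a - fst b) ^ n \<le> ?C" for a b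
  proof -
    obtain k \<sigma> where a: "a = (k, \<sigma>)" by (cases a)
    obtain j \<tau> where b: "b = (j, \<tau>)" by (cases b)
    show ?thesis
    proof (cases "k = j")
      case True
      show ?thesis
      proof (cases "\<sigma> = \<tau>")
        case True
        then have "Err a b = (GGm k k - gg 0) * of_real T"
          using \<open>k = j\<close> by (simp add: Err_def Mat_def gram_def ww_self osc_0 a b left_diff_distrib)
        then have "cmod (of_real (bracket (fst a)) * Err a b) * bracket (fst a - fst b) ^ n = (cmod (GGm k k - gg 0) * bracket k) * T"
          using \<open>k = j\<close> T by (simp add: a b norm_mult bracket_def[of 0])
        also have "\<dots> \<le> C1 * T" using C1[of k] T by (intro mult_right_mono) auto
        finally show ?thesis using nn by linarith
      next
        case False
        then have "Err a b = 0" using \<open>k = j\<close> by (simp add: Err_def Mat_def gram_def ww_opposite a b)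
        then show ?thesis using nn by simp
      qed
    next
      case False
      then have E: "Err a b = of_real (ww a b) * GGm k j * osc (lam a - lam b)"
        by (simp add: Err_def Mat_def gram_def a b)
      have fst: "fst a = k" "fst b = j" by (simp_all add: a b)
      have main: "cmod (of_real (bracket (fst a)) * Err a b) * bracket (fst a - fst b) ^ n
          = (bracket k * (\<bar>ww a b\<bar> * cmod (osc (lam a - lam b)))) * (cmod (GGm k j) * bracket (k - j) ^ n)"
        unfolding E fst by (rule step)
      show ?thesis
      proof (cases "\<sigma> = \<tau>")
        case True
        have "bracket k * (\<bar>ww a b\<bar> * cmod (osc (lam a - lam b))) \<le> (C3 * (1 + \<bar>lam a - lam b\<bar>)) * (2 * cmod (osc (lam a - lam b)))"
          using C3(2)[OF False, of \<sigma>] True abs_ww_le[of a b] C3(1)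
          by (intro mult_mono mult_right_mono) (auto simp: a b)
        also have "\<dots> = 2 * C3 * (cmod (osc (lam a - lam b)) * (1 + \<bar>lam a - lam b\<bar>))" by (simp add: mult_ac)
        also have "\<dots> \<le> 2 * C3 * (T + 2)" using C3(1) by (intro mult_left_mono osc_decay) simp
        finally have "(bracket k * (\<bar>ww a b\<bar> * cmod (osc (lam a - lam b)))) * (cmod (GGm k j) * bracket (k - j) ^ n) \<le> 2 * C3 * (T + 2) * C2"
          using G[of k j] C3(1) T by (intro mult_mono[where b = "2 * C3 * (T + 2)" and d = C2]) auto
        then show ?thesis using nn unfolding main by linarith
      next
        case False
        have "bracket k * \<bar>ww a b\<bar> \<le> bracket k * (\<bar>ws k\<bar> + \<bar>ws j\<bar>)"
          using ww_cross[OF False, of k j] by (intro mult_left_mono) (auto simp: a b)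
        also have "\<dots> \<le> 2 * C4 * bracket (k - j)"
        proof -
          have "bracket k * \<bar>ws k\<bar> \<le> C4 * bracket (k - j)"
            using C4(2)[of k] mult_left_mono[OF bracket_ge1[of "k - j"] C4(1)] by (simp add: mult.commute)
          moreover have "bracket k * \<bar>ws j\<bar> \<le> (bracket (k - j) * bracket j) * \<bar>ws j\<bar>"
            by (intro mult_right_mono bracket_le_diff) auto
          moreover have "(bracket (k - j) * bracket j) * \<bar>ws j\<bar> \<le> C4 * bracket (k - j)"
            using mult_right_mono[OF C4(2)[of j], of "bracket (k - j)"] by (simp add: mult_ac)
          ultimately show ?thesis unfolding distrib_left by linarith
        qed
        finally have "(bracket k * \<bar>ww a b\<bar>) * cmod (osc (lam a - lam b)) \<le> (2 * C4 * bracket (k - j)) * T"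
          using C4(1) by (intro mult_mono[where b = "2 * C4 * bracket (k - j)" and d = T] norm_osc_le) auto
        then have "(bracket k * (\<bar>ww a b\<bar> * cmod (osc (lam a - lam b)))) * (cmod (GGm k j) * bracket (k - j) ^ n)
          \<le> ((2 * C4 * bracket (k - j)) * T) * (cmod (GGm k j) * bracket (k - j) ^ n)"
          unfolding mult.assoc[symmetric] by (intro mult_right_mono) auto
        also have "\<dots> = (2 * C4 * T) * (cmod (GGm k j) * bracket (k - j) ^ Suc n)" by (simp add: mult_ac)
        also have "\<dots> \<le> 2 * C4 * T * C2" using C4(1) T C2[of k j] by (intro mult_left_mono) auto
        finally show ?thesis using nn unfolding main by linarith
      qed
    qed
  qed
  then show "\<exists>C. \<forall>a b. cmod (of_real (bracket (fst a)) * Err a b) * bracket (fst a - fst b) ^ n \<le> C" by blast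
qed

lemma gg_0_T: "gg 0 * of_real T \<noteq> 0"
  using gg_0_pos T by auto

sublocale smoothing_matrix "\<lambda>a. bracket (fst a)" Err "gg 0 * of_real T"
proof
  show "1 \<le> bracket (fst a)" for a :: "int \<times> bool" by (rule bracket_ge1)
  show "finite {a :: int \<times> bool. bracket (fst a) \<le> r}" for r by (rule finite_bracket)
  show "gg 0 * of_real T \<noteq> 0" by (rule gg_0_T)
  fix p :: real assume p: "0 \<le> p"
  have "cmod (of_real (bracket (fst a)) * Err a b) * bracket (fst a) powr p * bracket (fst b) powr (-p)
      = cmod (Err a b) * bracket (fst a) powr (p + 1) * bracket (fst b) powr (-p)" for a b
    by (simp add: norm_mult powr_add mult_ac)
  then show "\<exists>R. \<forall>F. finite F \<longrightarrow>
        (\<forall>a. (\<Sum>b\<in>F. cmod (Err a b) * bracket (fst a) powr (p + 1) * bracket (fst b) powr (-p)) \<le> R) \<and>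
        (\<forall>b. (\<Sum>a\<in>F. cmod (Err a b) * bracket (fst a) powr (p + 1) * bracket (fst b) powr (-p)) \<le> R)"
    using weighted_Schur[OF off_diagonal_Err bracket_summable_fst p] by simp
qed

lemma op_eq_Mat:
  assumes "x \<in> l2"
  shows "op x a = mapp Mat x a"
proof -
  have s: "(\<lambda>b. norm (Err a b * x b)) summable_on UNIV"
    using lw_summable[OF order_refl] assms by (simp add: lw_0)
  have "((\<lambda>b. Err a b * x b) has_sum mapp Err x a) UNIV"
    unfolding mapp_def by (rule has_sum_infsum[OF Infinite_Sum.abs_summable_summable[OF s]])
  moreover have "((\<lambda>b. (if a = b then gg 0 * of_real T else 0) * x b) has_sum gg 0 * of_real T * x a) UNIV"
    by (rule has_sum_finite_neutralI[where B = "{a}"]) auto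
  ultimately have "((\<lambda>b. Err a b * x b + (if a = b then gg 0 * of_real T else 0) * x b) has_sum mapp Err x a + gg 0 * of_real T * x a) UNIV"
    by (rule has_sum_add)
  moreover have "Err a b * x b + (if a = b then gg 0 * of_real T else 0) * x b = Mat a b * x b" for b
    by (simp add: Err_def left_diff_distrib)
  ultimately show ?thesis by (simp add: op_def mapp_def infsumI add.commute)
qed

end

section \<open>Injectivity of the Gramian\<close>

text \<open>The Weierstrass test gives uniform convergence along finite index sets, which preserves
  continuity and commutes with the integral. It is the tool for every exchange of a mode sum with an
  integral in time or space.\<close>

lemma has_sum_integral:
  fixes \<phi> :: "'i \<Rightarrow> real \<Rightarrow> complex"
  assumes c: "\<And>i. continuous_on {a..b} (\<phi> i)"
    and le: "\<And>i t. t \<in> {a..b} \<Longrightarrow> norm (\<phi> i t) \<le> m i" and m: "m summable_on UNIV"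
  shows "continuous_on {a..b} (\<lambda>t. \<Sum>\<^sub>\<infinity>i. \<phi> i t)"
    and "((\<lambda>i. integral {a..b} (\<phi> i)) has_sum integral {a..b} (\<lambda>t. \<Sum>\<^sub>\<infinity>i. \<phi> i t)) UNIV"
proof -
  have u: "uniform_limit {a..b} (\<lambda>F t. \<Sum>i\<in>F. \<phi> i t) (\<lambda>t. \<Sum>\<^sub>\<infinity>i. \<phi> i t) (finite_subsets_at_top UNIV)"
    by (rule Weierstrass_m_test_general[OF _ m]) (use le in auto)
  have cs: "continuous_on {a..b} (\<lambda>t. \<Sum>i\<in>F. \<phi> i t)" for F by (intro continuous_intros c)
  show "continuous_on {a..b} (\<lambda>t. \<Sum>\<^sub>\<infinity>i. \<phi> i t)"
    by (rule uniform_limit_theorem[OF _ u]) (auto simp: cs)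
  obtain I J where I: "\<And>F. ((\<lambda>t. \<Sum>i\<in>F. \<phi> i t) has_integral I F) {a..b}"
    and J: "((\<lambda>t. \<Sum>\<^sub>\<infinity>i. \<phi> i t) has_integral J) {a..b}" and lim: "(I \<longlongrightarrow> J) (finite_subsets_at_top UNIV)"
    using uniform_limit_integral[OF u cs] by auto
  have "\<forall>\<^sub>F F in finite_subsets_at_top UNIV. I F = (\<Sum>i\<in>F. integral {a..b} (\<phi> i))"
  proof (rule eventually_finite_subsets_at_top_weakI)
    fix F :: "'i set" assume "finite F"
    then have "((\<lambda>t. \<Sum>i\<in>F. \<phi> i t) has_integral (\<Sum>i\<in>F. integral {a..b} (\<phi> i))) {a..b}"
      by (intro has_integral_sum) (auto intro: integrable_integral integrable_continuous_interval c)
    then show "I F = (\<Sum>i\<in>F. integral {a..b} (\<phi> i))" using has_integral_unique[OF I] by blast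
  qed
  then have "((\<lambda>F. \<Sum>i\<in>F. integral {a..b} (\<phi> i)) \<longlongrightarrow> J) (finite_subsets_at_top UNIV)"
    using lim tendsto_cong by fastforce
  then show "((\<lambda>i. integral {a..b} (\<phi> i)) has_sum integral {a..b} (\<lambda>t. \<Sum>\<^sub>\<infinity>i. \<phi> i t)) UNIV"
    unfolding has_sum_def integral_unique[OF J] .
qed

lemma circle_int_integral:
  fixes f :: "real \<Rightarrow> complex"
  assumes "continuous_on {0..2*pi} f"
  shows "circle_int f = integral {0..2*pi} f"
  unfolding circle_int_def
  by (rule set_borel_integral_eq_integral(2)) (intro borel_integrable_atLeastAtMost' assms)

text \<open>Multiplied by \<open>cis y ^ N\<close>, the relation becomes an ordinary polynomial
  equation for \<open>cis y\<close> with infinitely many roots. The subtracted constant sits at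
  exponent \<open>N\<close>, which \<open>k \<noteq> 0\<close> avoids.\<close>

lemma trig_poly_const_on_infinite:
  assumes F: "finite F" and Y: "infinite Y" "Y \<subseteq> {0..<2*pi}" and eq: "\<And>y. y \<in> Y \<Longrightarrow> trig F d y = A"
    and k: "k \<in> F" "k \<noteq> 0"
  shows "d k = 0"
proof -
  \<comment> \<open>Any shift that makes all exponents nonnegative would do; the sum of the absolute
    values is a convenient one.\<close>
  define N where "N = (\<Sum>k\<in>F. nat \<bar>k\<bar>)"
  have N: "0 \<le> j + int N" if "j \<in> F" for j
  proof -
    have "nat \<bar>j\<bar> \<le> N" unfolding N_def using F that by (intro member_le_sum) auto
    then show ?thesis by linarith
  qed
  define p where "p = (\<Sum>j\<in>F. monom (d j) (nat (j + int N))) - monom A N"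
  have "poly p (cis y) = 0" if "y \<in> Y" for y
  proof -
    have m: "cis y ^ nat (j + int N) = cis y ^ N * e j y" if "j \<in> F" for j
      using N[OF that] by (simp add: e_def Complex.DeMoivre cis_mult algebra_simps)
    have "poly p (cis y) = (\<Sum>j\<in>F. d j * cis y ^ nat (j + int N)) - A * cis y ^ N"
      by (simp add: p_def poly_sum poly_monom)
    also have "(\<Sum>j\<in>F. d j * cis y ^ nat (j + int N)) = (\<Sum>j\<in>F. cis y ^ N * (d j * e j y))"
      by (intro sum.cong) (simp_all add: m)
    also have "\<dots> = cis y ^ N * A" 
      unfolding sum_distrib_left[symmetric] using eq[OF that] unfolding trig_def by simp
    finally show ?thesis by (simp add: mult.commute)
  qed
  then have "cis ` Y \<subseteq> {z. poly p z = 0}" by auto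
  moreover have "inj_on cis Y"
  proof (rule inj_onI)
    fix x y assume "x \<in> Y" "y \<in> Y" "cis x = cis y"
    then have "Arg2pi (cis x) = x" "Arg2pi (cis y) = y"
      using Y(2) by (auto intro!: Arg2pi_unique[of 1] simp: cis_conv_exp mult.commute)
    then show "x = y" using \<open>cis x = cis y\<close> by metis
  qed
  then have "infinite (cis ` Y)" using Y(1) finite_image_iff by blast
  ultimately have "infinite {z. poly p z = 0}" using infinite_super by blast
  then have "p = 0" using poly_roots_finite by blast
  then have "coeff p (nat (k + int N)) = 0" by simp
  moreover have "coeff p (nat (k + int N)) = d k"
  proof -
    have inj: "nat (j + int N) = nat (k + int N) \<longleftrightarrow> j = k" if "j \<in> F" for j
      using N[OF that] N[OF k(1)] by (simp add: eq_nat_nat_iff)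
    have "coeff p (nat (k + int N)) = (\<Sum>j\<in>F. if j = k then d j else 0) - (if N = nat (k + int N) then A else 0)"
      unfolding p_def coeff_diff coeff_sum coeff_monom
      by (intro arg_cong2[of _ _ _ _ "(-)"] sum.cong) (auto simp: inj)
    also have "\<dots> = d k" using F k N[OF k(1)] by simp
    finally show ?thesis .
  qed
  ultimately show ?thesis by simp
qed

context control_system
begin

text \<open>A finite set is null, so \<open>g\<close> would otherwise have integral 0 over a period
  instead of 1.\<close>

lemma infinite_support: "\<exists>Y. infinite Y \<and> Y \<subseteq> {0..<2*pi} \<and> (\<forall>y\<in>Y. g y \<noteq> 0)"
proof (rule ccontr)
  assume "\<not> ?thesis"
  then have fin: "finite {y \<in> {0..<2*pi}. g y \<noteq> 0}" by blast
  have "AE y in lborel. y \<notin> {y \<in> {0..<2*pi}. g y \<noteq> 0}"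
    by (rule AE_not_in) (rule countable_imp_null_set_lborel[OF countable_finite[OF fin]])
  moreover have "AE y in lborel. y \<noteq> 2*pi" by (rule AE_lborel_singleton)
  ultimately have "AE y in cm. g y = 0" unfolding AE_cm by eventually_elim auto
  moreover have [measurable]: "g \<in> borel_measurable borel"
    by (intro borel_measurable_continuous_onI smooth_periodic_continuous smooth)
  ultimately have "integral\<^sup>L cm g = integral\<^sup>L cm (\<lambda>x. 0)" by (intro integral_cong_AE) auto
  then show False using total by (simp add: circle_int_cm)
qed

section \<open>The Gramian as an integral over time\<close>

lemma off_diagonal_gram: "off_diagonal fst gram"
  unfolding off_diagonal_def
proof
  fix n
  obtain C where C: "\<And>k j. cmod (GGm k j) * bracket (k - j) ^ n \<le> C"
    using off_diagonal_GGm unfolding off_diagonal_def by meson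
  have "cmod (gram a b) * bracket (fst a - fst b) ^ n \<le> 2 * C" for a b
  proof -
    have "cmod (gram a b) * bracket (fst a - fst b) ^ n = \<bar>ww a b\<bar> * (cmod (GGm (fst a) (fst b)) * bracket (fst a - fst b) ^ n)"
      by (simp add: gram_def norm_mult)
    also have "\<dots> \<le> 2 * C" using abs_ww_le C by (intro mult_mono) auto
    finally show ?thesis .
  qed
  then show "\<exists>C. \<forall>a b. cmod (gram a b) * bracket (fst a - fst b) ^ n \<le> C" by blast
qed

lemma gram_summable:
  assumes "z \<in> l2"
  shows "(\<lambda>b. norm (gram a b * z b)) summable_on UNIV"
proof -
  have "(\<lambda>a. complex_of_real (bracket (fst a) powr 0) * z a) \<in> l2" using assms by simp
  then show ?thesis using weighted_Schur_bound[OF off_diagonal_gram bracket_summable_fst order_refl] by blast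
qed

lemma gram_flow:
  assumes x: "x \<in> l2"
  shows "continuous_on {s..t} (\<lambda>r. mapp gram (flow (- r) x) a)"
    and "cmod (mapp gram (flow (- r) x) a) \<le> (\<Sum>\<^sub>\<infinity>b. cmod (gram a b * x b))"
proof -
  have "(\<lambda>b. norm (gram a b * x b)) summable_on UNIV" by (rule gram_summable[OF x])
  then show "continuous_on {s..t} (\<lambda>r. mapp gram (flow (- r) x) a)"
    unfolding mapp_def
    by (intro has_sum_integral(1)[where m = "\<lambda>b. norm (gram a b * x b)"])
      (auto simp: norm_mult flow_def intro!: continuous_intros)
  have "(\<lambda>b. norm (gram a b * flow (- r) x b)) summable_on UNIV" using x by (intro gram_summable) simp
  from norm_infsum_bound[OF this] show "cmod (mapp gram (flow (- r) x) a) \<le> (\<Sum>\<^sub>\<infinity>b. cmod (gram a b * x b))"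
    by (simp add: mapp_def norm_mult)
qed

text \<open>The phase inside \<open>osc\<close> is split between output and input mode. The sum over
  \<open>b\<close> is dominated by \<open>norm (gram a b * x b)\<close>, which does not depend on
  time, so it may be exchanged with the integral.\<close>

lemma Mat_integral:
  assumes x: "x \<in> l2"
  shows "mapp Mat x a = integral {0..T} (\<lambda>r. cis (lam a * r) * mapp gram (flow (- r) x) a)"
proof -
  let ?\<phi> = "\<lambda>b r. cis (lam a * r) * (gram a b * flow (- r) x b)"
  have s: "(\<lambda>b. norm (gram a b * x b)) summable_on UNIV" by (rule gram_summable[OF x])
  have "((\<lambda>b. integral {0..T} (?\<phi> b)) has_sum integral {0..T} (\<lambda>r. \<Sum>\<^sub>\<infinity>b. ?\<phi> b r)) UNIV"
    by (rule has_sum_integral(2)[OF _ _ s]) (auto simp: norm_mult flow_def intro!: continuous_intros)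
  moreover have "integral {0..T} (?\<phi> b) = Mat a b * x b" for b
  proof -
    have "?\<phi> b r = (gram a b * x b) * cis ((lam a - lam b) * r)" for r
    proof -
      have "cis (lam a * r) * cis (lam b * - r) = cis ((lam a - lam b) * r)" by (simp add: cis_mult left_diff_distrib)
      then show ?thesis unfolding flow_def by (metis mult.assoc mult.commute)
    qed
    then have "?\<phi> b = (\<lambda>r. (gram a b * x b) * cis ((lam a - lam b) * r))" by (rule ext)
    then show ?thesis by (simp add: Mat_def osc_def mult_ac)
  qed
  moreover have "(\<Sum>\<^sub>\<infinity>b. ?\<phi> b r) = cis (lam a * r) * mapp gram (flow (- r) x) a" for r
    unfolding mapp_def by (rule infsum_cmult_right')
  ultimately show ?thesis by (simp add: mapp_def infsumI)
qed

section \<open>Smooth sequences and pointwise observation\<close>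

definition smoothseq :: "(int \<times> bool \<Rightarrow> complex) \<Rightarrow> bool" where
  "smoothseq x \<longleftrightarrow> (\<forall>p\<ge>0. x \<in> lw p)"

lemma smoothseq_l2: "smoothseq x \<Longrightarrow> x \<in> l2"
  unfolding smoothseq_def using lw_0 by blast

text \<open>Multiplication by \<open>lam\<close> costs three orders of weight, harmless when every
  order is available.\<close>

lemma smoothseq_lam:
  assumes "smoothseq x"
  shows "smoothseq (\<lambda>a. of_real (lam a) * x a)"
  unfolding smoothseq_def
proof (intro allI impI)
  fix p :: real assume p: "0 \<le> p"
  obtain C where "0 \<le> C \<and> (\<forall>a. \<bar>lam a\<bar> \<le> C * bracket (fst a) ^ 3)" using lam_bounds(3) by (rule exE)
  then have C: "0 \<le> C" "\<And>a. \<bar>lam a\<bar> \<le> C * bracket (fst a) ^ 3" by auto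
  have x: "(\<lambda>a. of_real (bracket (fst a) powr (p + 3)) * x a) \<in> l2"
    using assms p by (simp add: smoothseq_def lw_def)
  show "(\<lambda>a. of_real (lam a) * x a) \<in> lw p" unfolding lw_def mem_Collect_eq
  proof (rule l2_mono(1)[OF l2_cmult(1)[OF x, of "of_real C"]])
    fix a :: "int \<times> bool"
    have "bracket (fst a) powr (p + 3) = bracket (fst a) powr p * bracket (fst a) ^ 3"
      using powr_realpow[OF bracket_pos, of "fst a" 3] by (simp add: powr_add)
    moreover have "bracket (fst a) powr p * (\<bar>lam a\<bar> * cmod (x a)) \<le> bracket (fst a) powr p * ((C * bracket (fst a) ^ 3) * cmod (x a))"
      by (intro mult_left_mono mult_right_mono C) auto
    ultimately show "cmod (of_real (bracket (fst a) powr p) * (of_real (lam a) * x a)) \<le> cmod (of_real C * (of_real (bracket (fst a) powr (p + 3)) * x a))"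
      using C(1) by (simp add: norm_mult norm_power mult_ac)
  qed
qed

text \<open>Cauchy-Schwarz pairs the square-summable weight of order -1 with the sequence weighted
  to order 2; the product still dominates \<open>x\<close>.\<close>

lemma smoothseq_summable:
  assumes "smoothseq x"
  shows "(\<lambda>b. norm (x b)) summable_on UNIV"
proof -
  have "(\<lambda>a. of_real (bracket (fst a) powr 2) * x a) \<in> l2"
    using assms[unfolded smoothseq_def, rule_format, of 2] unfolding lw_def mem_Collect_eq by simp
  moreover have "(\<lambda>a::int \<times> bool. complex_of_real (bracket (fst a) powr (-1))) \<in> l2"
  proof -
    obtain S where "\<forall>(F :: (int \<times> bool) set) k. finite F \<longrightarrow> (\<Sum>j\<in>F. 1 / bracket (k - fst j) ^ 2) \<le> S"
      using bracket_summable_fst unfolding bracket_summable_def by (rule exE)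
    then have "finite F \<Longrightarrow> (\<Sum>j\<in>F. 1 / bracket (0 - fst j) ^ 2) \<le> S" for F :: "(int \<times> bool) set"
      by blast
    then have S: "finite F \<Longrightarrow> (\<Sum>j\<in>F. 1 / bracket (fst j) ^ 2) \<le> S" for F :: "(int \<times> bool) set"
      by simp
    have "0 \<le> S" using S[of "{}"] by simp
    show ?thesis
      by (rule l2I_sq(1)[where C = "sqrt S"]) (use S \<open>0 \<le> S\<close> in \<open>auto simp: norm_divide powr_minus power_inverse inverse_eq_divide power_divide\<close>)
  qed
  ultimately have "(\<lambda>a. norm (of_real (bracket (fst a) powr (-1)) * (of_real (bracket (fst a) powr 2) * x a))) summable_on UNIV"
    by (intro l2_mult_summable(1))
  moreover have "norm (x a) \<le> norm (of_real (bracket (fst a) powr (-1)) * (of_real (bracket (fst a) powr 2) * x a))" for a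
  proof -
    have "bracket (fst a) powr (-1) * bracket (fst a) powr 2 = bracket (fst a)"
      by (simp add: powr_add[symmetric] power2_eq_square)
    then have "of_real (bracket (fst a) powr (-1)) * (of_real (bracket (fst a) powr 2) * x a) = of_real (bracket (fst a)) * x a"
      by (metis mult.assoc of_real_mult)
    then have "norm (of_real (bracket (fst a) powr (-1)) * (of_real (bracket (fst a) powr 2) * x a)) = bracket (fst a) * norm (x a)"
      by (simp only: norm_mult norm_of_real abs_of_nonneg[OF bracket_nonneg])
    then show ?thesis using mult_right_mono[OF bracket_ge1[of "fst a"] norm_ge_zero[of "x a"]] by simp
  qed
  ultimately show ?thesis by (rule summable_on_comparison_test) auto
qed

lemma G_e_continuous: "continuous_on A (G (e k))"
  unfolding G_eq e_def by (intro continuous_intros smooth_periodic_continuous smooth)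

lemma G_e_bounded: "\<exists>B\<ge>0. \<forall>k y. cmod (G (e k) y) \<le> B"
proof -
  obtain C where C: "\<And>x. \<bar>g x\<bar> \<le> C" using smooth_periodic_bounded[OF smooth] by auto
  have C0: "0 \<le> C" using C[of 0] by linarith
  define D where "D = 1 + n2 (cplx g) * sqrt (2*pi)"
  have "cmod (avg (e k)) \<le> n2 (cplx g) * sqrt (2*pi)" for k
    unfolding avg_def using Cauchy_Schwarz_cm(2)[OF g_L2 L2_circle_e] by simp
  then have "cmod (e k y - avg (e k)) \<le> D" for k y
    using norm_triangle_ineq4[of "e k y" "avg (e k)"] unfolding D_def by (simp add: add.commute order_trans)
  then have "cmod (G (e k) y) \<le> C * D" for k y
    unfolding G_eq norm_mult norm_of_real by (intro mult_mono C C0) auto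
  moreover have "0 \<le> C * D" using C0 by (simp add: D_def)
  ultimately show ?thesis by blast
qed

definition wcp :: "bool \<Rightarrow> int \<times> bool \<Rightarrow> real" where
  "wcp c b = (if c then wu b else wv b)"

text \<open>What \<open>G\<close> makes of the state with eigencoordinates \<open>z\<close>, mode by
  mode: its \<open>u\<close> component for true \<open>c\<close>, its \<open>v\<close> component
  otherwise. For summable \<open>z\<close> the series is continuous in \<open>y\<close>, so that
  vanishing can be asserted at every point.\<close>

definition \<Psi> :: "(int \<times> bool \<Rightarrow> complex) \<Rightarrow> bool \<Rightarrow> real \<Rightarrow> complex" where
  "\<Psi> z c y = (\<Sum>\<^sub>\<infinity>b. z b * (of_real (wcp c b) * G (e (fst b)) y))"

lemma abs_wcp_le: "\<bar>wcp c b\<bar> \<le> 1"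
  using abs_wu_wv_le by (simp add: wcp_def)

lemma \<Psi>_term_bound: "\<exists>B\<ge>0. \<forall>c b y. cmod (of_real (wcp c b) * G (e (fst b)) y) \<le> B"
proof -
  obtain B where "0 \<le> B \<and> (\<forall>k y. cmod (G (e k) y) \<le> B)" using G_e_bounded by (rule exE)
  then have B: "0 \<le> B" "\<And>k y. cmod (G (e k) y) \<le> B" by auto
  have "cmod (of_real (wcp c b) * G (e (fst b)) y) \<le> 1 * B" for c b y
    unfolding norm_mult norm_of_real by (intro mult_mono abs_wcp_le B) auto
  then show ?thesis using B(1) by auto
qed

lemma \<Psi>_majorant:
  assumes "(\<lambda>b. norm (z b)) summable_on UNIV"
  shows "\<exists>m. m summable_on UNIV \<and> (\<forall>c b y. norm (z b * (of_real (wcp c b) * G (e (fst b)) y)) \<le> m b)"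
proof -
  obtain B where "0 \<le> B \<and> (\<forall>c b y. cmod (of_real (wcp c b) * G (e (fst b)) y) \<le> B)" using \<Psi>_term_bound by (rule exE)
  then have B: "\<And>c b y. cmod (of_real (wcp c b) * G (e (fst b)) y) \<le> B" by auto
  have "(\<lambda>b. norm (z b) * B) summable_on UNIV" using assms by (rule summable_on_cmult_left)
  moreover have "norm (z b * (of_real (wcp c b) * G (e (fst b)) y)) \<le> norm (z b) * B" for c b y
    unfolding norm_mult[of "z b"] by (intro mult_left_mono B) simp
  ultimately show ?thesis by blast
qed

lemma \<Psi>_continuous:
  assumes "(\<lambda>b. norm (z b)) summable_on UNIV"
  shows "continuous_on {s..t} (\<Psi> z c)"
proof -
  obtain m where "m summable_on UNIV \<and> (\<forall>c b y. norm (z b * (of_real (wcp c b) * G (e (fst b)) y)) \<le> m b)"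
    using \<Psi>_majorant[OF assms] by (rule exE)
  then show ?thesis unfolding \<Psi>_def[abs_def]
    by (intro has_sum_integral(1)[where m = m]) (auto intro!: continuous_intros G_e_continuous)
qed

lemma gram_eq_inner:
  "gram a b = (\<Sum>c\<in>UNIV. of_real (wcp c a) * integral {0..2*pi} (\<lambda>y. (of_real (wcp c b) * G (e (fst b)) y) * G (e (- fst a)) y)) / (2*pi)"
proof -
  have "circle_int (\<lambda>y. G (e (fst b)) y * G (e (- fst a)) y) = integral {0..2*pi} (\<lambda>y. G (e (fst b)) y * G (e (- fst a)) y)"
    by (intro circle_int_integral continuous_intros G_e_continuous)
  moreover have "integral {0..2*pi} (\<lambda>y. (of_real (wcp c b) * G (e (fst b)) y) * G (e (- fst a)) y) = of_real (wcp c b) * integral {0..2*pi} (\<lambda>y. G (e (fst b)) y * G (e (- fst a)) y)" for c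
    by (simp add: mult.assoc)
  ultimately show ?thesis
    by (simp add: gram_def GGm_eq_inner UNIV_bool wcp_def ww_def algebra_simps add_divide_distrib)
qed

lemma gram_\<Psi>:
  assumes "(\<lambda>b. norm (z b)) summable_on UNIV"
  shows "mapp gram z a = (\<Sum>c\<in>UNIV. of_real (wcp c a) * integral {0..2*pi} (\<lambda>y. \<Psi> z c y * G (e (- fst a)) y)) / (2*pi)"
proof -
  obtain B where "0 \<le> B \<and> (\<forall>k y. cmod (G (e k) y) \<le> B)" using G_e_bounded by (rule exE)
  then have B: "0 \<le> B" "\<And>k y. cmod (G (e k) y) \<le> B" by auto
  obtain m where "m summable_on UNIV \<and> (\<forall>c b y. norm (z b * (of_real (wcp c b) * G (e (fst b)) y)) \<le> m b)"
    using \<Psi>_majorant[OF assms] by (rule exE)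
  then have m: "m summable_on UNIV" "\<And>c b y. norm (z b * (of_real (wcp c b) * G (e (fst b)) y)) \<le> m b" by auto
  have m0: "0 \<le> m b" for b using m(2)[of b] norm_ge_zero order_trans by blast
  let ?\<phi> = "\<lambda>c b y. (z b * (of_real (wcp c b) * G (e (fst b)) y)) * G (e (- fst a)) y"
  have "((\<lambda>b. integral {0..2*pi} (?\<phi> c b)) has_sum integral {0..2*pi} (\<lambda>y. \<Sum>\<^sub>\<infinity>b. ?\<phi> c b y)) UNIV" for c
  proof (rule has_sum_integral(2)[where m = "\<lambda>b. m b * B"])
    show "(\<lambda>b. m b * B) summable_on UNIV" using m(1) by (rule summable_on_cmult_left)
    show "norm (?\<phi> c b y) \<le> m b * B" for b y
      unfolding norm_mult[of "_ * _" "G _ _"] by (intro mult_mono m B m0) simp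
  qed (intro continuous_intros G_e_continuous)
  moreover have "(\<Sum>\<^sub>\<infinity>b. ?\<phi> c b y) = \<Psi> z c y * G (e (- fst a)) y" for c y
    unfolding \<Psi>_def by (rule infsum_cmult_left')
  moreover have "integral {0..2*pi} (?\<phi> c b) = z b * integral {0..2*pi} (\<lambda>y. (of_real (wcp c b) * G (e (fst b)) y) * G (e (- fst a)) y)" for c b
    by (simp add: mult.assoc)
  ultimately have "((\<lambda>b. z b * integral {0..2*pi} (\<lambda>y. (of_real (wcp c b) * G (e (fst b)) y) * G (e (- fst a)) y)) has_sum
      integral {0..2*pi} (\<lambda>y. \<Psi> z c y * G (e (- fst a)) y)) UNIV" for c
    by simp
  then have "((\<lambda>b. \<Sum>c\<in>UNIV. of_real (wcp c a) / (2*pi) * (z b * integral {0..2*pi} (\<lambda>y. (of_real (wcp c b) * G (e (fst b)) y) * G (e (- fst a)) y))) has_sum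
      (\<Sum>c\<in>UNIV. of_real (wcp c a) / (2*pi) * integral {0..2*pi} (\<lambda>y. \<Psi> z c y * G (e (- fst a)) y))) UNIV"
    by (intro has_sum_finite_sum has_sum_cmult_right) auto
  moreover have "(\<Sum>c\<in>UNIV. of_real (wcp c a) / (2*pi) * (z b * integral {0..2*pi} (\<lambda>y. (of_real (wcp c b) * G (e (fst b)) y) * G (e (- fst a)) y))) = gram a b * z b" for b
    unfolding gram_eq_inner sum_divide_distrib sum_distrib_right by (intro sum.cong) (simp_all add: mult_ac)
  ultimately show ?thesis
    by (simp add: mapp_def infsumI sum_divide_distrib)
qed

text \<open>Expanding one factor of \<open>(cmod (\<Psi> z c y))\<^sup>2\<close> termwise and using
  that conjugation of \<open>G (e j)\<close> reverses the frequency yields the entries of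
  \<open>gram\<close>. The form is thus the observed energy, and nonnegative.\<close>

lemma gram_form:
  assumes s: "(\<lambda>b. norm (z b)) summable_on UNIV"
  shows "((\<lambda>a. cnj (z a) * mapp gram z a) has_sum of_real ((\<Sum>c\<in>UNIV. integral {0..2*pi} (\<lambda>y. (cmod (\<Psi> z c y))\<^sup>2)) / (2*pi))) UNIV"
proof -
  obtain m where "m summable_on UNIV \<and> (\<forall>c b y. norm (z b * (of_real (wcp c b) * G (e (fst b)) y)) \<le> m b)"
    using \<Psi>_majorant[OF s] by (rule exE)
  then have m: "m summable_on UNIV" "\<And>c b y. norm (z b * (of_real (wcp c b) * G (e (fst b)) y)) \<le> m b" by auto
  have m0: "0 \<le> m b" for b using m(2)[of b] norm_ge_zero order_trans by blast
  let ?\<phi> = "\<lambda>c a y. \<Psi> z c y * cnj (z a * (of_real (wcp c a) * G (e (fst a)) y))"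
  have "((\<lambda>a. integral {0..2*pi} (?\<phi> c a)) has_sum integral {0..2*pi} (\<lambda>y. \<Sum>\<^sub>\<infinity>a. ?\<phi> c a y)) UNIV" for c
  proof -
    have "compact (\<Psi> z c ` {0..2*pi})" by (intro compact_continuous_image \<Psi>_continuous s) simp
    then obtain C where C: "\<And>y. y \<in> {0..2*pi} \<Longrightarrow> norm (\<Psi> z c y) \<le> C"
      using compact_imp_bounded bounded_iff by (metis imageI)
    have C0: "0 \<le> C" by (rule order_trans[OF norm_ge_zero C[of 0]]) simp
    show ?thesis
    proof (rule has_sum_integral(2)[where m = "\<lambda>a. C * m a"])
      show "(\<lambda>b. C * m b) summable_on UNIV" using m(1) by (rule summable_on_cmult_right)
      show "norm (?\<phi> c a y) \<le> C * m a" if "y \<in> {0..2*pi}" for a y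
        unfolding norm_mult[of "\<Psi> _ _ _"] complex_mod_cnj by (intro mult_mono m C that C0 m0) simp
      show "continuous_on {0..2*pi} (?\<phi> c a)" for a
        by (intro continuous_intros G_e_continuous \<Psi>_continuous s)
    qed
  qed
  moreover have "(\<Sum>\<^sub>\<infinity>a. ?\<phi> c a y) = of_real ((cmod (\<Psi> z c y))\<^sup>2)" for c y
  proof -
    have "(\<Sum>\<^sub>\<infinity>a. ?\<phi> c a y) = \<Psi> z c y * (\<Sum>\<^sub>\<infinity>a. cnj (z a * (of_real (wcp c a) * G (e (fst a)) y)))"
      by (rule infsum_cmult_right')
    also have "(\<Sum>\<^sub>\<infinity>a. cnj (z a * (of_real (wcp c a) * G (e (fst a)) y))) = cnj (\<Psi> z c y)"
      unfolding \<Psi>_def by (rule infsum_cnj)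
    finally show ?thesis by (simp only: complex_norm_square)
  qed
  moreover have "integral {0..2*pi} (\<lambda>y. complex_of_real ((cmod (\<Psi> z c y))\<^sup>2)) = of_real (integral {0..2*pi} (\<lambda>y. (cmod (\<Psi> z c y))\<^sup>2))" for c
  proof (rule integral_unique, rule has_integral_of_real, rule integrable_integral)
    show "(\<lambda>y. (cmod (\<Psi> z c y))\<^sup>2) integrable_on {0..2*pi}"
      by (intro integrable_continuous_interval continuous_intros \<Psi>_continuous s)
  qed
  ultimately have "((\<lambda>a. integral {0..2*pi} (?\<phi> c a)) has_sum of_real (integral {0..2*pi} (\<lambda>y. (cmod (\<Psi> z c y))\<^sup>2))) UNIV" for c
    by simp
  then have "((\<lambda>a. \<Sum>c\<in>UNIV. integral {0..2*pi} (?\<phi> c a) / (2*pi)) has_sum (\<Sum>c\<in>UNIV. complex_of_real (integral {0..2*pi} (\<lambda>y. (cmod (\<Psi> z c y))\<^sup>2)) / (2*pi))) UNIV"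
    by (intro has_sum_finite_sum has_sum_divide_const) auto
  moreover have "(\<Sum>c\<in>UNIV. integral {0..2*pi} (?\<phi> c a) / (2*pi)) = cnj (z a) * mapp gram z a" for a
  proof -
    have "integral {0..2*pi} (?\<phi> c a) = cnj (z a) * (of_real (wcp c a) * integral {0..2*pi} (\<lambda>y. \<Psi> z c y * G (e (- fst a)) y))" for c
    proof -
      have "?\<phi> c a = (\<lambda>y. (cnj (z a) * of_real (wcp c a)) * (\<Psi> z c y * G (e (- fst a)) y))"
        by (simp add: cnj_G_e mult_ac)
      then show ?thesis by (simp add: mult.assoc)
    qed
    then show ?thesis unfolding gram_\<Psi>[OF s] by (simp add: sum_distrib_left sum_divide_distrib)
  qed
  ultimately show ?thesis by (simp add: sum_divide_distrib)
qed

section \<open>Unobservable states\<close>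

definition control_kernel :: "(int \<times> bool \<Rightarrow> complex) set" where
  "control_kernel = {x. smoothseq x \<and> (\<forall>r\<in>{0..T}. \<forall>c. \<forall>y\<in>{0..2*pi}. \<Psi> (flow (- r) x) c y = 0)}"

lemma smoothseq_flow_summable: "smoothseq x \<Longrightarrow> (\<lambda>b. norm (flow r x b)) summable_on UNIV"
  using smoothseq_summable by simp

text \<open>Pairing \<open>mapp Mat x\<close> with \<open>x\<close> gives the observed energy
  integrated over time. A continuous nonnegative integrand with zero integral vanishes; this is used
  in time and then in space.\<close>

lemma Mat_zero_imp_kernel:
  assumes x: "smoothseq x" and 0: "\<And>a. mapp Mat x a = 0"
  shows "x \<in> control_kernel"
proof -
  note x2 = smoothseq_l2[OF x]
  obtain R where "0 \<le> R \<and> (\<forall>z. (\<lambda>a. complex_of_real (bracket (fst a) powr 0) * z a) \<in> l2 \<longrightarrow>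
     (\<forall>a. (\<lambda>b. norm (gram a b * z b)) summable_on UNIV) \<and> (\<lambda>a. of_real (bracket (fst a) powr 0) * mapp gram z a) \<in> l2 \<and>
     l2n (\<lambda>a. of_real (bracket (fst a) powr 0) * mapp gram z a) \<le> R * l2n (\<lambda>a. of_real (bracket (fst a) powr 0) * z a))"
    using weighted_Schur_bound[OF off_diagonal_gram bracket_summable_fst order_refl] by (rule exE)
  then have R: "mapp gram z \<in> l2" "l2n (mapp gram z) \<le> R * l2n z" if "z \<in> l2" for z using that by auto
  let ?F = "\<lambda>a r. cis (lam a * r) * mapp gram (flow (- r) x) a"
  let ?Q = "\<lambda>r. (\<Sum>c\<in>UNIV. integral {0..2*pi} (\<lambda>y. (cmod (\<Psi> (flow (- r) x) c y))\<^sup>2)) / (2*pi)"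
  have bF: "cmod (?F a r) \<le> R * l2n x" for a r
  proof -
    have f: "flow (- r) x \<in> l2" using x2 by simp
    have "cmod (mapp gram (flow (- r) x) a) \<le> l2n (mapp gram (flow (- r) x))" by (rule norm_le_l2n[OF R(1)[OF f]])
    also have "\<dots> \<le> R * l2n (flow (- r) x)" by (rule R(2)[OF f])
    also have "l2n (flow (- r) x) = l2n x" by (rule l2n_cong) simp
    finally show ?thesis by (simp add: norm_mult)
  qed
  have cF: "continuous_on {0..T} (?F a)" for a
    by (intro continuous_intros gram_flow(1) x2)
  have s: "(\<lambda>a. norm (x a) * (R * l2n x)) summable_on UNIV"
    by (rule summable_on_cmult_left[OF smoothseq_summable[OF x]])
  have c: "continuous_on {0..T} (\<lambda>r. cnj (x a) * ?F a r)" for a by (intro continuous_intros cF)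
  have b: "norm (cnj (x a) * ?F a r) \<le> norm (x a) * (R * l2n x)" for a r
    unfolding norm_mult[of "cnj _"] complex_mod_cnj by (intro mult_left_mono bF) simp
  note H = has_sum_integral[OF c b s]
  have Q: "(\<Sum>\<^sub>\<infinity>a. cnj (x a) * ?F a r) = of_real (?Q r)" for r
  proof -
    have "(\<lambda>a. cnj (x a) * ?F a r) = (\<lambda>a. cnj (flow (- r) x a) * mapp gram (flow (- r) x) a)"
    proof
      fix a
      have "cnj (flow (- r) x a) = cnj (x a) * cis (lam a * r)" by (simp add: flow_def cis_cnj mult.commute)
      then show "cnj (x a) * ?F a r = cnj (flow (- r) x a) * mapp gram (flow (- r) x) a" by simp
    qed
    then show ?thesis by (simp only: infsumI[OF gram_form[OF smoothseq_flow_summable[OF x]]])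
  qed
  have Is: "integral {0..T} (\<lambda>r. cnj (x a) * ?F a r) = 0" for a
    using Mat_integral[OF x2, of a] 0[of a] by simp
  have "((\<lambda>a :: int \<times> bool. 0) has_sum integral {0..T} (\<lambda>r. complex_of_real (?Q r))) UNIV"
    using H(2) unfolding Q Is .
  from has_sum_unique[OF this has_sum_0_simp] have "integral {0..T} (\<lambda>r. complex_of_real (?Q r)) = 0" .
  \<comment> \<open>The energy inherits continuity in time from the uniformly convergent mode sum
    that represents it.\<close>
  moreover have cQ: "continuous_on {0..T} ?Q"
  proof -
    have "continuous_on {0..T} (\<lambda>r. Re (complex_of_real (?Q r)))"
      using H(1) unfolding Q by (intro continuous_on_Re)
    then show ?thesis by simp
  qed
  moreover have "integral {0..T} (\<lambda>r. complex_of_real (?Q r)) = of_real (integral {0..T} ?Q)"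
    by (rule integral_unique, rule has_integral_of_real, rule integrable_integral, rule integrable_continuous_interval, rule cQ)
  ultimately have I0: "integral {0..T} ?Q = 0" by simp
  have sq_int: "(\<lambda>y. (cmod (\<Psi> (flow (- r) x) c y))\<^sup>2) integrable_on {0..2*pi}"
    and sq_cont: "continuous_on {0..2*pi} (\<lambda>y. (cmod (\<Psi> (flow (- r) x) c y))\<^sup>2)" for r c
    by (intro integrable_continuous_interval continuous_intros \<Psi>_continuous smoothseq_flow_summable x)+
  have sq_nn: "0 \<le> integral {0..2*pi} (\<lambda>y. (cmod (\<Psi> (flow (- r) x) c y))\<^sup>2)" for r c
    by (rule integral_nonneg[OF sq_int]) simp
  have Q_nn: "0 \<le> ?Q r" for r by (intro divide_nonneg_nonneg sum_nonneg sq_nn) simp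
  have Q0: "?Q r = 0" if "r \<in> {0..T}" for r
    by (rule integral_eq_0_iff[OF cQ T Q_nn, THEN iffD1, OF I0, THEN bspec, OF that])
  have i0: "integral {0..2*pi} (\<lambda>y. (cmod (\<Psi> (flow (- r) x) c y))\<^sup>2) = 0" if "r \<in> {0..T}" for r c
  proof -
    have "(\<Sum>c\<in>UNIV. integral {0..2*pi} (\<lambda>y. (cmod (\<Psi> (flow (- r) x) c y))\<^sup>2)) = 0"
      using Q0[OF that] by (simp only: divide_eq_0_iff) simp
    from sum_nonneg_0[OF _ _ this UNIV_I[of c]] sq_nn show ?thesis by simp
  qed
  have "\<Psi> (flow (- r) x) c y = 0" if "r \<in> {0..T}" "y \<in> {0..2*pi}" for r c y
  proof -
    have "(cmod (\<Psi> (flow (- r) x) c y))\<^sup>2 = 0"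
      by (rule integral_eq_0_iff[OF sq_cont _ _, THEN iffD1, OF _ _ i0[OF that(1)], THEN bspec, OF _ _ that(2)]) simp_all
    then show ?thesis by simp
  qed
  then show ?thesis using x by (simp add: control_kernel_def)
qed

text \<open>The converse direction returns the multiples by powers of \<open>lam\<close> to the
  kernel of \<open>op\<close>, where finitely many coordinates decide.\<close>

lemma kernel_imp_Mat_zero:
  assumes "x \<in> control_kernel"
  shows "mapp Mat x a = 0"
proof -
  have x: "smoothseq x" and 0: "\<And>r c y. r \<in> {0..T} \<Longrightarrow> y \<in> {0..2*pi} \<Longrightarrow> \<Psi> (flow (- r) x) c y = 0"
    using assms by (auto simp: control_kernel_def)
  have "mapp gram (flow (- r) x) a = 0" if "r \<in> {0..T}" for r
  proof -
    have "integral {0..2*pi} (\<lambda>y. \<Psi> (flow (- r) x) c y * G (e (- fst a)) y) = integral {0..2*pi} (\<lambda>y. 0)" for c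
      by (rule integral_cong) (simp add: 0[OF that])
    then show ?thesis unfolding gram_\<Psi>[OF smoothseq_flow_summable[OF x]] by simp
  qed
  then have "integral {0..T} (\<lambda>r. cis (lam a * r) * mapp gram (flow (- r) x) a) = integral {0..T} (\<lambda>r. 0)"
    by (intro integral_cong) simp
  then show ?thesis unfolding Mat_integral[OF smoothseq_l2[OF x]] by simp
qed

text \<open>Multiplication by \<open>lam\<close> is differentiation in time.\<close>

lemma kernel_lam:
  assumes "x \<in> control_kernel"
  shows "(\<lambda>a. of_real (lam a) * x a) \<in> control_kernel" (is "?x' \<in> _")
proof -
  have x: "smoothseq x" and 0: "\<And>r c y. r \<in> {0..T} \<Longrightarrow> y \<in> {0..2*pi} \<Longrightarrow> \<Psi> (flow (- r) x) c y = 0"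
    using assms by (auto simp: control_kernel_def)
  have x': "smoothseq ?x'" by (rule smoothseq_lam[OF x])
  obtain m where "m summable_on UNIV \<and> (\<forall>c b y. norm (?x' b * (of_real (wcp c b) * G (e (fst b)) y)) \<le> m b)"
    using \<Psi>_majorant[OF smoothseq_summable[OF x']] by (rule exE)
  then have m: "m summable_on UNIV" "\<And>c b y. norm (?x' b * (of_real (wcp c b) * G (e (fst b)) y)) \<le> m b" by auto
  have "\<Psi> (flow (- t) ?x') c y = 0" if t: "t \<in> {0..T}" and y: "y \<in> {0..2*pi}" for t c y
  proof -
    define \<kappa> where "\<kappa> b = of_real (wcp c b) * G (e (fst b)) y" for b
    let ?\<phi> = "\<lambda>b r. flow (- r) ?x' b * \<kappa> b"
    have cont: "continuous_on {0..s} (?\<phi> b)" for b s unfolding flow_def by (intro continuous_intros)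
    have bd: "norm (?\<phi> b r) \<le> m b" for b r using m(2)[of b c y] by (simp add: norm_mult \<kappa>_def)
    have \<Psi>: "\<Psi> (flow (- r) z) c y = (\<Sum>\<^sub>\<infinity>b. flow (- r) z b * \<kappa> b)" for r z by (simp add: \<Psi>_def \<kappa>_def)
    have h: "continuous_on {0..T} (\<lambda>r. \<Psi> (flow (- r) ?x') c y)"
      unfolding \<Psi> by (rule has_sum_integral(1)[OF cont bd m(1)])
    \<comment> \<open>Instead of differentiating the series for \<open>x\<close> termwise, the
      series for \<open>?x'\<close> is integrated termwise: the result is a multiple of the
      difference of two observations of \<open>x\<close>, both zero. Its continuous integrand must
      then vanish.\<close>
    have "integral {0..s} (\<lambda>r. \<Psi> (flow (- r) ?x') c y) = 0" if s: "s \<in> {0..T}" for s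
    proof -
      have "integral {0..s} (?\<phi> b) = \<i> * (flow (- s) x b * \<kappa> b - flow (- 0) x b * \<kappa> b)" for b
      proof (rule integral_unique)
        have "((\<lambda>r. \<i> * (flow (- r) x b * \<kappa> b)) has_vector_derivative ?\<phi> b r) (at r within {0..s})" for r
        proof -
          have fe: "\<i> * (flow (- r) x b * \<kappa> b) = (\<i> * x b * \<kappa> b) * exp (- (\<i> * of_real (lam b)) * of_real r)" for r
            by (simp add: flow_def cis_conv_exp mult_ac)
          have ge: "?\<phi> b r = (\<i> * x b * \<kappa> b) * (- (\<i> * of_real (lam b)) * exp (- (\<i> * of_real (lam b)) * of_real r))"
            by (simp add: flow_def cis_conv_exp mult_ac)
          show ?thesis unfolding fe ge
            by (rule has_vector_derivative_real_field) (auto intro!: derivative_eq_intros)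
        qed
        then have "(?\<phi> b has_integral (\<i> * (flow (- s) x b * \<kappa> b) - \<i> * (flow (- 0) x b * \<kappa> b))) {0..s}"
          using s by (intro fundamental_theorem_of_calculus) auto
        then show "(?\<phi> b has_integral \<i> * (flow (- s) x b * \<kappa> b - flow (- 0) x b * \<kappa> b)) {0..s}"
          by (simp add: right_diff_distrib)
      qed
      with has_sum_integral(2)[OF cont bd m(1), of s]
      have A: "((\<lambda>b. \<i> * (flow (- s) x b * \<kappa> b - flow (- 0) x b * \<kappa> b)) has_sum integral {0..s} (\<lambda>r. \<Psi> (flow (- r) ?x') c y)) UNIV"
        unfolding \<Psi> by simp
      obtain m0 where "m0 summable_on UNIV \<and> (\<forall>c b y. norm (x b * (of_real (wcp c b) * G (e (fst b)) y)) \<le> m0 b)"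
        using \<Psi>_majorant[OF smoothseq_summable[OF x]] by (rule exE)
      then have m0: "m0 summable_on UNIV" "\<And>c b y. norm (x b * (of_real (wcp c b) * G (e (fst b)) y)) \<le> m0 b" by auto
      have hs: "((\<lambda>b. flow (- r) x b * \<kappa> b) has_sum 0) UNIV" if r: "r \<in> {0..T}" for r
      proof -
        have "(\<lambda>b. norm (flow (- r) x b * \<kappa> b)) summable_on UNIV"
          by (rule Infinite_Sum.abs_summable_on_comparison_test'[OF m0(1)]) (use m0(2)[of _ c y] in \<open>simp add: norm_mult \<kappa>_def\<close>)
        from has_sum_infsum[OF Infinite_Sum.abs_summable_summable[OF this]]
        show ?thesis using 0[OF r y, of c] unfolding \<Psi> by simp
      qed
      have "((\<lambda>b. \<i> * (flow (- s) x b * \<kappa> b + - (flow (- 0) x b * \<kappa> b))) has_sum \<i> * (0 + - 0)) UNIV"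
        using T s by (intro has_sum_cmult_right has_sum_add has_sum_uminusI hs) auto
      then show ?thesis using has_sum_unique[OF A] by simp
    qed
    note I0 = this
    \<comment> \<open>Differentiating within \<open>{0..T}\<close> includes the endpoints through
      one-sided derivatives.\<close>
    have D: "((\<lambda>s. integral {0..s} (\<lambda>r. \<Psi> (flow (- r) ?x') c y)) has_vector_derivative \<Psi> (flow (- t) ?x') c y) (at t within {0..T})"
      by (rule integral_has_vector_derivative[OF h t])
    have D0: "((\<lambda>s. 0) has_vector_derivative \<Psi> (flow (- t) ?x') c y) (at t within {0..T})"
      by (rule has_vector_derivative_transform[OF t _ D]) (simp add: I0)
    show ?thesis
      by (rule vector_derivative_unique_within_closed_interval[OF T _ D0[folded cbox_interval] has_vector_derivative_const])
        (use t in simp)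
  qed
  then show ?thesis using x' by (simp add: control_kernel_def)
qed

text \<open>Only time 0 is used: wherever \<open>g\<close> is nonzero, each component of the state,
  a trigonometric polynomial, equals its \<open>g\<close>-average.\<close>

lemma kernel_finite_support:
  assumes x: "x \<in> control_kernel" and fin: "finite {b. x b \<noteq> 0}" and Z: "\<And>b. fst b = 0 \<Longrightarrow> x b = 0"
  shows "x = (\<lambda>b. 0)"
proof -
  define S where "S = {b. x b \<noteq> 0}"
  define F where "F = fst ` S"
  have fF: "finite F" using fin by (simp add: S_def F_def)
  define d where "d c k = (\<Sum>\<sigma>\<in>UNIV. x (k, \<sigma>) * of_real (wcp c (k, \<sigma>)))" for c k
  obtain Y where Y: "infinite Y" "Y \<subseteq> {0..<2*pi}" "\<And>y. y \<in> Y \<Longrightarrow> g y \<noteq> 0" using infinite_support by auto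
  have "\<exists>A. \<forall>y\<in>Y. trig F (d c) y = A" for c
  proof (intro exI ballI)
    fix y assume y: "y \<in> Y"
    then have y2: "y \<in> {0..2*pi}" using Y(2) by auto
    have sum_S: "(\<Sum>\<^sub>\<infinity>b. x b * \<kappa> b) = (\<Sum>k\<in>F. \<Sum>\<sigma>\<in>UNIV. x (k, \<sigma>) * \<kappa> (k, \<sigma>))" for \<kappa> :: "int \<times> bool \<Rightarrow> complex"
    proof -
      have "(\<Sum>\<^sub>\<infinity>b. x b * \<kappa> b) = (\<Sum>\<^sub>\<infinity>b\<in>F \<times> UNIV. x b * \<kappa> b)"
        by (rule infsum_cong_neutral) (auto simp: F_def S_def image_iff)
      also have "\<dots> = (\<Sum>b\<in>F \<times> UNIV. x b * \<kappa> b)" using fF by (intro infsum_finite) auto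
      finally show ?thesis by (simp add: sum.cartesian_product)
    qed
    have "\<forall>r\<in>{0..T}. \<forall>c. \<forall>y\<in>{0..2*pi}. \<Psi> (flow (- r) x) c y = 0" using x by (simp add: control_kernel_def)
    from this[rule_format, of 0 y c] have "0 = \<Psi> (flow (- 0) x) c y" using T y2 by simp
    also have "\<dots> = (\<Sum>\<^sub>\<infinity>b. x b * (of_real (wcp c b) * (of_real (g y) * (e (fst b) y - avg (e (fst b))))))"
      by (simp add: \<Psi>_def flow_def G_eq)
    also have "\<dots> = of_real (g y) * (trig F (d c) y - (\<Sum>k\<in>F. d c k * avg (e k)))"
      unfolding sum_S trig_def d_def by (simp add: sum_distrib_left sum_distrib_right sum_subtractf algebra_simps UNIV_bool sum.distrib)
    finally show "trig F (d c) y = (\<Sum>k\<in>F. d c k * avg (e k))" using Y(3)[OF y] by simp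
  qed
  then have d0: "d c k = 0" if "k \<in> F" "k \<noteq> 0" for c k
    using trig_poly_const_on_infinite[OF fF Y(1,2) _ that] by blast
  have "x (k, \<sigma>) = 0" for k \<sigma>
  proof (cases "k \<in> F \<and> k \<noteq> 0")
    case True
    \<comment> \<open>The two eigenvectors at one frequency are orthonormal, so the coordinate is
      recovered from the two components.\<close>
    have "(\<Sum>c\<in>UNIV. of_real (wcp c (k, \<sigma>)) * d c k) = (\<Sum>\<tau>\<in>UNIV. of_real (ww (k, \<sigma>) (k, \<tau>)) * x (k, \<tau>))"
      by (simp add: d_def UNIV_bool wcp_def ww_def algebra_simps)
    also have "\<dots> = x (k, \<sigma>)"
      using ww_self[of "(k, \<sigma>)"] ww_opposite[of \<sigma> "\<not> \<sigma>" k] by (cases \<sigma>) (simp_all add: UNIV_bool)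
    finally show ?thesis using d0 True by simp
  next
    case False
    then show ?thesis using Z[of "(k, \<sigma>)"] by (auto simp: F_def S_def image_iff)
  qed
  then show ?thesis by (auto simp: fun_eq_iff)
qed

abbreviation zero_modes :: "(int \<times> bool) set" where "zero_modes \<equiv> {a. fst a = 0}"

lemma Mat_zero_mode: "fst a = 0 \<Longrightarrow> mapp Mat x a = 0"
  by (simp add: mapp_def Mat_def gram_def GGm_0)

text \<open>Products of \<open>x\<close> with powers of \<open>lam\<close> stay in the kernel. More
  of them than determining coordinates are dependent there, so a combination vanishes identically;
  this reads \<open>P (lam a) * x a = 0\<close> for a nonzero polynomial \<open>P\<close> and
  confines \<open>x\<close> to finitely many level sets.\<close>

theorem op_injective:
  assumes x: "x \<in> l2" "\<And>a. a \<in> zero_modes \<Longrightarrow> x a = 0" "\<And>a. a \<notin> zero_modes \<Longrightarrow> op x a = 0"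
  shows "x = (\<lambda>a. 0)"
proof -
  have sx: "smoothseq x"
    unfolding smoothseq_def using regularity[OF x] by blast
  have "mapp Mat x a = 0" for a
    using x(3)[of a] Mat_zero_mode[of a x] op_eq_Mat[OF x(1), of a] by (cases "fst a = 0") auto
  then have K: "x \<in> control_kernel" by (rule Mat_zero_imp_kernel[OF sx])
  obtain L where L0: "finite L \<and> (\<forall>x\<in>l2. (\<forall>a\<in>zero_modes \<union> L. x a = 0) \<and> (\<forall>a. a \<notin> zero_modes \<longrightarrow> op x a = 0) \<longrightarrow> x = (\<lambda>a. 0))"
    using finite_dimensional_kernel[of zero_modes] by (rule exE)
  have L: "finite L" "z = (\<lambda>a. 0)"
    if "z \<in> l2" "\<And>a. a \<in> zero_modes \<union> L \<Longrightarrow> z a = 0" "\<And>a. a \<notin> zero_modes \<Longrightarrow> op z a = 0" for z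
    using conjunct1[OF L0] conjunct2[OF L0, THEN bspec, OF that(1)] that(2,3) by simp_all
  have fL: "finite L" using L0 by (rule conjunct1)
  define v where "v i a = of_real (lam a) ^ i * x a" for i :: nat and a
  have vK: "v i \<in> control_kernel" for i
  proof (induction i)
    case 0
    then show ?case using K by (simp add: v_def[abs_def])
  next
    case (Suc i)
    then show ?case using kernel_lam[OF Suc] by (simp add: v_def[abs_def] mult.assoc)
  qed
  have vl: "v i \<in> l2" for i using vK[of i] smoothseq_l2 by (auto simp: control_kernel_def)
  \<comment> \<open>One exponent more than there are determining coordinates.\<close>
  define J where "J = {..card L}"
  obtain \<beta> where \<beta>: "\<exists>j\<in>J. \<beta> j \<noteq> 0" "\<And>l. l \<in> L \<Longrightarrow> (\<Sum>j\<in>J. \<beta> j * v j l) = 0"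
    using linear_dependence[OF fL, of J v] by (auto simp: J_def)
  let ?z = "\<lambda>a. \<Sum>j\<in>J. \<beta> j * v j a"
  have fJ: "finite J" by (simp add: J_def)
  have os: "op ?z a = (\<Sum>j\<in>J. \<beta> j * op (v j) a) \<and> ?z \<in> l2" for a by (rule op_sum[OF fJ vl])
  have "?z = (\<lambda>a. 0)"
  proof (rule L(2))
    show "?z \<in> l2" using os by blast
    show "?z a = 0" if "a \<in> zero_modes \<union> L" for a using that x(2)[of a] \<beta>(2)[of a] by (auto simp: v_def)
    have "op (v j) a = 0" for j a using op_eq_Mat[OF vl] kernel_imp_Mat_zero[OF vK] by simp
    then show "op ?z a = 0" for a using os[of a] by simp
  qed
  then have z0: "(\<Sum>j\<in>J. \<beta> j * of_real (lam a) ^ j) * x a = 0" for a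
    unfolding sum_distrib_right using fun_cong[of ?z "\<lambda>a. 0" a] by (simp add: v_def mult.assoc)
  define P where "P = (\<Sum>j\<in>J. monom (\<beta> j) j)"
  have "P \<noteq> 0"
  proof -
    obtain j where j: "j \<in> J" "\<beta> j \<noteq> 0" using \<beta>(1) by blast
    have "coeff P j = \<beta> j" using j(1) fJ by (simp add: P_def coeff_sum)
    then show ?thesis using j(2) by auto
  qed
  then have fr: "finite {\<xi>. poly P \<xi> = 0}" by (rule poly_roots_finite)
  have "{b. x b \<noteq> 0} \<subseteq> (\<Union>\<xi>\<in>{\<xi>. poly P \<xi> = 0}. {b. lam b = Re \<xi>})"
  proof
    fix b assume "b \<in> {b. x b \<noteq> 0}"
    then have "poly P (of_real (lam b)) = 0" using z0[of b] by (simp add: P_def poly_sum poly_monom)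
    then show "b \<in> (\<Union>\<xi>\<in>{\<xi>. poly P \<xi> = 0}. {b. lam b = Re \<xi>})" by (intro UN_I[of "of_real (lam b)"]) auto
  qed
  then have "finite {b. x b \<noteq> 0}" using fr finite_lam_fiber by (meson finite_UN_I finite_subset)
  then show ?thesis by (rule kernel_finite_support[OF K]) (use x(2) in auto)
qed

end

section \<open>The group and its generator\<close>

text \<open>Regrouping by frequency. Passing from the grouped sum back to the full one relies on
  nonnegative terms.\<close>

lemma has_sum_modes:
  fixes f :: "int \<times> bool \<Rightarrow> real"
  assumes "\<And>a. 0 \<le> f a"
  shows "(f has_sum S) UNIV \<longleftrightarrow> ((\<lambda>k. f (k, True) + f (k, False)) has_sum S) UNIV"
proof -
  let ?g = "\<lambda>k. f (k, True) + f (k, False)"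
  have U: "(UNIV :: (int \<times> bool) set) = Sigma UNIV (\<lambda>_. UNIV)" by auto
  have inner: "((\<lambda>\<sigma>. f (k, \<sigma>)) has_sum ?g k) UNIV" for k
    by (rule has_sum_finiteI) (auto simp: UNIV_bool)
  show ?thesis
  proof
    assume "(f has_sum S) UNIV"
    then show "(?g has_sum S) UNIV" unfolding U by (rule has_sum_SigmaD) (rule inner)
  next
    assume g: "(?g has_sum S) UNIV"
    then have "f summable_on Sigma UNIV (\<lambda>_. UNIV)"
      using assms by (intro summable_on_SigmaI[OF inner]) (auto simp: summable_on_def)
    then show "(f has_sum S) UNIV" unfolding U using g by (intro has_sum_SigmaI[OF inner])
  qed
qed

lemma l2_has_sum: "z \<in> l2 \<longleftrightarrow> ((\<lambda>a. (cmod (z a))\<^sup>2) has_sum (l2n z)\<^sup>2) UNIV"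
  unfolding l2n_sq l2_def mem_Collect_eq by (rule summable_iff_has_sum_infsum)

lemma l2n_eqI: "((\<lambda>a. (cmod (z a))\<^sup>2) has_sum S) UNIV \<Longrightarrow> z \<in> l2 \<and> l2n z = sqrt S"
  by (auto simp: l2_def l2n_def summable_on_def dest: infsumI)

lemma rotation_norm:
  fixes p q :: complex and c s :: real
  assumes "c\<^sup>2 + s\<^sup>2 = 1"
  shows "(cmod (of_real c * p - of_real s * q))\<^sup>2 + (cmod (of_real s * p + of_real c * q))\<^sup>2 = (cmod p)\<^sup>2 + (cmod q)\<^sup>2"
proof -
  have "(cmod (of_real c * p - of_real s * q))\<^sup>2 + (cmod (of_real s * p + of_real c * q))\<^sup>2
      = (c\<^sup>2 + s\<^sup>2) * ((cmod p)\<^sup>2 + (cmod q)\<^sup>2)"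
    unfolding cmod_power2 by (simp add: power2_eq_square algebra_simps)
  then show ?thesis by (simp add: assms)
qed

lemma sob_mono:
  assumes "r \<le> s" "f \<in> sob s"
  shows "f \<in> sob r"
proof -
  have "(\<lambda>k. of_real (bracket k powr r) * fourier f k) \<in> l2"
    by (rule l2_mono(1)[where y = "\<lambda>k. of_real (bracket k powr s) * fourier f k"])
      (use assms bracket_ge1 in \<open>simp_all add: mem_sob_iff norm_mult mult_right_mono powr_mono\<close>)
  then show ?thesis using assms(2) by (simp add: mem_sob_iff)
qed

context coupled_system
begin

definition coef :: "state \<Rightarrow> int \<times> bool \<Rightarrow> complex" where
  "coef U a = of_real (wu a) * fourier (fst U) (fst a) + of_real (wv a) * fourier (snd U) (fst a)"

definition recon :: "(int \<times> bool \<Rightarrow> real) \<Rightarrow> (int \<times> bool \<Rightarrow> complex) \<Rightarrow> int \<Rightarrow> complex" where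
  "recon w z k = of_real (w (k, True)) * z (k, True) + of_real (w (k, False)) * z (k, False)"

text \<open>\<open>recon wu\<close> and \<open>recon wv\<close> invert \<open>coef\<close> because the eigenbasis is orthonormal.\<close>

definition Syn :: "(int \<times> bool \<Rightarrow> complex) \<Rightarrow> state" where
  "Syn z = (synth (recon wu z), synth (recon wv z))"

definition wt :: "real \<Rightarrow> (int \<times> bool \<Rightarrow> complex) \<Rightarrow> int \<times> bool \<Rightarrow> complex" where
  "wt s z = (\<lambda>a. of_real (bracket (fst a) powr s) * z a)"

text \<open>The eigencoordinates of \<open>states K s\<close>. Real values become a symmetry under
  \<open>k\<close> to \<open>- k\<close> without exchange of branches, since the eigenvectors are
  even in \<open>k\<close>.\<close>

definition seqs :: "complex set \<Rightarrow> real \<Rightarrow> (int \<times> bool \<Rightarrow> complex) set" where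
  "seqs K s = {z. wt s z \<in> l2 \<and> (\<forall>a. fst a = 0 \<longrightarrow> z a = 0) \<and>
     (K = \<real> \<longrightarrow> (\<forall>k \<sigma>. z (- k, \<sigma>) = cnj (z (k, \<sigma>))))}"

lemma unit_vector: "complex_of_real (wc k) * of_real (wc k) + of_real (ws k) * of_real (ws k) = 1"
  using wc_ws[of k] by (simp add: power2_eq_square flip: of_real_mult of_real_add)

lemma unit_vector_mult: "complex_of_real (wc k) * (of_real (wc k) * p) + of_real (ws k) * (of_real (ws k) * p) = p"
  using unit_vector[of k] by (simp add: mult.assoc[symmetric] distrib_right[symmetric])

lemma recon_coef: "recon wu (coef U) k = fourier (fst U) k" "recon wv (coef U) k = fourier (snd U) k"
  using unit_vector_mult[of k "fourier (fst U) k"] unit_vector_mult[of k "fourier (snd U) k"]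
  by (simp_all add: recon_def coef_def wu_def wv_def algebra_simps)

lemma coef_recon:
  assumes "fourier (fst U) = recon wu z" "fourier (snd U) = recon wv z"
  shows "coef U = z"
proof
  fix a :: "int \<times> bool"
  obtain k \<sigma> where a: "a = (k, \<sigma>)" by (cases a)
  show "coef U a = z a"
    using unit_vector_mult[of k "z a"]
    by (cases \<sigma>) (simp_all add: coef_def assms recon_def wu_def wv_def a algebra_simps)
qed

lemma coef_inject:
  "coef U = coef V \<Longrightarrow> fourier (fst U) = fourier (fst V) \<and> fourier (snd U) = fourier (snd V)"
  using recon_coef[of U] recon_coef[of V] by (metis ext)

lemma norm_modes:
  "(cmod (z (k, True)))\<^sup>2 + (cmod (z (k, False)))\<^sup>2 = (cmod (recon wu z k))\<^sup>2 + (cmod (recon wv z k))\<^sup>2"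
proof -
  have "recon wv z k = of_real (wc k) * z (k, False) - of_real (ws k) * z (k, True)"
    "recon wu z k = of_real (ws k) * z (k, False) + of_real (wc k) * z (k, True)"
    by (simp_all add: recon_def wu_def wv_def)
  then show ?thesis using rotation_norm[OF wc_ws, of k "z (k, False)" "z (k, True)"] by simp
qed

lemma norm_modes_wt:
  "(cmod (wt s z (k, True)))\<^sup>2 + (cmod (wt s z (k, False)))\<^sup>2
    = (cmod (of_real (bracket k powr s) * recon wu z k))\<^sup>2 + (cmod (of_real (bracket k powr s) * recon wv z k))\<^sup>2"
  using norm_modes[of z k] by (simp add: wt_def norm_mult power_mult_distrib distrib_left[symmetric])

text \<open>Passage to eigencoordinates is a rotation at each frequency and commutes with the
  weight, which depends on the frequency alone.\<close>

lemma wt_l2_iff: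
  "wt s z \<in> l2 \<longleftrightarrow> (\<lambda>k. of_real (bracket k powr s) * recon wu z k) \<in> l2 \<and> (\<lambda>k. of_real (bracket k powr s) * recon wv z k) \<in> l2"
  (is "_ \<longleftrightarrow> ?p \<in> l2 \<and> ?q \<in> l2")
proof
  assume "wt s z \<in> l2"
  then have "((\<lambda>k. (cmod (?p k))\<^sup>2 + (cmod (?q k))\<^sup>2) has_sum (l2n (wt s z))\<^sup>2) UNIV"
    unfolding l2_has_sum by (subst (asm) has_sum_modes) (simp_all add: norm_modes_wt)
  then have s: "(\<lambda>k. (cmod (?p k))\<^sup>2 + (cmod (?q k))\<^sup>2) summable_on UNIV" by (auto simp: summable_on_def)
  show "?p \<in> l2 \<and> ?q \<in> l2" unfolding l2_def mem_Collect_eq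
    by (intro conjI summable_on_comparison_test[OF s]) auto
next
  assume "?p \<in> l2 \<and> ?q \<in> l2"
  then have "((\<lambda>k. (cmod (?p k))\<^sup>2 + (cmod (?q k))\<^sup>2) has_sum (l2n ?p)\<^sup>2 + (l2n ?q)\<^sup>2) UNIV"
    unfolding l2_has_sum by (intro has_sum_add) auto
  then have "((\<lambda>a. (cmod (wt s z a))\<^sup>2) has_sum (l2n ?p)\<^sup>2 + (l2n ?q)\<^sup>2) UNIV"
    by (subst has_sum_modes) (simp_all add: norm_modes_wt)
  then show "wt s z \<in> l2" using l2n_eqI by blast
qed

lemma l2n_wt:
  assumes "wt s z \<in> l2"
  shows "l2n (wt s z) = sqrt ((l2n (\<lambda>k. of_real (bracket k powr s) * recon wu z k))\<^sup>2 + (l2n (\<lambda>k. of_real (bracket k powr s) * recon wv z k))\<^sup>2)"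
  (is "_ = sqrt ((l2n ?p)\<^sup>2 + (l2n ?q)\<^sup>2)")
proof -
  have "((\<lambda>k. (cmod (?p k))\<^sup>2 + (cmod (?q k))\<^sup>2) has_sum (l2n ?p)\<^sup>2 + (l2n ?q)\<^sup>2) UNIV"
    using assms[unfolded wt_l2_iff, unfolded l2_has_sum] by (intro has_sum_add) auto
  then have "((\<lambda>a. (cmod (wt s z a))\<^sup>2) has_sum (l2n ?p)\<^sup>2 + (l2n ?q)\<^sup>2) UNIV"
    by (subst has_sum_modes) (simp_all add: norm_modes_wt)
  then show ?thesis using l2n_eqI by blast
qed

lemma recon_coef': "recon wu (coef U) = fourier (fst U)" "recon wv (coef U) = fourier (snd U)"
  by (rule ext, rule recon_coef)+

lemma states_L2: "U \<in> states K s \<Longrightarrow> fst U \<in> L2_circle \<and> snd U \<in> L2_circle"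
  by (auto simp: states_def sob0_def mem_sob_iff)

lemma states_iff:
  "U \<in> states K s \<longleftrightarrow> fst U \<in> L2_circle \<and> snd U \<in> L2_circle \<and> range (fst U) \<subseteq> K \<and> range (snd U) \<subseteq> K \<and>
     wt s (coef U) \<in> l2 \<and> (\<forall>a. fst a = 0 \<longrightarrow> coef U a = 0)"
proof -
  have "(\<forall>a. fst a = 0 \<longrightarrow> coef U a = 0) \<longleftrightarrow> fourier (fst U) 0 = 0 \<and> fourier (snd U) 0 = 0"
    using recon_coef[of U 0] by (auto simp: coef_def recon_def)
  then show ?thesis
    by (cases U) (auto simp: states_def sob0_def mem_sob_iff mean_eq wt_l2_iff recon_coef')
qed

lemma state_norm_eq:
  assumes "U \<in> states K s"
  shows "state_norm s U = l2n (wt s (coef U))"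
  using assms l2n_wt[of s "coef U"] by (cases U) (simp add: states_iff state_norm_def sob_norm_eq recon_coef')

lemma coef_seqs:
  assumes "U \<in> states K s"
  shows "coef U \<in> seqs K s"
proof -
  have "coef U (- k, \<sigma>) = cnj (coef U (k, \<sigma>))" if "K = \<real>" for k \<sigma>
    using assms that hermitian_fourier[of "fst U"] hermitian_fourier[of "snd U"]
    by (simp add: states_iff coef_def w_minus hermitian_def)
  then show ?thesis using assms by (simp add: seqs_def states_iff)
qed

lemma Syn_states:
  assumes z: "z \<in> seqs K s" and s: "0 \<le> s" and K: "K \<in> {\<real>, UNIV}"
  shows "Syn z \<in> states K s" "coef (Syn z) = z"
proof -
  have w: "wt s z \<in> l2" using z by (simp add: seqs_def)
  have l: "recon w z \<in> l2" if "(\<lambda>k. of_real (bracket k powr s) * recon w z k) \<in> l2" for w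
  proof (rule l2_mono(1)[OF that])
    show "cmod (recon w z k) \<le> cmod (of_real (bracket k powr s) * recon w z k)" for k
      using mult_right_mono[OF ge_one_powr_ge_zero[OF bracket_ge1[of k] s] norm_ge_zero[of "recon w z k"]]
      by (simp add: norm_mult)
  qed
  have 1: "recon wu z \<in> l2" "recon wv z \<in> l2" using w l unfolding wt_l2_iff by auto
  have h: "hermitian (recon wu z)" "hermitian (recon wv z)" if "K = \<real>"
    using z that by (simp_all add: seqs_def hermitian_def recon_def w_minus)
  note S = synth[OF 1(1)] synth[OF 1(2)]
  show c: "coef (Syn z) = z" by (rule coef_recon) (simp_all add: Syn_def S)
  show "Syn z \<in> states K s"
    unfolding states_iff c using z w K S(1,4) S(3,6) h by (auto simp: Syn_def seqs_def)
qed

section \<open>Linear structure of the state space in eigencoordinates\<close>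

lemma coef_add:
  assumes "fst U \<in> L2_circle \<and> snd U \<in> L2_circle" "fst V \<in> L2_circle \<and> snd V \<in> L2_circle"
  shows "coef (U + V) a = coef U a + coef V a"
  using assms by (simp add: coef_def plus_fun_def fourier_add[unfolded] algebra_simps)

lemma coef_diff:
  assumes "fst U \<in> L2_circle \<and> snd U \<in> L2_circle" "fst V \<in> L2_circle \<and> snd V \<in> L2_circle"
  shows "coef (U - V) a = coef U a - coef V a"
  using assms by (simp add: coef_def fun_diff_def fourier_diff algebra_simps)

lemma coef_scaleR: "coef (r *\<^sub>R U) a = of_real r * coef U a"
  by (simp add: coef_def scaleR_fun_def scaleR_conv_of_real fourier_cmult algebra_simps)

lemma states_add:
  assumes U: "U \<in> states K s" and V: "V \<in> states K s" and K: "K \<in> {\<real>, UNIV}"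
  shows "U + V \<in> states K s"
proof -
  have L: "fst U \<in> L2_circle \<and> snd U \<in> L2_circle" "fst V \<in> L2_circle \<and> snd V \<in> L2_circle"
    using U V states_L2 by auto
  have c: "coef (U + V) = (\<lambda>a. coef U a + coef V a)" using coef_add[OF L] by auto
  have "wt s (coef (U + V)) = (\<lambda>a. wt s (coef U) a + wt s (coef V) a)" by (simp add: c wt_def distrib_left)
  moreover have "(\<lambda>a. wt s (coef U) a + wt s (coef V) a) \<in> l2" using U V by (intro l2_add) (auto simp: states_iff)
  moreover have "range (fst U + fst V) \<subseteq> K" "range (snd U + snd V) \<subseteq> K"
    using U V K by (auto simp: states_iff plus_fun_def intro!: Reals_add)
  moreover have "fst U + fst V \<in> L2_circle" "snd U + snd V \<in> L2_circle"
    using L by (auto simp: plus_fun_def L2_circle_add)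
  ultimately show ?thesis using U V unfolding states_iff by (simp add: c)
qed

lemma states_scaleR:
  assumes U: "U \<in> states K s" and K: "K \<in> {\<real>, UNIV}"
  shows "r *\<^sub>R U \<in> states K s"
proof -
  have L: "fst U \<in> L2_circle \<and> snd U \<in> L2_circle" using U states_L2 by auto
  have c: "coef (r *\<^sub>R U) = (\<lambda>a. of_real r * coef U a)" by (rule ext) (rule coef_scaleR)
  have "wt s (coef (r *\<^sub>R U)) = (\<lambda>a. of_real r * wt s (coef U) a)" by (simp add: c wt_def mult.left_commute)
  moreover have "(\<lambda>a. of_real r * wt s (coef U) a) \<in> l2" using U by (intro l2_cmult) (auto simp: states_iff)
  moreover have "range (r *\<^sub>R fst U) \<subseteq> K" "range (r *\<^sub>R snd U) \<subseteq> K"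
    using U K by (auto simp: states_iff scaleR_fun_def scaleR_conv_of_real intro!: Reals_mult)
  moreover have "r *\<^sub>R fst U \<in> L2_circle" "r *\<^sub>R snd U \<in> L2_circle"
    using L by (auto simp: scaleR_fun_def scaleR_conv_of_real L2_circle_cmult)
  ultimately show ?thesis using U unfolding states_iff by (simp add: c)
qed

lemma states_diff:
  assumes "U \<in> states K s" "V \<in> states K s" "K \<in> {\<real>, UNIV}"
  shows "U - V \<in> states K s"
  using states_add[OF assms(1) states_scaleR[OF assms(2,3), of "-1"] assms(3)] by simp

lemma state_norm_diff:
  assumes "U \<in> states K s" "V \<in> states K s" "K \<in> {\<real>, UNIV}"
  shows "state_norm s (U - V) = l2n (wt s (\<lambda>a. coef U a - coef V a))"
proof -
  have "coef (U - V) = (\<lambda>a. coef U a - coef V a)" using coef_diff states_L2 assms(1,2) by blast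
  then show ?thesis using state_norm_eq[OF states_diff[OF assms]] by simp
qed

section \<open>The group of the linear part\<close>

definition W :: "real \<Rightarrow> state \<Rightarrow> state" where
  "W t U = Syn (flow t (coef U))"

lemma flow_seqs: "z \<in> seqs K s \<Longrightarrow> flow t z \<in> seqs K s"
proof -
  assume z: "z \<in> seqs K s"
  have "wt s (flow t z) \<in> l2 \<longleftrightarrow> wt s z \<in> l2" by (rule l2_cong) (simp add: wt_def norm_mult)
  then show ?thesis using z by (auto simp: seqs_def flow_def lam_minus cis_cnj)
qed

lemma W_states:
  assumes "U \<in> states K s" "0 \<le> s" "K \<in> {\<real>, UNIV}"
  shows "W t U \<in> states K s" "coef (W t U) = flow t (coef U)"
  unfolding W_def by (rule Syn_states[OF flow_seqs[OF coef_seqs[OF assms(1)]] assms(2,3)])+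

lemma l2n_wt_flow: "l2n (wt s (flow t z)) = l2n (wt s z)"
  by (rule l2n_cong) (simp add: wt_def norm_mult)

lemma flow_tendsto:
  assumes "wt s z \<in> l2"
  shows "((\<lambda>t. l2n (wt s (\<lambda>a. flow t z a - flow t0 z a))) \<longlongrightarrow> 0) (at t0 within A)"
proof (rule l2n_dominated)
  show "(\<lambda>a. 2 * wt s z a) \<in> l2" using assms by (rule l2_cmult)
  show "cmod (wt s (\<lambda>a. flow t z a - flow t0 z a) a) \<le> cmod (2 * wt s z a)" for t a
  proof -
    have "cmod (flow t z a - flow t0 z a) \<le> 2 * cmod (z a)"
      using norm_triangle_ineq4[of "flow t z a" "flow t0 z a"] by simp
    then have "bracket (fst a) powr s * cmod (flow t z a - flow t0 z a) \<le> bracket (fst a) powr s * (2 * cmod (z a))"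
      by (rule mult_left_mono) simp
    then show ?thesis by (simp add: wt_def norm_mult mult_ac)
  qed
  show "((\<lambda>t. wt s (\<lambda>a. flow t z a - flow t0 z a) a) \<longlongrightarrow> 0) (at t0 within A)" for a
    unfolding wt_def flow_def cis_conv_exp by (rule tendsto_eq_rhs, (rule tendsto_intros)+) simp
qed

text \<open>Every law is an identity between eigencoordinates. \<open>Syn\<close> selects
  representatives, so equality is obtained in the seminorm, which is how \<open>C0_group\<close> is
  phrased.\<close>

lemma C0_group_W:
  assumes s: "0 \<le> s" and K: "K \<in> {\<real>, UNIV}"
  shows "C0_group (states K s) (state_norm s) W"
  unfolding C0_group_def
proof (intro conjI allI ballI)
  note Ws = W_states[OF _ s K]
  have zero: "l2n (wt s (\<lambda>a. 0)) = 0" by (simp add: wt_def)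
  show "W t U \<in> states K s" if "U \<in> states K s" for t U using Ws[OF that] by simp
  show "state_norm s (W t (a *\<^sub>R U + b *\<^sub>R V) - (a *\<^sub>R W t U + b *\<^sub>R W t V)) = 0"
    if U: "U \<in> states K s" and V: "V \<in> states K s" for t a b U V
  proof -
    note sc = states_scaleR[OF _ K]
    have UV: "a *\<^sub>R U + b *\<^sub>R V \<in> states K s" by (intro states_add sc U V K)
    have WW: "a *\<^sub>R W t U + b *\<^sub>R W t V \<in> states K s" by (intro states_add sc Ws U V K)
    have "coef (W t (a *\<^sub>R U + b *\<^sub>R V)) c - coef (a *\<^sub>R W t U + b *\<^sub>R W t V) c = 0" for c
      using U V Ws(2)[OF UV] Ws(2)[OF U] Ws(2)[OF V] states_L2[OF sc[OF U]] states_L2[OF sc[OF V]]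
        states_L2[OF sc[OF Ws(1)[OF U]]] states_L2[OF sc[OF Ws(1)[OF V]]]
      by (simp add: coef_add coef_scaleR flow_def algebra_simps)
    then show ?thesis unfolding state_norm_diff[OF Ws(1)[OF UV] WW K] by (simp add: zero)
  qed
  show "\<exists>C. \<forall>U\<in>states K s. state_norm s (W t U) \<le> C * state_norm s U" for t
  proof (intro exI[of _ 1] ballI)
    fix U assume U: "U \<in> states K s"
    show "state_norm s (W t U) \<le> 1 * state_norm s U"
      unfolding state_norm_eq[OF Ws(1)[OF U]] state_norm_eq[OF U] Ws(2)[OF U] by (simp add: l2n_wt_flow)
  qed
  show "state_norm s (W 0 U - U) = 0" if U: "U \<in> states K s" for U
    unfolding state_norm_diff[OF Ws(1)[OF U] U K] Ws(2)[OF U] by (simp add: flow_def zero)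
  show "state_norm s (W (t + r) U - W t (W r U)) = 0" if U: "U \<in> states K s" for t r U
  proof -
    have "flow (t + r) z = flow t (flow r z)" for z
      by (simp add: flow_def fun_eq_iff distrib_left cis_mult[symmetric] mult.assoc)
    then show ?thesis
      unfolding state_norm_diff[OF Ws(1)[OF U] Ws(1)[OF Ws(1)[OF U]] K] Ws(2)[OF U] Ws(2)[OF Ws(1)[OF U]] by (simp add: zero)
  qed
  show "((\<lambda>t. state_norm s (W t U - U)) \<longlongrightarrow> 0) (at 0)" if U: "U \<in> states K s" for U
  proof -
    have "wt s (coef U) \<in> l2" using U by (simp add: states_iff)
    from flow_tendsto[OF this, of 0 UNIV] show ?thesis
      unfolding state_norm_diff[OF Ws(1)[OF U] U K] Ws(2)[OF U] by (simp add: flow_def)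
  qed
qed

section \<open>Identification of the generator\<close>

lemma coef_L:
  assumes u: "\<And>k. fourier u1 k = (\<i> * of_int k) ^ 1 * fourier u k" "\<And>k. fourier u3 k = (\<i> * of_int k) ^ 3 * fourier u k"
    and v: "\<And>k. fourier v1 k = (\<i> * of_int k) ^ 1 * fourier v k" "\<And>k. fourier v3 k = (\<i> * of_int k) ^ 3 * fourier v k"
    and p: "\<And>k. fourier p k = - fourier u3 k - \<mu> * fourier u1 k - \<eta> * fourier v1 k"
    and q: "\<And>k. fourier q k = - complex_of_real \<eta> * fourier u1 k - \<alpha> * fourier v3 k - \<zeta> * fourier v1 k"
  shows "coef (p, q) a = \<i> * of_real (lam a) * coef (u, v) a"
proof -
  obtain k \<sigma> where a: "a = (k, \<sigma>)" by (cases a)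
  let ?k = "complex_of_int k" and ?u = "fourier u k" and ?v = "fourier v k"
  let ?wu = "complex_of_real (wu a)" and ?wv = "complex_of_real (wv a)"
  have E: "?k * ((?k ^ 2 - \<mu>) * ?wu - \<eta> * ?wv) = of_real (lam a) * ?wu"
    "?k * (- \<eta> * ?wu + (\<alpha> * ?k ^ 2 - \<zeta>) * ?wv) = of_real (lam a) * ?wv"
    using arg_cong[OF eigen(1)[of k \<sigma>], of complex_of_real] arg_cong[OF eigen(2)[of k \<sigma>], of complex_of_real] by (simp_all add: a)
  have i3: "(\<i> * ?k) ^ 3 = - \<i> * (?k * ?k ^ 2)"
  proof -
    have "(\<i> * ?k) ^ 3 = (\<i> * \<i>) * \<i> * (?k * ?k ^ 2)" by (simp only: power3_eq_cube power2_eq_square mult_ac)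
    then show ?thesis by simp
  qed
  have uv: "fourier u1 k = \<i> * ?k * ?u" "fourier u3 k = - \<i> * (?k * ?k ^ 2) * ?u"
    "fourier v1 k = \<i> * ?k * ?v" "fourier v3 k = - \<i> * (?k * ?k ^ 2) * ?v"
    unfolding u v i3 power_one_right by (rule refl)+
  have "coef (p, q) a = \<i> * ((?k * ((?k ^ 2 - \<mu>) * ?wu - \<eta> * ?wv)) * ?u + (?k * (- \<eta> * ?wu + (\<alpha> * ?k ^ 2 - \<zeta>) * ?wv)) * ?v)"
    by (simp add: coef_def a p q uv algebra_simps)
  also have "\<dots> = \<i> * of_real (lam a) * coef (u, v) a"
    unfolding E by (simp add: coef_def a algebra_simps)
  finally show ?thesis .
qed

lemma L_graph_coef:
  assumes "(U, V) \<in> L_graph K \<alpha> \<mu> \<zeta> \<eta> s"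
  shows "coef V a = \<i> * of_real (lam a) * coef U a"
proof -
  obtain u v p q where UV: "U = (u, v)" "V = (p, q)" by (cases U; cases V)
  obtain u1 u3 v1 v3 :: "real \<Rightarrow> complex" where d: "distr_deriv 1 u u1" "distr_deriv 3 u u3" "distr_deriv 1 v v1" "distr_deriv 3 v v3"
    and p: "ae_eq p (\<lambda>x. - u3 x - \<mu> * u1 x - \<eta> * v1 x)" and q: "ae_eq q (\<lambda>x. - complex_of_real \<eta> * u1 x - \<alpha> * v3 x - \<zeta> * v1 x)"
    and V: "(p, q) \<in> states K s"
    using assms unfolding L_graph_def UV by blast
  have L: "u1 \<in> L2_circle" "u3 \<in> L2_circle" "v1 \<in> L2_circle" "v3 \<in> L2_circle" using d by (auto simp: distr_deriv_def)
  have Lp: "p \<in> L2_circle" "q \<in> L2_circle" using states_L2[OF V] by auto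
  have P: "(\<lambda>x. - u3 x - \<mu> * u1 x - \<eta> * v1 x) = (\<lambda>x. ((-1) * u3 x - \<mu> * u1 x) - \<eta> * v1 x)"
    and Q: "(\<lambda>x. - complex_of_real \<eta> * u1 x - \<alpha> * v3 x - \<zeta> * v1 x) = (\<lambda>x. ((- \<eta>) * u1 x - \<alpha> * v3 x) - \<zeta> * v1 x)" by simp_all
  have L': "(\<lambda>x. - u3 x - \<mu> * u1 x - \<eta> * v1 x) \<in> L2_circle" "(\<lambda>x. - complex_of_real \<eta> * u1 x - \<alpha> * v3 x - \<zeta> * v1 x) \<in> L2_circle"
    unfolding P Q by (intro L2_circle_diff L2_circle_cmult L)+
  have fp: "fourier p k = - fourier u3 k - \<mu> * fourier u1 k - \<eta> * fourier v1 k" for k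
    unfolding fourier_cong_ae[OF p L2_circleD(1)[OF Lp(1)] L2_circleD(1)[OF L'(1)]] P
    by (subst fourier_diff fourier_cmult; (intro L2_circle_diff L2_circle_cmult L)?)+ simp
  have fq: "fourier q k = - complex_of_real \<eta> * fourier u1 k - \<alpha> * fourier v3 k - \<zeta> * fourier v1 k" for k
    unfolding fourier_cong_ae[OF q L2_circleD(1)[OF Lp(2)] L2_circleD(1)[OF L'(2)]] Q
    by (subst fourier_diff fourier_cmult; (intro L2_circle_diff L2_circle_cmult L)?)+ simp
  show ?thesis unfolding UV
    by (rule coef_L[OF distr_deriv_fourier[OF d(1)] distr_deriv_fourier[OF d(2)] distr_deriv_fourier[OF d(3)] distr_deriv_fourier[OF d(4)] fp fq])
qed

lemma difference_quotient_tendsto: "((\<lambda>t. (cis (l * t) - 1) / of_real t) \<longlongrightarrow> \<i> * of_real l) (at 0)"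
proof -
  have "DERIV (\<lambda>z. exp (\<i> * of_real l * z)) 0 :> \<i> * of_real l"
    by (auto intro!: derivative_eq_intros)
  then have "((\<lambda>h. (exp (\<i> * of_real l * h) - 1) / h) \<longlongrightarrow> \<i> * of_real l) (at 0)"
    by (simp add: DERIV_def)
  moreover have "filterlim complex_of_real (at 0) (at 0)"
    by (rule filterlim_atI) (auto intro!: tendsto_eq_intros simp: eventually_at_filter)
  ultimately have "((\<lambda>t. (exp (\<i> * of_real l * of_real t) - 1) / of_real t) \<longlongrightarrow> \<i> * of_real l) (at 0)"
    by (rule filterlim_compose)
  then show ?thesis by (simp add: cis_conv_exp mult.assoc)
qed

lemma norm_cis_diff_one: "cmod (cis \<theta> - 1) \<le> \<bar>\<theta>\<bar>"
  using dist_exp_i_1[of \<theta>] abs_sin_x_le_abs_x[of "\<theta> / 2"] by (simp add: dist_norm cis_conv_exp)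

lemma coef_difference_quotient:
  assumes "U \<in> states K s" "V \<in> states K s" "0 \<le> s" "K \<in> {\<real>, UNIV}"
  shows "state_norm s ((W t U - U) /\<^sub>R t - V) = l2n (wt s (\<lambda>a. (cis (lam a * t) - 1) / of_real t * coef U a - coef V a))"
proof -
  note Ws = W_states[OF assms(1,3,4), of t]
  have D: "W t U - U \<in> states K s" by (rule states_diff[OF Ws(1) assms(1,4)])
  have "coef ((W t U - U) /\<^sub>R t) a = (cis (lam a * t) - 1) / of_real t * coef U a" for a
    unfolding coef_scaleR coef_diff[OF states_L2[OF Ws(1)] states_L2[OF assms(1)]] Ws(2)
    by (simp add: flow_def field_simps)
  then show ?thesis
    unfolding state_norm_diff[OF states_scaleR[OF D assms(4)] assms(2,4)] by simp
qed

text \<open>Convergence of the difference quotients forces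
  \<open>coef V a = \<i> * of_real (lam a) * coef U a\<close>. The lower cubic bound on
  \<open>lam\<close> converts the regularity of \<open>U\<close> and \<open>V\<close> into three
  further orders for \<open>U\<close>, after which the derivatives are synthesised from their
  coefficients.\<close>

lemma generator_subset_L_graph:
  assumes s: "0 \<le> s" and K: "K \<in> {\<real>, UNIV}"
    and UV: "(U, V) \<in> generator (states K s) (state_norm s) W"
  shows "(U, V) \<in> L_graph K \<alpha> \<mu> \<zeta> \<eta> s"
proof -
  have U: "U \<in> states K s" and V: "V \<in> states K s"
    and lim: "((\<lambda>t. state_norm s ((W t U - U) /\<^sub>R t - V)) \<longlongrightarrow> 0) (at 0)"
    using UV by (auto simp: generator_def)
  let ?D = "\<lambda>t a. (cis (lam a * t) - 1) / of_real t * coef U a - coef V a"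
  have D: "state_norm s ((W t U - U) /\<^sub>R t - V) = l2n (wt s (?D t))" for t
    by (rule coef_difference_quotient[OF U V s K])
  have Dl2: "wt s (?D t) \<in> l2" for t
  proof -
    have "(\<lambda>a. (1 / of_real t) * (wt s (flow t (coef U)) a - wt s (coef U) a) - wt s (coef V) a) \<in> l2"
      using U V coef_seqs[OF U] flow_seqs[OF coef_seqs[OF U]]
      by (intro l2_diff l2_cmult) (auto simp: states_iff seqs_def)
    moreover have "(\<lambda>a. (1 / of_real t) * (wt s (flow t (coef U)) a - wt s (coef U) a) - wt s (coef V) a) = wt s (?D t)"
      by (simp add: wt_def flow_def fun_eq_iff diff_divide_distrib algebra_simps)
    ultimately show ?thesis by simp
  qed
  have VU: "coef V a = \<i> * of_real (lam a) * coef U a" for a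
  proof -
    have "((\<lambda>t. wt s (?D t) a) \<longlongrightarrow> 0) (at 0)"
      by (rule Lim_null_comparison[OF always_eventually lim], unfold D, rule allI, rule norm_le_l2n[OF Dl2])
    moreover have "((\<lambda>t. wt s (?D t) a) \<longlongrightarrow> wt s (\<lambda>a. \<i> * of_real (lam a) * coef U a - coef V a) a) (at 0)"
      unfolding wt_def by (intro tendsto_intros difference_quotient_tendsto)
    ultimately have "wt s (\<lambda>a. \<i> * of_real (lam a) * coef U a - coef V a) a = 0"
      using tendsto_unique[OF trivial_limit_at] by blast
    then show ?thesis using bracket_ge1[of "fst a"] by (simp add: wt_def)
  qed
  obtain C where "C \<ge> 0 \<and> (\<forall>a. bracket (fst a) ^ 3 \<le> C * (1 + \<bar>lam a\<bar>))" using lam_bounds(2) by (rule exE)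
  then have C: "C \<ge> 0" "\<And>a. bracket (fst a) ^ 3 \<le> C * (1 + \<bar>lam a\<bar>)" by auto
  have b3: "bracket k powr (s + 3) = bracket k powr s * bracket k ^ 3" for k
    using bracket_ge1[of k] powr_realpow[of "bracket k" 3] by (simp add: powr_add)
  have "wt (s + 3) (coef U) \<in> l2"
  proof (rule l2_mono(1))
    show "(\<lambda>a. of_real C * (of_real (cmod (wt s (coef U) a)) + of_real (cmod (wt s (coef V) a)))) \<in> l2"
      using U V by (intro l2_cmult l2_add) (auto simp: states_iff l2_def)
    fix a
    have "bracket (fst a) ^ 3 * cmod (coef U a) \<le> C * (1 + \<bar>lam a\<bar>) * cmod (coef U a)"
      by (rule mult_right_mono[OF C(2)]) simp
    also have "\<dots> = C * (cmod (coef U a) + cmod (coef V a))" by (simp add: VU norm_mult algebra_simps)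
    finally have "bracket (fst a) powr s * (bracket (fst a) ^ 3 * cmod (coef U a)) \<le> bracket (fst a) powr s * (C * (cmod (coef U a) + cmod (coef V a)))"
      by (rule mult_left_mono) simp
    also have "\<dots> = cmod (of_real (C * (cmod (wt s (coef U) a) + cmod (wt s (coef V) a))))"
      using C(1) unfolding norm_of_real by (simp add: wt_def norm_mult algebra_simps)
    finally show "cmod (wt (s + 3) (coef U) a) \<le> cmod (of_real C * (of_real (cmod (wt s (coef U) a)) + of_real (cmod (wt s (coef V) a))))"
      by (simp add: wt_def norm_mult b3 mult.assoc flip: of_real_add of_real_mult)
  qed
  then have U3: "U \<in> states K (s + 3)" using U by (simp add: states_iff)
  have synthesis: "\<exists>w. distr_deriv n u w \<and> w \<in> L2_circle \<and> (\<forall>k. fourier w k = (\<i> * of_int k) ^ n * fourier u k)"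
    if u: "u \<in> sob0 K (s + 3)" and n: "n \<le> 3" for u n
  proof -
    have uL: "u \<in> L2_circle" and l: "(\<lambda>k. of_real (bracket k powr (s + 3)) * fourier u k) \<in> l2"
      using u by (auto simp: sob0_def mem_sob_iff)
    have "(\<lambda>k. (\<i> * of_int k) ^ n * fourier u k) \<in> l2"
    proof (rule l2_mono(1)[OF l])
      fix k
      have "cmod (\<i> * of_int k) ^ n \<le> bracket k ^ n"
        by (rule power_mono) (simp_all add: bracket_def norm_mult)
      also have "\<dots> \<le> bracket k ^ 3" by (rule power_increasing[OF n bracket_ge1])
      also have "\<dots> \<le> bracket k powr (s + 3)"
        unfolding b3 using ge_one_powr_ge_zero[OF bracket_ge1[of k] s] bracket_ge1[of k] by (simp add: mult_le_cancel_right1)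
      finally show "cmod ((\<i> * of_int k) ^ n * fourier u k) \<le> cmod (of_real (bracket k powr (s + 3)) * fourier u k)"
        by (simp add: norm_mult norm_power mult_right_mono)
    qed
    note S = synth[OF this]
    have "distr_deriv n u (synth (\<lambda>k. (\<i> * of_int k) ^ n * fourier u k))"
      by (rule distr_derivI[OF uL S(1)]) (simp add: S(2))
    then show ?thesis using S by auto
  qed
  obtain u v p q where UVp: "U = (u, v)" "V = (p, q)" by (cases U; cases V)
  have uv: "u \<in> sob0 K (s + 3)" "v \<in> sob0 K (s + 3)" using U3 by (auto simp: UVp states_def)
  obtain u1 where u1: "distr_deriv 1 u u1" "u1 \<in> L2_circle" "\<And>k. fourier u1 k = (\<i> * of_int k) ^ 1 * fourier u k" using synthesis[OF uv(1), of 1] by auto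
  obtain u3 where u3: "distr_deriv 3 u u3" "u3 \<in> L2_circle" "\<And>k. fourier u3 k = (\<i> * of_int k) ^ 3 * fourier u k" using synthesis[OF uv(1), of 3] by auto
  obtain v1 where v1: "distr_deriv 1 v v1" "v1 \<in> L2_circle" "\<And>k. fourier v1 k = (\<i> * of_int k) ^ 1 * fourier v k" using synthesis[OF uv(2), of 1] by auto
  obtain v3 where v3: "distr_deriv 3 v v3" "v3 \<in> L2_circle" "\<And>k. fourier v3 k = (\<i> * of_int k) ^ 3 * fourier v k" using synthesis[OF uv(2), of 3] by auto
  define p' where "p' = (\<lambda>x. - u3 x - \<mu> * u1 x - \<eta> * v1 x)"
  define q' where "q' = (\<lambda>x. - complex_of_real \<eta> * u1 x - \<alpha> * v3 x - \<zeta> * v1 x)"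
  have P: "p' = (\<lambda>x. ((-1) * u3 x - \<mu> * u1 x) - \<eta> * v1 x)" and Q: "q' = (\<lambda>x. ((- \<eta>) * u1 x - \<alpha> * v3 x) - \<zeta> * v1 x)"
    by (simp_all add: p'_def q'_def)
  note L = u1(2) u3(2) v1(2) v3(2)
  have L': "p' \<in> L2_circle" "q' \<in> L2_circle" unfolding P Q by (intro L2_circle_diff L2_circle_cmult L)+
  have fp: "fourier p' k = - fourier u3 k - \<mu> * fourier u1 k - \<eta> * fourier v1 k" for k
    unfolding P by (subst fourier_diff fourier_cmult; (intro L2_circle_diff L2_circle_cmult L)?)+ simp
  have fq: "fourier q' k = - complex_of_real \<eta> * fourier u1 k - \<alpha> * fourier v3 k - \<zeta> * fourier v1 k" for k
    unfolding Q by (subst fourier_diff fourier_cmult; (intro L2_circle_diff L2_circle_cmult L)?)+ simp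
  have "coef (p', q') = coef V"
    by (rule ext, unfold coef_L[OF u1(3) u3(3) v1(3) v3(3) fp fq], unfold UVp(1)[symmetric], rule VU[symmetric])
  from coef_inject[OF this] have f: "fourier p k = fourier p' k" "fourier q k = fourier q' k" for k by (simp_all add: UVp)
  have pq: "p \<in> L2_circle" "q \<in> L2_circle" using states_L2[OF V] by (simp_all add: UVp)
  have "ae_eq p p'" "ae_eq q q'" by (rule ae_eqI[OF pq(1) L'(1) f(1)], rule ae_eqI[OF pq(2) L'(2) f(2)])
  then show ?thesis using U3 V u1(1) u3(1) v1(1) v3(1) unfolding L_graph_def UVp p'_def q'_def by blast
qed

text \<open>The quotient \<open>(cis (lam a * t) - 1) / of_real t\<close> is bounded by
  \<open>\<bar>lam a\<bar>\<close>, so \<open>coef V\<close> dominates the difference quotients for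
  all \<open>t\<close> and coordinatewise convergence suffices.\<close>

lemma L_graph_subset_generator:
  assumes s: "0 \<le> s" and K: "K \<in> {\<real>, UNIV}"
    and UV: "(U, V) \<in> L_graph K \<alpha> \<mu> \<zeta> \<eta> s"
  shows "(U, V) \<in> generator (states K s) (state_norm s) W"
proof -
  have V: "V \<in> states K s" and U3: "U \<in> states K (s + 3)" using UV by (auto simp: L_graph_def)
  have U: "U \<in> states K s"
    using U3 sob_mono[of s "s + 3" "fst U"] sob_mono[of s "s + 3" "snd U"]
    by (cases U) (auto simp: states_def sob0_def)
  note VU = L_graph_coef[OF UV]
  have "((\<lambda>t. l2n (wt s (\<lambda>a. (cis (lam a * t) - 1) / of_real t * coef U a - coef V a))) \<longlongrightarrow> 0) (at 0)"
  proof (rule l2n_dominated)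
    show "(\<lambda>a. 2 * wt s (coef V) a) \<in> l2" using V by (intro l2_cmult) (simp add: states_iff)
    fix t a
    have "cmod ((cis (lam a * t) - 1) / of_real t) \<le> \<bar>lam a\<bar>"
      using norm_cis_diff_one[of "lam a * t"] by (cases "t = 0") (simp_all add: norm_divide divide_simps abs_mult)
    then have "cmod ((cis (lam a * t) - 1) / of_real t) * cmod (coef U a) \<le> \<bar>lam a\<bar> * cmod (coef U a)"
      by (rule mult_right_mono) simp
    then have "cmod ((cis (lam a * t) - 1) / of_real t * coef U a) \<le> cmod (coef V a)"
      unfolding VU norm_mult by simp
    then have "cmod ((cis (lam a * t) - 1) / of_real t * coef U a - coef V a) \<le> 2 * cmod (coef V a)"
      using norm_triangle_ineq4[of "(cis (lam a * t) - 1) / of_real t * coef U a" "coef V a"] by linarith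
    then have "bracket (fst a) powr s * cmod ((cis (lam a * t) - 1) / of_real t * coef U a - coef V a) \<le> bracket (fst a) powr s * (2 * cmod (coef V a))"
      by (rule mult_left_mono) simp
    then show "cmod (wt s (\<lambda>a. (cis (lam a * t) - 1) / of_real t * coef U a - coef V a) a) \<le> cmod (2 * wt s (coef V) a)"
      by (simp add: wt_def norm_mult mult_ac)
  next
    fix a
    show "((\<lambda>t. wt s (\<lambda>a. (cis (lam a * t) - 1) / of_real t * coef U a - coef V a) a) \<longlongrightarrow> 0) (at 0)"
      unfolding wt_def by (rule tendsto_eq_rhs, (rule tendsto_intros difference_quotient_tendsto)+) (simp add: VU)
  qed
  then show ?thesis using U V by (simp add: generator_def coef_difference_quotient[OF U V s K])
qed

lemma generator_W:
  assumes "0 \<le> s" "K \<in> {\<real>, UNIV}"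
  shows "generator (states K s) (state_norm s) W = L_graph K \<alpha> \<mu> \<zeta> \<eta> s"
  using generator_subset_L_graph[OF assms] L_graph_subset_generator[OF assms] by auto

end

section \<open>Bochner integrals of continuous curves\<close>

text \<open>Minkowski's integral inequality by duality: pairing with the integral itself on a finite
  set gives \<open>?S * ?S \<le> ?S * (M * (b - a))\<close>.\<close>

lemma l2_integral:
  fixes \<phi> :: "'i \<Rightarrow> real \<Rightarrow> complex"
  assumes ab: "a \<le> b" and int: "\<And>i. \<phi> i integrable_on {a..b}"
    and l2: "\<And>r. r \<in> {a..b} \<Longrightarrow> (\<lambda>i. \<phi> i r) \<in> l2" and le: "\<And>r. r \<in> {a..b} \<Longrightarrow> l2n (\<lambda>i. \<phi> i r) \<le> M"
  shows "(\<lambda>i. integral {a..b} (\<phi> i)) \<in> l2" "l2n (\<lambda>i. integral {a..b} (\<phi> i)) \<le> M * (b - a)"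
proof -
  let ?c = "\<lambda>i. integral {a..b} (\<phi> i)"
  have M: "0 \<le> M" using le[of a] l2n_nonneg[of "\<lambda>i. \<phi> i a"] ab by (meson atLeastAtMost_iff order_refl order_trans)
  have "L2_set (\<lambda>i. cmod (?c i)) F \<le> M * (b - a)" if F: "finite F" for F
  proof -
    let ?S = "L2_set (\<lambda>i. cmod (?c i)) F"
    have "((\<lambda>r. \<Sum>i\<in>F. cnj (?c i) * \<phi> i r) has_integral (\<Sum>i\<in>F. cnj (?c i) * ?c i)) {a..b}"
      by (intro has_integral_sum F has_integral_mult_right integrable_integral int)
    moreover have "cmod (\<Sum>i\<in>F. cnj (?c i) * \<phi> i r) \<le> ?S * M" if r: "r \<in> {a..b}" for r
    proof -
      have "cmod (\<Sum>i\<in>F. cnj (?c i) * \<phi> i r) \<le> (\<Sum>i\<in>F. \<bar>cmod (?c i)\<bar> * \<bar>cmod (\<phi> i r)\<bar>)"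
        by (rule order_trans[OF norm_sum]) (simp add: norm_mult)
      also have "\<dots> \<le> ?S * L2_set (\<lambda>i. cmod (\<phi> i r)) F" by (rule L2_set_mult_ineq)
      also have "\<dots> \<le> ?S * M"
        using order_trans[OF L2_set_le_l2n[OF l2[OF r] F] le[OF r]] by (intro mult_left_mono) auto
      finally show ?thesis .
    qed
    moreover have "0 \<le> ?S * M" using M by simp
    ultimately have "cmod (\<Sum>i\<in>F. cnj (?c i) * ?c i) \<le> (?S * M) * Sigma_Algebra.measure lborel {a..b}"
      using has_integral_bound[of "?S * M" _ _ a b] unfolding box_real by blast
    moreover have "(\<Sum>i\<in>F. cnj (?c i) * ?c i) = of_real (?S\<^sup>2)"
      by (simp add: L2_set_def sum_nonneg complex_norm_square[symmetric] mult.commute)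
    ultimately have "?S * ?S \<le> ?S * (M * (b - a))" using ab by (simp add: power2_eq_square norm_mult)
    then show ?thesis
      using M ab mult_le_cancel_left_pos[of ?S ?S "M * (b - a)"] L2_set_nonneg[of "\<lambda>i. cmod (?c i)" F]
      by (cases "?S = 0") (simp_all add: less_le)
  qed
  from l2I[OF this] show "?c \<in> l2" "l2n ?c \<le> M * (b - a)" by auto
qed

text \<open>A Lebesgue number for a cover by balls of small oscillation. Continuity is assumed on
  the whole line, so \<open>r'\<close> may leave the interval.\<close>

lemma l2_uniformly_continuous:
  fixes z :: "real \<Rightarrow> 'i \<Rightarrow> complex"
  assumes l2: "\<And>r. z r \<in> l2" and lim: "\<And>r. ((\<lambda>r'. l2n (\<lambda>i. z r' i - z r i)) \<longlongrightarrow> 0) (at r)" and e: "0 < \<epsilon>"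
  shows "\<exists>\<delta>>0. \<forall>r\<in>{a..b}. \<forall>r'. \<bar>r' - r\<bar> < \<delta> \<longrightarrow> l2n (\<lambda>i. z r' i - z r i) < \<epsilon>"
proof -
  let ?G = "{ball r d | r d. 0 < d \<and> (\<forall>r'\<in>ball r d. l2n (\<lambda>i. z r' i - z r i) < \<epsilon> / 2)}"
  have cover: "{a..b} \<subseteq> \<Union> ?G"
  proof
    fix r assume "r \<in> {a..b}"
    have "eventually (\<lambda>r'. l2n (\<lambda>i. z r' i - z r i) < \<epsilon> / 2) (at r)" using order_tendstoD(2)[OF lim half_gt_zero[OF e]] .
    then obtain d where d: "0 < d" "\<And>r'. r' \<noteq> r \<Longrightarrow> dist r' r < d \<Longrightarrow> l2n (\<lambda>i. z r' i - z r i) < \<epsilon> / 2"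
      unfolding eventually_at by auto
    have "l2n (\<lambda>i. z r' i - z r i) < \<epsilon> / 2" if "r' \<in> ball r d" for r'
      using d(2)[of r'] that e by (cases "r' = r") (auto simp: dist_commute)
    then have "ball r d \<in> ?G" using d(1) by blast
    then show "r \<in> \<Union> ?G" using d(1) by (meson UnionI centre_in_ball)
  qed
  obtain \<delta> where \<delta>: "0 < \<delta>" "\<And>r. r \<in> {a..b} \<Longrightarrow> \<exists>B\<in>?G. ball r \<delta> \<subseteq> B"
    using Heine_Borel_lemma[OF compact_Icc cover] by blast
  have "l2n (\<lambda>i. z r' i - z r i) < \<epsilon>" if r: "r \<in> {a..b}" and r': "\<bar>r' - r\<bar> < \<delta>" for r r'
  proof -
    obtain B where "B \<in> ?G" "ball r \<delta> \<subseteq> B" using \<delta>(2)[OF r] by blast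
    then obtain c d where cd: "\<And>r'. r' \<in> ball c d \<Longrightarrow> l2n (\<lambda>i. z r' i - z c i) < \<epsilon> / 2" "ball r \<delta> \<subseteq> ball c d" by blast
    have "r \<in> ball c d" "r' \<in> ball c d"
      using subsetD[OF cd(2), of r] subsetD[OF cd(2), of r'] r' \<delta>(1) by (simp_all add: dist_real_def abs_minus_commute)
    then have "l2n (\<lambda>i. z r' i - z c i) + l2n (\<lambda>i. z r i - z c i) < \<epsilon>" using cd(1)[of r] cd(1)[of r'] by simp
    moreover have "l2n (\<lambda>i. (z r' i - z c i) - (z r i - z c i)) \<le> l2n (\<lambda>i. z r' i - z c i) + l2n (\<lambda>i. z r i - z c i)"
      by (intro l2_diff l2)
    ultimately show ?thesis by simp
  qed
  then show ?thesis using \<delta>(1) by blast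
qed

text \<open>The curve frozen at the grid point just below \<open>r\<close>, on a grid of mesh
  \<open>1 / Suc n\<close>. On a bounded interval only finitely many values occur, so this is a
  simple function.\<close>

definition steps :: "(real \<Rightarrow> 'v) \<Rightarrow> nat \<Rightarrow> real \<Rightarrow> 'v" where
  "steps F n r = F (of_int \<lfloor>of_nat (Suc n) * r\<rfloor> / of_nat (Suc n))"

lemma step_point:
  fixes r :: real
  assumes "0 \<le> r"
  shows "(0 :: real) \<le> of_int \<lfloor>of_nat (Suc n) * r\<rfloor> / of_nat (Suc n)"
    and "\<bar>of_int \<lfloor>of_nat (Suc n) * r\<rfloor> / of_nat (Suc n) - r\<bar> \<le> 1 / of_nat (Suc n)"
proof -
  have "\<bar>of_int \<lfloor>of_nat (Suc n) * r\<rfloor> - of_nat (Suc n) * r\<bar> \<le> 1" by linarith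
  moreover have "of_int \<lfloor>of_nat (Suc n) * r\<rfloor> / of_nat (Suc n) - r = (of_int \<lfloor>of_nat (Suc n) * r\<rfloor> - of_nat (Suc n) * r) / of_nat (Suc n)"
    by (simp add: field_simps)
  ultimately show "\<bar>of_int \<lfloor>of_nat (Suc n) * r\<rfloor> / of_nat (Suc n) - r\<bar> \<le> 1 / of_nat (Suc n)"
    by (simp add: abs_divide divide_right_mono)
qed (use assms in simp)

lemma simple_into_steps:
  assumes S: "S \<subseteq> {0..t}" and X: "\<And>r. F r \<in> X"
  shows "simple_into X (lebesgue_on S) (steps F n)"
proof -
  have "simple_function (lebesgue_on S) (\<lambda>r::real. \<lfloor>of_nat (Suc n) * r\<rfloor>)"
    unfolding simple_function_eq_measurable
  proof
    have "(\<lambda>r::real. \<lfloor>of_nat (Suc n) * r\<rfloor>) ` space (lebesgue_on S) \<subseteq> {0..\<lfloor>of_nat (Suc n) * t\<rfloor>}"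
    proof
      fix k assume "k \<in> (\<lambda>r::real. \<lfloor>of_nat (Suc n) * r\<rfloor>) ` space (lebesgue_on S)"
      then obtain r where r: "r \<in> S" "k = \<lfloor>of_nat (Suc n) * r\<rfloor>" by auto
      then have "0 \<le> r" "r \<le> t" using S by auto
      then have "0 \<le> of_nat (Suc n) * r" "of_nat (Suc n) * r \<le> of_nat (Suc n) * t" by (simp_all add: mult_left_mono)
      then show "k \<in> {0..\<lfloor>of_nat (Suc n) * t\<rfloor>}" unfolding r(2) by (simp add: floor_mono del: of_nat_Suc)
    qed
    then show "finite ((\<lambda>r::real. \<lfloor>of_nat (Suc n) * r\<rfloor>) ` space (lebesgue_on S))" by (rule finite_subset) simp
    have "(\<lambda>r::real. \<lfloor>of_nat (Suc n) * r\<rfloor>) \<in> measurable borel (count_space UNIV)" by measurable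
    then have "(\<lambda>r::real. \<lfloor>of_nat (Suc n) * r\<rfloor>) \<in> measurable lebesgue (count_space UNIV)"
      by (simp add: measurable_completion measurable_lborel1)
    then show "(\<lambda>r::real. \<lfloor>of_nat (Suc n) * r\<rfloor>) \<in> measurable (lebesgue_on S) (count_space UNIV)"
      by (rule measurable_restrict_space1)
  qed
  from simple_function_compose1[OF this, of "\<lambda>k. F (of_int k / of_nat (Suc n))"]
  show ?thesis using X by (auto simp: simple_into_def steps_def[abs_def])
qed

lemma simple_integrable:
  fixes t :: real
  assumes "simple_function (lebesgue_on {0..t}) f"
  shows "Bochner_Integration.simple_bochner_integrable (lebesgue_on {0..t}) f"
proof (rule simple_bochner_integrable.intros[OF assms])
  have "emeasure (lebesgue_on {0..t}) {y \<in> space (lebesgue_on {0..t}). f y \<noteq> 0} \<le> emeasure (lebesgue_on {0..t}) (space (lebesgue_on {0..t}))"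
    by (rule emeasure_space)
  also have "\<dots> < \<infinity>" by (simp add: emeasure_restrict_space emeasure_lborel_Icc_eq)
  finally show "emeasure (lebesgue_on {0..t}) {y \<in> space (lebesgue_on {0..t}). f y \<noteq> 0} \<noteq> \<infinity>" by simp
qed

context coupled_system
begin

lemma states_zero: "K \<in> {\<real>, UNIV} \<Longrightarrow> 0 \<in> states K s"
proof -
  assume "K \<in> {\<real>, UNIV}"
  moreover have "fourier (\<lambda>x. 0) k = 0" for k by (simp add: fourier_def circle_int_def)
  moreover have "(\<lambda>x. 0 :: complex) \<in> L2_circle" by (rule L2_circle_const)
  ultimately show ?thesis by (auto simp: states_def sob0_def mem_sob_iff mean_eq zero_fun_def zero_prod_def)
qed

lemma states_sum:
  assumes "finite Y" "Y \<subseteq> states K s" "K \<in> {\<real>, UNIV}"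
  shows "(\<Sum>y\<in>Y. c y *\<^sub>R y) \<in> states K s \<and> coef (\<Sum>y\<in>Y. c y *\<^sub>R y) a = (\<Sum>y\<in>Y. c y *\<^sub>R coef y a)"
  using assms(1,2)
proof (induction rule: finite_induct)
  case empty
  have "coef 0 a = coef (0 *\<^sub>R 0) a" by simp
  also have "\<dots> = 0" by (subst coef_scaleR) simp
  finally show ?case using states_zero[OF assms(3)] by simp
next
  case (insert y Y)
  then have y: "c y *\<^sub>R y \<in> states K s" and Y: "(\<Sum>y\<in>Y. c y *\<^sub>R y) \<in> states K s"
    using states_scaleR[OF _ assms(3)] by auto
  have "coef (c y *\<^sub>R y + (\<Sum>y\<in>Y. c y *\<^sub>R y)) a = c y *\<^sub>R coef y a + (\<Sum>y\<in>Y. c y *\<^sub>R coef y a)"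
    using insert by (subst coef_add[OF states_L2[OF y] states_L2[OF Y]]) (simp add: coef_scaleR scaleR_conv_of_real)
  then show ?case using states_add[OF y Y assms(3)] insert(1,2) by simp
qed

text \<open>For a simple function the abstract integral is a finite sum, through which linear
  coordinates pass. This links the seminormed integral to ordinary integrals of coordinates.\<close>

lemma coef_simple_integral:
  fixes t :: real
  assumes \<Phi>: "simple_into (states K s) (lebesgue_on {0..t}) \<Phi>" and K: "K \<in> {\<real>, UNIV}"
  shows "Bochner_Integration.simple_bochner_integral (lebesgue_on {0..t}) \<Phi> \<in> states K s"
    and "(\<lambda>r. coef (\<Phi> r) a) integrable_on {0..t}"
    and "coef (Bochner_Integration.simple_bochner_integral (lebesgue_on {0..t}) \<Phi>) a = integral {0..t} (\<lambda>r. coef (\<Phi> r) a)"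
proof -
  let ?M = "lebesgue_on {0..t}"
  have sf: "simple_function ?M \<Phi>" and st: "\<Phi> ` space ?M \<subseteq> states K s" using \<Phi> by (auto simp: simple_into_def)
  have sfc: "simple_function ?M (\<lambda>r. coef (\<Phi> r) a)" using simple_function_compose1[OF sf, of "\<lambda>U. coef U a"] .
  have fin: "finite (\<Phi> ` space ?M)" using sf by (rule simple_functionD)
  note sum = states_sum[OF fin st K]
  show "Bochner_Integration.simple_bochner_integral ?M \<Phi> \<in> states K s"
    unfolding simple_bochner_integral_def by (rule conjunct1[OF sum])
  have I: "integrable ?M (\<lambda>r. coef (\<Phi> r) a)" by (rule integrableI_simple_bochner_integrable[OF simple_integrable[OF sfc]])
  then show "(\<lambda>r. coef (\<Phi> r) a) integrable_on {0..t}" by (rule integrable_on_lebesgue_on) simp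
  have "coef (Bochner_Integration.simple_bochner_integral ?M \<Phi>) a
     = (\<Sum>y\<in>\<Phi> ` space ?M. measure ?M {r \<in> space ?M. \<Phi> r = y} *\<^sub>R coef y a)"
    unfolding simple_bochner_integral_def by (rule conjunct2[OF sum])
  also have "\<dots> = Bochner_Integration.simple_bochner_integral ?M (\<lambda>r. coef (\<Phi> r) a)"
    by (rule simple_bochner_integral_partition[symmetric, OF simple_integrable[OF sfc] sf]) auto
  also have "\<dots> = integral\<^sup>L ?M (\<lambda>r. coef (\<Phi> r) a)" by (rule simple_bochner_integrable_eq_integral[OF simple_integrable[OF sfc]])
  also have "\<dots> = integral {0..t} (\<lambda>r. coef (\<Phi> r) a)" by (rule lebesgue_integral_eq_integral[OF I]) simp
  finally show "coef (Bochner_Integration.simple_bochner_integral ?M \<Phi>) a = integral {0..t} (\<lambda>r. coef (\<Phi> r) a)" .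
qed

lemma wt_diff_l2:
  assumes "U \<in> states K s" "V \<in> states K s"
  shows "wt s (\<lambda>a. coef U a - coef V a) \<in> l2"
proof -
  have "wt s (\<lambda>a. coef U a - coef V a) = (\<lambda>a. wt s (coef U) a - wt s (coef V) a)" by (simp add: wt_def right_diff_distrib)
  moreover have "wt s (coef U) \<in> l2" "wt s (coef V) \<in> l2" using assms by (simp_all add: states_iff)
  ultimately show ?thesis using l2_diff(1) by simp
qed

text \<open>Stated on the whole line, so that continuity is two-sided at every time and no interval
  has to be carried along.\<close>

definition continuous_states :: "complex set \<Rightarrow> real \<Rightarrow> (real \<Rightarrow> state) \<Rightarrow> bool" where
  "continuous_states K s F \<longleftrightarrow> (\<forall>r. F r \<in> states K s \<and> ((\<lambda>r'. state_norm s (F r' - F r)) \<longlongrightarrow> 0) (at r))"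

lemma steps_uniform:
  assumes F: "continuous_states K s F" and K: "K \<in> {\<real>, UNIV}" and e: "0 < \<epsilon>"
  shows "\<exists>m. \<forall>n\<ge>m. \<forall>r\<in>{0..t}. state_norm s (F r - steps F n r) < \<epsilon>"
proof -
  have st: "F r \<in> states K s" for r using F by (simp add: continuous_states_def)
  note N = state_norm_diff[OF st st K]
  have d: "(\<lambda>a. wt s (coef (F r')) a - wt s (coef (F r)) a) = wt s (\<lambda>a. coef (F r') a - coef (F r) a)" for r r'
    by (simp add: wt_def right_diff_distrib)
  have "\<exists>\<delta>>0. \<forall>r\<in>{0..t}. \<forall>r'. \<bar>r' - r\<bar> < \<delta> \<longrightarrow> l2n (\<lambda>a. wt s (coef (F r')) a - wt s (coef (F r)) a) < \<epsilon>"
  proof (rule l2_uniformly_continuous[OF _ _ e])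
    show "wt s (coef (F r)) \<in> l2" for r using st[of r] by (simp add: states_iff)
    show "((\<lambda>r'. l2n (\<lambda>a. wt s (coef (F r')) a - wt s (coef (F r)) a)) \<longlongrightarrow> 0) (at r)" for r
      using F unfolding d N[symmetric] by (simp add: continuous_states_def)
  qed
  then obtain \<delta> where \<delta>: "0 < \<delta>" "\<And>r r'. r \<in> {0..t} \<Longrightarrow> \<bar>r' - r\<bar> < \<delta> \<Longrightarrow> l2n (\<lambda>a. wt s (coef (F r')) a - wt s (coef (F r)) a) < \<epsilon>" by blast
  obtain m where m: "1 / of_nat (Suc m) < \<delta>" using nat_approx_posE[OF \<delta>(1)] by blast
  have "state_norm s (F r - steps F n r) < \<epsilon>" if "n \<ge> m" "r \<in> {0..t}" for n r
  proof -
    let ?r = "of_int \<lfloor>of_nat (Suc n) * r\<rfloor> / of_nat (Suc n)"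
    have "1 / of_nat (Suc n) \<le> (1 / of_nat (Suc m) :: real)" using that(1) by (intro divide_left_mono) auto
    then have "\<bar>?r - r\<bar> < \<delta>" using step_point(2)[of r n] that(2) m by simp
    from \<delta>(2)[OF that(2) this] have "state_norm s (F ?r - F r) < \<epsilon>" unfolding d N .
    moreover have "state_norm s (F ?r - F r) = state_norm s (F r - F ?r)" unfolding N
      by (rule l2n_cong) (simp add: wt_def norm_mult norm_minus_commute)
    ultimately show ?thesis by (simp add: steps_def)
  qed
  then show ?thesis by blast
qed

lemma steps_tendsto:
  assumes "continuous_states K s F" "K \<in> {\<real>, UNIV}" "r \<in> {0..t}"
  shows "(\<lambda>n. state_norm s (F r - steps F n r)) \<longlonglongrightarrow> 0"
proof (rule LIMSEQ_I)
  fix \<epsilon> :: real assume "0 < \<epsilon>"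
  have nn: "0 \<le> state_norm s U" for U by (simp add: state_norm_def split_beta)
  obtain m where "\<And>n r. n \<ge> m \<Longrightarrow> r \<in> {0..t} \<Longrightarrow> state_norm s (F r - steps F n r) < \<epsilon>"
    using steps_uniform[OF assms(1,2) \<open>0 < \<epsilon>\<close>, of t] by blast
  then have "\<forall>n\<ge>m. norm (state_norm s (F r - steps F n r) - 0) < \<epsilon>"
    using assms(3) nn by (simp add: abs_of_nonneg)
  then show "\<exists>m. \<forall>n\<ge>m. norm (state_norm s (F r - steps F n r) - 0) < \<epsilon>" by (rule exI)
qed

lemma coef_tendsto:
  assumes F: "continuous_states K s F" and K: "K \<in> {\<real>, UNIV}" and s: "0 \<le> s"
  shows "continuous_on A (\<lambda>r. coef (F r) a)"
proof -
  have st: "F r \<in> states K s" for r using F by (simp add: continuous_states_def)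
  have "isCont (\<lambda>r. coef (F r) a) r" for r
    unfolding isCont_def
  proof (rule LIM_zero_cancel)
    show "((\<lambda>r'. coef (F r') a - coef (F r) a) \<longlongrightarrow> 0) (at r)"
    proof (rule Lim_null_comparison[OF always_eventually])
      show "((\<lambda>r'. state_norm s (F r' - F r)) \<longlongrightarrow> 0) (at r)" using F by (simp add: continuous_states_def)
      show "\<forall>r'. cmod (coef (F r') a - coef (F r) a) \<le> state_norm s (F r' - F r)"
      proof
        fix r'
        let ?d = "\<lambda>a. coef (F r') a - coef (F r) a"
        have "wt s ?d \<in> l2"
          by (rule wt_diff_l2[OF st st])
        have "cmod (?d a) \<le> cmod (wt s ?d a)"
          using mult_right_mono[OF ge_one_powr_ge_zero[OF bracket_ge1[of "fst a"] s] norm_ge_zero[of "?d a"]]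
          by (simp add: wt_def norm_mult)
        also have "\<dots> \<le> state_norm s (F r' - F r)"
          unfolding state_norm_diff[OF st st K] by (rule norm_le_l2n) fact
        finally show "cmod (?d a) \<le> state_norm s (F r' - F r)" .
      qed
    qed
  qed
  then show ?thesis by (simp add: continuous_at_imp_continuous_on)
qed

lemma strongly_measurable_states:
  assumes "continuous_states K s F" "K \<in> {\<real>, UNIV}" "S \<subseteq> {0..t}"
  shows "strongly_measurable (states K s) (state_norm s) (lebesgue_on S) F"
  unfolding strongly_measurable_def
proof (intro conjI exI allI)
  show "AE r in lebesgue_on S. F r \<in> states K s" using assms(1) by (simp add: continuous_states_def)
  show "simple_into (states K s) (lebesgue_on S) (steps F n)" for n
    by (rule simple_into_steps[OF assms(3)]) (use assms(1) in \<open>simp add: continuous_states_def\<close>)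
  show "AE r in lebesgue_on S. (\<lambda>n. state_norm s (F r - steps F n r)) \<longlonglongrightarrow> 0"
    by (rule AE_I2, rule steps_tendsto[OF assms(1,2), of _ t]) (use assms(3) in auto)
qed

text \<open>Step functions converge uniformly on the interval. This bounds the integrated error
  directly, and the error of the integrals through their coordinates and
  \<open>l2_integral\<close>.\<close>

lemma has_bochner_integral_states:
  assumes F: "continuous_states K s F" and K: "K \<in> {\<real>, UNIV}" and s: "0 \<le> s" and t: "0 \<le> t"
    and I: "I \<in> states K s" "\<And>a. coef I a = integral {0..t} (\<lambda>r. coef (F r) a)"
  shows "has_bochner_integral_in (states K s) (state_norm s) (lebesgue_on {0..t}) F I"
  unfolding has_bochner_integral_in_def
proof (intro conjI exI allI)
  let ?M = "lebesgue_on {0..t}"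
  have st: "F r \<in> states K s" for r using F by (simp add: continuous_states_def)
  have nn: "0 \<le> state_norm s U" for U by (simp add: state_norm_def split_beta)
  show "I \<in> states K s" by fact
  show "strongly_measurable (states K s) (state_norm s) ?M F"
    by (rule strongly_measurable_states[OF F K order_refl])
  show simple: "simple_into (states K s) ?M (steps F n)" for n by (rule simple_into_steps[OF order_refl st])
  show "(\<lambda>n. \<integral>\<^sup>+ r. ennreal (state_norm s (F r - steps F n r)) \<partial>?M) \<longlonglongrightarrow> 0"
  proof (rule order_tendstoI)
    fix c :: ennreal assume "0 < c"
    then have "\<exists>d>0. ennreal d \<le> c" by (cases c) (auto intro: exI[of _ 1])
    then obtain d where d: "0 < d" "ennreal d \<le> c" by blast
    \<comment> \<open>Dividing by \<open>t + 1\<close> rather than \<open>t\<close> admits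
      \<open>t = 0\<close> and leaves the final inequality strict.\<close>
    obtain m where m: "\<And>n r. n \<ge> m \<Longrightarrow> r \<in> {0..t} \<Longrightarrow> state_norm s (F r - steps F n r) < d / (t + 1)"
      using steps_uniform[OF F K, of "d / (t + 1)" t] d(1) t by (smt (verit) divide_pos_pos)
    have "(\<integral>\<^sup>+ r. ennreal (state_norm s (F r - steps F n r)) \<partial>?M) < c" if "n \<ge> m" for n
    proof -
      have "(\<integral>\<^sup>+ r. ennreal (state_norm s (F r - steps F n r)) \<partial>?M) \<le> (\<integral>\<^sup>+ r. ennreal (d / (t + 1)) \<partial>?M)"
        using m[OF that] by (intro nn_integral_mono ennreal_leI) (auto intro: less_imp_le)
      also have "\<dots> = ennreal (d / (t + 1)) * ennreal t"
        using t by (simp add: emeasure_restrict_space)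
      also have "\<dots> = ennreal (d / (t + 1) * t)" by (rule ennreal_mult[symmetric]) (use d(1) t in auto)
      also have "\<dots> < ennreal d" using d(1) t by (simp add: ennreal_less_iff field_simps)
      finally show ?thesis using d(2) by (rule less_le_trans)
    qed
    then show "\<forall>\<^sub>F n in sequentially. (\<integral>\<^sup>+ r. ennreal (state_norm s (F r - steps F n r)) \<partial>?M) < c"
      unfolding eventually_sequentially by blast
  qed simp
  show "(\<lambda>n. state_norm s (Bochner_Integration.simple_bochner_integral ?M (steps F n) - I)) \<longlonglongrightarrow> 0"
  proof (rule LIMSEQ_I)
    fix \<epsilon> :: real assume e: "0 < \<epsilon>"
    obtain m where m: "\<And>n r. n \<ge> m \<Longrightarrow> r \<in> {0..t} \<Longrightarrow> state_norm s (F r - steps F n r) < \<epsilon> / (t + 1)"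
      using steps_uniform[OF F K, of "\<epsilon> / (t + 1)" t] e t by (smt (verit) divide_pos_pos)
    have "state_norm s (Bochner_Integration.simple_bochner_integral ?M (steps F n) - I) < \<epsilon>" if n: "n \<ge> m" for n
    proof -
      note S = coef_simple_integral[OF simple K, of n]
      let ?\<phi> = "\<lambda>a r. of_real (bracket (fst a) powr s) * (coef (steps F n r) a - coef (F r) a)"
      have Fi: "(\<lambda>r. coef (F r) a) integrable_on {0..t}" for a
        by (rule integrable_continuous_real[OF coef_tendsto[OF F K s]])
      have eq: "wt s (\<lambda>a. coef (Bochner_Integration.simple_bochner_integral ?M (steps F n)) a - coef I a) = (\<lambda>a. integral {0..t} (?\<phi> a))"
        unfolding wt_def S(3) I(2) by (rule ext) (simp add: Henstock_Kurzweil_Integration.integral_diff[OF S(2) Fi])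
      have phi: "(\<lambda>a. ?\<phi> a r) = wt s (\<lambda>a. coef (steps F n r) a - coef (F r) a)" for r by (simp add: wt_def)
      have sts: "steps F n r \<in> states K s" for r by (simp add: steps_def st)
      have comm: "l2n (wt s (\<lambda>a. coef (steps F n r) a - coef (F r) a)) = state_norm s (F r - steps F n r)" for r
        unfolding state_norm_diff[OF st sts K] by (rule l2n_cong) (simp add: wt_def norm_mult norm_minus_commute)
      have "l2n (\<lambda>a. integral {0..t} (?\<phi> a)) \<le> \<epsilon> / (t + 1) * (t - 0)"
      proof (rule l2_integral(2)[OF t])
        show "?\<phi> a integrable_on {0..t}" for a
          using integrable_diff[OF S(2) Fi] by (rule integrable_on_mult_right)
        fix r assume r: "r \<in> {0..t}"
        show "(\<lambda>a. ?\<phi> a r) \<in> l2"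
          unfolding phi by (rule wt_diff_l2[OF sts st])
        show "l2n (\<lambda>a. ?\<phi> a r) \<le> \<epsilon> / (t + 1)" unfolding phi comm using m[OF n r] by simp
      qed
      also have "\<dots> < \<epsilon>" using e t by (simp add: field_simps)
      finally show ?thesis unfolding state_norm_diff[OF S(1) I(1) K] eq .
    qed
    then show "\<exists>m. \<forall>n\<ge>m. norm (state_norm s (Bochner_Integration.simple_bochner_integral ?M (steps F n) - I) - 0) < \<epsilon>"
      using nn by auto
  qed
qed

text \<open>The flow is isometric, so replacing \<open>z r\<close> by \<open>z r0\<close> costs
  their distance at whatever time; what remains is strong continuity on the fixed sequence
  \<open>z r0\<close>.\<close>

lemma flow_continuous:
  assumes z: "\<And>r. r \<in> A \<Longrightarrow> wt s (z r) \<in> l2" and r0: "r0 \<in> A"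
    and lim: "((\<lambda>r. l2n (wt s (\<lambda>a. z r a - z r0 a))) \<longlongrightarrow> 0) (at r0 within A)"
    and \<theta>: "continuous (at r0 within A) \<theta>"
  shows "((\<lambda>r. l2n (wt s (\<lambda>a. flow (\<theta> r) (z r) a - flow (\<theta> r0) (z r0) a))) \<longlongrightarrow> 0) (at r0 within A)"
proof (rule Lim_null_comparison)
  have "isCont (\<lambda>t. l2n (wt s (\<lambda>a. flow t (z r0) a - flow (\<theta> r0) (z r0) a))) (\<theta> r0)"
    using flow_tendsto[OF z[OF r0], of "\<theta> r0" UNIV] by (simp add: isCont_def wt_def)
  from isCont_tendsto_compose[OF this \<theta>[unfolded continuous_within]]
  have "((\<lambda>r. l2n (wt s (\<lambda>a. flow (\<theta> r) (z r0) a - flow (\<theta> r0) (z r0) a))) \<longlongrightarrow> 0) (at r0 within A)"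
    by (simp add: wt_def)
  from tendsto_add[OF lim this]
  show "((\<lambda>r. l2n (wt s (\<lambda>a. z r a - z r0 a)) + l2n (wt s (\<lambda>a. flow (\<theta> r) (z r0) a - flow (\<theta> r0) (z r0) a))) \<longlongrightarrow> 0) (at r0 within A)" by simp
  have "l2n (wt s (\<lambda>a. flow (\<theta> r) (z r) a - flow (\<theta> r0) (z r0) a))
      \<le> l2n (wt s (\<lambda>a. z r a - z r0 a)) + l2n (wt s (\<lambda>a. flow (\<theta> r) (z r0) a - flow (\<theta> r0) (z r0) a))" if r: "r \<in> A" for r
  proof -
    let ?x = "wt s (flow (\<theta> r) (\<lambda>a. z r a - z r0 a))" and ?y = "wt s (\<lambda>a. flow (\<theta> r) (z r0) a - flow (\<theta> r0) (z r0) a)"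
    have fl: "wt s (flow t (z r)) \<in> l2" if "r \<in> A" for t r
      using z[OF that] by (subst l2_cong[of _ "wt s (z r)"]) (simp_all add: wt_def norm_mult)
    have "wt s (\<lambda>a. x a - y a) = (\<lambda>a. wt s x a - wt s y a)" for x y by (simp add: wt_def right_diff_distrib)
    note d = this
    have x: "?x = (\<lambda>a. wt s (flow (\<theta> r) (z r)) a - wt s (flow (\<theta> r) (z r0)) a)"
      by (simp add: wt_def flow_def right_diff_distrib)
    have "?x \<in> l2" "?y \<in> l2" unfolding x unfolding d by (intro l2_diff fl r r0)+
    from l2_add(2)[OF this] have "l2n (\<lambda>a. ?x a + ?y a) \<le> l2n (wt s (\<lambda>a. z r a - z r0 a)) + l2n ?y" by (simp add: l2n_wt_flow)
    moreover have "(\<lambda>a. ?x a + ?y a) = wt s (\<lambda>a. flow (\<theta> r) (z r) a - flow (\<theta> r0) (z r0) a)"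
      by (simp add: wt_def flow_def fun_eq_iff algebra_simps)
    ultimately show ?thesis by simp
  qed
  then show "\<forall>\<^sub>F r in at r0 within A. norm (l2n (wt s (\<lambda>a. flow (\<theta> r) (z r) a - flow (\<theta> r0) (z r0) a)))
      \<le> l2n (wt s (\<lambda>a. z r a - z r0 a)) + l2n (wt s (\<lambda>a. flow (\<theta> r) (z r0) a - flow (\<theta> r0) (z r0) a))"
    by (auto simp: eventually_at_filter)
qed

lemma continuous_states_W:
  assumes F: "continuous_states K s F" and K: "K \<in> {\<real>, UNIV}" and s: "0 \<le> s" and \<theta>: "continuous_on UNIV \<theta>"
  shows "continuous_states K s (\<lambda>r. W (\<theta> r) (F r))"
  unfolding continuous_states_def
proof (intro allI conjI)
  have st: "F r \<in> states K s" for r using F by (simp add: continuous_states_def)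
  note Ws = W_states[OF st s K]
  fix r
  show "W (\<theta> r) (F r) \<in> states K s" by (rule Ws)
  have "((\<lambda>r'. l2n (wt s (\<lambda>a. flow (\<theta> r') (coef (F r')) a - flow (\<theta> r) (coef (F r)) a))) \<longlongrightarrow> 0) (at r)"
  proof (rule flow_continuous)
    show "wt s (coef (F r)) \<in> l2" for r using st[of r] by (simp add: states_iff)
    show "((\<lambda>r'. l2n (wt s (\<lambda>a. coef (F r') a - coef (F r) a))) \<longlongrightarrow> 0) (at r)"
      using F unfolding state_norm_diff[OF st st K, symmetric] by (simp add: continuous_states_def)
    show "isCont \<theta> r" using \<theta> by (simp add: continuous_on_eq_continuous_at)
  qed simp
  then show "((\<lambda>r'. state_norm s (W (\<theta> r') (F r') - W (\<theta> r) (F r))) \<longlongrightarrow> 0) (at r)"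
    unfolding state_norm_diff[OF Ws(1) Ws(1) K] Ws(2) .
qed

end

section \<open>Exact controllability\<close>

context coupled_system
begin

lemma seqs_l2:
  assumes "z \<in> seqs K s" "0 \<le> s"
  shows "z \<in> l2"
proof (rule l2_mono(1))
  show "wt s z \<in> l2" using assms by (simp add: seqs_def)
  show "cmod (z a) \<le> cmod (wt s z a)" for a
    using mult_right_mono[OF ge_one_powr_ge_zero[OF bracket_ge1[of "fst a"] assms(2)] norm_ge_zero[of "z a"]]
    by (simp add: wt_def norm_mult)
qed

lemma wt_lin: "wt s (\<lambda>a. x a + y a) = (\<lambda>a. wt s x a + wt s y a)" "wt s (\<lambda>a. x a - y a) = (\<lambda>a. wt s x a - wt s y a)"
  by (simp_all add: wt_def distrib_left right_diff_distrib)

lemma seqs_add: "x \<in> seqs K s \<Longrightarrow> y \<in> seqs K s \<Longrightarrow> (\<lambda>a. x a + y a) \<in> seqs K s"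
  unfolding seqs_def mem_Collect_eq wt_lin by (auto intro: l2_add)

lemma seqs_diff: "x \<in> seqs K s \<Longrightarrow> y \<in> seqs K s \<Longrightarrow> (\<lambda>a. x a - y a) \<in> seqs K s"
  unfolding seqs_def mem_Collect_eq wt_lin by (auto intro: l2_diff)

lemma state_norm_components:
  "sob_norm s (fst U) \<le> state_norm s U" "sob_norm s (snd U) \<le> state_norm s U"
  by (simp_all add: state_norm_def split_beta real_sqrt_sum_squares_ge1 real_sqrt_sum_squares_ge2)

lemma sob_norm_nonneg: "0 \<le> sob_norm s f"
  by (simp add: sob_norm_eq)

text \<open>A projection is linear and does not increase the norm, so the step functions of the
  state project to those of the component. Square integrability is immediate from
  boundedness.\<close>

lemma L2_into_component:
  fixes T :: real
  assumes C: "continuous_states K s C" and K: "K \<in> {\<real>, UNIV}" and B: "\<And>r. state_norm s (C r) \<le> B"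
    and \<pi>: "\<pi> = fst \<or> \<pi> = snd"
  shows "L2_into (sob0 K s) (sob_norm s) (lebesgue_on {0<..<T}) (\<lambda>r. \<pi> (C r))"
  unfolding L2_into_def strongly_measurable_def
proof (intro conjI exI allI)
  have st: "C r \<in> states K s" for r using C by (simp add: continuous_states_def)
  have \<pi>st: "\<pi> (C r) \<in> sob0 K s" for r using st[of r] \<pi> by (auto simp: states_def)
  have \<pi>N: "sob_norm s (\<pi> U) \<le> state_norm s U" for U using \<pi> by (elim disjE) (simp_all only: state_norm_components)
  have \<pi>d: "\<pi> U - \<pi> V = \<pi> (U - V)" for U V using \<pi> by auto
  show "AE r in lebesgue_on {0<..<T}. \<pi> (C r) \<in> sob0 K s" using \<pi>st by simp
  show "simple_into (sob0 K s) (lebesgue_on {0<..<T}) (steps (\<lambda>r. \<pi> (C r)) n)" for n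
    by (rule simple_into_steps[of _ T]) (use \<pi>st in auto)
  show "AE r in lebesgue_on {0<..<T}. (\<lambda>n. sob_norm s (\<pi> (C r) - steps (\<lambda>r. \<pi> (C r)) n r)) \<longlonglongrightarrow> 0"
  proof (rule AE_I2)
    fix r assume "r \<in> space (lebesgue_on {0<..<T})"
    then have r: "r \<in> {0..T}" by simp
    show "(\<lambda>n. sob_norm s (\<pi> (C r) - steps (\<lambda>r. \<pi> (C r)) n r)) \<longlonglongrightarrow> 0"
    proof (rule Lim_null_comparison[OF always_eventually steps_tendsto[OF C K r]], rule allI)
      show "norm (sob_norm s (\<pi> (C r) - steps (\<lambda>r. \<pi> (C r)) n r)) \<le> state_norm s (C r - steps C n r)" for n
        using \<pi>N[of "C r - steps C n r"] sob_norm_nonneg by (simp add: steps_def \<pi>d)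
    qed
  qed
  have "(sob_norm s (\<pi> (C r)))\<^sup>2 \<le> B\<^sup>2" for r
    using order_trans[OF \<pi>N B, of r] by (intro power_mono sob_norm_nonneg)
  then have "(\<integral>\<^sup>+ r. ennreal ((sob_norm s (\<pi> (C r)))\<^sup>2) \<partial>lebesgue_on {0<..<T}) \<le> (\<integral>\<^sup>+ r. ennreal (B\<^sup>2) \<partial>lebesgue_on {0<..<T})"
    by (intro nn_integral_mono ennreal_leI)
  also have "\<dots> < \<infinity>"
    by (cases "0 \<le> T") (simp_all add: emeasure_restrict_space emeasure_lborel_Ioo ennreal_mult_less_top)
  finally show "(\<integral>\<^sup>+ r. ennreal ((sob_norm s (\<pi> (C r)))\<^sup>2) \<partial>lebesgue_on {0<..<T}) < \<infinity>" .
qed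

lemma cont_into_component:
  assumes U: "\<And>t. t \<in> S \<Longrightarrow> U t \<in> states K s"
    and lim: "\<And>t. t \<in> S \<Longrightarrow> ((\<lambda>r. state_norm s (U r - U t)) \<longlongrightarrow> 0) (at t within S)"
    and \<pi>: "\<pi> = fst \<or> \<pi> = snd"
  shows "cont_into (sob0 K s) (sob_norm s) S (\<lambda>r. \<pi> (U r))"
  unfolding cont_into_def
proof (intro ballI conjI)
  fix t assume t: "t \<in> S"
  show "\<pi> (U t) \<in> sob0 K s" using U[OF t] \<pi> by (auto simp: states_def)
  show "((\<lambda>r. sob_norm s (\<pi> (U r) - \<pi> (U t))) \<longlongrightarrow> 0) (at t within S)"
  proof (rule Lim_null_comparison[OF always_eventually lim[OF t]], rule allI)
    fix r
    have "\<pi> (U r) - \<pi> (U t) = \<pi> (U r - U t)" using \<pi> by auto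
    then show "norm (sob_norm s (\<pi> (U r) - \<pi> (U t))) \<le> state_norm s (U r - U t)"
      using \<pi> state_norm_components[of s "U r - U t"] sob_norm_nonneg by auto
  qed
qed

end

context control_system
begin

text \<open>At zero modes both sides vanish; elsewhere the Fredholm alternative applies. For real
  data the conjugate of \<open>x\<close>, reflected in frequency, solves the same equations, and
  uniqueness makes it equal to \<open>x\<close>.\<close>

lemma controllable_modes:
  assumes s: "0 \<le> s" and c: "c \<in> seqs K s"
  shows "\<exists>x\<in>seqs K s. \<forall>a. mapp Mat x a = c a"
proof -
  have "c \<in> lw s" using c by (simp add: lw_def seqs_def wt_def)
  from Fredholm_alternative[of zero_modes, OF op_injective s this]
  obtain x where x: "x \<in> lw s" "\<And>a. a \<in> zero_modes \<Longrightarrow> x a = 0" "\<And>a. a \<notin> zero_modes \<Longrightarrow> op x a = c a" by blast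
  have xl: "x \<in> l2" by (rule l2_imp_lw_0[OF x(1) s])
  have Mx: "mapp Mat x a = c a" for a
  proof (cases "fst a = 0")
    case True
    moreover have "c a = 0" using c True unfolding seqs_def by blast
    ultimately show ?thesis by (simp add: Mat_zero_mode)
  next
    case False
    then show ?thesis using x(3)[of a] op_eq_Mat[OF xl, of a] by simp
  qed
  have "x (- k, \<sigma>) = cnj (x (k, \<sigma>))" if K: "K = \<real>" for k \<sigma>
  proof -
    let ?n = "\<lambda>a :: int \<times> bool. (- fst a, snd a)"
    have bij: "bij ?n" by (rule o_bij[of ?n]) (auto simp: fun_eq_iff)
    define y where "y a = cnj (x (?n a))" for a
    have yl: "y \<in> l2" using l2_reindex[OF bij xl] l2_cong[of y "\<lambda>a. x (?n a)"] by (simp add: y_def)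
    have cM: "Mat (?n a) (?n b) = cnj (Mat a b)" for a b
    proof -
      obtain k \<sigma> j \<tau> where ab: "a = (k, \<sigma>)" "b = (j, \<tau>)" by (cases a; cases b)
      have "lam (- k, \<sigma>) - lam (- j, \<tau>) = - (lam (k, \<sigma>) - lam (j, \<tau>))" by (simp add: lam_minus)
      then show ?thesis unfolding Mat_def gram_def ww_def by (simp add: ab w_minus cnj_GGm cnj_osc)
    qed
    have My: "mapp Mat y a = c a" for a
    proof -
      obtain k \<sigma> where a: "a = (k, \<sigma>)" by (cases a)
      have "mapp Mat y a = (\<Sum>\<^sub>\<infinity>b. cnj (Mat (?n a) (?n b) * x (?n b)))" by (simp add: mapp_def y_def cM)
      also have "\<dots> = cnj (\<Sum>\<^sub>\<infinity>b. Mat (?n a) (?n b) * x (?n b))" by (rule infsum_cnj)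
      also have "(\<Sum>\<^sub>\<infinity>b. Mat (?n a) (?n b) * x (?n b)) = mapp Mat x (?n a)"
        unfolding mapp_def by (rule infsum_reindex_bij_betw[OF bij])
      finally show ?thesis using c K by (simp add: Mx a seqs_def)
    qed
    have "(\<lambda>a. x a - y a) = (\<lambda>a. 0)"
    proof (rule op_injective)
      show "(\<lambda>a. x a - y a) \<in> l2" by (rule l2_diff[OF xl yl])
      show "x a - y a = 0" if "a \<in> zero_modes" for a using that x(2)[of a] x(2)[of "?n a"] by (simp add: y_def)
      show "op (\<lambda>a. x a - y a) a = 0" for a
        unfolding op_diff[OF xl yl] op_eq_Mat[OF xl] op_eq_Mat[OF yl] Mx My by simp
    qed
    then have "x a = y a" for a by (metis eq_iff_diff_eq_0)
    from this[of "(- k, \<sigma>)"] show ?thesis by (simp add: y_def)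
  qed
  then have "x \<in> seqs K s" using x by (auto simp: seqs_def lw_def wt_def)
  then show ?thesis using Mx by blast
qed

section \<open>The control operator on states and the construction of the control\<close>

definition B :: "state \<Rightarrow> state" where "B U = (G (fst U), G (snd U))"

lemma B_states: "U \<in> states K s \<Longrightarrow> 0 \<le> s \<Longrightarrow> K \<in> {\<real>, UNIV} \<Longrightarrow> B U \<in> states K s"
  by (auto simp: B_def states_def intro: G_mem_sob0)

lemma G_diff:
  assumes "p \<in> L2_circle" "q \<in> L2_circle"
  shows "G (p - q) = G p - G q"
proof -
  have "avg (p - q) = avg p - avg q"
    using L2_integrable_mult[OF g_L2 assms(1)] L2_integrable_mult[OF g_L2 assms(2)]
    by (simp add: avg_def circle_int_cm right_diff_distrib)
  then show ?thesis unfolding G_eq by (simp add: fun_eq_iff right_diff_distrib)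
qed

lemma B_diff: "U \<in> states K s \<Longrightarrow> V \<in> states K s \<Longrightarrow> B (U - V) = B U - B V"
  using states_L2[of U K s] states_L2[of V K s] by (simp add: B_def G_diff)

lemma B_bounded:
  assumes "0 \<le> s"
  shows "\<exists>R\<ge>0. \<forall>U\<in>states K s. state_norm s (B U) \<le> R * state_norm s U"
proof -
  obtain R where "R \<ge> 0 \<and> (\<forall>p\<in>sob s. G p \<in> sob s \<and> sob_norm s (G p) \<le> R * sob_norm s p)"
    using G_sob0[OF assms] by (rule exE)
  then have R: "R \<ge> 0" "\<And>p. p \<in> sob s \<Longrightarrow> sob_norm s (G p) \<le> R * sob_norm s p" by auto
  have "state_norm s (B U) \<le> R * state_norm s U" if "U \<in> states K s" for U
  proof -
    have u: "fst U \<in> sob s" "snd U \<in> sob s" using that by (auto simp: states_def sob0_def)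
    have "(sob_norm s (G (fst U)))\<^sup>2 + (sob_norm s (G (snd U)))\<^sup>2 \<le> (R * sob_norm s (fst U))\<^sup>2 + (R * sob_norm s (snd U))\<^sup>2"
      by (intro add_mono power_mono R u sob_norm_nonneg)
    also have "\<dots> = R\<^sup>2 * ((sob_norm s (fst U))\<^sup>2 + (sob_norm s (snd U))\<^sup>2)" by (simp add: power_mult_distrib distrib_left)
    finally have "state_norm s (B U) \<le> sqrt (R\<^sup>2 * ((sob_norm s (fst U))\<^sup>2 + (sob_norm s (snd U))\<^sup>2))"
      unfolding state_norm_def B_def split_beta by (simp only: fst_conv snd_conv real_sqrt_le_iff)
    also have "\<dots> = R * state_norm s U" using R(1) by (simp add: state_norm_def split_beta real_sqrt_mult)
    finally show ?thesis .
  qed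
  then show ?thesis using R(1) by blast
qed

lemma continuous_states_B:
  assumes F: "continuous_states K s F" and s: "0 \<le> s" and K: "K \<in> {\<real>, UNIV}"
  shows "continuous_states K s (\<lambda>r. B (F r))"
  unfolding continuous_states_def
proof (intro allI conjI)
  have st: "F r \<in> states K s" for r using F by (simp add: continuous_states_def)
  fix r
  show "B (F r) \<in> states K s" by (rule B_states[OF st s K])
  obtain R where R: "\<And>U. U \<in> states K s \<Longrightarrow> state_norm s (B U) \<le> R * state_norm s U" using B_bounded[OF s, of K] by auto
  have nn: "0 \<le> state_norm s U" for U by (simp add: state_norm_def split_beta)
  show "((\<lambda>r'. state_norm s (B (F r') - B (F r))) \<longlongrightarrow> 0) (at r)"
  proof (rule Lim_null_comparison[OF always_eventually], rule allI)
    show "norm (state_norm s (B (F r') - B (F r))) \<le> R * state_norm s (F r' - F r)" for r'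
      unfolding B_diff[OF st st, symmetric] using R[OF states_diff[OF st st K]] nn by simp
    have "((\<lambda>r'. state_norm s (F r' - F r)) \<longlongrightarrow> 0) (at r)" using F by (simp add: continuous_states_def)
    then show "((\<lambda>r'. R * state_norm s (F r' - F r)) \<longlongrightarrow> 0) (at r)" by (rule tendsto_mult_right_zero)
  qed
qed

text \<open>This ties the matrix \<open>gram\<close> to the evolution. Summing over both branches at
  one frequency reassembles the Fourier coefficients of the components, since the eigenbasis is
  orthonormal.\<close>

lemma coef_BB:
  assumes U: "U \<in> states K s" and s: "0 \<le> s"
  shows "coef (B (B U)) a = mapp gram (coef U) a"
proof -
  let ?k = "fst a"
  have L: "fst U \<in> L2_circle" "snd U \<in> L2_circle" using states_L2[OF U] by auto
  have sumG: "((\<lambda>j. GGm ?k j * fourier p j) has_sum mapp GGm (fourier p) ?k) UNIV" if "p \<in> L2_circle" for p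
  proof -
    have "(\<lambda>j. complex_of_real (bracket j powr 0) * fourier p j) \<in> l2"
      using Bessel[OF that] bracket_ge1 by (subst l2_cong[of _ "fourier p"]) (simp_all add: norm_mult bracket_def)
    then have "(\<lambda>j. norm (GGm ?k j * fourier p j)) summable_on UNIV"
      using weighted_Schur_bound[OF off_diagonal_GGm bracket_summable_id order_refl] by blast
    then show ?thesis unfolding mapp_def by (rule has_sum_infsum[OF Infinite_Sum.abs_summable_summable])
  qed
  have "((\<lambda>j. of_real (wu a) * (GGm ?k j * fourier (fst U) j) + of_real (wv a) * (GGm ?k j * fourier (snd U) j))
      has_sum of_real (wu a) * mapp GGm (fourier (fst U)) ?k + of_real (wv a) * mapp GGm (fourier (snd U)) ?k) UNIV"
    by (intro has_sum_add has_sum_cmult_right sumG L)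
  moreover have "of_real (wu a) * mapp GGm (fourier (fst U)) ?k + of_real (wv a) * mapp GGm (fourier (snd U)) ?k = coef (B (B U)) a"
    by (simp add: coef_def B_def fourier_GG L)
  ultimately have 1: "((\<lambda>j. of_real (wu a) * (GGm ?k j * fourier (fst U) j) + of_real (wv a) * (GGm ?k j * fourier (snd U) j)) has_sum coef (B (B U)) a) UNIV"
    by simp
  have "(\<lambda>b. gram a b * coef U b) summable_on UNIV"
    by (rule Infinite_Sum.abs_summable_summable[OF gram_summable[OF seqs_l2[OF coef_seqs[OF U] s]]])
  then have h: "((\<lambda>b. gram a b * coef U b) has_sum mapp gram (coef U) a) (Sigma UNIV (\<lambda>_. UNIV))"
    unfolding mapp_def by simp
  have "((\<lambda>j. gram a (j, True) * coef U (j, True) + gram a (j, False) * coef U (j, False)) has_sum mapp gram (coef U) a) UNIV"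
    by (rule has_sum_SigmaD[OF h]) (auto simp: UNIV_bool intro!: has_sum_finiteI)
  moreover have "gram a (j, True) * coef U (j, True) + gram a (j, False) * coef U (j, False)
      = of_real (wu a) * (GGm ?k j * fourier (fst U) j) + of_real (wv a) * (GGm ?k j * fourier (snd U) j)" for j
    unfolding recon_coef[of U, symmetric] recon_def by (simp add: gram_def ww_def algebra_simps)
  ultimately show ?thesis using has_sum_unique[OF 1] by simp
qed

text \<open>With \<open>P\<close> the free solution equal to \<open>Syn x\<close> at time
  \<open>T\<close> and \<open>B (P r)\<close> as control, Duhamel's integral at time
  \<open>T\<close> is the Gramian applied to \<open>x\<close>: the group is unitary, so running
  backwards gives the adjoint.\<close>

theorem exact_control:
  assumes s: "0 \<le> s" and K: "K \<in> {\<real>, UNIV}" and U0: "U0 \<in> states K s" and U1: "U1 \<in> states K s"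
  shows "\<exists>f h. L2_into (sob0 K s) (sob_norm s) (lebesgue_on {0<..<T}) f \<and>
    L2_into (sob0 K s) (sob_norm s) (lebesgue_on {0<..<T}) h \<and>
    (\<exists>u v. cont_into (sob0 K s) (sob_norm s) {0..T} u \<and> cont_into (sob0 K s) (sob_norm s) {0..T} v \<and>
      mild_solution K g \<alpha> \<mu> \<zeta> \<eta> s T f h u v \<and> (u 0, v 0) = U0 \<and> (u T, v T) = U1)"
proof -
  \<comment> \<open>What the control must supply beyond the free evolution of the initial
    state.\<close>
  define c where "c a = coef U1 a - flow T (coef U0) a" for a
  have "c \<in> seqs K s" unfolding c_def[abs_def] by (intro seqs_diff flow_seqs coef_seqs U0 U1)
  then obtain x where x: "x \<in> seqs K s" "\<And>a. mapp Mat x a = c a" using controllable_modes[OF s] by blast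
  have xl: "x \<in> l2" by (rule seqs_l2[OF x(1) s])
  note Xs = Syn_states[OF x(1) s K]
  define P where "P r = W (r - T) (Syn x)" for r
  define C where "C r = B (P r)" for r
  define Y where "Y r = B (C r)" for r
  have N0: "state_norm s 0 = 0" using state_norm_diff[OF Xs(1) Xs(1) K] by (simp add: wt_def)
  have Pc: "continuous_states K s P" unfolding P_def[abs_def]
    by (rule continuous_states_W[OF _ K s]) (auto simp: continuous_states_def Xs N0 intro!: continuous_intros)
  have Cc: "continuous_states K s C" unfolding C_def[abs_def] by (rule continuous_states_B[OF Pc s K])
  have Yc: "continuous_states K s Y" unfolding Y_def[abs_def] by (rule continuous_states_B[OF Cc s K])
  have Ps: "P r \<in> states K s" and Cs: "C r \<in> states K s" and Ys: "Y r \<in> states K s" for r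
    using Pc Cc Yc by (simp_all add: continuous_states_def)
  have Ycoef: "coef (Y r) a = mapp gram (flow (r - T) x) a" for r a
    unfolding Y_def C_def coef_BB[OF Ps s] by (simp add: P_def W_states[OF Xs(1) s K] Xs(2))
  obtain R where R: "R \<ge> 0" "\<And>U. U \<in> states K s \<Longrightarrow> state_norm s (B U) \<le> R * state_norm s U" using B_bounded[OF s, of K] by auto
  have PN: "state_norm s (P r) = l2n (wt s x)" for r
    unfolding state_norm_eq[OF Ps] unfolding P_def W_states(2)[OF Xs(1) s K] Xs(2) by (rule l2n_wt_flow)
  have CN: "state_norm s (C r) \<le> R * l2n (wt s x)" for r
    using R(2)[OF Ps, of r] by (simp add: C_def PN)
  have YN: "state_norm s (Y r) \<le> R * (R * l2n (wt s x))" for r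
    using order_trans[OF R(2)[OF Cs, of r] mult_left_mono[OF CN R(1)]] by (simp add: Y_def)

  define M where "M = R * (R * l2n (wt s x))"
  \<comment> \<open>The forcing pulled back to time 0. In this picture Duhamel's integral is a plain
    integral \<open>H\<close> of a bounded curve, hence Lipschitz in \<open>t\<close>.\<close>
  define k where "k r = flow (- r) (coef (Y r))" for r
  define H where "H t a = integral {0..t} (\<lambda>r. k r a)" for t a
  have kc: "continuous_on A (\<lambda>r. k r a)" for A a
    unfolding k_def flow_def by (intro continuous_intros coef_tendsto[OF Yc K s])
  then have ki: "(\<lambda>r. k r a) integrable_on {p..q}" for a p q by (rule integrable_continuous_real)
  have kseq: "k r \<in> seqs K s" for r unfolding k_def by (intro flow_seqs coef_seqs Ys)
  have kM: "l2n (wt s (k r)) \<le> M" for r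
    using YN[of r] unfolding k_def l2n_wt_flow state_norm_eq[OF Ys] M_def .
  have k_integral: "wt s (\<lambda>a. integral {p..q} (\<lambda>r. k r a)) \<in> l2" "l2n (wt s (\<lambda>a. integral {p..q} (\<lambda>r. k r a))) \<le> M * (q - p)"
    if "p \<le> q" for p q
  proof -
    have eq: "wt s (\<lambda>a. integral {p..q} (\<lambda>r. k r a)) = (\<lambda>a. integral {p..q} (\<lambda>r. wt s (k r) a))" by (simp add: wt_def)
    have i: "(\<lambda>r. wt s (k r) a) integrable_on {p..q}" for a unfolding wt_def by (rule integrable_on_mult_right[OF ki])
    have l: "wt s (k r) \<in> l2" for r using kseq[of r] by (simp add: seqs_def)
    show "wt s (\<lambda>a. integral {p..q} (\<lambda>r. k r a)) \<in> l2" "l2n (wt s (\<lambda>a. integral {p..q} (\<lambda>r. k r a))) \<le> M * (q - p)"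
      unfolding eq using l2_integral[of p q "\<lambda>a r. wt s (k r) a" M] that i l kM by auto
  qed
  have Hseq: "H t \<in> seqs K s" if "0 \<le> t" for t
  proof -
    have "H t (- j, \<sigma>) = cnj (H t (j, \<sigma>))" if "K = \<real>" for j \<sigma>
    proof -
      have "k r (- j, \<sigma>) = cnj (k r (j, \<sigma>))" for r using kseq[of r] that by (simp add: seqs_def)
      then show ?thesis by (simp add: H_def Henstock_Kurzweil_Integration.integral_cnj)
    qed
    moreover have "H t a = 0" if "fst a = 0" for a
    proof -
      have "k r a = 0" for r using kseq[of r] that unfolding seqs_def by blast
      then show ?thesis by (simp add: H_def)
    qed
    moreover have "wt s (H t) \<in> l2" unfolding H_def[abs_def] by (rule k_integral(1)[OF that])
    ultimately show ?thesis unfolding seqs_def mem_Collect_eq by blast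
  qed
  have HL: "l2n (wt s (\<lambda>a. H q a - H p a)) \<le> M * (q - p)" if "0 \<le> p" "p \<le> q" for p q
  proof -
    have "H q a - H p a = integral {p..q} (\<lambda>r. k r a)" for a
      unfolding H_def using Henstock_Kurzweil_Integration.integral_combine[OF that ki, of a] by (simp add: algebra_simps)
    then show ?thesis using k_integral(2)[OF that(2)] by simp
  qed
  \<comment> \<open>Reflecting \<open>r\<close> to \<open>T - r\<close> brings the integral into the
    form of \<open>Mat_integral\<close>, where the free solution runs backwards from
    \<open>x\<close>.\<close>
  have HT: "flow T (H T) a = c a" for a
  proof -
    have "integral {0..T} (\<lambda>r. k r a) = integral {0..T} (\<lambda>r. k (T - r) a)"
    proof -
      have "((\<lambda>r. k r a) has_integral integral {0..T} (\<lambda>r. k r a)) (cbox 0 T)" using integrable_integral[OF ki[of a 0 T]] by simp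
      from has_integral_affinity[OF this, of "-1" T]
      have "((\<lambda>r. k (T - r) a) has_integral integral {0..T} (\<lambda>r. k r a)) ((\<lambda>r. T - r) ` {0..T})"
        by (simp add: algebra_simps)
      moreover have "(\<lambda>r. T - r) ` {0..T} = {0..T}" by (simp add: image_minus_const_atLeastAtMost')
      ultimately show ?thesis by (simp add: integral_unique)
    qed
    then have "flow T (H T) a = integral {0..T} (\<lambda>r. cis (lam a * T) * k (T - r) a)"
      by (simp add: flow_def H_def)
    also have "\<dots> = integral {0..T} (\<lambda>r. cis (lam a * r) * mapp gram (flow (- r) x) a)"
    proof -
      have "cis (lam a * T) * k (T - r) a = cis (lam a * r) * mapp gram (flow (- r) x) a" for r
      proof -
        have "cis (lam a * T) * cis (lam a * (- (T - r))) = cis (lam a * r)" by (simp add: cis_mult algebra_simps)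
        then show ?thesis by (simp add: k_def Ycoef flow_def mult.assoc[symmetric])
      qed
      then show ?thesis by simp
    qed
    also have "\<dots> = c a" using Mat_integral[OF xl, of a] x(2)[of a] by simp
    finally show ?thesis .
  qed

  define z where "z t a = coef U0 a + H t a" for t a
  \<comment> \<open>The given pairs are inserted at the two end times so that the end conditions
    hold as equalities; at other times any representative serves.\<close>
  define U where "U t = (if t = 0 then U0 else if t = T then U1 else Syn (flow t (z t)))" for t
  have zseq: "z t \<in> seqs K s" if "0 \<le> t" for t
    unfolding z_def[abs_def] by (intro seqs_add coef_seqs U0 Hseq that)
  have Us: "U t \<in> states K s" "coef (U t) = flow t (z t)" if t: "0 \<le> t" for t
  proof -
    note S = Syn_states[OF flow_seqs[OF zseq[OF t]] s K, of t]
    have "coef U0 = flow 0 (z 0)" by (simp add: flow_def z_def H_def)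
    moreover have "coef U1 = flow T (z T)"
    proof
      fix a
      have "flow T (z T) a = flow T (coef U0) a + flow T (H T) a" by (simp add: flow_def z_def distrib_left)
      then show "coef U1 a = flow T (z T) a" unfolding HT by (simp add: c_def)
    qed
    ultimately show "U t \<in> states K s" "coef (U t) = flow t (z t)" using U0 U1 S by (auto simp: U_def)
  qed
  have Ulim: "((\<lambda>r. state_norm s (U r - U t)) \<longlongrightarrow> 0) (at t within {0..T})" if t: "t \<in> {0..T}" for t
  proof -
    have "((\<lambda>r. l2n (wt s (\<lambda>a. flow r (z r) a - flow t (z t) a))) \<longlongrightarrow> 0) (at t within {0..T})"
    proof (rule flow_continuous[where \<theta> = "\<lambda>r. r"])
      show "wt s (z r) \<in> l2" if "r \<in> {0..T}" for r using zseq[of r] that by (simp add: seqs_def)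
      show "t \<in> {0..T}" by (rule t)
      show "continuous (at t within {0..T}) (\<lambda>r. r)" by (rule continuous_ident)
      show "((\<lambda>r. l2n (wt s (\<lambda>a. z r a - z t a))) \<longlongrightarrow> 0) (at t within {0..T})"
      proof (rule Lim_null_comparison)
        have "((\<lambda>r. M * \<bar>r - t\<bar>) \<longlongrightarrow> M * \<bar>t - t\<bar>) (at t within {0..T})" by (intro tendsto_intros)
        then show "((\<lambda>r. M * \<bar>r - t\<bar>) \<longlongrightarrow> 0) (at t within {0..T})" by simp
        have "l2n (wt s (\<lambda>a. z r a - z t a)) \<le> M * \<bar>r - t\<bar>" if r: "r \<in> {0..T}" for r
        proof (cases "t \<le> r")
          case True
          then show ?thesis using HL[of t r] t by (simp add: z_def)
        next
          case False
          have "l2n (wt s (\<lambda>a. H r a - H t a)) = l2n (wt s (\<lambda>a. H t a - H r a))"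
            by (rule l2n_cong) (simp add: wt_def norm_mult norm_minus_commute)
          then show ?thesis using HL[of r t] r False by (simp add: z_def)
        qed
        then show "\<forall>\<^sub>F r in at t within {0..T}. norm (l2n (wt s (\<lambda>a. z r a - z t a))) \<le> M * \<bar>r - t\<bar>"
          by (simp add: eventually_at_filter)
      qed
    qed
    then show ?thesis
    proof (rule Lim_transform_eventually)
      have "l2n (wt s (\<lambda>a. flow r (z r) a - flow t (z t) a)) = state_norm s (U r - U t)" if "r \<in> {0..T}" for r
        using state_norm_diff[OF Us(1) Us(1) K, of r t] that t Us(2)[of r] Us(2)[of t] by simp
      then show "\<forall>\<^sub>F r in at t within {0..T}. l2n (wt s (\<lambda>a. flow r (z r) a - flow t (z t) a)) = state_norm s (U r - U t)"
        by (simp add: eventually_at_filter)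
    qed
  qed

  have mild: "mild_solution K g \<alpha> \<mu> \<zeta> \<eta> s T (\<lambda>r. fst (C r)) (\<lambda>r. snd (C r)) (\<lambda>t. fst (U t)) (\<lambda>t. snd (U t))"
    unfolding mild_solution_def
  proof (intro exI[of _ W] conjI ballI)
    show "C0_group (states K s) (state_norm s) W" by (rule C0_group_W[OF s K])
    show "generator (states K s) (state_norm s) W = L_graph K \<alpha> \<mu> \<zeta> \<eta> s" by (rule generator_W[OF s K])
    fix t assume "t \<in> {0..T}"
    then have t: "0 \<le> t" by simp
    note I = Syn_states[OF flow_seqs[OF Hseq[OF t]] s K, of t]
    have Wc: "continuous_states K s (\<lambda>r. W (t - r) (Y r))" by (rule continuous_states_W[OF Yc K s]) (intro continuous_intros)
    have "has_bochner_integral_in (states K s) (state_norm s) (lebesgue_on {0..t}) (\<lambda>r. W (t - r) (Y r)) (Syn (flow t (H t)))"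
    proof (rule has_bochner_integral_states[OF Wc K s t I(1)])
      fix a
      have "coef (W (t - r) (Y r)) a = cis (lam a * t) * k r a" for r
      proof -
        have "cis (lam a * t) * cis (lam a * (- r)) = cis (lam a * (t - r))" by (simp add: cis_mult algebra_simps)
        then show ?thesis unfolding W_states(2)[OF Ys s K] by (simp add: flow_def k_def mult.assoc[symmetric])
      qed
      then show "coef (Syn (flow t (H t))) a = integral {0..t} (\<lambda>r. coef (W (t - r) (Y r)) a)"
        unfolding I(2) by (simp add: flow_def H_def)
    qed
    moreover have "state_norm s ((fst (U t), snd (U t)) - (W t (fst (U 0), snd (U 0)) + Syn (flow t (H t)))) = 0"
    proof -
      have U0': "U 0 = U0" by (simp add: U_def)
      note W0 = W_states[OF U0 s K, of t]
      have "coef (W t U0 + Syn (flow t (H t))) a = flow t (z t) a" for a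
        unfolding coef_add[OF states_L2[OF W0(1)] states_L2[OF I(1)]] W0(2) I(2) by (simp add: flow_def z_def distrib_left)
      then show ?thesis
        unfolding prod.collapse U0' state_norm_diff[OF Us(1)[OF t] states_add[OF W0(1) I(1) K] K] Us(2)[OF t] by (simp add: wt_def)
    qed
    ultimately show "\<exists>I. has_bochner_integral_in (states K s) (state_norm s) (lebesgue_on {0..t})
          (\<lambda>r. W (t - r) (G_op g (fst (C r)), G_op g (snd (C r)))) I \<and>
          state_norm s ((fst (U t), snd (U t)) - (W t (fst (U 0), snd (U 0)) + I)) = 0"
      unfolding Y_def B_def by blast
  qed

  have control: "L2_into (sob0 K s) (sob_norm s) (lebesgue_on {0<..<T}) (\<lambda>r. fst (C r))"
    "L2_into (sob0 K s) (sob_norm s) (lebesgue_on {0<..<T}) (\<lambda>r. snd (C r))"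
    by (rule L2_into_component[OF Cc K CN]; simp)+
  have solution: "cont_into (sob0 K s) (sob_norm s) {0..T} (\<lambda>t. fst (U t))" "cont_into (sob0 K s) (sob_norm s) {0..T} (\<lambda>t. snd (U t))"
    by (rule cont_into_component[OF Us(1) Ulim]; simp)+
  have ends: "(fst (U 0), snd (U 0)) = U0" "(fst (U T), snd (U T)) = U1" using T by (simp_all add: U_def)
  show ?thesis
    by (rule exI, rule exI, rule conjI, rule control(1), rule conjI, rule control(2), rule exI, rule exI,
        rule conjI, rule solution(1), rule conjI, rule solution(2), rule conjI, rule mild, rule conjI, rule ends(1), rule ends(2))
qed

end

theorem theorem1p3:
  fixes g :: "real \<Rightarrow> real" and \<omega> :: "real set"
    and \<alpha> \<mu> \<zeta> \<eta> T s :: real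
    and K :: "complex set"
    and u0 v0 u1 v1 :: "real \<Rightarrow> complex"
  assumes "smooth_periodic g" and "\<And>x. 0 \<le> g x"
    and "{x. g x > 0} = \<omega>" and "open \<omega>" and "\<omega> \<noteq> {}"
    and "circle_int g = 1"
    and "\<alpha> < 0" and "\<zeta> - \<mu> > 0" and "T > 0" and "s \<ge> 0"
    and "K \<in> {\<real>, UNIV}"
    and "u0 \<in> sob0 K s" and "v0 \<in> sob0 K s" and "u1 \<in> sob0 K s" and "v1 \<in> sob0 K s"
  shows "\<exists>f h.
    L2_into (sob0 K s) (sob_norm s) (lebesgue_on {0<..<T}) f \<and>
    L2_into (sob0 K s) (sob_norm s) (lebesgue_on {0<..<T}) h \<and>
    (\<exists>u v.
      cont_into (sob0 K s) (sob_norm s) {0..T} u \<and>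
      cont_into (sob0 K s) (sob_norm s) {0..T} v \<and>
      mild_solution K g \<alpha> \<mu> \<zeta> \<eta> s T f h u v \<and>
      ae_eq (u 0) u0 \<and> ae_eq (v 0) v0 \<and>
      ae_eq (u T) u1 \<and> ae_eq (v T) v1)"
proof -
  interpret control_system g \<alpha> \<mu> \<zeta> \<eta> T using assms by unfold_locales auto
  have "(u0, v0) \<in> states K s" "(u1, v1) \<in> states K s" using assms by (auto simp: states_def)
  from exact_control[OF assms(10,11) this] obtain f h u v where
    "L2_into (sob0 K s) (sob_norm s) (lebesgue_on {0<..<T}) f" "L2_into (sob0 K s) (sob_norm s) (lebesgue_on {0<..<T}) h"
    "cont_into (sob0 K s) (sob_norm s) {0..T} u" "cont_into (sob0 K s) (sob_norm s) {0..T} v"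
    "mild_solution K g \<alpha> \<mu> \<zeta> \<eta> s T f h u v" "(u 0, v 0) = (u0, v0)" "(u T, v T) = (u1, v1)"
    by (elim exE conjE)
  moreover from this have "ae_eq (u 0) u0" "ae_eq (v 0) v0" "ae_eq (u T) u1" "ae_eq (v T) v1"
    by (simp_all add: ae_eq_def)
  ultimately show ?thesis by blast
qed

end
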